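(* Fix $d\in\mathbb{N}$ and $n\ge d+1$. Let $X_1,\dots,X_n$ be independent standard Gaussian random vectors in $\mathbb{R}^d$ and let $\mathcal{P}_{n,d}=\mathrm{conv}(X_1,\dots,X_n)$. Then for all $j\in\{0,\dots,d-1\}$ and $k\in\{j,\dots,d-1\}$, $$\mathbb{E}\sum_{F\in\mathcal{F}_j(\mathcal{P}_{n,d})}\upsilon_k\big(T_F(\mathcal{P}_{n,d})\big)=\sigma\genfrac{[}{]}{0pt}{}{n}{k+1}\,\sigma\genfrac{\{}{\}}{0pt}{}{k+1}{j+1}.$$ In the remaining case $j\in\{0,\dots,d-1\}$ and $k=d$, $$\mathbb{E}\sum_{F\in\mathcal{F}_j(\mathcal{P}_{n,d})}\upsilon_d\big(T_F(\mathcal{P}_{n,d})\big)=\sum_{s=0}^{\infty}(-1)^s\,\sigma\genfrac{[}{]}{0pt}{}{n}{d-s}\,\sigma\genfrac{\{}{\}}{0pt}{}{d-s}{j+1}=\sum_{s=1}^{\infty}(-1)^{s+1}\,\sigma\genfrac{[}{]}{0pt}{}{n}{d+s}\,\sigma\genfrac{\{}{\}}{0pt}{}{d+s}{j+1}.$$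
   Context: $\mathbb{N}=\{1,2,\dots\}$. A polyhedral cone is the set of nonnegative linear combinations of finitely many vectors. The solid angle of a polyhedral cone $C$ is $\alpha(C)=\mathbb{P}[Z\in C]$ with $Z$ uniformly distributed on the unit sphere of the linear hull of $C$; $\alpha(C)=1$ if $C$ is a linear subspace (including $C=\{0\}$). For a polyhedral set $P\subset\mathbb{R}^d$ (finite intersection of closed half-spaces; polytopes and polyhedral cones are special cases), $\mathcal{F}_j(P)$ is the set of its $j$-dimensional faces ($P$ itself being a face). The tangent cone at a face $F$ is $T_F(P)=\{v\in\mathbb{R}^d: f_0+\varepsilon v\in P\text{ for some }\varepsilon>0\}$, where $f_0$ is any point of the relative interior of $F$. The normal cone is the polar cone $N_F(P)=\{w:\langle w,u\rangle\le 0\ \text{for all } u\in T_F(P)\}$. For a random polytope these objects are computed for each realization. The $k$-th conic intrinsic volume of a polyhedral cone $C\subset\mathbb{R}^d$, $k\in\{0,\dots,d\}$, is $\upsilon_k(C)=\sum_{F\in\mathcal{F}_k(C)}\alpha(F)\,\alpha(N_F(C))$. Angle sums of the regular simplex: let $e_1,\dots,e_n$ be the standard basis of $\mathbb{R}^n$ and $\Delta_n=\mathrm{conv}(e_1,\dots,e_n)$, $\Delta_k=\mathrm{conv}(e_1,\dots,e_k)\subset\mathbb{R}^n$ for $k\le n$. For $n\in\mathbb{N}$ and $k\in\{1,\dots,n\}$ put $$\sigma\genfrac{\{}{\}}{0pt}{}{n}{k}=\binom nk\,\alpha(T_{\Delta_k}(\Delta_n)),\qquad \sigma\genfrac{[}{]}{0pt}{}{n}{k}=\binom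 nk\,\alpha(N_{\Delta_k}(\Delta_n)),$$ and put both equal to $0$ if $k\notin\{1,\dots,n\}$. A product $\sigma\genfrac{[}{]}{0pt}{}{n}{m}\sigma\genfrac{\{}{\}}{0pt}{}{m}{i}$ with $m\le 0$ is $0$, so all sums are finite. *)

theory Defs
  imports "HOL-Probability.Probability" "HOL-Library.Poly_Mapping"
begin

text \<open>
  The angle sums of regular simplices involve the spaces \<open>R\<^sup>n\<close> for varying \<open>n\<close> within one formula,
  so the dimension cannot be fixed by a type. We work in the inner product space of finitely
  supported real sequences, with the standard Euclidean structure, and take \<open>R\<^sup>n\<close> to be the
  subspace of sequences supported in \<open>{1..n}\<close>.
\<close>

instantiation poly_mapping :: (type, real_vector) real_vector
begin

definition scaleR_poly_mapping :: "real \<Rightarrow> ('a \<Rightarrow>\<^sub>0 'b) \<Rightarrow> ('a \<Rightarrow>\<^sub>0 'b)" where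
  "scaleR_poly_mapping r p = Poly_Mapping.map (scaleR r) p"

lemma lookup_scaleR [simp]:
  "Poly_Mapping.lookup (r *\<^sub>R p) k = r *\<^sub>R Poly_Mapping.lookup (p :: 'a \<Rightarrow>\<^sub>0 'b) k"
  by (simp add: scaleR_poly_mapping_def map.rep_eq when_def)

instance
  by standard (auto intro!: poly_mapping_eqI simp: lookup_add scaleR_add_right scaleR_add_left)

end

instantiation poly_mapping :: (type, real_inner) real_inner
begin

definition inner_poly_mapping :: "('a \<Rightarrow>\<^sub>0 'b) \<Rightarrow> ('a \<Rightarrow>\<^sub>0 'b) \<Rightarrow> real" where
  "inner_poly_mapping p q =
     (\<Sum>k \<in> Poly_Mapping.keys p \<inter> Poly_Mapping.keys q.
        Poly_Mapping.lookup p k \<bullet> Poly_Mapping.lookup q k)"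

definition norm_poly_mapping :: "('a \<Rightarrow>\<^sub>0 'b) \<Rightarrow> real" where
  "norm_poly_mapping p = sqrt (p \<bullet> p)"

definition dist_poly_mapping :: "('a \<Rightarrow>\<^sub>0 'b) \<Rightarrow> ('a \<Rightarrow>\<^sub>0 'b) \<Rightarrow> real" where
  "dist_poly_mapping p q = norm (p - q)"

definition sgn_poly_mapping :: "('a \<Rightarrow>\<^sub>0 'b) \<Rightarrow> ('a \<Rightarrow>\<^sub>0 'b)" where
  "sgn_poly_mapping p = p /\<^sub>R norm p"

definition uniformity_poly_mapping :: "(('a \<Rightarrow>\<^sub>0 'b) \<times> ('a \<Rightarrow>\<^sub>0 'b)) filter" where
  "uniformity_poly_mapping = (INF e\<in>{0 <..}. principal {(x, y). dist x y < e})"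

definition open_poly_mapping :: "('a \<Rightarrow>\<^sub>0 'b) set \<Rightarrow> bool" where
  "open_poly_mapping U \<longleftrightarrow> (\<forall>x\<in>U. eventually (\<lambda>(x', y). x' = x \<longrightarrow> y \<in> U) uniformity)"

lemma inner_poly_mapping_superset:
  fixes p q :: "'a \<Rightarrow>\<^sub>0 'b"
  assumes "finite A" "Poly_Mapping.keys p \<inter> Poly_Mapping.keys q \<subseteq> A"
  shows "p \<bullet> q = (\<Sum>k\<in>A. Poly_Mapping.lookup p k \<bullet> Poly_Mapping.lookup q k)"
  unfolding inner_poly_mapping_def using assms
  by (intro sum.mono_neutral_left) (auto simp: in_keys_iff)

instance
proof
  fix x y z :: "'a \<Rightarrow>\<^sub>0 'b" and r :: real
  let ?A = "Poly_Mapping.keys x \<union> Poly_Mapping.keys y \<union> Poly_Mapping.keys z"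
  show "x \<bullet> y = y \<bullet> x"
    by (simp add: inner_poly_mapping_def inner_commute Int_commute)
  have "(x + y) \<bullet> z = (\<Sum>k\<in>?A. Poly_Mapping.lookup (x + y) k \<bullet> Poly_Mapping.lookup z k)"
    by (rule inner_poly_mapping_superset) auto
  also have "\<dots> = (\<Sum>k\<in>?A. Poly_Mapping.lookup x k \<bullet> Poly_Mapping.lookup z k)
                 + (\<Sum>k\<in>?A. Poly_Mapping.lookup y k \<bullet> Poly_Mapping.lookup z k)"
    by (simp add: lookup_add inner_add_left sum.distrib)
  also have "(\<Sum>k\<in>?A. Poly_Mapping.lookup x k \<bullet> Poly_Mapping.lookup z k) = x \<bullet> z"
    by (rule inner_poly_mapping_superset [symmetric]) auto
  also have "(\<Sum>k\<in>?A. Poly_Mapping.lookup y k \<bullet> Poly_Mapping.lookup z k) = y \<bullet> z"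
    by (rule inner_poly_mapping_superset [symmetric]) auto
  finally show "(x + y) \<bullet> z = x \<bullet> z + y \<bullet> z" .
  have "(r *\<^sub>R x) \<bullet> y = (\<Sum>k\<in>?A. Poly_Mapping.lookup (r *\<^sub>R x) k \<bullet> Poly_Mapping.lookup y k)"
    by (rule inner_poly_mapping_superset) auto
  also have "\<dots> = r * (\<Sum>k\<in>?A. Poly_Mapping.lookup x k \<bullet> Poly_Mapping.lookup y k)"
    by (simp add: sum_distrib_left)
  also have "(\<Sum>k\<in>?A. Poly_Mapping.lookup x k \<bullet> Poly_Mapping.lookup y k) = x \<bullet> y"
    by (rule inner_poly_mapping_superset [symmetric]) auto
  finally show "(r *\<^sub>R x) \<bullet> y = r * (x \<bullet> y)" .
  show "0 \<le> x \<bullet> x"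
    by (simp add: inner_poly_mapping_def sum_nonneg)
  have "(x \<bullet> x = 0) \<longleftrightarrow> (\<forall>k\<in>Poly_Mapping.keys x. Poly_Mapping.lookup x k \<bullet> Poly_Mapping.lookup x k = 0)"
    by (simp add: inner_poly_mapping_def sum_nonneg_eq_0_iff)
  also have "\<dots> \<longleftrightarrow> x = 0"
    by (auto simp: in_keys_iff intro: poly_mapping_eqI)
  finally show "(x \<bullet> x = 0) = (x = 0)" .
qed (simp_all only: norm_poly_mapping_def dist_poly_mapping_def sgn_poly_mapping_def
       uniformity_poly_mapping_def open_poly_mapping_def)

end


section \<open>Solid angles\<close>

definition orthonormal_basis :: "'a::real_inner set \<Rightarrow> 'a set" where
  "orthonormal_basis L =
     (SOME B. finite B \<and> pairwise orthogonal B \<and> (\<forall>b\<in>B. norm b = 1) \<and> span B = L)"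

text \<open>
  Lebesgue measure on a finite-dimensional linear subspace \<open>L\<close>, as a measure on the ambient space;
  by rotation invariance it does not depend on the choice of the orthonormal basis.
\<close>
definition lborel_subspace :: "'a::real_inner set \<Rightarrow> 'a measure" where
  "lborel_subspace L =
     distr (\<Pi>\<^sub>M b\<in>orthonormal_basis L. lborel) borel (\<lambda>f. \<Sum>b\<in>orthonormal_basis L. f b *\<^sub>R b)"

text \<open>
  The uniform distribution on the unit sphere of \<open>L\<close> is the law of the direction of a uniformly
  distributed point of the unit ball of \<open>L\<close>.
\<close>
definition uniform_sphere :: "'a::real_inner set \<Rightarrow> 'a measure" where
  "uniform_sphere L = distr (uniform_measure (lborel_subspace L) (cball 0 1)) borel sgn"

definition solid_angle :: "'a::real_inner set \<Rightarrow> real" where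
  "solid_angle C = (if subspace C then 1 else measure (uniform_sphere (span C)) C)"


section \<open>Faces, tangent and normal cones\<close>

definition faces :: "nat \<Rightarrow> 'a::euclidean_space set \<Rightarrow> 'a set set" where
  "faces j P = {F. F face_of P \<and> aff_dim F = int j}"

text \<open>For convex \<open>P\<close>, all relative interior points \<open>f\<^sub>0\<close> of a face \<open>F\<close> yield the same set.\<close>
definition tangent_cone :: "'a::real_normed_vector set \<Rightarrow> 'a set \<Rightarrow> 'a set" where
  "tangent_cone F P = {v. \<exists>f\<^sub>0\<in>rel_interior F. \<exists>\<epsilon>>0. f\<^sub>0 + \<epsilon> *\<^sub>R v \<in> P}"

text \<open>The normal cone depends on the ambient space \<open>V\<close> in which the polar cone is taken.\<close>
definition normal_cone :: "'a::real_inner set \<Rightarrow> 'a set \<Rightarrow> 'a set \<Rightarrow> 'a set" where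
  "normal_cone V F P = {w \<in> V. \<forall>u\<in>tangent_cone F P. w \<bullet> u \<le> 0}"

definition conic_intrinsic_volume :: "nat \<Rightarrow> 'a::euclidean_space set \<Rightarrow> real" where
  "conic_intrinsic_volume k C =
     (\<Sum>F\<in>faces k C. solid_angle F * solid_angle (normal_cone UNIV F C))"


section \<open>Angle sums of the regular simplex\<close>

definition coord_space :: "nat \<Rightarrow> (nat \<Rightarrow>\<^sub>0 real) set" where
  "coord_space n = {x. Poly_Mapping.keys x \<subseteq> {1..n}}"

definition std_simplex :: "nat \<Rightarrow> (nat \<Rightarrow>\<^sub>0 real) set" where
  "std_simplex n = convex hull ((\<lambda>i. Poly_Mapping.single i 1) ` {1..n})"

text \<open>
  The angle sums \<open>\<sigma>{n,k}\<close> (internal angles) and \<open>\<sigma>[n,k]\<close> (external angles). A second index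
  of \<open>0\<close> gives \<open>0\<close>, so a truncated difference on \<^typ>\<open>nat\<close> as index behaves like a nonpositive integer.
\<close>
definition internal_angle_sum :: "nat \<Rightarrow> nat \<Rightarrow> real" where
  "internal_angle_sum n k =
     (if k \<in> {1..n}
      then real (n choose k) * solid_angle (tangent_cone (std_simplex k) (std_simplex n))
      else 0)"

definition external_angle_sum :: "nat \<Rightarrow> nat \<Rightarrow> real" where
  "external_angle_sum n k =
     (if k \<in> {1..n}
      then real (n choose k) *
             solid_angle (normal_cone (coord_space n) (std_simplex k) (std_simplex n))
      else 0)"



section \<open>Gaussian polytopes\<close>

definition standard_gaussian :: "'w measure \<Rightarrow> ('w \<Rightarrow> 'a::euclidean_space) \<Rightarrow> bool" where
  "standard_gaussian M Y \<longleftrightarrow>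
     distributed M lborel Y (\<lambda>x. ennreal (\<Prod>b\<in>Basis. std_normal_density (x \<bullet> b)))"

definition random_polytope :: "(nat \<Rightarrow> 'w \<Rightarrow> 'a::real_vector) \<Rightarrow> nat \<Rightarrow> 'w \<Rightarrow> 'a set" where
  "random_polytope X n \<omega> = convex hull ((\<lambda>i. X i \<omega>) ` {1..n})"

end

theory Submission
  imports Defs
begin

text \<open>
  The expected face sums reduce to the probability that a Gaussian point \<open>z\<close>, independent of the
  Gaussian points \<open>x i\<close> with \<open>i \<in> N = {1..n}\<close>, projects into a given face of a tangent cone.
  Faces of the polytope are indexed by sets \<open>I \<subseteq> N\<close>. The tangent cone at the face \<open>I\<close> is
  \<open>icone x I N\<close>, generated by the differences \<open>x i - x j\<close> with \<open>j \<in> I\<close>; its faces are the cones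
  \<open>icone x I J\<close>, where \<open>J \<supseteq> I\<close> is the index set of another face of the polytope. The product of
  the angle of \<open>icone x I J\<close> and the angle of its normal cone is the probability that the metric
  projection of \<open>z\<close> lies in this face (\<open>measure_kkt_split\<close>), an event written \<open>kkt x I J N z\<close>. So
  the face sum is a sum of such probabilities over the chains \<open>I \<subseteq> J\<close> with prescribed dimensions
  (\<open>face_sum_polytope\<close>), and in general position dimension is cardinality minus one.

  Let \<open>card J \<le> d\<close>. Decompose the configuration, an element of \<open>\<real>\<^sup>n \<otimes> \<real>\<^sup>d\<close>, along the span
  of the normal cone of the regular simplex at the face \<open>J\<close> and its orthogonal complement. The complement
  part determines the projection \<open>p\<close> of \<open>z\<close> to \<open>icone x J J\<close>. The inner products of the other part with
  the residual \<open>z - p\<close> form, after normalisation, a standard Gaussian vector, and \<open>z - p\<close> is in the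
  normal cone of the face exactly if this vector is in the normal cone of the regular simplex. Hence
  the expectation of \<open>kkt I J N\<close> is \<open>normal_angle J N\<close> times that of \<open>kkt I J J\<close>
  (\<open>kkt_prob_factor\<close>). Since \<open>z\<close> projects into exactly one face, these expectations satisfy the same
  linear recursion as the angles of the regular simplex, and so the expectation of \<open>kkt I J J\<close> is
  \<open>tangent_angle I J\<close> (\<open>kkt_prob_self\<close>). Summation over \<open>I\<close> and \<open>J\<close>, with the symmetry of the
  simplex, gives the case \<open>k < d\<close>.

  For \<open>k = d\<close> the only set \<open>J\<close> is \<open>N\<close>, and the quantity is the probability that the tangent cone is
  proper, so that \<open>I\<close> is a face, and contains \<open>z\<close>. The probability that the cone contains \<open>z\<close>, proper
  or not, is \<open>1\<close> minus the sum of the cases \<open>k < d\<close>. To find the probability that it is proper, project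
  the points along \<open>z\<close>: the number of the points \<open>z, -z\<close> in the cone is the number of full cones among
  the cone and its projection (\<open>projection_dichotomy\<close>), and the projected configuration is again
  Gaussian, in dimension \<open>d - 1\<close>. This recursion in \<open>d\<close> produces the first alternating sum
  (\<open>proper_prob_formula\<close>, \<open>emeasure_mem_proper_tangent\<close>). In dimension \<open>n - 1\<close> the points form
  a simplex, whose tangent cones at proper faces are always proper; the same formula then is the
  Gauss-Bonnet relation for the tangent cones of the regular simplex (\<open>gauss_bonnet_simplex\<close>), which
  turns the first alternating sum into the second.
\<close>

section \<open>Finitely supported families and orthonormal systems\<close>

lemma norm_single_poly_mapping [simp]:
  "norm (Poly_Mapping.single i v :: 'i \<Rightarrow>\<^sub>0 'a::real_inner) = norm v"
proof -
  have "Poly_Mapping.single i v \<bullet> Poly_Mapping.single i v = v \<bullet> v"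
    by (subst inner_poly_mapping_superset[of "{i}"]) auto
  then show ?thesis
    by (simp add: norm_eq_sqrt_inner)
qed

lemma poly_mapping_sum_single:
  fixes p :: "'i \<Rightarrow>\<^sub>0 'a::comm_monoid_add"
  assumes "finite A" "Poly_Mapping.keys p \<subseteq> A"
  shows "p = (\<Sum>i\<in>A. Poly_Mapping.single i (Poly_Mapping.lookup p i))"
proof (rule poly_mapping_eqI)
  fix k
  show "Poly_Mapping.lookup p k = Poly_Mapping.lookup (\<Sum>i\<in>A. Poly_Mapping.single i (Poly_Mapping.lookup p i)) k"
    using assms by (auto simp: lookup_sum lookup_single when_def in_keys_iff)
qed

text \<open>
  Sums \<open>\<Sum> single i v\<close> with \<open>v\<close> in a countable dense set form a countable dense set.
\<close>

instance poly_mapping :: (countable, "{real_inner, second_countable_topology}") second_countable_topology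
proof
  obtain D :: "'b set" where D: "countable D" "\<And>X. open X \<Longrightarrow> X \<noteq> {} \<Longrightarrow> \<exists>d\<in>D. d \<in> X"
    using countable_dense_setE by blast
  define E where "E = (\<lambda>S. \<Sum>(i,v)\<in>S. Poly_Mapping.single i v) ` {S. finite S \<and> S \<subseteq> (UNIV::'a set) \<times> D}"
  have cE: "countable E"
    unfolding E_def using D(1) by (intro countable_image countable_Collect_finite_subset) auto
  have dense: "\<exists>q\<in>E. dist p q < e" if "e > 0" for p :: "'a \<Rightarrow>\<^sub>0 'b" and e
  proof -
    define n where "n = card (Poly_Mapping.keys p)"
    have "\<exists>d\<in>D. dist (Poly_Mapping.lookup p i) d < e / (n + 1)" for i
    proof -
      have "0 < e / (n + 1)" using that by simp
      then have "\<exists>d\<in>D. d \<in> ball (Poly_Mapping.lookup p i) (e / (n+1))"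
        by (intro D(2)) (auto simp: not_le)
      then show ?thesis by (simp only: mem_ball)
    qed
    then obtain g where g: "\<And>i. g i \<in> D" "\<And>i. dist (Poly_Mapping.lookup p i) (g i) < e / (n + 1)"
      by metis
    define S where "S = (\<lambda>i. (i, g i)) ` Poly_Mapping.keys p"
    have q: "(\<Sum>(i,v)\<in>S. Poly_Mapping.single i v) = (\<Sum>i\<in>Poly_Mapping.keys p. Poly_Mapping.single i (g i))"
      unfolding S_def by (subst sum.reindex) (auto simp: inj_on_def)
    have "dist p (\<Sum>(i,v)\<in>S. Poly_Mapping.single i v)
        = norm (\<Sum>i\<in>Poly_Mapping.keys p. Poly_Mapping.single i (Poly_Mapping.lookup p i - g i))"
      unfolding q dist_norm
      by (subst poly_mapping_sum_single[of "Poly_Mapping.keys p" p])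
         (auto simp: sum_subtractf single_diff)
    also have "\<dots> \<le> (\<Sum>i\<in>Poly_Mapping.keys p. norm (Poly_Mapping.lookup p i - g i))"
      by (rule order_trans[OF norm_sum]) simp
    also have "\<dots> \<le> (\<Sum>i\<in>Poly_Mapping.keys p. e / (n+1))"
      using g(2) by (intro sum_mono) (auto simp: dist_norm less_imp_le)
    also have "\<dots> < e"
      using that by (simp add: n_def field_simps)
    finally show ?thesis
      using g(1) by (intro bexI[of _ "\<Sum>(i,v)\<in>S. Poly_Mapping.single i v"]) (auto simp: E_def S_def)
  qed
  define BB where "BB = (\<lambda>(q, k). ball q (1 / Suc k)) ` (E \<times> (UNIV::nat set))"
  have "topological_basis BB"
  proof (rule topological_basisI)
    show "\<And>B'. B' \<in> BB \<Longrightarrow> open B'" by (auto simp: BB_def)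
    fix O' :: "('a \<Rightarrow>\<^sub>0 'b) set" and p assume "open O'" "p \<in> O'"
    then obtain e where e: "e > 0" "ball p e \<subseteq> O'" using openE by blast
    obtain k where k: "1 / Suc k < e / 2" using e(1) nat_approx_posE[of "e/2"] by auto
    obtain q where q: "q \<in> E" "dist p q < 1 / Suc k" using dense[of "1/Suc k" p] by auto
    have "ball q (1 / Suc k) \<subseteq> O'"
    proof
      fix y assume "y \<in> ball q (1 / Suc k)"
      then have "dist p y < e"
        using q(2) k dist_triangle[of p y q] by (simp add: dist_commute)
      then show "y \<in> O'" using e(2) by auto
    qed
    then show "\<exists>B'\<in>BB. p \<in> B' \<and> B' \<subseteq> O'"
      using q by (intro bexI[of _ "ball q (1/Suc k)"]) (auto simp: BB_def dist_commute)
  qed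
  moreover have "countable BB" unfolding BB_def using cE by auto
  ultimately show "\<exists>B::('a \<Rightarrow>\<^sub>0 'b) set set. countable B \<and> open = generate_topology B"
    using topological_basis_imp_subbasis by blast
qed

definition orthonormal :: "'a::real_inner set \<Rightarrow> bool" where
  "orthonormal B \<longleftrightarrow> finite B \<and> (\<forall>b\<in>B. \<forall>c\<in>B. b \<bullet> c = (if b = c then 1 else 0))"

lemma orthonormal_altdef:
  "orthonormal B \<longleftrightarrow> finite B \<and> pairwise orthogonal B \<and> (\<forall>b\<in>B. norm b = 1)"
  unfolding orthonormal_def pairwise_def orthogonal_def
  by (auto simp: norm_eq_1 split: if_splits)

lemma orthonormal_finite: "orthonormal B \<Longrightarrow> finite B"
  by (simp add: orthonormal_def)

lemma orthonormal_inner: "orthonormal B \<Longrightarrow> b \<in> B \<Longrightarrow> c \<in> B \<Longrightarrow> b \<bullet> c = (if b = c then 1 else 0)"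
  by (simp add: orthonormal_def)

lemma orthonormal_subset: "orthonormal B \<Longrightarrow> A \<subseteq> B \<Longrightarrow> orthonormal A"
  by (auto simp: orthonormal_def finite_subset subset_eq)

lemma orthonormal_norm: "orthonormal B \<Longrightarrow> b \<in> B \<Longrightarrow> norm b = 1"
  by (simp add: norm_eq_1 orthonormal_inner)

lemma orthonormal_inner_sum:
  assumes "orthonormal B" "b \<in> B"
  shows "(\<Sum>c\<in>B. f c *\<^sub>R c) \<bullet> b = f b"
proof -
  have "(\<Sum>c\<in>B. f c *\<^sub>R c) \<bullet> b = (\<Sum>c\<in>B. if c = b then f c else 0)"
    unfolding inner_sum_left using assms by (intro sum.cong) (auto simp: orthonormal_inner)
  also have "\<dots> = f b" using assms by (simp add: orthonormal_finite)
  finally show ?thesis .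
qed

lemma orthonormal_expand:
  assumes "orthonormal B" "v \<in> span B"
  shows "v = (\<Sum>b\<in>B. (v \<bullet> b) *\<^sub>R b)"
proof -
  obtain f where v: "v = (\<Sum>b\<in>B. f b *\<^sub>R b)"
    using assms by (auto simp: orthonormal_def span_finite)
  have "f b = v \<bullet> b" if "b \<in> B" for b
    using that assms(1) by (simp add: v orthonormal_inner_sum)
  then have "(\<Sum>b\<in>B. f b *\<^sub>R b) = (\<Sum>b\<in>B. (v \<bullet> b) *\<^sub>R b)" by (intro sum.cong) auto
  then show ?thesis using v by metis
qed

lemma orthonormal_inner_expand:
  assumes "orthonormal B" "v \<in> span B"
  shows "v \<bullet> w = (\<Sum>b\<in>B. (v \<bullet> b) * (w \<bullet> b))"
proof -
  have "v \<bullet> w = (\<Sum>b\<in>B. (v \<bullet> b) *\<^sub>R b) \<bullet> w"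
    using orthonormal_expand[OF assms] by simp
  also have "\<dots> = (\<Sum>b\<in>B. (v \<bullet> b) * (w \<bullet> b))"
    by (simp only: inner_sum_left inner_scaleR_left inner_commute[of w])
  finally show ?thesis .
qed

lemma orthonormal_independent: "orthonormal B \<Longrightarrow> independent B"
  unfolding orthonormal_altdef by (intro pairwise_orthogonal_independent) (auto simp: norm_eq_zero)

lemma span_sum_scaleR: "finite B \<Longrightarrow> (\<Sum>b\<in>B. f b *\<^sub>R b) \<in> span B"
  by (intro span_sum span_scale span_base)

lemma orthonormal_Un:
  assumes "orthonormal A" "orthonormal B" "\<And>a b. a \<in> A \<Longrightarrow> b \<in> B \<Longrightarrow> a \<bullet> b = 0"
  shows "orthonormal (A \<union> B)" and "A \<inter> B = {}"
proof -
  show *: "A \<inter> B = {}"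
    using assms by (auto simp: orthonormal_def) (metis disjoint_iff inner_commute zero_neq_one)
  show "orthonormal (A \<union> B)"
    using assms * inner_commute unfolding orthonormal_def
    by (metis (no_types, lifting) Un_iff disjoint_iff finite_UnI)
qed

lemma orthonormal_extend_span:
  assumes "finite S"
  obtains C where "orthonormal C" "span C = span S"
proof -
  obtain D where D: "finite D" "span D = span S" "pairwise orthogonal D"
    using basis_orthogonal[OF assms] by auto
  define C where "C = sgn ` (D - {0})"
  have inj: "b = c" if "b \<in> D - {0}" "c \<in> D - {0}" "sgn b = sgn c" for b c
  proof (rule ccontr)
    assume "b \<noteq> c"
    then have "b \<bullet> c = 0" using D(3) that by (auto simp: pairwise_def orthogonal_def)
    then have "sgn b \<bullet> sgn c = 0" by (simp add: sgn_div_norm)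
    with that have "sgn c \<bullet> sgn c = 0" by simp
    then show False using that by (simp add: sgn_zero_iff)
  qed
  have "orthonormal C"
    unfolding orthonormal_altdef C_def using D
    by (auto simp: norm_sgn pairwise_def orthogonal_def sgn_div_norm)
  moreover have "span C = span S"
  proof -
    have "span C \<subseteq> span D"
      unfolding C_def by (intro span_minimal) (auto simp: sgn_div_norm intro!: span_scale intro: span_base)
    moreover have "D \<subseteq> span C"
    proof
      fix b assume b: "b \<in> D"
      show "b \<in> span C"
      proof (cases "b = 0")
        case False
        then have "b = norm b *\<^sub>R sgn b" by (simp add: sgn_div_norm)
        moreover have "sgn b \<in> span C" using b False by (auto simp: C_def intro!: span_base)
        ultimately show ?thesis by (metis span_scale)
      qed (simp add: span_zero)
    qed
    ultimately show ?thesis using D(2) by (metis span_minimal subspace_span subset_antisym)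
  qed
  ultimately show ?thesis using that by blast
qed

lemma orthonormal_basis:
  assumes "finite S" "L = span S"
  shows "orthonormal (orthonormal_basis L)" "span (orthonormal_basis L) = L"
proof -
  obtain C where "orthonormal C" "span C = span S" using orthonormal_extend_span[OF assms(1)] .
  then have "\<exists>C. finite C \<and> pairwise orthogonal C \<and> (\<forall>b\<in>C. norm b = 1) \<and> span C = L"
    using assms(2) by (auto simp: orthonormal_altdef)
  from someI_ex[OF this] show "orthonormal (orthonormal_basis L)" "span (orthonormal_basis L) = L"
    unfolding orthonormal_basis_def by (auto simp: orthonormal_altdef)
qed

text \<open>
  Gram-Schmidt for \<open>A\<close>, and then for the components of the elements of \<open>B\<close> orthogonal to \<open>A\<close>.
\<close>

lemma orthonormal_complement:
  assumes "orthonormal B" "finite A" "A \<subseteq> span B"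
  obtains B1 B2 where "orthonormal (B1 \<union> B2)" "B1 \<inter> B2 = {}" "span B1 = span A"
    "span (B1 \<union> B2) = span B" "\<And>v. v \<in> span B \<Longrightarrow> (\<forall>a\<in>A. v \<bullet> a = 0) \<longleftrightarrow> v \<in> span B2"
proof -
  obtain B1 where B1: "orthonormal B1" "span B1 = span A"
    using orthonormal_extend_span[OF assms(2)] .
  define pr where "pr v = (\<Sum>b\<in>B1. (v \<bullet> b) *\<^sub>R b)" for v
  have pr: "(v - pr v) \<bullet> a = 0" if "a \<in> span B1" for v a
  proof -
    have "\<forall>b\<in>B1. (v - pr v) \<bullet> b = 0"
      using B1(1) by (simp add: inner_diff_left pr_def orthonormal_inner_sum)
    then have "\<forall>b\<in>B1. orthogonal (v - pr v) b" by (simp add: orthogonal_def)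
    then show ?thesis using orthogonal_to_span[OF that] by (auto simp: orthogonal_def)
  qed
  have fin: "finite ((\<lambda>v. v - pr v) ` B)" using assms(1) orthonormal_finite by blast
  obtain B2 where B2: "orthonormal B2" "span B2 = span ((\<lambda>v. v - pr v) ` B)"
    using orthonormal_extend_span[OF fin] .
  have prs: "pr v \<in> span B1" for v
    unfolding pr_def using B1 orthonormal_finite by (blast intro: span_sum_scaleR)
  have orth: "a \<bullet> b = 0" if "a \<in> span B1" "b \<in> span B2" for a b
  proof -
    have "orthogonal a b"
      using that(2) unfolding B2(2)
      by (rule orthogonal_to_span) (auto simp: orthogonal_def inner_commute[of a] pr that(1))
    then show ?thesis by (simp add: orthogonal_def)
  qed
  have A1: "A \<subseteq> span B1" using B1(2) span_superset by blast
  have "span B1 \<subseteq> span B"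
    unfolding B1(2) using assms(3) by (simp add: span_minimal)
  moreover have "span B2 \<subseteq> span B"
    unfolding B2(2) using prs \<open>span B1 \<subseteq> span B\<close>
    by (intro span_minimal) (auto intro!: span_diff intro: span_base)
  ultimately have "span (B1 \<union> B2) \<subseteq> span B"
    using span_superset by (intro span_minimal) auto
  moreover have "B \<subseteq> span (B1 \<union> B2)"
  proof
    fix v assume "v \<in> B"
    then have "v - pr v \<in> span B2" unfolding B2(2) by (intro span_base) auto
    then have "v - pr v \<in> span (B1 \<union> B2)" "pr v \<in> span (B1 \<union> B2)"
      using prs span_mono[of B1 "B1 \<union> B2"] span_mono[of B2 "B1 \<union> B2"] by auto
    then show "v \<in> span (B1 \<union> B2)" using span_add by fastforce
  qed
  ultimately have sp: "span (B1 \<union> B2) = span B" by (metis span_minimal subspace_span subset_antisym)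
  have on: "orthonormal (B1 \<union> B2)" "B1 \<inter> B2 = {}"
    using orthonormal_Un[OF B1(1) B2(1)] orth span_base by blast+
  have char: "(\<forall>a\<in>A. v \<bullet> a = 0) \<longleftrightarrow> v \<in> span B2" if v: "v \<in> span B" for v
  proof
    assume "v \<in> span B2"
    then show "\<forall>a\<in>A. v \<bullet> a = 0" using orth A1 by (auto simp: inner_commute[of v])
  next
    assume h: "\<forall>a\<in>A. v \<bullet> a = 0"
    have "v \<bullet> a = 0" if "a \<in> span A" for a
      using orthogonal_to_span[OF that, of v] h by (auto simp: orthogonal_def)
    then have z: "v \<bullet> b = 0" if "b \<in> B1" for b using that B1(2) span_base by blast
    have "v = (\<Sum>b\<in>B1\<union>B2. (v \<bullet> b) *\<^sub>R b)"
      using orthonormal_expand[OF on(1)] sp v by simp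
    also have "\<dots> = (\<Sum>b\<in>B2. (v \<bullet> b) *\<^sub>R b)"
      using on B1(1) B2(1) z by (subst sum.union_disjoint) (auto simp: orthonormal_def)
    also have "\<dots> \<in> span B2" using B2(1) by (intro span_sum_scaleR) (simp add: orthonormal_def)
    finally show "v \<in> span B2" .
  qed
  show ?thesis by (rule that[OF on B1(2) sp char])
qed

lemma orthonormal_span_remove:
  assumes X: "orthonormal X" "e \<in> X"
  shows "span (X - {e}) = {v \<in> span X. v \<bullet> e = 0}"
proof (rule subset_antisym)
  have "v \<bullet> e = 0" if "v \<in> span (X - {e})" for v
  proof -
    have "orthogonal e v" using that by (rule orthogonal_to_span) (use X in \<open>auto simp: orthogonal_def orthonormal_inner\<close>)
    then show ?thesis by (simp add: orthogonal_def inner_commute)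
  qed
  moreover have "span (X - {e}) \<subseteq> span X" by (rule span_mono) auto
  ultimately show "span (X - {e}) \<subseteq> {v \<in> span X. v \<bullet> e = 0}" by auto
  show "{v \<in> span X. v \<bullet> e = 0} \<subseteq> span (X - {e})"
  proof clarify
    fix v assume v: "v \<in> span X" "v \<bullet> e = 0"
    have "v = (\<Sum>b\<in>X. (v \<bullet> b) *\<^sub>R b)" using X v by (intro orthonormal_expand) auto
    also have "\<dots> = (\<Sum>b\<in>X - {e}. (v \<bullet> b) *\<^sub>R b)"
      using X v by (intro sum.mono_neutral_right) (auto simp: orthonormal_finite)
    also have "\<dots> \<in> span (X - {e})" using X by (intro span_sum_scaleR) (auto simp: orthonormal_finite)
    finally show "v \<in> span (X - {e})" .
  qed
qed

lemma orthonormal_card_eq: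
  assumes "orthonormal A" "orthonormal B" "span A = span B"
  shows "card A = card B"
  using assms by (metis orthonormal_independent dim_span_eq_card_independent)

section \<open>Gaussian measures on subspaces\<close>

definition std_normal :: "real measure" where
  "std_normal = density lborel (\<lambda>x. ennreal (std_normal_density x))"

lemma sets_std_normal [simp, measurable_cong]: "sets std_normal = sets borel"
  and space_std_normal [simp]: "space std_normal = UNIV"
  by (auto simp: std_normal_def)

lemma prob_space_std_normal: "prob_space std_normal"
  unfolding std_normal_def by (rule prob_space_normal_density) simp

interpretation std_normal: prob_space std_normal by (rule prob_space_std_normal)

interpretation std_normal_prod: product_sigma_finite "\<lambda>_. std_normal" ..

text \<open>
  The standard Gaussian distribution of the subspace \<open>span B\<close>, for orthonormal \<open>B\<close>. By
  \<open>gauss_cong_span\<close> it depends only on the subspace. For \<open>B\<close> that is not orthonormal it is still the law of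
  a sum of independent multiples.
\<close>

definition gauss :: "'a::{real_inner,second_countable_topology} set \<Rightarrow> 'a measure" where
  "gauss B = distr (\<Pi>\<^sub>M b\<in>B. std_normal) borel (\<lambda>f. \<Sum>b\<in>B. f b *\<^sub>R b)"

lemma sets_gauss [simp, measurable_cong]: "sets (gauss B) = sets borel"
  and space_gauss [simp]: "space (gauss B) = UNIV"
  by (auto simp: gauss_def)

lemma measurable_gauss_sum [measurable]:
  fixes B :: "'a::{real_inner,second_countable_topology} set"
  shows "(\<lambda>f. \<Sum>b\<in>B. f b *\<^sub>R b) \<in> borel_measurable (\<Pi>\<^sub>M b\<in>B. std_normal)"
  by measurable

lemma prob_space_gauss: "prob_space (gauss B)"
  unfolding gauss_def
  by (intro prob_space.prob_space_distr prob_space_PiM prob_space_std_normal) auto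

interpretation gauss: prob_space "gauss B" for B by (rule prob_space_gauss)

text \<open>
  Convolution. With finitely many independent components, all independence arguments are
  rewritings of \<open>gauss (A \<union> B)\<close> as a convolution.
\<close>

definition sum_law :: "'a::{real_normed_vector,second_countable_topology} measure \<Rightarrow> 'a measure \<Rightarrow> 'a measure" where
  "sum_law M N = distr (M \<Otimes>\<^sub>M N) borel (\<lambda>(x, y). x + y)"

lemma sets_sum_law [simp, measurable_cong]: "sets (sum_law M N) = sets borel"
  and space_sum_law [simp]: "space (sum_law M N) = UNIV"
  by (auto simp: sum_law_def)

lemma measurable_add_pair [measurable]:
  fixes M N :: "'a::{real_normed_vector,second_countable_topology} measure"
  assumes "sets M = sets borel" "sets N = sets borel"
  shows "(\<lambda>(x, y). x + y) \<in> borel_measurable (M \<Otimes>\<^sub>M N)"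
  using assms by (simp cong: measurable_cong_sets)

lemma nn_integral_sum_law:
  fixes M N :: "'a::{real_normed_vector,second_countable_topology} measure"
  assumes [simp, measurable_cong]: "sets M = sets borel" "sets N = sets borel" and "sigma_finite_measure N"
    and [measurable]: "f \<in> borel_measurable borel"
  shows "(\<integral>\<^sup>+x. f x \<partial>sum_law M N) = (\<integral>\<^sup>+x. \<integral>\<^sup>+y. f (x + y) \<partial>N \<partial>M)"
proof -
  interpret N: sigma_finite_measure N by fact
  have "(\<integral>\<^sup>+x. f x \<partial>sum_law M N) = (\<integral>\<^sup>+p. f (fst p + snd p) \<partial>(M \<Otimes>\<^sub>M N))"
    unfolding sum_law_def
    by (subst nn_integral_distr) (auto simp: case_prod_unfold intro!: measurable_add_pair[unfolded case_prod_unfold])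
  also have "\<dots> = (\<integral>\<^sup>+x. \<integral>\<^sup>+y. f (x + y) \<partial>N \<partial>M)"
    by (subst N.nn_integral_fst[symmetric]) auto
  finally show ?thesis .
qed

lemma distr_sum_law:
  fixes M N :: "'a::{real_normed_vector,second_countable_topology} measure"
    and T :: "'a \<Rightarrow> 'b::{real_normed_vector,second_countable_topology}"
  assumes s [simp, measurable_cong]: "sets M = sets borel" "sets N = sets borel"
    and sf: "prob_space M" "prob_space N"
    and [measurable]: "T \<in> borel_measurable borel" and lin: "\<And>x y. T (x + y) = T x + T y"
  shows "distr (sum_law M N) borel T = sum_law (distr M borel T) (distr N borel T)"
proof -
  interpret N: prob_space N by fact
  interpret M: prob_space M by fact
  interpret TN: prob_space "distr N borel T" by (rule N.prob_space_distr) measurable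
  interpret TM: prob_space "distr M borel T" by (rule M.prob_space_distr) measurable
  have T: "T \<in> measurable M borel" "T \<in> measurable N borel" by measurable
  show ?thesis
    unfolding sum_law_def
    using TN.sigma_finite_measure_axioms
    by (subst pair_measure_distr[OF T])
       (auto simp: distr_distr case_prod_unfold comp_def lin
             intro!: arg_cong2[where f="\<lambda>a b. distr a borel b"])
qed

lemma gauss_Un:
  fixes A B :: "'a::{real_inner,second_countable_topology} set"
  assumes "finite A" "finite B" "A \<inter> B = {}"
  shows "gauss (A \<union> B) = sum_law (gauss A) (gauss B)"
proof -
  let ?PA = "\<Pi>\<^sub>M b\<in>A. std_normal" and ?PB = "\<Pi>\<^sub>M b\<in>B. std_normal"
  have gA: "(\<lambda>f. \<Sum>b\<in>A. f b *\<^sub>R b) \<in> measurable ?PA borel" and gB: "(\<lambda>f. \<Sum>b\<in>B. f b *\<^sub>R b) \<in> measurable ?PB borel"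
    by measurable
  have mm: "merge A B \<in> measurable (?PA \<Otimes>\<^sub>M ?PB) (\<Pi>\<^sub>M b\<in>A\<union>B. std_normal)" by (rule measurable_merge)
  have "gauss (A \<union> B) = distr (distr (?PA \<Otimes>\<^sub>M ?PB) (\<Pi>\<^sub>M b\<in>A\<union>B. std_normal) (merge A B)) borel
      (\<lambda>f. \<Sum>b\<in>A\<union>B. f b *\<^sub>R b)"
    unfolding gauss_def using assms by (subst std_normal_prod.distr_merge) auto
  also have "\<dots> = distr (?PA \<Otimes>\<^sub>M ?PB) borel (\<lambda>p. \<Sum>b\<in>A\<union>B. merge A B p b *\<^sub>R b)"
    using mm by (subst distr_distr) (auto simp: comp_def)
  also have "\<dots> = distr (?PA \<Otimes>\<^sub>M ?PB) borel ((\<lambda>(x, y). x + y) \<circ> (\<lambda>(f, g). (\<Sum>b\<in>A. f b *\<^sub>R b, \<Sum>b\<in>B. g b *\<^sub>R b)))"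
  proof (intro distr_cong refl)
    fix p :: "('a \<Rightarrow> real) \<times> ('a \<Rightarrow> real)"
    obtain f g where p: "p = (f, g)" by force
    have "(\<Sum>b\<in>A. merge A B (f,g) b *\<^sub>R b) = (\<Sum>b\<in>A. f b *\<^sub>R b)"
      by (intro sum.cong) (auto simp: merge_def)
    moreover have "(\<Sum>b\<in>B. merge A B (f,g) b *\<^sub>R b) = (\<Sum>b\<in>B. g b *\<^sub>R b)"
      using assms by (intro sum.cong) (auto simp: merge_def)
    ultimately show "(\<Sum>b\<in>A\<union>B. merge A B p b *\<^sub>R b) = ((\<lambda>(x, y). x + y) \<circ> (\<lambda>(f, g). (\<Sum>b\<in>A. f b *\<^sub>R b, \<Sum>b\<in>B. g b *\<^sub>R b))) p"
      using assms by (simp add: sum.union_disjoint p)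
  qed
  also have "\<dots> = distr (distr (?PA \<Otimes>\<^sub>M ?PB) (borel \<Otimes>\<^sub>M borel) (\<lambda>(f, g). (\<Sum>b\<in>A. f b *\<^sub>R b, \<Sum>b\<in>B. g b *\<^sub>R b))) borel (\<lambda>(x, y). x + y)"
    using gA gB by (subst distr_distr) (auto simp: case_prod_unfold intro!: measurable_Pair measurable_compose[OF measurable_fst] measurable_compose[OF measurable_snd])
  also have "\<dots> = sum_law (gauss A) (gauss B)"
    unfolding sum_law_def gauss_def
    by (subst pair_measure_distr[OF gA gB])
       (use gauss.sigma_finite_measure_axioms[of B, unfolded gauss_def] in auto)
  finally show ?thesis .
qed

lemma gauss_empty: "gauss {} = return borel 0"
proof -
  have "prob_space (\<Pi>\<^sub>M b\<in>{}::'a set. std_normal)" by (intro prob_space_PiM prob_space_std_normal)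
  then show ?thesis
    unfolding gauss_def by (simp add: prob_space.distr_const)
qed

lemma gauss_singleton: "gauss {b} = distr std_normal borel (\<lambda>s. s *\<^sub>R b)"
proof -
  have "std_normal = distr (\<Pi>\<^sub>M c\<in>{b}. std_normal) std_normal (\<lambda>f. f b)"
    by (rule std_normal_prod.distr_singleton[symmetric])
  then have "distr std_normal borel (\<lambda>s. s *\<^sub>R b) = distr (distr (\<Pi>\<^sub>M c\<in>{b}. std_normal) std_normal (\<lambda>f. f b)) borel (\<lambda>s. s *\<^sub>R b)"
    by simp
  also have "\<dots> = gauss {b}"
    unfolding gauss_def by (subst distr_distr) (auto simp: comp_def)
  finally show ?thesis ..
qed

lemma gauss_image:
  fixes T :: "'a::{real_inner,second_countable_topology} \<Rightarrow> 'b::{real_inner,second_countable_topology}"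
  assumes "finite B" "inj_on T B" "linear T" and [measurable]: "T \<in> borel_measurable borel"
  shows "distr (gauss B) borel T = gauss (T ` B)"
  using assms(1,2)
proof (induction B)
  case empty
  then show ?case
    using assms(3) by (simp add: gauss_empty distr_return linear_0)
next
  case (insert b B)
  have b: "distr (gauss {b}) borel T = gauss {T b}"
    using assms(3) by (simp add: gauss_singleton distr_distr comp_def linear_cmul)
  have "distr (gauss (insert b B)) borel T = distr (sum_law (gauss {b}) (gauss B)) borel T"
    using gauss_Un[of "{b}" B] insert by simp
  also have "\<dots> = sum_law (distr (gauss {b}) borel T) (distr (gauss B) borel T)"
    using assms by (intro distr_sum_law) (auto intro: prob_space_gauss simp: linear_add)
  also have "\<dots> = sum_law (gauss {T b}) (gauss (T ` B))"
    using insert b by simp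
  also have "\<dots> = gauss (T ` insert b B)"
    using gauss_Un[of "{T b}" "T ` B"] insert by simp
  finally show ?case .
qed

text \<open>
  The components killed by \<open>T\<close> integrate out.
\<close>

lemma gauss_kernel:
  fixes T :: "'a::{real_inner,second_countable_topology} \<Rightarrow> 'b::{real_inner,second_countable_topology}"
  assumes "finite A" "finite B" "A \<inter> B = {}" "inj_on T A" "linear T" and [measurable]: "T \<in> borel_measurable borel"
    and "\<And>b. b \<in> B \<Longrightarrow> T b = 0"
  shows "distr (gauss (A \<union> B)) borel T = gauss (T ` A)"
proof -
  have z: "T (\<Sum>b\<in>B. f b *\<^sub>R b) = 0" for f
    using assms(5,7) by (simp add: linear_sum linear_cmul)
  have "distr (gauss B) borel T = distr (\<Pi>\<^sub>M b\<in>B. std_normal) borel (\<lambda>_. 0::'b)"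
    unfolding gauss_def by (subst distr_distr) (auto simp: comp_def z)
  also have "\<dots> = return borel 0"
    by (intro prob_space.distr_const prob_space_PiM prob_space_std_normal) auto
  finally have B: "distr (gauss B) borel T = gauss {}" by (simp add: gauss_empty)
  have "distr (gauss (A \<union> B)) borel T = distr (sum_law (gauss A) (gauss B)) borel T"
    using gauss_Un[of A B] assms by simp
  also have "\<dots> = sum_law (distr (gauss A) borel T) (distr (gauss B) borel T)"
    using assms by (intro distr_sum_law) (auto intro: prob_space_gauss simp: linear_add)
  also have "\<dots> = sum_law (gauss (T ` A)) (gauss {})"
    using assms by (simp add: B gauss_image)
  also have "\<dots> = gauss (T ` A)"
    using gauss_Un[of "T ` A" "{}"] assms by simp
  finally show ?thesis .
qed

text \<open>
  Translation invariance in one variable for each fixed value of the other.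
\<close>

lemma nn_integral_lborel_shear:
  fixes H :: "real \<times> real \<Rightarrow> ennreal"
  assumes [measurable]: "H \<in> borel_measurable (borel \<Otimes>\<^sub>M borel)"
  shows "(\<integral>\<^sup>+s. \<integral>\<^sup>+t. H (s + a * t, t) \<partial>lborel \<partial>lborel) = (\<integral>\<^sup>+s. \<integral>\<^sup>+t. H (s, t) \<partial>lborel \<partial>lborel)"
    and "(\<integral>\<^sup>+s. \<integral>\<^sup>+t. H (s, t + a * s) \<partial>lborel \<partial>lborel) = (\<integral>\<^sup>+s. \<integral>\<^sup>+t. H (s, t) \<partial>lborel \<partial>lborel)"
proof -
  have tr: "(\<integral>\<^sup>+s. f (s + c) \<partial>lborel) = (\<integral>\<^sup>+s. f s \<partial>lborel)" if "f \<in> borel_measurable borel" for f :: "real \<Rightarrow> ennreal" and c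
    using nn_integral_real_affine[OF that, of 1 c] by (simp add: add.commute)
  show "(\<integral>\<^sup>+s. \<integral>\<^sup>+t. H (s, t + a * s) \<partial>lborel \<partial>lborel) = (\<integral>\<^sup>+s. \<integral>\<^sup>+t. H (s, t) \<partial>lborel \<partial>lborel)"
    by (intro nn_integral_cong tr) measurable
  have "(\<integral>\<^sup>+s. \<integral>\<^sup>+t. H (s + a * t, t) \<partial>lborel \<partial>lborel) = (\<integral>\<^sup>+t. \<integral>\<^sup>+s. H (s + a * t, t) \<partial>lborel \<partial>lborel)"
    by (rule lborel_pair.Fubini'[symmetric]) measurable
  also have "\<dots> = (\<integral>\<^sup>+t. \<integral>\<^sup>+s. H (s, t) \<partial>lborel \<partial>lborel)"
    by (intro nn_integral_cong tr) measurable
  also have "\<dots> = (\<integral>\<^sup>+s. \<integral>\<^sup>+t. H (s, t) \<partial>lborel \<partial>lborel)"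
    by (rule lborel_pair.Fubini') measurable
  finally show "(\<integral>\<^sup>+s. \<integral>\<^sup>+t. H (s + a * t, t) \<partial>lborel \<partial>lborel) = (\<integral>\<^sup>+s. \<integral>\<^sup>+t. H (s, t) \<partial>lborel \<partial>lborel)" .
qed

text \<open>
  A rotation is a product of three shears; this needs \<open>d \<noteq> 0\<close>.
\<close>

lemma nn_integral_lborel_rotation:
  fixes H :: "real \<times> real \<Rightarrow> ennreal"
  assumes H [measurable]: "H \<in> borel_measurable (borel \<Otimes>\<^sub>M borel)" and "c\<^sup>2 + d\<^sup>2 = 1" "d \<noteq> 0"
  shows "(\<integral>\<^sup>+s. \<integral>\<^sup>+t. H (c * s + d * t, - d * s + c * t) \<partial>lborel \<partial>lborel)
       = (\<integral>\<^sup>+s. \<integral>\<^sup>+t. H (s, t) \<partial>lborel \<partial>lborel)"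
proof -
  define a where "a = (1 - c) / d"
  have ad: "1 - a * d = c" using assms(3) by (simp add: a_def)
  have add: "a + a * c = d"
  proof -
    have "a + a * c = (1 - c) * (1 + c) / d" by (simp add: a_def add_divide_distrib[symmetric] distrib_left)
    also have "(1 - c) * (1 + c) = 1 - c\<^sup>2" by (simp add: algebra_simps power2_eq_square)
    also have "1 - c\<^sup>2 = d * d" using assms(2) by (simp add: power2_eq_square)
    finally show ?thesis using assms(3) by simp
  qed
  define H1 where "H1 = (\<lambda>(s,t). H (s + a * t, t))"
  define H2 where "H2 = (\<lambda>(s,t). H1 (s, t + (- d) * s))"
  have [measurable]: "H1 \<in> borel_measurable (borel \<Otimes>\<^sub>M borel)" unfolding H1_def by measurable
  have [measurable]: "H2 \<in> borel_measurable (borel \<Otimes>\<^sub>M borel)" unfolding H2_def by measurable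
  have "H (c * s + d * t, - d * s + c * t) = H2 (s + a * t, t)" for s t
  proof -
    have e2: "t + - d * (s + a * t) = - d * s + c * t"
      using ad by (simp add: algebra_simps) (metis ad add.commute diff_add_cancel distrib_right mult.commute mult.left_commute mult_1)
    have e1: "(s + a * t) + a * (- d * s + c * t) = c * s + d * t"
    proof -
      have "(s + a * t) + a * (- d * s + c * t) = (1 - a * d) * s + (a + a * c) * t" by (simp add: algebra_simps)
      then show ?thesis by (simp add: ad add)
    qed
    show ?thesis unfolding H2_def H1_def prod.case e2 e1 ..
  qed
  then have "(\<integral>\<^sup>+s. \<integral>\<^sup>+t. H (c * s + d * t, - d * s + c * t) \<partial>lborel \<partial>lborel) = (\<integral>\<^sup>+s. \<integral>\<^sup>+t. H2 (s, t) \<partial>lborel \<partial>lborel)"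
    using nn_integral_lborel_shear(1)[of H2 a] by simp
  also have "\<dots> = (\<integral>\<^sup>+s. \<integral>\<^sup>+t. H1 (s, t) \<partial>lborel \<partial>lborel)"
    using nn_integral_lborel_shear(2)[of H1 "- d"] by (simp add: H2_def)
  also have "\<dots> = (\<integral>\<^sup>+s. \<integral>\<^sup>+t. H (s, t) \<partial>lborel \<partial>lborel)"
    using nn_integral_lborel_shear(1)[of H a] by (simp add: H1_def)
  finally show ?thesis .
qed

lemma nn_integral_std_normal_rotation:
  fixes H :: "real \<times> real \<Rightarrow> ennreal"
  assumes [measurable]: "H \<in> borel_measurable (borel \<Otimes>\<^sub>M borel)" and cd: "c\<^sup>2 + d\<^sup>2 = 1" "d \<noteq> 0"
  shows "(\<integral>\<^sup>+s. \<integral>\<^sup>+t. H (c * s + d * t, - d * s + c * t) \<partial>std_normal \<partial>std_normal)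
       = (\<integral>\<^sup>+s. \<integral>\<^sup>+t. H (s, t) \<partial>std_normal \<partial>std_normal)"
proof -
  define \<Phi> where "\<Phi> = (\<lambda>(s,t). ennreal (std_normal_density s * std_normal_density t))"
  have [measurable]: "\<Phi> \<in> borel_measurable (borel \<Otimes>\<^sub>M borel)" unfolding \<Phi>_def by measurable
  have *: "(\<integral>\<^sup>+s. \<integral>\<^sup>+t. K (s, t) \<partial>std_normal \<partial>std_normal) = (\<integral>\<^sup>+s. \<integral>\<^sup>+t. \<Phi> (s,t) * K (s, t) \<partial>lborel \<partial>lborel)"
    if [measurable]: "K \<in> borel_measurable (borel \<Otimes>\<^sub>M borel)" for K
  proof -
    have "(\<integral>\<^sup>+s. \<integral>\<^sup>+t. K (s, t) \<partial>std_normal \<partial>std_normal)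
        = (\<integral>\<^sup>+s. ennreal (std_normal_density s) * (\<integral>\<^sup>+t. ennreal (std_normal_density t) * K (s, t) \<partial>lborel) \<partial>lborel)"
      unfolding std_normal_def by (subst nn_integral_density, measurable)+
    also have "\<dots> = (\<integral>\<^sup>+s. (\<integral>\<^sup>+t. \<Phi> (s,t) * K (s, t) \<partial>lborel) \<partial>lborel)"
      by (subst nn_integral_cmult[symmetric], measurable)
         (simp add: \<Phi>_def ennreal_mult mult.assoc)
    finally show ?thesis .
  qed
  have inv: "\<Phi> (c * s + d * t, - d * s + c * t) = \<Phi> (s, t)" for s t
  proof -
    have "(c * s + d * t)\<^sup>2 + (- d * s + c * t)\<^sup>2 = (c\<^sup>2 + d\<^sup>2) * (s\<^sup>2 + t\<^sup>2)"
      by (simp add: power2_eq_square algebra_simps)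
    then have e: "(c * s + d * t)\<^sup>2 + (- d * s + c * t)\<^sup>2 = s\<^sup>2 + t\<^sup>2" using cd by simp
    have "std_normal_density u * std_normal_density v = 1 / (2 * pi) * exp (- (u\<^sup>2 + v\<^sup>2) / 2)" for u v :: real
      by (simp add: normal_density_def real_sqrt_mult[symmetric] exp_add[symmetric] field_simps)
    note dens = this
    show ?thesis unfolding \<Phi>_def prod.case dens e ..
  qed
  have m: "(\<lambda>p. H (c * fst p + d * snd p, - d * fst p + c * snd p)) \<in> borel_measurable (borel \<Otimes>\<^sub>M borel)" by measurable
  have "(\<integral>\<^sup>+s. \<integral>\<^sup>+t. H (c * s + d * t, - d * s + c * t) \<partial>std_normal \<partial>std_normal)
      = (\<integral>\<^sup>+s. \<integral>\<^sup>+t. \<Phi> (c * s + d * t, - d * s + c * t) * H (c * s + d * t, - d * s + c * t) \<partial>lborel \<partial>lborel)"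
    unfolding inv using *[OF m] by simp
  also have "\<dots> = (\<integral>\<^sup>+s. \<integral>\<^sup>+t. \<Phi> (s,t) * H (s, t) \<partial>lborel \<partial>lborel)"
    using nn_integral_lborel_rotation[of "\<lambda>p. \<Phi> p * H p" c d] cd by simp
  finally show ?thesis using *[of H] by simp
qed

lemma nn_integral_gauss_pair:
  fixes b1 b2 :: "'a::{real_inner,second_countable_topology}"
  assumes "b1 \<noteq> b2" and [measurable]: "f \<in> borel_measurable borel"
  shows "(\<integral>\<^sup>+x. f x \<partial>gauss {b1, b2}) = (\<integral>\<^sup>+s. \<integral>\<^sup>+t. f (s *\<^sub>R b1 + t *\<^sub>R b2) \<partial>std_normal \<partial>std_normal)"
proof -
  have "gauss {b1, b2} = sum_law (gauss {b1}) (gauss {b2})"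
    using gauss_Un[of "{b1}" "{b2}"] assms(1) by (simp add: insert_commute)
  then have "(\<integral>\<^sup>+x. f x \<partial>gauss {b1, b2}) = (\<integral>\<^sup>+x. \<integral>\<^sup>+y. f (x + y) \<partial>gauss {b2} \<partial>gauss {b1})"
    by (simp add: nn_integral_sum_law gauss.sigma_finite_measure_axioms)
  also have "\<dots> = (\<integral>\<^sup>+s. \<integral>\<^sup>+t. f (s *\<^sub>R b1 + t *\<^sub>R b2) \<partial>std_normal \<partial>std_normal)"
    unfolding gauss_singleton by (subst nn_integral_distr, measurable)+
  finally show ?thesis .
qed

lemma measure_eqI_nn_integral:
  assumes "sets M = sets borel" "sets N = sets borel"
    "\<And>f. f \<in> borel_measurable borel \<Longrightarrow> (\<integral>\<^sup>+x. f x \<partial>M) = (\<integral>\<^sup>+x. f x \<partial>N)"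
  shows "M = N"
proof (rule measure_eqI)
  show "sets M = sets N" using assms by simp
  fix A assume "A \<in> sets M"
  then have "A \<in> sets borel" using assms by simp
  then show "emeasure M A = emeasure N A"
    using assms(3)[of "indicator A"] assms(1,2) by simp
qed

text \<open>
  Planar rotation invariance; it suffices for the general case since rotations in coordinate planes
  carry any orthonormal basis to any other, up to signs.
\<close>

lemma gauss_rotate_pair:
  fixes b1 b2 :: "'a::{real_inner,second_countable_topology}"
  assumes "orthonormal {b1, b2}" "b1 \<noteq> b2" "c\<^sup>2 + d\<^sup>2 = 1" "d \<noteq> 0"
  shows "gauss {b1, b2} = gauss {c *\<^sub>R b1 + d *\<^sub>R b2, - d *\<^sub>R b1 + c *\<^sub>R b2}"
    and "orthonormal {c *\<^sub>R b1 + d *\<^sub>R b2, - d *\<^sub>R b1 + c *\<^sub>R b2}"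
    and "c *\<^sub>R b1 + d *\<^sub>R b2 \<noteq> - d *\<^sub>R b1 + c *\<^sub>R b2"
proof -
  let ?c1 = "c *\<^sub>R b1 + d *\<^sub>R b2" and ?c2 = "- d *\<^sub>R b1 + c *\<^sub>R b2"
  have i: "b1 \<bullet> b1 = 1" "b2 \<bullet> b2 = 1" "b1 \<bullet> b2 = 0" "b2 \<bullet> b1 = 0"
    using assms(1,2) by (auto simp: orthonormal_def)
  have ii: "?c1 \<bullet> ?c1 = 1" "?c2 \<bullet> ?c2 = 1" "?c1 \<bullet> ?c2 = 0"
    using assms(3) by (auto simp: inner_add_left inner_add_right inner_diff_left inner_diff_right i power2_eq_square algebra_simps)
  then show ne: "?c1 \<noteq> ?c2" by auto
  show "orthonormal {?c1, ?c2}"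
    using ii ne inner_commute[of ?c2 ?c1] by (auto simp: orthonormal_def simp del: inner_simps)
  have cd: "c\<^sup>2 + (- d)\<^sup>2 = 1" "- d \<noteq> 0" using assms by auto
  show "gauss {b1, b2} = gauss {?c1, ?c2}"
  proof (rule measure_eqI_nn_integral)
    fix f :: "'a \<Rightarrow> ennreal" assume [measurable]: "f \<in> borel_measurable borel"
    have "(\<integral>\<^sup>+x. f x \<partial>gauss {b1, b2}) = (\<integral>\<^sup>+s. \<integral>\<^sup>+t. f (s *\<^sub>R b1 + t *\<^sub>R b2) \<partial>std_normal \<partial>std_normal)"
      using assms by (simp add: nn_integral_gauss_pair)
    also have "\<dots> = (\<integral>\<^sup>+s. \<integral>\<^sup>+t. f ((c * s + (- d) * t) *\<^sub>R b1 + (- (- d) * s + c * t) *\<^sub>R b2) \<partial>std_normal \<partial>std_normal)"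
      using nn_integral_std_normal_rotation[OF _ cd, of "\<lambda>p. f (fst p *\<^sub>R b1 + snd p *\<^sub>R b2)"] by simp
    also have "\<dots> = (\<integral>\<^sup>+s. \<integral>\<^sup>+t. f (s *\<^sub>R ?c1 + t *\<^sub>R ?c2) \<partial>std_normal \<partial>std_normal)"
      by (simp add: algebra_simps)
    also have "\<dots> = (\<integral>\<^sup>+x. f x \<partial>gauss {?c1, ?c2})"
      using ne by (simp add: nn_integral_gauss_pair)
    finally show "(\<integral>\<^sup>+x. f x \<partial>gauss {b1, b2}) = (\<integral>\<^sup>+x. f x \<partial>gauss {?c1, ?c2})" .
  qed auto
qed

lemma std_normal_uminus: "distr std_normal borel uminus = std_normal"
proof (rule measure_eqI_nn_integral)
  fix f :: "real \<Rightarrow> ennreal" assume [measurable]: "f \<in> borel_measurable borel"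
  have "(\<integral>\<^sup>+x. f x \<partial>distr std_normal borel uminus) = (\<integral>\<^sup>+x. f (- x) \<partial>std_normal)"
    by (subst nn_integral_distr) auto
  also have "\<dots> = (\<integral>\<^sup>+x. ennreal (std_normal_density x) * f (- x) \<partial>lborel)"
    unfolding std_normal_def by (subst nn_integral_density) auto
  also have "\<dots> = (\<integral>\<^sup>+x. ennreal (std_normal_density (- x)) * f x \<partial>lborel)"
    by (subst nn_integral_real_affine[where c="-1" and t=0]) auto
  also have "\<dots> = (\<integral>\<^sup>+x. f x \<partial>std_normal)"
    unfolding std_normal_def by (subst nn_integral_density) (auto simp: normal_density_def)
  finally show "(\<integral>\<^sup>+x. f x \<partial>distr std_normal borel uminus) = (\<integral>\<^sup>+x. f x \<partial>std_normal)" .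
qed auto

lemma gauss_singleton_uminus: "gauss {- b} = gauss {b}"
proof -
  have "gauss {b} = distr (distr std_normal borel uminus) borel (\<lambda>s. s *\<^sub>R b)"
    by (simp add: std_normal_uminus gauss_singleton)
  also have "\<dots> = distr std_normal borel (\<lambda>s. s *\<^sub>R (- b))"
    by (subst distr_distr) (auto simp: comp_def)
  finally show ?thesis by (simp add: gauss_singleton)
qed

text \<open>
  A Gaussian measure may be written in an orthonormal basis through a prescribed unit vector.
  Induction on the number of basis vectors that are not orthogonal to \<open>e\<close>.
\<close>

lemma gauss_exchange:
  fixes B :: "'a::{real_inner,second_countable_topology} set"
  assumes "orthonormal B" "e \<in> span B" "norm e = 1"
  shows "\<exists>C. orthonormal C \<and> e \<in> C \<and> span C = span B \<and> gauss C = gauss B"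
  using assms
proof (induction "card {b\<in>B. e \<bullet> b \<noteq> 0}" arbitrary: B rule: less_induct)
  case less
  note on = less.prems(1)
  have fin: "finite B" using on by (rule orthonormal_finite)
  let ?N = "{b\<in>B. e \<bullet> b \<noteq> 0}"
  have ee: "e \<bullet> e = 1" using less.prems by (simp add: norm_eq_1)
  have exp: "e = (\<Sum>b\<in>?N. (e \<bullet> b) *\<^sub>R b)"
  proof -
    have "e = (\<Sum>b\<in>B. (e \<bullet> b) *\<^sub>R b)" using less.prems by (intro orthonormal_expand)
    also have "\<dots> = (\<Sum>b\<in>?N. (e \<bullet> b) *\<^sub>R b)" using fin by (intro sum.mono_neutral_right) auto
    finally show ?thesis .
  qed
  show ?case
  proof (cases "\<exists>b1\<in>?N. \<exists>b2\<in>?N. b1 \<noteq> b2")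
    case False
    have "?N \<noteq> {}" using exp ee by (metis inner_zero_left sum.empty zero_neq_one)
    then obtain b where b: "b \<in> ?N" by auto
    with False have N: "?N = {b}" by auto
    then have eb: "e = (e \<bullet> b) *\<^sub>R b" using exp by simp
    then have "e \<bullet> e = (e \<bullet> b) * (e \<bullet> b)" by (metis inner_commute inner_scaleR_left)
    then have "e \<bullet> b = 1 \<or> e \<bullet> b = - 1" using ee by (metis square_eq_1_iff)
    then have pm: "e = b \<or> e = - b" using eb by auto
    let ?R = "B - {b}"
    have B: "B = {b} \<union> ?R" using b by auto
    have orth: "a \<bullet> r = 0" if "a \<in> {e}" "r \<in> ?R" for a r
      using that pm on b by (auto simp: orthonormal_inner)
    have ose: "orthonormal {e}" using ee by (auto simp: orthonormal_def)
    have oR: "orthonormal ?R" using on by (rule orthonormal_subset) auto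
    note o = orthonormal_Un[OF ose oR orth]
    have "gauss ({e} \<union> ?R) = sum_law (gauss {e}) (gauss ?R)"
      using o fin by (intro gauss_Un) auto
    also have "gauss {e} = gauss {b}" using pm by (auto simp: gauss_singleton_uminus)
    also have "sum_law (gauss {b}) (gauss ?R) = gauss ({b} \<union> ?R)"
      using fin by (intro gauss_Un[symmetric]) auto
    finally have g: "gauss ({e} \<union> ?R) = gauss B" using B by simp
    have "span ({e} \<union> ?R) = span B"
    proof (rule subset_antisym)
      have "b \<in> span ({e} \<union> ?R)"
      proof (cases "e = b")
        case False
        then have "b = - e" using pm by auto
        then show ?thesis by (simp add: span_neg span_base)
      qed (simp add: span_base)
      then have "B \<subseteq> span ({e} \<union> ?R)" by (auto intro: span_base)
      then show "span B \<subseteq> span ({e} \<union> ?R)" by (simp add: span_minimal)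
      have "{e} \<union> ?R \<subseteq> span B" using less.prems by (auto intro: span_base)
      then show "span ({e} \<union> ?R) \<subseteq> span B" by (simp add: span_minimal)
    qed
    then show ?thesis using o(1) g by blast
  next
    case True
    then obtain b1 b2 where b: "b1 \<in> ?N" "b2 \<in> ?N" "b1 \<noteq> b2" by blast
    \<comment> \<open>Rotate in the plane of \<open>b1\<close> and \<open>b2\<close> until one of the two vectors is orthogonal to \<open>e\<close>.\<close>
    define r where "r = sqrt ((e \<bullet> b1)\<^sup>2 + (e \<bullet> b2)\<^sup>2)"
    have r: "r > 0" "r\<^sup>2 = (e \<bullet> b1)\<^sup>2 + (e \<bullet> b2)\<^sup>2"
      unfolding r_def using b by (auto simp: add_pos_nonneg)
    define c d where "c = (e \<bullet> b1) / r" and "d = (e \<bullet> b2) / r"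
    have cd: "c\<^sup>2 + d\<^sup>2 = 1" "d \<noteq> 0"
      using r b by (auto simp: c_def d_def power_divide add_divide_distrib[symmetric])
    let ?c1 = "c *\<^sub>R b1 + d *\<^sub>R b2" and ?c2 = "- d *\<^sub>R b1 + c *\<^sub>R b2"
    let ?R = "B - {b1, b2}"
    have o12: "orthonormal {b1, b2}" using on by (rule orthonormal_subset) (use b in auto)
    note rot = gauss_rotate_pair[OF o12 b(3) cd]
    have B: "B = {b1, b2} \<union> ?R" using b by auto
    have i: "b1 \<bullet> x = 0" "b2 \<bullet> x = 0" if "x \<in> ?R" for x
      using that b on by (auto simp: orthonormal_inner)
    have oR: "orthonormal ?R" using on by (rule orthonormal_subset) auto
    have orth: "a \<bullet> x = 0" if "a \<in> {?c1, ?c2}" "x \<in> ?R" for a x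
      using that i by (auto simp: inner_add_left inner_diff_left)
    note o = orthonormal_Un[OF rot(2) oR orth]
    let ?C = "{?c1, ?c2} \<union> ?R"
    have "gauss ?C = sum_law (gauss {?c1, ?c2}) (gauss ?R)"
      using o fin by (intro gauss_Un) auto
    also have "\<dots> = sum_law (gauss {b1, b2}) (gauss ?R)" using rot(1) by simp
    also have "\<dots> = gauss ({b1, b2} \<union> ?R)"
      using fin by (intro gauss_Un[symmetric]) auto
    finally have g: "gauss ?C = gauss B" using B by simp
    have e2: "e \<bullet> ?c2 = 0" by (simp add: inner_add_right inner_diff_right c_def d_def)
    have sC: "span ?C = span B"
    proof (rule subset_antisym)
      have "?C \<subseteq> span B"
        using b by (auto intro!: span_add span_diff span_scale intro: span_base)
      then show "span ?C \<subseteq> span B" by (simp add: span_minimal)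
      have c12: "?c1 \<in> span ?C" "?c2 \<in> span ?C" by (auto intro: span_base)
      have "b1 = c *\<^sub>R ?c1 - d *\<^sub>R ?c2"
        using cd by (simp add: algebra_simps power2_eq_square) (metis scaleR_left.add scaleR_one)
      moreover have "b2 = d *\<^sub>R ?c1 + c *\<^sub>R ?c2"
        using cd by (simp add: algebra_simps power2_eq_square) (metis scaleR_left.add scaleR_one add.commute)
      ultimately have "b1 \<in> span ?C" "b2 \<in> span ?C"
        using c12 by (metis span_diff span_scale, metis span_add span_scale)
      then have "B \<subseteq> span ?C" by (auto intro: span_base)
      then show "span B \<subseteq> span ?C" by (simp add: span_minimal)
    qed
    have "{x\<in>?C. e \<bullet> x \<noteq> 0} \<subseteq> insert ?c1 (?N - {b1, b2})" using e2 by auto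
    then have "card {x\<in>?C. e \<bullet> x \<noteq> 0} \<le> card (insert ?c1 (?N - {b1, b2}))"
      using fin by (intro card_mono) auto
    also have "\<dots> \<le> Suc (card (?N - {b1, b2}))" by (rule card_insert_le_m1) auto
    also have "\<dots> < card ?N"
    proof -
      have "card (?N - {b1, b2}) = card ?N - 2" using b by (subst card_Diff_subset) auto
      moreover have "card {b1, b2} \<le> card ?N" using b fin by (intro card_mono) auto
      ultimately show ?thesis using b by simp
    qed
    finally have "card {x\<in>?C. e \<bullet> x \<noteq> 0} < card ?N" .
    from less.hyps[OF this o(1)] less.prems show ?thesis unfolding sC g by auto
  qed
qed

text \<open>
  Rotation invariance: exchange the elements of \<open>C\<close> into \<open>B\<close> one at a time.
\<close>

theorem gauss_cong_span:
  fixes B C :: "'a::{real_inner,second_countable_topology} set"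
  assumes "orthonormal B" "orthonormal C" "span B = span C"
  shows "gauss B = gauss C"
  using assms
proof (induction "card C" arbitrary: B C)
  case 0
  then have C: "C = {}" by (simp add: orthonormal_finite)
  then have "card B = 0" using orthonormal_card_eq[OF 0(2,3,4)] by simp
  then show ?case using 0 C by (simp add: orthonormal_finite)
next
  case (Suc n)
  then obtain e where e: "e \<in> C" by fastforce
  have "norm e = 1" "e \<in> span B" using e Suc.prems by (auto simp: orthonormal_norm span_base)
  from gauss_exchange[OF Suc.prems(1) this(2,1)] obtain D where
    D: "orthonormal D" "e \<in> D" "span D = span B" "gauss D = gauss B" by blast
  have sp: "span (X - {e}) = {v \<in> span X. v \<bullet> e = 0}" if X: "orthonormal X" "e \<in> X" for X
    by (rule orthonormal_span_remove[OF X])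
  have "gauss (D - {e}) = gauss (C - {e})"
  proof (rule Suc.hyps(1))
    show "n = card (C - {e})" using Suc.hyps(2) e Suc.prems by (simp add: orthonormal_finite)
    show "orthonormal (D - {e})" using D(1) by (rule orthonormal_subset) auto
    show "orthonormal (C - {e})" using Suc.prems(2) by (rule orthonormal_subset) auto
    show "span (D - {e}) = span (C - {e})" using sp D e Suc.prems by simp
  qed
  moreover have "gauss X = sum_law (gauss {e}) (gauss (X - {e}))" if "orthonormal X" "e \<in> X" for X
    using gauss_Un[of "{e}" "X - {e}"] that by (simp add: orthonormal_finite insert_absorb)
  ultimately show ?case using D Suc.prems e by metis
qed

lemma sets_span [measurable]:
  fixes B :: "'a::{real_inner,second_countable_topology} set"
  assumes "orthonormal B"
  shows "span B \<in> sets borel"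
proof -
  have "span B = {x \<in> space borel. x = (\<Sum>b\<in>B. (x \<bullet> b) *\<^sub>R b)}"
  proof (intro set_eqI iffI)
    fix x assume "x \<in> {x \<in> space borel. x = (\<Sum>b\<in>B. (x \<bullet> b) *\<^sub>R b)}"
    then have "x = (\<Sum>b\<in>B. (x \<bullet> b) *\<^sub>R b)" by simp
    moreover have "(\<Sum>b\<in>B. (x \<bullet> b) *\<^sub>R b) \<in> span B"
      by (intro span_sum_scaleR orthonormal_finite assms)
    ultimately show "x \<in> span B" by metis
  qed (use orthonormal_expand[OF assms] in auto)
  also have "\<dots> \<in> sets borel" by measurable
  finally show ?thesis .
qed

lemma AE_gauss_span:
  fixes B :: "'a::{real_inner,second_countable_topology} set"
  assumes "orthonormal B"
  shows "AE x in gauss B. x \<in> span B"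
proof -
  have "{x \<in> space borel. x \<in> span B} \<in> sets borel" using sets_span[OF assms] by simp
  then show ?thesis
    unfolding gauss_def
    by (subst AE_distr_iff[OF measurable_gauss_sum])
       (auto intro!: AE_I2 span_sum_scaleR orthonormal_finite[OF assms])
qed

text \<open>
  Exchange \<open>e\<close> into the basis; the other basis vectors do not contribute to the inner product.
\<close>

lemma gauss_inner_law:
  fixes B :: "'a::{real_inner,second_countable_topology} set"
  assumes "orthonormal B" "e \<in> span B" "norm e = 1"
  shows "distr (gauss B) borel (\<lambda>x. x \<bullet> e) = std_normal"
proof -
  obtain C where C: "orthonormal C" "e \<in> C" "span C = span B" "gauss C = gauss B"
    using gauss_exchange[OF assms] by blast
  have "C = {e} \<union> (C - {e})" using C by auto
  moreover have "distr (gauss ({e} \<union> (C - {e}))) borel (\<lambda>x. x \<bullet> e) = gauss ((\<lambda>x. x \<bullet> e) ` {e})"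
    using C assms(3)
    by (intro gauss_kernel) (auto simp: orthonormal_finite orthonormal_inner norm_eq_1 linear_iff inner_add_left)
  moreover have "gauss {1::real} = std_normal"
    by (simp add: gauss_singleton distr_id2)
  ultimately show ?thesis using C assms(3) by (simp add: norm_eq_1)
qed

lemma AE_std_normal_neq: "AE x in std_normal. x \<noteq> c"
proof -
  have "AE x in lborel. 0 < ennreal (std_normal_density x) \<longrightarrow> x \<noteq> c"
    using AE_lborel_singleton[of c] by eventually_elim blast
  then show ?thesis unfolding std_normal_def by (subst AE_density) auto
qed

lemma AE_gauss_hyperplane:
  fixes B :: "'a::{real_inner,second_countable_topology} set"
  assumes "orthonormal B" "v \<in> span B" "v \<noteq> 0"
  shows "AE x in gauss B. x \<bullet> v \<noteq> c"
proof -
  have e: "sgn v \<in> span B" "norm (sgn v) = 1" using assms by (auto simp: sgn_div_norm span_scale)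
  have "AE s in distr (gauss B) borel (\<lambda>x. x \<bullet> sgn v). s \<noteq> c / norm v"
    unfolding gauss_inner_law[OF assms(1) e] by (rule AE_std_normal_neq)
  then have "AE x in gauss B. x \<bullet> sgn v \<noteq> c / norm v"
    by (subst (asm) AE_distr_iff) auto
  then show ?thesis
    by eventually_elim (use assms(3) in \<open>auto simp: sgn_div_norm field_simps\<close>)
qed

lemma gauss_uminus:
  fixes B :: "'a::{real_inner,second_countable_topology} set"
  assumes "orthonormal B"
  shows "distr (gauss B) borel uminus = gauss B"
proof -
  have "distr (gauss B) borel uminus = gauss (uminus ` B)"
    using assms by (intro gauss_image) (auto simp: orthonormal_finite linear_iff)
  also have "\<dots> = gauss B"
  proof (rule gauss_cong_span)
    show "orthonormal (uminus ` B)" using assms by (auto simp: orthonormal_def)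
    show "span (uminus ` B) = span B"
    proof (rule subset_antisym)
      show "span (uminus ` B) \<subseteq> span B"
        by (intro span_minimal) (auto simp: span_neg span_base)
      have "b \<in> span (uminus ` B)" if "b \<in> B" for b
        using that span_neg[of "- b" "uminus ` B"] by (auto intro: span_base)
      then show "span B \<subseteq> span (uminus ` B)" by (intro span_minimal) auto
    qed
  qed fact
  finally show ?thesis .
qed

lemma emeasure_gauss_Un:
  fixes A B :: "'a::{real_inner,second_countable_topology} set"
  assumes "finite A" "finite B" "A \<inter> B = {}" and [measurable]: "E \<in> sets borel"
  shows "emeasure (gauss (A \<union> B)) E = (\<integral>\<^sup>+x. emeasure (gauss B) {y. x + y \<in> E} \<partial>gauss A)"
proof -
  have "emeasure (gauss (A \<union> B)) E = (\<integral>\<^sup>+x. indicator E x \<partial>sum_law (gauss A) (gauss B))"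
    using assms by (simp add: gauss_Un)
  also have "\<dots> = (\<integral>\<^sup>+x. \<integral>\<^sup>+y. indicator E (x + y) \<partial>gauss B \<partial>gauss A)"
    by (rule nn_integral_sum_law) (auto intro: gauss.sigma_finite_measure_axioms)
  also have "\<dots> = (\<integral>\<^sup>+x. emeasure (gauss B) {y. x + y \<in> E} \<partial>gauss A)"
  proof (intro nn_integral_cong)
    fix x :: 'a
    have [measurable]: "{y. x + y \<in> E} \<in> sets (gauss B)"
      using measurable_sets[of "\<lambda>y. x + y" borel borel E] by (simp add: vimage_def)
    have "(\<integral>\<^sup>+y. indicator E (x + y) \<partial>gauss B) = (\<integral>\<^sup>+y. indicator {y. x + y \<in> E} y \<partial>gauss B)"
      by (intro nn_integral_cong) (auto simp: indicator_def)
    then show "(\<integral>\<^sup>+y. indicator E (x + y) \<partial>gauss B) = emeasure (gauss B) {y. x + y \<in> E}" by simp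
  qed
  finally show ?thesis .
qed

lemma AE_gauss_Un:
  fixes A B :: "'a::{real_inner,second_countable_topology} set"
  assumes "finite A" "finite B" "A \<inter> B = {}" and [measurable]: "Measurable.pred borel P"
    and "AE x in gauss A. AE y in gauss B. P (x + y)"
  shows "AE z in gauss (A \<union> B). P z"
proof -
  have "{z. \<not> P z} \<in> sets borel" by measurable
  then have "emeasure (gauss (A \<union> B)) {z. \<not> P z} = (\<integral>\<^sup>+x. emeasure (gauss B) {y. \<not> P (x + y)} \<partial>gauss A)"
    using emeasure_gauss_Un[OF assms(1-3)] by simp
  also have "\<dots> = (\<integral>\<^sup>+x. 0 \<partial>gauss A)"
    using assms(5)
  proof (intro nn_integral_cong_AE, eventually_elim)
    case (elim x)
    then show ?case by (subst (asm) AE_iff_measurable[OF _ refl]) auto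
  qed
  finally show ?thesis by (subst AE_iff_measurable[OF _ refl]) auto
qed

text \<open>
  Orthogonal components of a Gaussian vector are independent.
\<close>

lemma emeasure_gauss_orthogonal_event:
  fixes A B :: "'a::{real_inner,second_countable_topology} set"
  assumes on: "orthonormal A" "orthonormal B" and "A \<inter> B = {}"
    and [measurable]: "E \<in> sets borel" "C \<in> sets borel" "D \<in> sets borel"
    and ev: "\<And>x y. x \<in> span A \<Longrightarrow> y \<in> span B \<Longrightarrow> x + y \<in> E \<longleftrightarrow> x \<in> C \<and> y \<in> D"
  shows "emeasure (gauss (A \<union> B)) E = emeasure (gauss A) C * emeasure (gauss B) D"
proof -
  have "emeasure (gauss (A \<union> B)) E = (\<integral>\<^sup>+x. emeasure (gauss B) {y. x + y \<in> E} \<partial>gauss A)"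
    using assms by (intro emeasure_gauss_Un) (auto simp: orthonormal_finite)
  also have "\<dots> = (\<integral>\<^sup>+x. emeasure (gauss B) D * indicator C x \<partial>gauss A)"
  proof (rule nn_integral_cong_AE, rule AE_mp[OF AE_gauss_span[OF on(1)]], intro AE_I2 impI)
    fix x assume elim: "x \<in> span A"
    have m: "{y. x + y \<in> E} \<in> sets (gauss B)"
      using measurable_sets[of "\<lambda>y. x + y" borel borel E] by (simp add: vimage_def)
    show "emeasure (gauss B) {y. x + y \<in> E} = emeasure (gauss B) D * indicator C x"
    proof (cases "x \<in> C")
      case True
      then have "emeasure (gauss B) {y. x + y \<in> E} = emeasure (gauss B) D"
        using ev[OF elim] m AE_gauss_span[OF on(2)] by (intro emeasure_eq_AE) auto
      then show ?thesis using True by simp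
    next
      case False
      then have "emeasure (gauss B) {y. x + y \<in> E} = emeasure (gauss B) {}"
        using ev[OF elim] m AE_gauss_span[OF on(2)] by (intro emeasure_eq_AE) auto
      then show ?thesis using False by simp
    qed
  qed
  also have "\<dots> = emeasure (gauss A) C * emeasure (gauss B) D"
    by (subst nn_integral_cmult) (auto simp: mult.commute)
  finally show ?thesis .
qed

lemma PiM_std_normal_density:
  assumes "finite B"
  shows "(\<Pi>\<^sub>M b\<in>B. std_normal) = density (\<Pi>\<^sub>M b\<in>B. lborel) (\<lambda>f. \<Prod>b\<in>B. ennreal (std_normal_density (f b)))"
proof (rule std_normal_prod.PiM_eqI[symmetric])
  interpret L: product_sigma_finite "\<lambda>_. lborel :: real measure" ..
  show "finite B" by fact
  show "sets (density (\<Pi>\<^sub>M b\<in>B. lborel) (\<lambda>f. \<Prod>b\<in>B. ennreal (std_normal_density (f b)))) = sets (\<Pi>\<^sub>M b\<in>B. std_normal)"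
    by (simp cong: sets_PiM_cong)
  fix A :: "'a \<Rightarrow> real set" assume A: "\<And>b. b \<in> B \<Longrightarrow> A b \<in> sets std_normal"
  then have [measurable]: "\<And>b. b \<in> B \<Longrightarrow> A b \<in> sets borel" by simp
  have [measurable]: "Pi\<^sub>E B A \<in> sets (\<Pi>\<^sub>M b\<in>B. lborel)" using assms A by (intro sets_PiM_I_finite) auto
  have "emeasure (density (\<Pi>\<^sub>M b\<in>B. lborel) (\<lambda>f. \<Prod>b\<in>B. ennreal (std_normal_density (f b)))) (Pi\<^sub>E B A)
      = (\<integral>\<^sup>+f. (\<Prod>b\<in>B. ennreal (std_normal_density (f b))) * indicator (Pi\<^sub>E B A) f \<partial>(\<Pi>\<^sub>M b\<in>B. lborel))"
    using assms by (subst emeasure_density) auto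
  also have "\<dots> = (\<integral>\<^sup>+f. (\<Prod>b\<in>B. ennreal (std_normal_density (f b)) * indicator (A b) (f b)) \<partial>(\<Pi>\<^sub>M b\<in>B. lborel))"
  proof (intro nn_integral_cong)
    fix f assume "f \<in> space (\<Pi>\<^sub>M b\<in>B. lborel :: real measure)"
    then have e: "f \<in> extensional B" by (auto simp: space_PiM PiE_def)
    have "indicator (Pi\<^sub>E B A) f = (\<Prod>b\<in>B. indicator (A b) (f b) :: ennreal)"
    proof (cases "f \<in> Pi\<^sub>E B A")
      case False
      then obtain b where "b \<in> B" "f b \<notin> A b" using e by (auto simp: PiE_def)
      then have "(\<Prod>b\<in>B. indicator (A b) (f b) :: ennreal) = 0"
        using assms by (intro prod_zero) (auto intro!: bexI[of _ b])
      then show ?thesis using False by simp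
    qed (auto simp: PiE_def Pi_def)
    then show "(\<Prod>b\<in>B. ennreal (std_normal_density (f b))) * indicator (Pi\<^sub>E B A) f
        = (\<Prod>b\<in>B. ennreal (std_normal_density (f b)) * indicator (A b) (f b))"
      by (simp add: prod.distrib)
  qed
  also have "\<dots> = (\<Prod>b\<in>B. \<integral>\<^sup>+x. ennreal (std_normal_density x) * indicator (A b) x \<partial>lborel)"
    using assms by (intro L.product_nn_integral_prod) auto
  also have "\<dots> = (\<Prod>b\<in>B. emeasure std_normal (A b))"
    unfolding std_normal_def using A by (intro prod.cong refl) (subst emeasure_density, auto)
  finally show "emeasure (density (\<Pi>\<^sub>M b\<in>B. lborel) (\<lambda>f. \<Prod>b\<in>B. ennreal (std_normal_density (f b)))) (Pi\<^sub>E B A) = (\<Prod>b\<in>B. emeasure std_normal (A b))" .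
qed

lemma gauss_Basis_density:
  "gauss (Basis :: 'a::euclidean_space set) = density lborel (\<lambda>x. ennreal (\<Prod>b\<in>Basis. std_normal_density (x \<bullet> b)))"
proof -
  let ?P = "\<Pi>\<^sub>M b\<in>(Basis::'a set). (lborel :: real measure)"
  have m: "(\<lambda>f. \<Sum>b\<in>Basis. f b *\<^sub>R b) \<in> measurable ?P (borel :: 'a measure)" by measurable
  have "density lborel (\<lambda>x::'a. ennreal (\<Prod>b\<in>Basis. std_normal_density (x \<bullet> b)))
     = distr (density ?P (\<lambda>f. ennreal (\<Prod>b\<in>Basis. std_normal_density ((\<Sum>b\<in>Basis. f b *\<^sub>R b) \<bullet> b)))) borel (\<lambda>f. \<Sum>b\<in>Basis. f b *\<^sub>R b)"
    unfolding lborel_eq[where 'a='a] by (rule density_distr[OF _ m]) measurable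
  also have "(\<lambda>f. ennreal (\<Prod>b\<in>Basis. std_normal_density ((\<Sum>b\<in>(Basis::'a set). f b *\<^sub>R b) \<bullet> b)))
     = (\<lambda>f. \<Prod>b\<in>Basis. ennreal (std_normal_density (f b)))"
    by (intro ext) (simp add: prod_ennreal)
  finally show ?thesis
    unfolding gauss_def by (simp add: PiM_std_normal_density)
qed

lemma orthonormal_Basis: "orthonormal (Basis :: 'a::euclidean_space set)"
  by (auto simp: orthonormal_def inner_Basis)

section \<open>Solid angles are Gaussian probabilities\<close>

lemma PiM_lborel_scale:
  fixes r :: real
  assumes "finite B" "r > 0"
  shows "(\<Pi>\<^sub>M b\<in>B. lborel) = density (distr (\<Pi>\<^sub>M b\<in>B. lborel) (\<Pi>\<^sub>M b\<in>B. lborel) (\<lambda>f. \<lambda>b\<in>B. r * f b)) (\<lambda>_. ennreal (r ^ card B))"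
proof -
  interpret L: product_sigma_finite "\<lambda>_. lborel :: real measure" ..
  let ?L = "\<Pi>\<^sub>M b\<in>B. (lborel :: real measure)"
  let ?S = "\<lambda>f::'a \<Rightarrow> real. \<lambda>b\<in>B. r * f b"
  have m: "?S \<in> measurable ?L ?L" by measurable
  show ?thesis
  proof (rule L.PiM_eqI[symmetric])
    fix A :: "'a \<Rightarrow> real set" assume A: "\<And>b. b \<in> B \<Longrightarrow> A b \<in> sets lborel"
    then have [measurable]: "\<And>b. b \<in> B \<Longrightarrow> A b \<in> sets borel" by simp
    have [measurable]: "Pi\<^sub>E B A \<in> sets ?L" using assms A by (intro sets_PiM_I_finite) auto
    have v: "?S -` (Pi\<^sub>E B A) \<inter> space ?L = Pi\<^sub>E B (\<lambda>b. {x. r * x \<in> A b})"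
      by (auto simp: space_PiM PiE_def Pi_def)
    have ms: "{x. r * x \<in> A b} \<in> sets lborel" if "b \<in> B" for b
      using A[OF that] measurable_sets[of "\<lambda>x. r * x" borel borel "A b"] by (simp add: vimage_def)
    have "emeasure (density (distr ?L ?L ?S) (\<lambda>_. ennreal (r ^ card B))) (Pi\<^sub>E B A)
        = ennreal (r ^ card B) * emeasure ?L (Pi\<^sub>E B (\<lambda>b. {x. r * x \<in> A b}))"
      using m by (subst emeasure_density) (auto simp: nn_integral_cmult_indicator emeasure_distr v)
    also have "\<dots> = (\<Prod>b\<in>B. ennreal r * emeasure lborel {x. r * x \<in> A b})"
      using assms ms by (subst L.emeasure_PiM) (auto simp: prod.distrib ennreal_power)
    also have "\<dots> = (\<Prod>b\<in>B. emeasure lborel (A b))"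
    proof (intro prod.cong refl)
      fix b assume b: "b \<in> B"
      have "emeasure lborel (A b) = emeasure (density (distr lborel borel ((*) r)) (\<lambda>_. ennreal \<bar>r\<bar>)) (A b)"
        using lborel_distr_mult'[of r] assms by simp
      also have "\<dots> = ennreal r * emeasure lborel {x. r * x \<in> A b}"
        using A[OF b] assms by (subst emeasure_density) (auto simp: nn_integral_cmult_indicator emeasure_distr vimage_def)
      finally show "ennreal r * emeasure lborel {x. r * x \<in> A b} = emeasure lborel (A b)" ..
    qed
    finally show "emeasure (density (distr ?L ?L ?S) (\<lambda>_. ennreal (r ^ card B))) (Pi\<^sub>E B A) = (\<Prod>b\<in>B. emeasure lborel (A b))" .
  qed (use assms in auto)
qed

definition scone :: "'a::real_vector set \<Rightarrow> bool" where
  "scone C \<longleftrightarrow> 0 \<in> C \<and> (\<forall>x\<in>C. \<forall>t>0. t *\<^sub>R x \<in> C)"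

lemma scone_scaleR_iff: "scone C \<Longrightarrow> t > 0 \<Longrightarrow> t *\<^sub>R x \<in> C \<longleftrightarrow> x \<in> C"
proof
  assume C: "scone C" and t: "t > 0" and x: "t *\<^sub>R x \<in> C"
  then have "inverse t *\<^sub>R (t *\<^sub>R x) \<in> C" unfolding scone_def by (meson positive_imp_inverse_positive)
  then show "x \<in> C" using t by simp
qed (simp add: scone_def)

lemma scone_sgn_iff: "scone C \<Longrightarrow> sgn x \<in> C \<longleftrightarrow> x \<in> C" for x :: "'a::real_normed_vector"
  using scone_scaleR_iff[of C "inverse (norm x)" x] by (cases "x = 0") (auto simp: sgn_div_norm scone_def)

text \<open>
  The Gaussian density as a mixture of indicator functions of balls.
\<close>

lemma exp_layer_cake:
  fixes \<rho> :: real
  assumes "\<rho> \<ge> 0"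
  shows "ennreal (exp (- \<rho>\<^sup>2 / 2)) = (\<integral>\<^sup>+t. ennreal (t * exp (- t\<^sup>2 / 2)) * indicator {\<rho>..} t \<partial>lborel)"
proof -
  have "(\<integral>\<^sup>+t. ennreal (t * exp (- t\<^sup>2 / 2)) * indicator {\<rho>..} t \<partial>lborel) = ennreal (0 - (- exp (- \<rho>\<^sup>2 / 2)))"
  proof (rule nn_integral_FTC_atLeast)
    show "DERIV (\<lambda>t. - exp (- t\<^sup>2 / 2)) t :> t * exp (- t\<^sup>2 / 2)" for t :: real
      by (auto intro!: derivative_eq_intros)
    have "filterlim (\<lambda>t::real. - (t\<^sup>2) / 2) at_bot at_top" by real_asymp
    then have "((\<lambda>t::real. exp (- t\<^sup>2 / 2)) \<longlongrightarrow> 0) at_top"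
      by (rule filterlim_compose[OF exp_at_bot])
    then show "((\<lambda>t::real. - exp (- t\<^sup>2 / 2)) \<longlongrightarrow> 0) at_top" using tendsto_minus by fastforce
  qed (use assms in auto)
  then show ?thesis by simp
qed

text \<open>
  By the layer-cake formula the Gaussian measure of a cone is a mixture of the volumes of its
  intersections with balls, and these scale with the radius. The factor \<open>K\<close> does not depend on the cone,
  so it cancels in normalised quantities.
\<close>

lemma emeasure_gauss_scone:
  fixes B :: "'a::{real_inner,second_countable_topology} set" and C :: "'a set"
  assumes on: "orthonormal B" and C: "scone C" and [measurable]: "C \<in> sets borel"
  defines "K \<equiv> ennreal ((1 / sqrt (2 * pi)) ^ card B) *
     (\<integral>\<^sup>+t. ennreal (t * exp (- t\<^sup>2 / 2)) * (ennreal (t ^ card B) * indicator {0<..} t) \<partial>lborel)"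
  shows "emeasure (gauss B) C = K * emeasure (distr (\<Pi>\<^sub>M b\<in>B. lborel) borel (\<lambda>f. \<Sum>b\<in>B. f b *\<^sub>R b)) (cball 0 1 \<inter> C)"
proof -
  let ?L = "\<Pi>\<^sub>M b\<in>B. (lborel :: real measure)"
  let ?s = "\<lambda>f. \<Sum>b\<in>B. f b *\<^sub>R b"
  interpret L: product_sigma_finite "\<lambda>_. lborel :: real measure" ..
  have fin: "finite B" using on by (rule orthonormal_finite)
  interpret L: sigma_finite_measure ?L using fin by (rule L.sigma_finite)
  interpret P: pair_sigma_finite ?L "lborel :: real measure" ..
  have s [measurable]: "?s \<in> measurable ?L borel" by measurable
  define m where "m = card B"
  define c where "c = (1 / sqrt (2 * pi)) ^ m"
  define V where "V r = emeasure ?L {f \<in> space ?L. ?s f \<in> C \<and> norm (?s f) \<le> r}" for r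
  have V: "V r = ennreal (r ^ m) * V 1" if "r > 0" for r
  proof -
    let ?S = "\<lambda>f::'a \<Rightarrow> real. \<lambda>b\<in>B. r * f b"
    have mS: "?S \<in> measurable ?L ?L" by measurable
    let ?A = "{f \<in> space ?L. ?s f \<in> C \<and> norm (?s f) \<le> r}"
    have mA: "?A \<in> sets ?L" by measurable
    have sS: "?s (?S f) = r *\<^sub>R ?s f" for f
      by (simp add: scaleR_sum_right)
    have "?S -` ?A \<inter> space ?L = {f \<in> space ?L. ?s f \<in> C \<and> norm (?s f) \<le> 1}"
      using that measurable_space[OF mS] scone_scaleR_iff[OF C that] unfolding vimage_def mem_Collect_eq sS by auto
    then have "V r = ennreal (r ^ m) * emeasure ?L {f \<in> space ?L. ?s f \<in> C \<and> norm (?s f) \<le> 1}"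
      unfolding V_def m_def by (subst PiM_lborel_scale[OF fin that])
        (use mA mS in \<open>auto simp: emeasure_density nn_integral_cmult_indicator emeasure_distr\<close>)
    then show ?thesis by (simp add: V_def)
  qed
  have norm2: "(norm (?s f))\<^sup>2 = (\<Sum>b\<in>B. (f b)\<^sup>2)" for f
  proof -
    have "?s f \<bullet> ?s f = (\<Sum>b\<in>B. (?s f \<bullet> b) * (?s f \<bullet> b))"
      using on fin by (intro orthonormal_inner_expand span_sum_scaleR) auto
    also have "\<dots> = (\<Sum>b\<in>B. (f b)\<^sup>2)"
      using on by (intro sum.cong) (auto simp: orthonormal_inner_sum power2_eq_square)
    finally show ?thesis by (simp add: power2_norm_eq_inner)
  qed
  have dens: "(\<Prod>b\<in>B. ennreal (std_normal_density (f b))) = ennreal c * ennreal (exp (- (norm (?s f))\<^sup>2 / 2))" for f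
  proof -
    have "(\<Prod>b\<in>B. ennreal (std_normal_density (f b))) = ennreal (\<Prod>b\<in>B. std_normal_density (f b))"
      by (simp add: prod_ennreal)
    also have "(\<Prod>b\<in>B. std_normal_density (f b)) = c * exp (\<Sum>b\<in>B. - (f b)\<^sup>2 / 2)"
      using fin by (simp add: normal_density_def prod_dividef exp_sum c_def m_def power_divide)
    also have "(\<Sum>b\<in>B. - (f b)\<^sup>2 / 2) = - (norm (?s f))\<^sup>2 / 2"
      by (simp add: norm2 sum_divide_distrib sum_negf)
    finally show ?thesis by (simp add: ennreal_mult c_def)
  qed
  have mF: "(\<lambda>(f, t). ennreal (t * exp (- t\<^sup>2 / 2)) * indicator {norm (?s f)..} t * indicator C (?s f) :: ennreal)
        \<in> borel_measurable (?L \<Otimes>\<^sub>M lborel)"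
  proof -
    have "(\<lambda>p. ennreal (snd p * exp (- (snd p)\<^sup>2 / 2)) * indicator {norm (?s (fst p))..} (snd p) * indicator C (?s (fst p)) :: ennreal)
       = (\<lambda>p. if norm (?s (fst p)) \<le> snd p \<and> ?s (fst p) \<in> C then ennreal (snd p * exp (- (snd p)\<^sup>2 / 2)) else 0)"
      by (auto simp: indicator_def)
    also have "\<dots> \<in> borel_measurable (?L \<Otimes>\<^sub>M lborel)"
    proof -
      have [measurable]: "(\<lambda>p. ?s (fst p)) \<in> borel_measurable (?L \<Otimes>\<^sub>M (lborel :: real measure))"
        using s by (rule measurable_compose[OF measurable_fst])
      show ?thesis by measurable
    qed
    finally show ?thesis
      by (simp add: case_prod_unfold)
  qed
  have "(\<integral>\<^sup>+f. (\<integral>\<^sup>+t. ennreal (t * exp (- t\<^sup>2 / 2)) * indicator {norm (?s f)..} t * indicator C (?s f) \<partial>lborel) \<partial>?L)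
      = (\<integral>\<^sup>+t. (\<integral>\<^sup>+f. ennreal (t * exp (- t\<^sup>2 / 2)) * indicator {norm (?s f)..} t * indicator C (?s f) \<partial>?L) \<partial>lborel)"
    by (rule P.Fubini'[symmetric]) (rule mF)
  also have "\<dots> = (\<integral>\<^sup>+t. ennreal (t * exp (- t\<^sup>2 / 2)) * V t \<partial>lborel)"
  proof (intro nn_integral_cong)
    fix t :: real
    have "(\<integral>\<^sup>+f. ennreal (t * exp (- t\<^sup>2 / 2)) * indicator {norm (?s f)..} t * indicator C (?s f) \<partial>?L)
        = (\<integral>\<^sup>+f. ennreal (t * exp (- t\<^sup>2 / 2)) * indicator {f \<in> space ?L. ?s f \<in> C \<and> norm (?s f) \<le> t} f \<partial>?L)"
      by (intro nn_integral_cong) (auto simp: indicator_def)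
    also have "\<dots> = ennreal (t * exp (- t\<^sup>2 / 2)) * V t"
      unfolding V_def by (rule nn_integral_cmult_indicator) measurable
    finally show "(\<integral>\<^sup>+f. ennreal (t * exp (- t\<^sup>2 / 2)) * indicator {norm (?s f)..} t * indicator C (?s f) \<partial>?L) = ennreal (t * exp (- t\<^sup>2 / 2)) * V t" .
  qed
  also have "\<dots> = (\<integral>\<^sup>+t. ennreal (t * exp (- t\<^sup>2 / 2)) * (ennreal (t ^ m) * indicator {0<..} t) * V 1 \<partial>lborel)"
  proof (intro nn_integral_cong)
    fix t :: real
    show "ennreal (t * exp (- t\<^sup>2 / 2)) * V t = ennreal (t * exp (- t\<^sup>2 / 2)) * (ennreal (t ^ m) * indicator {0<..} t) * V 1"
    proof (cases "t > 0")
      case False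
      then have "ennreal (t * exp (- t\<^sup>2 / 2)) = 0" by (simp add: ennreal_neg mult_nonpos_nonneg)
      then show ?thesis by (simp only: mult_zero_left)
    qed (simp add: V[of t] mult.assoc)
  qed
  also have "\<dots> = (\<integral>\<^sup>+t. ennreal (t * exp (- t\<^sup>2 / 2)) * (ennreal (t ^ m) * indicator {0<..} t) \<partial>lborel) * V 1"
    by (rule nn_integral_multc) measurable
  finally have X: "(\<integral>\<^sup>+f. (\<integral>\<^sup>+t. ennreal (t * exp (- t\<^sup>2 / 2)) * indicator {norm (?s f)..} t * indicator C (?s f) \<partial>lborel) \<partial>?L)
     = (\<integral>\<^sup>+t. ennreal (t * exp (- t\<^sup>2 / 2)) * (ennreal (t ^ m) * indicator {0<..} t) \<partial>lborel) * V 1" .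
  have V1: "V 1 = emeasure (distr ?L borel ?s) (cball 0 1 \<inter> C)"
    unfolding V_def by (subst emeasure_distr) (auto intro!: arg_cong2[where f=emeasure])
  have "emeasure (gauss B) C = (\<integral>\<^sup>+f. indicator C (?s f) \<partial>(\<Pi>\<^sub>M b\<in>B. std_normal))"
  proof -
    have "emeasure (gauss B) C = (\<integral>\<^sup>+x. indicator C x \<partial>gauss B)" by simp
    also have "\<dots> = (\<integral>\<^sup>+f. indicator C (?s f) \<partial>(\<Pi>\<^sub>M b\<in>B. std_normal))"
      unfolding gauss_def by (subst nn_integral_distr) auto
    finally show ?thesis .
  qed
  also have "\<dots> = (\<integral>\<^sup>+f. ennreal c * ennreal (exp (- (norm (?s f))\<^sup>2 / 2)) * indicator C (?s f) \<partial>?L)"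
    unfolding PiM_std_normal_density[OF fin] by (subst nn_integral_density) (auto simp: dens)
  also have "\<dots> = (\<integral>\<^sup>+f. ennreal c * (\<integral>\<^sup>+t. ennreal (t * exp (- t\<^sup>2 / 2)) * indicator {norm (?s f)..} t * indicator C (?s f) \<partial>lborel) \<partial>?L)"
  proof (intro nn_integral_cong)
    fix f
    have "(\<integral>\<^sup>+t. ennreal (t * exp (- t\<^sup>2 / 2)) * indicator {norm (?s f)..} t * indicator C (?s f) \<partial>lborel)
       = ennreal (exp (- (norm (?s f))\<^sup>2 / 2)) * indicator C (?s f)"
      by (subst exp_layer_cake) (auto intro!: nn_integral_multc)
    then show "ennreal c * ennreal (exp (- (norm (?s f))\<^sup>2 / 2)) * indicator C (?s f)
       = ennreal c * (\<integral>\<^sup>+t. ennreal (t * exp (- t\<^sup>2 / 2)) * indicator {norm (?s f)..} t * indicator C (?s f) \<partial>lborel)"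
      by (simp only: mult.assoc)
  qed
  also have "\<dots> = ennreal c * (\<integral>\<^sup>+f. (\<integral>\<^sup>+t. ennreal (t * exp (- t\<^sup>2 / 2)) * indicator {norm (?s f)..} t * indicator C (?s f) \<partial>lborel) \<partial>?L)"
    by (rule nn_integral_cmult) (use lborel.borel_measurable_nn_integral[OF mF] in simp)
  finally show ?thesis unfolding X V1 by (simp add: K_def c_def m_def mult.assoc)
qed

text \<open>
  The direction of a Gaussian vector is uniformly distributed on the sphere. If \<open>C\<close> is a subspace, then
  both sides are \<open>1\<close>, in accordance with the convention for solid angles.
\<close>

theorem solid_angle_gauss:
  fixes B :: "'a::{real_inner,second_countable_topology} set"
  assumes on: "orthonormal B" and sp: "span C = span B" and C: "scone C" "C \<in> sets borel"
  shows "solid_angle C = measure (gauss B) C"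
proof (cases "subspace C")
  case True
  then have "C = span B" using sp by (metis span_eq_iff)
  then have "measure (gauss B) C = 1"
    using AE_gauss_span[OF on] C(2) by (subst gauss.prob_eq_1) auto
  then show ?thesis using True by (simp add: solid_angle_def)
next
  case False
  define B' where "B' = orthonormal_basis (span C)"
  have B': "orthonormal B'" "span B' = span B"
    using orthonormal_basis[of B "span C"] on sp by (auto simp: B'_def orthonormal_finite)
  have g: "gauss B = gauss B'" using on B' by (intro gauss_cong_span) auto
  define \<mu> where "\<mu> = lborel_subspace (span C)"
  have \<mu>: "\<mu> = distr (\<Pi>\<^sub>M b\<in>B'. lborel) borel (\<lambda>f. \<Sum>b\<in>B'. f b *\<^sub>R b)"
    by (simp add: \<mu>_def lborel_subspace_def B'_def)
  have [simp, measurable_cong]: "sets \<mu> = sets borel" by (simp add: \<mu>)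
  have [simp]: "space \<mu> = UNIV" by (simp add: \<mu>)
  define K where "K = ennreal ((1 / sqrt (2 * pi)) ^ card B') *
     (\<integral>\<^sup>+t. ennreal (t * exp (- t\<^sup>2 / 2)) * (ennreal (t ^ card B') * indicator {0<..} t) \<partial>lborel)"
  have 1: "emeasure (gauss B) C = K * emeasure \<mu> (cball 0 1 \<inter> C)"
    unfolding g \<mu> K_def by (rule emeasure_gauss_scone) (use B' C in auto)
  have "emeasure (gauss B) UNIV = K * emeasure \<mu> (cball 0 1 \<inter> UNIV)"
    unfolding g \<mu> K_def by (rule emeasure_gauss_scone) (use B' in \<open>auto simp: scone_def\<close>)
  moreover have "emeasure (gauss B) UNIV = 1" using gauss.emeasure_space_1[of B] by simp
  ultimately have 2: "K * emeasure \<mu> (cball 0 1) = 1" by simp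
  have sgn [measurable]: "sgn \<in> borel_measurable (borel :: 'a measure)"
  proof -
    have "(\<lambda>x::'a. inverse (norm x) *\<^sub>R x) \<in> borel_measurable borel" by measurable
    then show ?thesis by (simp add: sgn_div_norm[abs_def])
  qed
  have cb: "cball 0 1 \<in> sets \<mu>" "C \<in> sets \<mu>" using C by auto
  have "emeasure (uniform_sphere (span C)) C = emeasure (uniform_measure \<mu> (cball 0 1)) (sgn -` C)"
    unfolding uniform_sphere_def \<mu>_def[symmetric] using C(2)
    by (subst emeasure_distr) (auto cong: measurable_cong_sets)
  also have "sgn -` C = C" using scone_sgn_iff[OF C(1)] by auto
  also have "emeasure (uniform_measure \<mu> (cball 0 1)) C = emeasure \<mu> (cball 0 1 \<inter> C) / emeasure \<mu> (cball 0 1)"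
    by (rule emeasure_uniform_measure[OF cb])
  also have "\<dots> = K * emeasure \<mu> (cball 0 1 \<inter> C)"
  proof -
    have ne: "emeasure \<mu> (cball 0 1) \<noteq> 0" "emeasure \<mu> (cball 0 1) \<noteq> \<top>"
      using 2 by (auto simp: ennreal_mult_top split: if_splits)
    have "emeasure \<mu> (cball 0 1 \<inter> C) = K * emeasure \<mu> (cball 0 1 \<inter> C) * emeasure \<mu> (cball 0 1)"
      using 2 by (metis mult.assoc mult.commute mult_1)
    then show ?thesis using ennreal_mult_divide_eq[OF ne] by metis
  qed
  also have "\<dots> = emeasure (gauss B) C" by (simp add: 1)
  finally show ?thesis using False by (simp add: solid_angle_def measure_def)
qed

text \<open>
  Both angles are Gaussian measures, and \<open>T\<close> carries one Gaussian measure to the other.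
\<close>

lemma solid_angle_isometry:
  fixes B :: "'a::{real_inner,second_countable_topology} set" and T :: "'a \<Rightarrow> 'b::{real_inner,second_countable_topology}"
  assumes on: "orthonormal B" and sp: "span C = span B" and C: "scone C" "C \<in> sets borel" "T ` C \<in> sets borel"
    and T: "linear T" "T \<in> borel_measurable borel" "\<And>x y. x \<in> span B \<Longrightarrow> y \<in> span B \<Longrightarrow> T x \<bullet> T y = x \<bullet> y"
  shows "solid_angle (T ` C) = solid_angle C"
proof -
  have inj: "x = y" if "x \<in> span B" "y \<in> span B" "T x = T y" for x y
  proof -
    have "x - y \<in> span B" using that by (simp add: span_diff)
    then have "(x - y) \<bullet> (x - y) = T (x - y) \<bullet> T (x - y)" using T(3) by simp
    also have "\<dots> = 0" using that T(1) by (simp add: linear_diff)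
    finally show ?thesis by simp
  qed
  have injB: "inj_on T B" using inj span_base by (metis inj_onI)
  have onT: "orthonormal (T ` B)"
    unfolding orthonormal_def
  proof (intro conjI ballI)
    fix a b assume "a \<in> T ` B" "b \<in> T ` B"
    then obtain x y where xy: "x \<in> B" "y \<in> B" "a = T x" "b = T y" by auto
    then have "a \<bullet> b = x \<bullet> y" using T(3) by (simp add: span_base)
    moreover have "a = b \<longleftrightarrow> x = y" using xy inj span_base by metis
    ultimately show "a \<bullet> b = (if a = b then 1 else 0)" using on xy by (simp add: orthonormal_inner)
  qed (use on in \<open>simp add: orthonormal_finite\<close>)
  have "span (T ` C) = span (T ` B)"
    using sp T(1) by (metis linear_span_image)
  moreover have "scone (T ` C)"
    using C(1) T(1) unfolding scone_def by (auto simp: linear_cmul[symmetric] image_iff) (metis linear_0)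
  ultimately have "solid_angle (T ` C) = measure (gauss (T ` B)) (T ` C)"
    using onT C by (intro solid_angle_gauss) auto
  also have "\<dots> = measure (distr (gauss B) borel T) (T ` C)"
    using on injB T by (subst gauss_image) (auto simp: orthonormal_finite)
  also have "\<dots> = measure (gauss B) (T -` T ` C)"
    using T C by (subst measure_distr) (auto cong: measurable_cong_sets)
  also have "\<dots> = measure (gauss B) C"
  proof (rule measure_eq_AE)
    show "AE x in gauss B. (x \<in> T -` T ` C) = (x \<in> C)"
      using AE_gauss_span[OF on]
    proof eventually_elim
      case (elim x)
      have "C \<subseteq> span B" using sp span_superset by blast
      then show ?case using inj[OF elim] by auto
    qed
    show "T -` T ` C \<in> sets (gauss B)" using measurable_sets[OF T(2) C(3)] by simp
  qed (use C in auto)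
  also have "\<dots> = solid_angle C" using solid_angle_gauss[OF on sp] C by simp
  finally show ?thesis .
qed

text \<open>
  Weights of total sum \<open>0\<close> encode combinations of differences. The weights of \<open>I\<close> may have any sign, as
  differences of two points of \<open>I\<close> may be taken in both directions.
\<close>

definition coef :: "'i set \<Rightarrow> 'i set \<Rightarrow> ('i \<Rightarrow> real) set" where
  "coef I J = {l. (\<forall>i. i \<notin> J \<longrightarrow> l i = 0) \<and> sum l J = 0 \<and> (\<forall>i\<in>J - I. l i \<ge> 0)}"

text \<open>
  For \<open>I \<subseteq> J\<close> and \<open>I \<noteq> {}\<close> this is the cone generated by the \<open>x i - x j\<close> with \<open>i \<in> J\<close> and \<open>j \<in> I\<close>, the
  tangent cone of \<open>convex hull (x ` J)\<close> at \<open>convex hull (x ` I)\<close>. For \<open>I = J\<close> it is the linear space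
  parallel to the affine hull of the points.
\<close>

definition icone :: "('i \<Rightarrow> 'a::real_vector) \<Rightarrow> 'i set \<Rightarrow> 'i set \<Rightarrow> 'a set" where
  "icone x I J = {p. \<exists>l\<in>coef I J. p = (\<Sum>i\<in>J. l i *\<^sub>R x i)}"

lemma iconeI: "l \<in> coef I J \<Longrightarrow> p = (\<Sum>i\<in>J. l i *\<^sub>R x i) \<Longrightarrow> p \<in> icone x I J"
  by (auto simp: icone_def)

lemma icone_mono:
  assumes "finite J" "K \<subseteq> J"
  shows "icone x I K \<subseteq> icone x I J"
proof
  fix p assume "p \<in> icone x I K"
  then obtain l where l: "l \<in> coef I K" "p = (\<Sum>i\<in>K. l i *\<^sub>R x i)" by (auto simp: icone_def)
  have "sum l J = sum l K" using assms l by (intro sum.mono_neutral_right) (auto simp: coef_def)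
  moreover have "(\<Sum>i\<in>J. l i *\<^sub>R x i) = (\<Sum>i\<in>K. l i *\<^sub>R x i)"
    using assms l by (intro sum.mono_neutral_right) (auto simp: coef_def)
  moreover have "l i \<ge> 0" if "i \<in> J - I" for i
    using that l(1) by (cases "i \<in> K") (auto simp: coef_def)
  moreover have "\<forall>i. i \<notin> J \<longrightarrow> l i = 0" "sum l K = 0" using l assms unfolding coef_def by auto
  ultimately have "l \<in> coef I J" unfolding coef_def by auto
  then show "p \<in> icone x I J"
    by (rule iconeI) (use l \<open>(\<Sum>i\<in>J. l i *\<^sub>R x i) = (\<Sum>i\<in>K. l i *\<^sub>R x i)\<close> in simp)
qed

lemma icone_mono_left: "I \<subseteq> I' \<Longrightarrow> icone x I J \<subseteq> icone x I' J"
  unfolding icone_def coef_def by auto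

lemma icone_zero [simp]: "0 \<in> icone x I J"
  unfolding icone_def coef_def by (auto intro!: bexI[of _ "\<lambda>_. 0"])

lemma icone_add:
  assumes "p \<in> icone x I J" "q \<in> icone x I J"
  shows "p + q \<in> icone x I J"
proof -
  obtain l m where "l \<in> coef I J" "p = (\<Sum>i\<in>J. l i *\<^sub>R x i)" "m \<in> coef I J" "q = (\<Sum>i\<in>J. m i *\<^sub>R x i)"
    using assms by (auto simp: icone_def)
  then show ?thesis
    by (intro iconeI[of "\<lambda>i. l i + m i"]) (auto simp: sum.distrib scaleR_left_distrib coef_def)
qed

lemma icone_scale:
  assumes "p \<in> icone x I J" "t \<ge> 0"
  shows "t *\<^sub>R p \<in> icone x I J"
proof -
  obtain l where "l \<in> coef I J" "p = (\<Sum>i\<in>J. l i *\<^sub>R x i)"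
    using assms by (auto simp: icone_def)
  then show ?thesis using assms(2)
    by (intro iconeI[of "\<lambda>i. t * l i"]) (auto simp: scaleR_sum_right sum_distrib_left[symmetric] coef_def)
qed

lemma icone_sum:
  "(\<And>s. s \<in> S \<Longrightarrow> g s \<in> icone x I J) \<Longrightarrow> (\<Sum>s\<in>S. g s) \<in> icone x I J"
  by (induction S rule: infinite_finite_induct) (auto intro: icone_add)

lemma scone_icone: "scone (icone x I J)"
  by (auto simp: scone_def intro: icone_scale)

lemma subspace_lin: "subspace (icone x J J)"
proof (rule subspaceI)
  fix t p assume "p \<in> icone x J J"
  then obtain l where "l \<in> coef J J" "p = (\<Sum>i\<in>J. l i *\<^sub>R x i)" by (auto simp: icone_def)
  then show "t *\<^sub>R p \<in> icone x J J"
    by (intro iconeI[of "\<lambda>i. t * l i"]) (auto simp: scaleR_sum_right sum_distrib_left[symmetric] coef_def)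
qed (auto intro: icone_add)

lemma icone_diff_mem:
  assumes "finite J" "i \<in> J" "j \<in> I" "j \<in> J"
  shows "x i - x j \<in> icone x I J"
proof -
  let ?l = "\<lambda>k. (if k = i then 1 else 0) - (if k = j then 1 else 0) :: real"
  have "?l \<in> coef I J" using assms by (auto simp: coef_def sum_subtractf)
  moreover have "(\<Sum>k\<in>J. ?l k *\<^sub>R x k) = x i - x j"
    using assms by (simp add: scaleR_left_diff_distrib sum_subtractf if_distrib[of "\<lambda>c. c *\<^sub>R _"] cong: if_cong)
  ultimately show ?thesis unfolding icone_def by (auto intro!: bexI[of _ ?l])
qed

lemma coef_sum_shift:
  fixes x :: "'i \<Rightarrow> 'a::real_vector"
  assumes "sum l J = 0"
  shows "(\<Sum>i\<in>J. l i *\<^sub>R x i) = (\<Sum>i\<in>J. l i *\<^sub>R (x i - c))"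
  using assms by (simp add: scaleR_right_diff_distrib sum_subtractf scaleR_sum_left[symmetric])

text \<open>
  Every element is a sum of nonnegative multiples of \<open>x i - x j\<close> and \<open>x j - x i\<close>, the latter only for
  \<open>i \<in> I\<close>, with one fixed \<open>j \<in> I\<close>.
\<close>

lemma icone_least:
  fixes x :: "'i \<Rightarrow> 'a::real_vector"
  assumes "j \<in> I" "I \<subseteq> J" "0 \<in> K" "\<And>p q. p \<in> K \<Longrightarrow> q \<in> K \<Longrightarrow> p + q \<in> K"
    "\<And>t p. p \<in> K \<Longrightarrow> t \<ge> 0 \<Longrightarrow> t *\<^sub>R p \<in> K" "\<And>i j. i \<in> J \<Longrightarrow> j \<in> I \<Longrightarrow> x i - x j \<in> K"
  shows "icone x I J \<subseteq> K"
proof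
  fix p assume "p \<in> icone x I J"
  then obtain l where l: "l \<in> coef I J" "p = (\<Sum>i\<in>J. l i *\<^sub>R x i)" by (auto simp: icone_def)
  have p: "p = (\<Sum>i\<in>J. l i *\<^sub>R (x i - x j))"
    using l by (simp add: coef_sum_shift[of l J x "x j"] coef_def)
  have "l i *\<^sub>R (x i - x j) \<in> K" if i: "i \<in> J" for i
  proof (cases "l i \<ge> 0")
    case False
    then have "i \<in> I" using l i by (force simp: coef_def)
    then have "x j - x i \<in> K" using assms(1,2,6) by auto
    then have "(- l i) *\<^sub>R (x j - x i) \<in> K" using False by (intro assms(5)) auto
    then show ?thesis by (simp add: scaleR_right_diff_distrib)
  qed (use assms i in auto)
  note mem = this
  have sumK: "(\<Sum>i\<in>S. g i) \<in> K" if "\<And>i. i \<in> S \<Longrightarrow> g i \<in> K" for S :: "'i set" and g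
    using that by (induction S rule: infinite_finite_induct) (auto simp: assms(3,4))
  show "p \<in> K" unfolding p by (rule sumK) (rule mem)
qed

lemma icone_subset_subspace:
  assumes "subspace V" "\<And>i. i \<in> J \<Longrightarrow> x i \<in> V"
  shows "icone x I J \<subseteq> V"
  using assms by (auto simp: icone_def intro!: subspace_sum subspace_scale)

lemma span_icone:
  assumes "finite J" "j \<in> I" "I \<subseteq> J"
  shows "span (icone x I J) = icone x J J"
proof (rule subset_antisym)
  show "span (icone x I J) \<subseteq> icone x J J"
    using assms by (intro span_minimal subspace_lin icone_mono_left)
  show "icone x J J \<subseteq> span (icone x I J)"
  proof (rule icone_least[of j])
    fix a b assume "a \<in> J" "b \<in> J"
    then have "x a - x j \<in> span (icone x I J)" "x b - x j \<in> span (icone x I J)"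
      using assms by (auto intro!: span_base icone_diff_mem)
    from span_diff[OF this] show "x a - x b \<in> span (icone x I J)" by simp
  qed (use assms in \<open>auto intro: span_zero span_add span_scale\<close>)
qed

lemma lin_eq_span:
  assumes "finite J" "j \<in> J"
  shows "icone x J J = span ((\<lambda>i. x i - x j) ` (J - {j}))"
proof (rule subset_antisym)
  show "span ((\<lambda>i. x i - x j) ` (J - {j})) \<subseteq> icone x J J"
    using assms by (intro span_minimal subspace_lin) (auto intro: icone_diff_mem)
  have *: "x a - x j \<in> span ((\<lambda>i. x i - x j) ` (J - {j}))" if "a \<in> J" for a
    using that by (cases "a = j") (auto intro: span_base span_zero)
  show "icone x J J \<subseteq> span ((\<lambda>i. x i - x j) ` (J - {j}))"
  proof (rule icone_least[of j])
    fix a b assume "a \<in> J" "b \<in> J"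
    from span_diff[OF *[OF this(1)] *[OF this(2)]]
    show "x a - x b \<in> span ((\<lambda>i. x i - x j) ` (J - {j}))" by simp
  qed (use assms in \<open>auto intro: span_zero span_add span_scale\<close>)
qed

section \<open>Moreau decomposition\<close>

text \<open>
  Moreau decomposition for a finitely generated cone, without compactness: induction on the
  generators. If the new generator has positive inner product with the old residual, then the
  projection uses it, and one may project everything to its orthogonal complement.
\<close>

lemma moreau_finite:
  fixes g :: "'s \<Rightarrow> 'a::real_inner"
  assumes "finite S"
  shows "\<exists>c. (\<forall>s\<in>S. c s \<ge> 0) \<and> (\<forall>s\<in>S. (z - (\<Sum>s\<in>S. c s *\<^sub>R g s)) \<bullet> g s \<le> 0) \<and>
     (z - (\<Sum>s\<in>S. c s *\<^sub>R g s)) \<bullet> (\<Sum>s\<in>S. c s *\<^sub>R g s) = 0"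
  using assms
proof (induction S arbitrary: z g)
  case (insert s S)
  obtain a where a: "\<forall>s\<in>S. a s \<ge> 0" "\<forall>s\<in>S. (z - (\<Sum>s\<in>S. a s *\<^sub>R g s)) \<bullet> g s \<le> 0"
     "(z - (\<Sum>s\<in>S. a s *\<^sub>R g s)) \<bullet> (\<Sum>s\<in>S. a s *\<^sub>R g s) = 0" using insert.IH by blast
  define p0 where "p0 = (\<Sum>s\<in>S. a s *\<^sub>R g s)"
  have upd: "(\<Sum>r\<in>insert s S. (c(s := t)) r *\<^sub>R g r) = (\<Sum>r\<in>S. c r *\<^sub>R g r) + t *\<^sub>R g s" for c :: "'s \<Rightarrow> real" and t
  proof -
    have "(\<Sum>r\<in>S. (c(s := t)) r *\<^sub>R g r) = (\<Sum>r\<in>S. c r *\<^sub>R g r)"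
      using insert.hyps by (intro sum.cong) auto
    then show ?thesis using insert.hyps by (simp add: add.commute)
  qed
  show ?case
  proof (cases "(z - p0) \<bullet> g s \<le> 0")
    case True
    have e: "(\<Sum>r\<in>insert s S. (a(s := 0)) r *\<^sub>R g r) = p0" unfolding upd by (simp add: p0_def)
    show ?thesis
      using a True by (intro exI[of _ "a(s := 0)"], unfold e) (auto simp: p0_def[symmetric] insert.hyps)
  next
    case False
    \<comment> \<open>\<open>Q\<close> is the orthogonal projection to the complement of \<open>g s\<close>.\<close>
    define v where "v = g s"
    have v0: "v \<bullet> v > 0" using False v_def by (metis inner_gt_zero_iff inner_zero_right order_refl)
    define Q where "Q u = u - (u \<bullet> v / (v \<bullet> v)) *\<^sub>R v" for u
    have Qlin: "Q (u - w) = Q u - Q w" "Q (t *\<^sub>R u) = t *\<^sub>R Q u" for u w t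
      by (auto simp: Q_def inner_diff_left diff_divide_distrib algebra_simps)
    have Qadd: "Q (u + w) = Q u + Q w" for u w
      by (auto simp: Q_def inner_add_left add_divide_distrib algebra_simps)
    have Qsum: "Q (\<Sum>r\<in>S. c r *\<^sub>R g r) = (\<Sum>r\<in>S. c r *\<^sub>R Q (g r))" for c
    proof -
      have "Q 0 = 0" by (simp add: Q_def)
      then show ?thesis by (induction S rule: infinite_finite_induct) (auto simp: Qadd Qlin)
    qed
    have Qv: "Q u \<bullet> v = 0" for u using v0 by (simp add: Q_def inner_diff_left)
    have Qfix: "Q u = u" if "u \<bullet> v = 0" for u using that by (simp add: Q_def)
    have Qin: "Q u \<bullet> Q w = Q u \<bullet> w" for u w
      by (subst (2) Q_def) (simp add: inner_diff_right Qv)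
    obtain c where c: "\<forall>r\<in>S. c r \<ge> 0" "\<forall>r\<in>S. (Q z - (\<Sum>r\<in>S. c r *\<^sub>R Q (g r))) \<bullet> Q (g r) \<le> 0"
      "(Q z - (\<Sum>r\<in>S. c r *\<^sub>R Q (g r))) \<bullet> (\<Sum>r\<in>S. c r *\<^sub>R Q (g r)) = 0"
      using insert.IH[of "Q z" "\<lambda>r. Q (g r)"] by blast
    define q where "q = (\<Sum>r\<in>S. c r *\<^sub>R g r)"
    define t where "t = (z - q) \<bullet> v / (v \<bullet> v)"
    define p where "p = q + t *\<^sub>R v"
    have wv: "(z - p) \<bullet> v = 0" using v0 by (simp add: p_def t_def inner_diff_left inner_add_left)
    have wQ: "z - p = Q (z - q)" by (simp add: p_def t_def Q_def)
    have wg: "(z - p) \<bullet> g r \<le> 0" if "r \<in> S" for r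
      using c(2) that unfolding wQ Qsum[symmetric] Qlin(1)[symmetric] Qin q_def by simp
    have wq: "(z - p) \<bullet> q = 0"
      using c(3) unfolding wQ Qsum[symmetric] Qlin(1)[symmetric] Qin q_def by simp
    have wp: "(z - p) \<bullet> p = 0" using wq wv by (simp add: p_def inner_add_right)
    have "t \<ge> 0"
    proof (rule ccontr)
      assume "\<not> t \<ge> 0"
      \<comment> \<open>With a negative weight \<open>t\<close> the old residual would force \<open>(p - p0) \<bullet> (p - p0) < 0\<close>.\<close>
      have "(p - p0) \<bullet> (p - p0) = p \<bullet> (z - p0) + p0 \<bullet> (z - p) - ((z - p0) \<bullet> p0 + (z - p) \<bullet> p)"
        by (simp add: inner_diff_left inner_diff_right inner_commute)
      also have "\<dots> = q \<bullet> (z - p0) + t * ((z - p0) \<bullet> v) + p0 \<bullet> (z - p)"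
        using a(3) wp by (simp add: p0_def p_def inner_add_left inner_commute)
      also have "q \<bullet> (z - p0) \<le> 0"
        unfolding q_def inner_sum_left using a(2) c(1)
        by (intro sum_nonpos) (auto simp: p0_def inner_commute mult_nonneg_nonpos)
      also have "p0 \<bullet> (z - p) \<le> 0"
        unfolding p0_def inner_sum_left using a(1) wg
        by (intro sum_nonpos) (auto simp: inner_commute mult_nonneg_nonpos)
      also have "t * ((z - p0) \<bullet> v) < 0" using \<open>\<not> t \<ge> 0\<close> False by (simp add: v_def mult_neg_pos)
      finally show False using inner_ge_zero[of "p - p0"] by simp
    qed
    moreover have e: "(\<Sum>r\<in>insert s S. (c(s := t)) r *\<^sub>R g r) = p"
      unfolding upd by (simp add: p_def q_def v_def)
    ultimately show ?thesis
      using c(1) wg wv wp by (intro exI[of _ "c(s := t)"], unfold e) (auto simp: v_def[symmetric])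
  qed
qed auto

definition polar :: "('i \<Rightarrow> 'a::real_inner) \<Rightarrow> 'i set \<Rightarrow> 'i set \<Rightarrow> 'a \<Rightarrow> bool" where
  "polar x I N w \<longleftrightarrow> (\<forall>i\<in>N. \<forall>j\<in>I. w \<bullet> (x i - x j) \<le> 0)"

text \<open>
  The Karush-Kuhn-Tucker conditions for the projection of \<open>z\<close> to \<open>icone x I N\<close> to lie in
  \<open>icone x I J\<close>: the residual \<open>z - p\<close> is orthogonal to \<open>icone x J J\<close> and nonpositive on all
  differences \<open>x i - x j\<close> with \<open>j \<in> J\<close>. They are stated for all positions, also if \<open>J\<close> does not index a face.
\<close>

definition kkt :: "('i \<Rightarrow> 'a::real_inner) \<Rightarrow> 'i set \<Rightarrow> 'i set \<Rightarrow> 'i set \<Rightarrow> 'a \<Rightarrow> bool" where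
  "kkt x I J N z \<longleftrightarrow> (\<exists>p\<in>icone x I J. polar x J N (z - p))"

lemma moreau_icone:
  fixes x :: "'i \<Rightarrow> 'a::real_inner"
  assumes "finite N" "I \<subseteq> N"
  obtains p where "p \<in> icone x I N" "polar x I N (z - p)" "(z - p) \<bullet> p = 0"
proof -
  define g where "g = (\<lambda>(i, j). x i - x j)"
  have fin: "finite (N \<times> I)" using assms finite_subset by blast
  from moreau_finite[OF fin, of z g] obtain c where c: "\<forall>s\<in>N\<times>I. c s \<ge> 0"
    "\<forall>s\<in>N\<times>I. (z - (\<Sum>s\<in>N\<times>I. c s *\<^sub>R g s)) \<bullet> g s \<le> 0"
    "(z - (\<Sum>s\<in>N\<times>I. c s *\<^sub>R g s)) \<bullet> (\<Sum>s\<in>N\<times>I. c s *\<^sub>R g s) = 0" by blast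
  show ?thesis
  proof (rule that[of "\<Sum>s\<in>N\<times>I. c s *\<^sub>R g s"])
    show "(\<Sum>s\<in>N\<times>I. c s *\<^sub>R g s) \<in> icone x I N"
      using assms c(1) by (intro icone_sum icone_scale) (auto simp: g_def intro!: icone_diff_mem)
    show "polar x I N (z - (\<Sum>s\<in>N\<times>I. c s *\<^sub>R g s))"
      using c(2) unfolding polar_def g_def by auto
  qed (rule c(3))
qed

lemma polar_inner_icone:
  assumes "polar x I N w" "I \<subseteq> N" "I \<noteq> {}" "p \<in> icone x I N"
  shows "w \<bullet> p \<le> 0"
proof -
  obtain j where j: "j \<in> I" using assms by auto
  have "icone x I N \<subseteq> {p. w \<bullet> p \<le> 0}"
    by (rule icone_least[OF j assms(2)]) (use assms(1) in \<open>auto simp: polar_def inner_add_right mult_nonneg_nonpos\<close>)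
  then show ?thesis using assms(4) by auto
qed

lemma polar_eq:
  assumes "polar x J N w" "i \<in> J" "j \<in> J" "J \<subseteq> N"
  shows "w \<bullet> (x i - x j) = 0"
proof -
  have "w \<bullet> (x i - x j) \<le> 0" "w \<bullet> (x j - x i) \<le> 0" using assms by (auto simp: polar_def)
  then show ?thesis by (simp add: inner_diff_right)
qed

lemma lin_orthogonal:
  assumes "\<And>i j. i \<in> J \<Longrightarrow> j \<in> J \<Longrightarrow> w \<bullet> (x i - x j) = 0" "p \<in> icone x J J"
  shows "w \<bullet> p = 0"
proof (cases "J = {}")
  case True
  then show ?thesis using assms(2) by (auto simp: icone_def)
next
  case False
  then obtain j where "j \<in> J" by auto
  then have "icone x J J \<subseteq> {p. w \<bullet> p = 0}"
    by (rule icone_least) (use assms in \<open>auto simp: inner_add_right\<close>)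
  then show ?thesis using assms(2) by auto
qed

text \<open>
  In a vanishing sum of terms of constant sign every term vanishes.
\<close>

lemma icone_face:
  assumes pol: "polar x I N w" and I: "I \<subseteq> N" "I \<noteq> {}" "finite N" and p: "p \<in> icone x I N" and "w \<bullet> p = 0"
  shows "p \<in> icone x I {i\<in>N. \<forall>j\<in>I. w \<bullet> (x i - x j) = 0}"
proof -
  let ?K = "{i\<in>N. \<forall>j\<in>I. w \<bullet> (x i - x j) = 0}"
  obtain j where j: "j \<in> I" using I by auto
  obtain l where l: "l \<in> coef I N" "p = (\<Sum>i\<in>N. l i *\<^sub>R x i)" using p by (auto simp: icone_def)
  have eqI: "w \<bullet> (x i - x j) = 0" if "i \<in> I" "j \<in> I" for i j
  proof -
    have "w \<bullet> (x i - x j) \<le> 0" "w \<bullet> (x j - x i) \<le> 0" using pol that I by (auto simp: polar_def)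
    then show ?thesis by (simp add: inner_diff_right)
  qed
  have "0 = w \<bullet> (\<Sum>i\<in>N. l i *\<^sub>R (x i - x j))"
    using assms(6) l coef_sum_shift[of l N x "x j"] by (simp add: coef_def)
  then have s0: "(\<Sum>i\<in>N. - (l i * (w \<bullet> (x i - x j)))) = 0" by (simp add: inner_sum_right sum_negf)
  have nn: "- (l i * (w \<bullet> (x i - x j))) \<ge> 0" if "i \<in> N" for i
    using that l(1) pol eqI[OF _ j] j by (cases "i \<in> I") (auto simp: coef_def polar_def mult_nonneg_nonpos)
  have z: "l i * (w \<bullet> (x i - x j)) = 0" if "i \<in> N" for i
    using sum_nonneg_eq_0_iff[OF I(3) nn] s0 that by simp
  have l0: "l i = 0" if "i \<in> N - ?K" for i
  proof -
    have "w \<bullet> (x i - x j) \<noteq> 0"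
    proof
      assume h: "w \<bullet> (x i - x j) = 0"
      have "w \<bullet> (x i - x k) = 0" if "k \<in> I" for k
        using eqI[OF that j] h by (simp add: inner_diff_right)
      then show False using that by auto
    qed
    then show ?thesis using z that by auto
  qed
  have "l \<in> coef I ?K"
  proof -
    have "sum l ?K = sum l N" using I l0 by (intro sum.mono_neutral_left) auto
    then show ?thesis using l(1) l0 unfolding coef_def by auto
  qed
  moreover have "(\<Sum>i\<in>N. l i *\<^sub>R x i) = (\<Sum>i\<in>?K. l i *\<^sub>R x i)"
    using I l0 by (intro sum.mono_neutral_right) auto
  ultimately show ?thesis using l(2) unfolding icone_def by auto
qed

text \<open>
  Each of the two residuals is nonpositive on the other projection, whence \<open>(p - q) \<bullet> (p - q) \<le> 0\<close>.
\<close>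

lemma moreau_unique:
  assumes I: "I \<subseteq> N" "I \<noteq> {}"
    and "p \<in> icone x I N" "polar x I N (z - p)" "(z - p) \<bullet> p = 0"
    and "q \<in> icone x I N" "polar x I N (z - q)" "(z - q) \<bullet> q = 0"
  shows "p = q"
proof -
  have "(p - q) \<bullet> (p - q) = (z - q) \<bullet> p + (z - p) \<bullet> q - (z - p) \<bullet> p - (z - q) \<bullet> q"
    by (simp add: inner_diff_left inner_diff_right inner_commute)
  also have "\<dots> \<le> 0"
    using polar_inner_icone[OF assms(4) I assms(6)] polar_inner_icone[OF assms(7) I assms(3)] assms(5,8) by simp
  finally have "(p - q) \<bullet> (p - q) = 0" using inner_ge_zero[of "p - q"] by linarith
  then show ?thesis by simp
qed

lemma kktD:
  assumes "kkt x I J N z" "I \<subseteq> J" "J \<subseteq> N" "finite N"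
  obtains p where "p \<in> icone x I J" "p \<in> icone x I N" "polar x J N (z - p)" "polar x I N (z - p)" "(z - p) \<bullet> p = 0"
proof -
  obtain p where p: "p \<in> icone x I J" "polar x J N (z - p)" using assms(1) by (auto simp: kkt_def)
  have "p \<in> icone x J J" using p(1) icone_mono_left[OF assms(2)] by blast
  then have "(z - p) \<bullet> p = 0"
    by (rule lin_orthogonal[rotated]) (rule polar_eq[OF p(2) _ _ assms(3)])
  moreover have "polar x I N (z - p)" using p(2) assms(2) by (auto simp: polar_def)
  moreover have "p \<in> icone x I N" using p(1) icone_mono[OF assms(4,3)] by blast
  ultimately show ?thesis using p that by blast
qed

section \<open>General position\<close>

text \<open>
  Affine independence of the family \<open>x\<close> on \<open>K\<close>; in contrast to independence of the set
  \<open>x ` K\<close>, coinciding points are excluded.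
\<close>

definition affine_indep :: "('i \<Rightarrow> 'a::real_vector) \<Rightarrow> 'i set \<Rightarrow> bool" where
  "affine_indep x K \<longleftrightarrow> (\<forall>l\<in>coef K K. (\<Sum>i\<in>K. l i *\<^sub>R x i) = 0 \<longrightarrow> (\<forall>i. l i = 0))"

lemma aindD: "affine_indep x K \<Longrightarrow> l \<in> coef K K \<Longrightarrow> (\<Sum>i\<in>K. l i *\<^sub>R x i) = 0 \<Longrightarrow> l i = 0"
  by (auto simp: affine_indep_def)

lemma affine_indep_subset:
  assumes "affine_indep x K" "finite K" "J \<subseteq> K"
  shows "affine_indep x J"
  unfolding affine_indep_def
proof (intro ballI impI allI)
  fix l i assume l: "l \<in> coef J J" "(\<Sum>i\<in>J. l i *\<^sub>R x i) = 0"
  have "sum l K = sum l J" using assms l by (intro sum.mono_neutral_right) (auto simp: coef_def)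
  moreover have "(\<Sum>i\<in>K. l i *\<^sub>R x i) = (\<Sum>i\<in>J. l i *\<^sub>R x i)"
    using assms l by (intro sum.mono_neutral_right) (auto simp: coef_def)
  moreover have "l \<in> coef K K" using l(1) assms(3) calculation by (auto simp: coef_def)
  ultimately show "l i = 0" using l(2) by (intro aindD[OF assms(1)]) simp_all
qed

lemma affine_indep_imp_independent:
  assumes "affine_indep x K" "finite K" "j \<in> K"
  shows "inj_on (\<lambda>i. x i - x j) (K - {j})" "independent ((\<lambda>i. x i - x j) ` (K - {j}))"
proof -
  have key: "\<forall>i\<in>K - {j}. c i = 0" if "(\<Sum>i\<in>K - {j}. c i *\<^sub>R (x i - x j)) = 0" for c
  proof -
    define l where "l i = (if i = j then - sum c (K - {j}) else if i \<in> K then c i else 0)" for i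
    have sl: "sum l (K - {j}) = sum c (K - {j})" by (intro sum.cong) (auto simp: l_def)
    have "sum l K = l j + sum l (K - {j})" using assms by (simp add: sum.remove)
    then have "sum l K = 0" unfolding sl by (simp add: l_def)
    moreover have "(\<Sum>i\<in>K. l i *\<^sub>R x i) = 0"
    proof -
      have "(\<Sum>i\<in>K. l i *\<^sub>R x i) = (\<Sum>i\<in>K. l i *\<^sub>R (x i - x j))"
        by (rule coef_sum_shift) fact
      also have "\<dots> = (\<Sum>i\<in>K - {j}. l i *\<^sub>R (x i - x j))"
        using assms by (intro sum.mono_neutral_right) auto
      also have "\<dots> = (\<Sum>i\<in>K - {j}. c i *\<^sub>R (x i - x j))" by (intro sum.cong) (auto simp: l_def)
      finally show ?thesis using that by simp
    qed
    moreover have "l \<in> coef K K" using calculation(1) assms(3) by (auto simp: coef_def l_def)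
    ultimately have "l i = 0" for i by (intro aindD[OF assms(1)])
    moreover have "l i = c i" if "i \<in> K - {j}" for i using that by (simp add: l_def)
    ultimately show ?thesis by metis
  qed
  show inj: "inj_on (\<lambda>i. x i - x j) (K - {j})"
  proof (rule inj_onI, rule ccontr)
    fix a b assume ab: "a \<in> K - {j}" "b \<in> K - {j}" "x a - x j = x b - x j" "a \<noteq> b"
    let ?c = "\<lambda>i. (if i = a then 1 else 0) - (if i = b then 1 else 0) :: real"
    have "(\<Sum>i\<in>K - {j}. ?c i *\<^sub>R (x i - x j)) = 0"
      using ab assms by (simp add: scaleR_left_diff_distrib sum_subtractf if_distrib[of "\<lambda>c. c *\<^sub>R _"] cong: if_cong)
    from key[OF this] ab(1) have "?c a = 0" by blast
    then show False using ab(4) by simp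
  qed
  show "independent ((\<lambda>i. x i - x j) ` (K - {j}))"
  proof (rule independent_if_scalars_zero)
    fix f v assume f: "(\<Sum>u\<in>(\<lambda>i. x i - x j) ` (K - {j}). f u *\<^sub>R u) = 0" "v \<in> (\<lambda>i. x i - x j) ` (K - {j})"
    then have "(\<Sum>i\<in>K - {j}. f (x i - x j) *\<^sub>R (x i - x j)) = 0" using inj by (simp add: sum.reindex)
    from key[OF this] show "f v = 0" using f(2) by auto
  qed (use assms in auto)
qed

text \<open>
  At most \<open>card B\<close> points span a proper affine subspace; the residual of a basis vector outside of
  its direction space is normal to it.
\<close>

lemma exists_normal_to_lin:
  fixes x :: "'i \<Rightarrow> 'a::real_inner"
  assumes "orthonormal B" "finite J" "J \<noteq> {}" "card J \<le> card B" "\<And>i. i \<in> J \<Longrightarrow> x i \<in> span B"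
  obtains v where "v \<in> span B" "v \<noteq> 0" "\<And>i j. i \<in> J \<Longrightarrow> j \<in> J \<Longrightarrow> v \<bullet> (x i - x j) = 0"
proof -
  obtain j where j: "j \<in> J" using assms by auto
  let ?S = "(\<lambda>i. x i - x j) ` (J - {j})"
  have "\<not> B \<subseteq> icone x J J"
  proof
    assume "B \<subseteq> icone x J J"
    then have "B \<subseteq> span ?S" using assms j by (simp add: lin_eq_span)
    then have "card B \<le> card ?S"
      using independent_span_bound[OF _ orthonormal_independent[OF assms(1)]] assms(2) by auto
    also have "\<dots> \<le> card (J - {j})" using assms by (intro card_image_le) auto
    also have "\<dots> < card J" using assms j by (intro psubset_card_mono) auto
    finally show False using assms by simp
  qed
  then obtain b where b: "b \<in> B" "b \<notin> icone x J J" by auto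
  obtain p where p: "p \<in> icone x J J" "polar x J J (b - p)" using moreau_icone[OF assms(2) subset_refl] by metis
  have "icone x J J \<subseteq> span B" using assms by (intro icone_subset_subspace) auto
  then have "b - p \<in> span B" using b p by (auto intro!: span_diff intro: span_base)
  moreover have "b - p \<noteq> 0" using b p by auto
  ultimately show ?thesis using polar_eq[OF p(2)] that by auto
qed

definition general_position :: "('i \<Rightarrow> 'a::real_vector) \<Rightarrow> 'i set \<Rightarrow> nat \<Rightarrow> bool" where
  "general_position x N d \<longleftrightarrow> (\<forall>K\<subseteq>N. card K \<le> d + 1 \<longrightarrow> affine_indep x K)"

text \<open>
  Otherwise \<open>w\<close> and \<open>d\<close> of the differences are \<open>d + 1\<close> independent vectors.
\<close>

lemma general_position_normal_zero:
  fixes x :: "'i \<Rightarrow> 'a::real_inner"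
  assumes "general_position x N d" "orthonormal B" "card B = d" "\<And>i. i \<in> N \<Longrightarrow> x i \<in> span B"
    "K \<subseteq> N" "finite N" "card K \<ge> d + 1" "w \<in> span B" "j \<in> K" "\<And>i. i \<in> K \<Longrightarrow> w \<bullet> (x i - x j) = 0"
  shows "w = 0"
proof (rule ccontr)
  assume w: "w \<noteq> 0"
  have finK: "finite K" using assms finite_subset by blast
  obtain K' where K': "K' \<subseteq> K - {j}" "card K' = d"
  proof -
    have "d \<le> card (K - {j})" using assms(7,9) finK by simp
    then show ?thesis using that by (metis obtain_subset_with_card_n)
  qed
  let ?K = "insert j K'"
  have cK: "card ?K = d + 1" using K' finK finite_subset[of K' K] by (subst card_insert_disjoint) auto
  have sub: "?K \<subseteq> K" using K' assms by auto
  have "?K \<subseteq> N" using sub assms(5) by blast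
  then have ai: "affine_indep x ?K" using assms(1) cK unfolding general_position_def by (metis order_refl)
  have fK: "finite ?K" by (rule finite_subset[OF sub finK])
  note ind = affine_indep_imp_independent[OF ai fK insertI1]
  let ?D = "(\<lambda>i. x i - x j) ` (?K - {j})"
  have cD: "card ?D = d" using card_image[OF ind(1)] cK fK card_Diff_singleton[of j ?K] by simp
  have "w \<notin> span ?D"
  proof
    assume "w \<in> span ?D"
    then have "orthogonal w w"
    proof (rule orthogonal_to_span)
      fix y assume "y \<in> ?D"
      then show "orthogonal w y" using assms(10) sub unfolding orthogonal_def by blast
    qed
    then show False using w by (simp add: orthogonal_def)
  qed
  then have "independent (insert w ?D)" using ind(2) by (rule independent_insertI)
  moreover have "insert w ?D \<subseteq> span B"
  proof -
    have "x i - x j \<in> span B" if "i \<in> ?K" for i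
      using that sub assms(4,5,9) by (intro span_diff) blast+
    then show ?thesis using assms(8) by blast
  qed
  moreover have "finite B" using assms(2) by (rule orthonormal_finite)
  ultimately have "card (insert w ?D) \<le> d" using independent_span_bound[of B "insert w ?D"] assms(3) by simp
  moreover have "w \<notin> ?D" by (metis \<open>w \<notin> span ?D\<close> span_base)
  ultimately show False using cD fK by simp
qed

text \<open>
  Besides avoiding the spaces \<open>icone x J J\<close> of small dimension, the residual of \<open>z\<close> to such a space is
  not orthogonal to any further difference. So the projection of \<open>z\<close> to a tangent cone is in the relative
  interior of exactly one face.
\<close>

definition generic_point :: "('i \<Rightarrow> 'a::real_inner) \<Rightarrow> 'i set \<Rightarrow> nat \<Rightarrow> 'a \<Rightarrow> bool" where
  "generic_point x N d z \<longleftrightarrow> (\<forall>J\<subseteq>N. J \<noteq> {} \<and> card J \<le> d \<longrightarrow> z \<notin> icone x J J \<and>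
     (\<forall>p\<in>icone x J J. (\<forall>i\<in>J. \<forall>j\<in>J. (z - p) \<bullet> (x i - x j) = 0) \<longrightarrow>
        (\<forall>i\<in>N - J. \<forall>j\<in>J. (z - p) \<bullet> (x i - x j) \<noteq> 0)))"

text \<open>
  Outside of the cone, the residual of the projection is nonzero, and \<open>J\<close> must be the set of
  all \<open>i\<close> with \<open>x i - x j\<close> orthogonal to it; general position bounds the cardinality of this set by \<open>d\<close>.
  Inside of the cone the residual is \<open>0\<close>, and no \<open>J\<close> with \<open>card J \<le> d\<close> is possible.
\<close>

theorem card_kkt:
  fixes x :: "'i \<Rightarrow> 'a::real_inner"
  assumes N: "finite N" "I \<subseteq> N" "I \<noteq> {}" and B: "orthonormal B" "card B = d"
    and xB: "\<And>i. i \<in> N \<Longrightarrow> x i \<in> span B" and zB: "z \<in> span B"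
    and gp: "general_position x N d" and generic_point: "generic_point x N d z"
  shows "card {J. I \<subseteq> J \<and> J \<subseteq> N \<and> card J \<le> d \<and> kkt x I J N z} = (if z \<in> icone x I N then 0 else 1)"
proof -
  obtain j where j: "j \<in> I" using N by auto
  obtain p where p: "p \<in> icone x I N" "polar x I N (z - p)" "(z - p) \<bullet> p = 0"
    using moreau_icone[OF N(1,2)] by metis
  show ?thesis
  proof (cases "z \<in> icone x I N")
    case True
    have "\<not> kkt x I J N z" if J: "I \<subseteq> J" "J \<subseteq> N" "card J \<le> d" for J
    proof
      assume "kkt x I J N z"
      then obtain q where q: "q \<in> icone x I J" "q \<in> icone x I N" "polar x I N (z - q)" "(z - q) \<bullet> q = 0"
        by (rule kktD) (use J N in auto)
      have "q = z" by (rule moreau_unique[OF N(2,3) q(2,3,4) True]) (auto simp: polar_def)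
      then have "z \<in> icone x J J" using q(1) icone_mono_left[OF J(1)] by blast
      then show False using generic_point J N by (auto simp: generic_point_def)
    qed
    then have "{J. I \<subseteq> J \<and> J \<subseteq> N \<and> card J \<le> d \<and> kkt x I J N z} = {}" by auto
    then show ?thesis using True by (metis card.empty)
  next
    case False
    let ?K = "{i\<in>N. \<forall>j\<in>I. (z - p) \<bullet> (x i - x j) = 0}"
    have pK: "p \<in> icone x I ?K" by (rule icone_face[OF p(2) N(2,3,1) p(1,3)])
    have IK: "I \<subseteq> ?K" using polar_eq[OF p(2) _ _ N(2)] N by auto
    have w: "z - p \<noteq> 0" using False p by auto
    have "icone x I N \<subseteq> span B" using xB by (intro icone_subset_subspace) auto
    then have wB: "z - p \<in> span B" using p zB by (auto intro: span_diff)
    have cK: "card ?K \<le> d"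
    proof (rule ccontr)
      assume "\<not> card ?K \<le> d"
      then have "z - p = 0"
        using general_position_normal_zero[OF gp B xB _ N(1) _ wB, of ?K j] IK j by auto
      then show False using w by simp
    qed
    have "kkt x I ?K N z"
      unfolding kkt_def
    proof (rule bexI[OF _ pK])
      have "(z - p) \<bullet> (x i - x k) \<le> 0" if "i \<in> N" "k \<in> ?K" for i k
      proof -
        have "(z - p) \<bullet> (x i - x j) \<le> 0" using p(2) that j by (auto simp: polar_def)
        moreover have "(z - p) \<bullet> (x k - x j) = 0" using that j by auto
        ultimately show ?thesis by (simp add: inner_diff_right)
      qed
      then show "polar x ?K N (z - p)" unfolding polar_def by blast
    qed
    moreover have "J = ?K" if J: "I \<subseteq> J" "J \<subseteq> N" "card J \<le> d" "kkt x I J N z" for J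
    proof -
      obtain q where q: "q \<in> icone x I J" "q \<in> icone x I N" "polar x J N (z - q)" "polar x I N (z - q)" "(z - q) \<bullet> q = 0"
        using kktD[OF J(4,1,2) N(1)] by metis
      have [simp]: "q = p" by (rule moreau_unique[OF N(2,3) q(2,4,5) p])
      have eq: "(z - p) \<bullet> (x i - x k) = 0" if "i \<in> J" "k \<in> J" for i k
        using polar_eq[OF q(3) that J(2)] by simp
      have "J \<subseteq> ?K" using eq J by auto
      moreover have "?K \<subseteq> J"
      proof
        fix i assume i: "i \<in> ?K"
        have "p \<in> icone x J J" using q(1) icone_mono_left[OF J(1)] by auto
        then have "\<forall>i\<in>N - J. \<forall>j\<in>J. (z - p) \<bullet> (x i - x j) \<noteq> 0"
          using generic_point J N eq unfolding generic_point_def by (metis subset_empty)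
        then have "i \<in> N - J \<Longrightarrow> (z - p) \<bullet> (x i - x j) \<noteq> 0" using j J by blast
        moreover have "(z - p) \<bullet> (x i - x j) = 0" "i \<in> N" using i j by blast+
        ultimately show "i \<in> J" by blast
      qed
      ultimately show ?thesis by auto
    qed
    ultimately have "{J. I \<subseteq> J \<and> J \<subseteq> N \<and> card J \<le> d \<and> kkt x I J N z} = {?K}"
      using IK cK by blast
    then show ?thesis using False by simp
  qed
qed

section \<open>Projection along a line\<close>

text \<open>
  Since \<open>u\<close> is orthogonal to \<open>z\<close>, the point \<open>z\<close> lies in the face of the cone exposed by \<open>u\<close>, which spans a
  space \<open>icone x J J\<close>; as \<open>u \<noteq> 0\<close>, this \<open>J\<close> has at most \<open>d\<close> elements.
\<close>

lemma general_position_polar_orthogonal: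
  fixes x :: "'i \<Rightarrow> 'a::real_inner"
  assumes N: "finite N" "I \<subseteq> N" "I \<noteq> {}" and B: "orthonormal B" "card B = d"
    and xB: "\<And>i. i \<in> N \<Longrightarrow> x i \<in> span B"
    and gp: "general_position x N d" and generic_point: "\<And>J. J \<subseteq> N \<Longrightarrow> J \<noteq> {} \<Longrightarrow> card J \<le> d \<Longrightarrow> z \<notin> icone x J J"
    and z: "z \<in> icone x I N" and u: "u \<in> span B" "u \<noteq> 0" "polar x I N u" "u \<bullet> z = 0"
  shows False
proof -
  obtain j where j: "j \<in> I" using N by auto
  let ?K = "{i\<in>N. \<forall>j\<in>I. u \<bullet> (x i - x j) = 0}"
  have IK: "I \<subseteq> ?K" using polar_eq[OF u(3) _ _ N(2)] N by auto
  have "z \<in> icone x I ?K" by (rule icone_face[OF u(3) N(2,3,1) z u(4)])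
  then have "z \<in> icone x ?K ?K" using icone_mono_left[OF IK] by blast
  moreover have "card ?K \<le> d"
  proof (rule ccontr)
    assume "\<not> card ?K \<le> d"
    then have cK: "card ?K \<ge> d + 1" by simp
    have KN: "?K \<subseteq> N" by blast
    have "u = 0"
      by (rule general_position_normal_zero[OF gp B xB KN N(1) cK u(1)]) (use IK j in blast)+
    then show False using u by simp
  qed
  moreover have "?K \<subseteq> N" "?K \<noteq> {}" using IK N(3) by blast+
  ultimately show False using generic_point[of ?K] by blast
qed

text \<open>
  The residual of the Moreau decomposition is in the polar cone.
\<close>

lemma polar_trivial_imp_mem:
  fixes x :: "'i \<Rightarrow> 'a::real_inner"
  assumes "finite N" "I \<subseteq> N" "\<And>i. i \<in> N \<Longrightarrow> x i \<in> span B" "z \<in> span B"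
    and nt: "\<not> (\<exists>u\<in>span B. u \<noteq> 0 \<and> polar x I N u)"
  shows "z \<in> icone x I N"
proof -
  obtain p where p: "p \<in> icone x I N" "polar x I N (z - p)" "(z - p) \<bullet> p = 0"
    using moreau_icone[OF assms(1,2)] by metis
  have "icone x I N \<subseteq> span B" using assms by (intro icone_subset_subspace) auto
  then have "z - p \<in> span B" using p assms by (auto intro: span_diff)
  then have "z - p = 0" using nt p by auto
  then show ?thesis using p by simp
qed

text \<open>
  On the right-hand side, the first summand says that the projection of the cone along \<open>z\<close> is the
  whole hyperplane orthogonal to \<open>z\<close>, the second that the cone is the whole space, both expressed by
  the polar cone. In general position the projection along \<open>z\<close> is full exactly if the line through \<open>z\<close>
  meets the cone outside of \<open>0\<close>, and the cone is full exactly if it contains both \<open>z\<close> and \<open>-z\<close>.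
\<close>

theorem projection_dichotomy:
  fixes x :: "'i \<Rightarrow> 'a::real_inner"
  assumes N: "finite N" "I \<subseteq> N" "I \<noteq> {}" "card N \<ge> d + 1" and B: "orthonormal B" "card B = d"
    and xB: "\<And>i. i \<in> N \<Longrightarrow> x i \<in> span B" and zB: "z \<in> span B"
    and gp: "general_position x N d" and generic_point: "\<And>J. J \<subseteq> N \<Longrightarrow> J \<noteq> {} \<Longrightarrow> card J \<le> d \<Longrightarrow> z \<notin> icone x J J"
  shows "of_bool (z \<in> icone x I N) + of_bool (- z \<in> icone x I N)
       = (of_bool (\<not> (\<exists>u\<in>span B. u \<noteq> 0 \<and> u \<bullet> z = 0 \<and> polar x I N u))
        + of_bool (\<not> (\<exists>u\<in>span B. u \<noteq> 0 \<and> polar x I N u)) :: 'c::semiring_1)"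
proof -
  let ?U = "\<exists>u\<in>span B. u \<noteq> 0 \<and> u \<bullet> z = 0 \<and> polar x I N u"
  let ?V = "\<exists>u\<in>span B. u \<noteq> 0 \<and> polar x I N u"
  have gz': "- z \<notin> icone x J J" if "J \<subseteq> N" "J \<noteq> {}" "card J \<le> d" for J
    using generic_point[OF that] subspace_neg[OF subspace_lin, of "- z" x J] by auto
  have zB': "- z \<in> span B" using zB by (rule span_neg)
  have icB: "icone x I N \<subseteq> span B" using xB by (intro icone_subset_subspace) auto
  have 1: "\<not> ?U" if "z \<in> icone x I N"
    using general_position_polar_orthogonal[OF N(1-3) B xB gp generic_point that] by blast
  have 2: "\<not> ?U" if "- z \<in> icone x I N"
    using general_position_polar_orthogonal[OF N(1-3) B xB gp gz' that] by auto
  have 3: "\<not> ?V" if "z \<in> icone x I N" "- z \<in> icone x I N"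
  proof
    assume ?V
    then obtain u where u: "u \<in> span B" "u \<noteq> 0" "polar x I N u" by auto
    then have "u \<bullet> z = 0"
      using polar_inner_icone[OF u(3) N(2,3) that(1)] polar_inner_icone[OF u(3) N(2,3) that(2)] by simp
    then show False using 1[OF that(1)] u by auto
  qed
  have 4: "?V" if "z \<notin> icone x I N \<or> - z \<notin> icone x I N"
  proof (rule ccontr)
    assume nt: "\<not> ?V"
    have "z \<in> icone x I N" by (rule polar_trivial_imp_mem[OF N(1,2) xB zB nt])
    moreover have "- z \<in> icone x I N" by (rule polar_trivial_imp_mem[OF N(1,2) xB zB' nt])
    ultimately show False using that by blast
  qed
  have 5: "?U" if z1: "z \<notin> icone x I N" and z2: "- z \<notin> icone x I N"
  proof -
    obtain p where p: "p \<in> icone x I N" "polar x I N (z - p)" "(z - p) \<bullet> p = 0"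
      using moreau_icone[OF N(1,2)] by metis
    obtain q where q: "q \<in> icone x I N" "polar x I N (- z - q)" "(- z - q) \<bullet> q = 0"
      using moreau_icone[OF N(1,2)] by metis
    define w v where "w = z - p" and "v = - z - q"
    have wz: "w \<noteq> 0" "v \<noteq> 0" using z1 z2 p q by (auto simp: w_def v_def)
    have wB: "w \<in> span B" "v \<in> span B" using p q zB zB' icB by (auto simp: w_def v_def intro!: span_diff)
    have a: "w \<bullet> z > 0"
    proof -
      have "w \<bullet> z = w \<bullet> w" using p by (simp add: w_def inner_diff_left inner_diff_right inner_commute)
      then show ?thesis using wz by simp
    qed
    have b: "v \<bullet> z < 0"
    proof -
      have "v \<bullet> (- z) = v \<bullet> v" using q by (simp add: v_def inner_diff_left inner_diff_right inner_commute)
      then show ?thesis using wz by (metis inner_gt_zero_iff inner_minus_right neg_0_less_iff_less)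
    qed
    \<comment> \<open>The positive combination of the residuals of \<open>z\<close> and \<open>-z\<close> that is orthogonal to \<open>z\<close>.\<close>
    define u where "u = (- (v \<bullet> z)) *\<^sub>R w + (w \<bullet> z) *\<^sub>R v"
    have uz: "u \<bullet> z = 0" by (simp add: u_def inner_add_left inner_diff_left)
    have uB: "u \<in> span B" using wB unfolding u_def by (intro span_add span_scale)
    have up: "polar x I N u"
      unfolding polar_def
    proof (intro ballI)
      fix i j assume "i \<in> N" "j \<in> I"
      then have "w \<bullet> (x i - x j) \<le> 0" "v \<bullet> (x i - x j) \<le> 0" using p q by (auto simp: polar_def w_def v_def)
      then show "u \<bullet> (x i - x j) \<le> 0"
        unfolding u_def inner_add_left inner_scaleR_left using a b
        by (intro add_nonpos_nonpos mult_nonneg_nonpos) auto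
    qed
    have "u \<noteq> 0"
    proof
      assume "u = 0"
      then have e: "(w \<bullet> z) *\<^sub>R v = (v \<bullet> z) *\<^sub>R w" by (simp add: u_def)
      have z0: "w \<bullet> (x i - x k) = 0" if "i \<in> N" "k \<in> I" for i k
      proof -
        have "w \<bullet> (x i - x k) \<le> 0" "v \<bullet> (x i - x k) \<le> 0"
          using p q that by (auto simp: polar_def w_def v_def)
        moreover have "(w \<bullet> z) * (v \<bullet> (x i - x k)) = (v \<bullet> z) * (w \<bullet> (x i - x k))"
          using e by (metis inner_scaleR_left)
        ultimately show ?thesis using a b
          by (metis less_eq_real_def mult_less_cancel_left_neg mult_neg_neg mult_nonneg_nonpos not_less)
      qed
      obtain j where j: "j \<in> I" using N by auto
      have "w = 0"
        using general_position_normal_zero[OF gp B xB subset_refl N(1,4) wB(1), of j] z0 j N by auto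
      then show False using wz by simp
    qed
    then show ?U using uz uB up by auto
  qed
  show ?thesis
    using 1 2 3 4 5 by (cases "z \<in> icone x I N"; cases "- z \<in> icone x I N") auto
qed

text \<open>
  An element of the polar cone is orthogonal to the differences of the points of \<open>I\<close>, which span the space.
\<close>

lemma polar_trivial_of_full:
  fixes x :: "'i \<Rightarrow> 'a::real_inner"
  assumes "finite N" "I \<subseteq> N" "I \<noteq> {}" "card I \<ge> d + 1" "orthonormal B" "card B = d"
    "\<And>i. i \<in> N \<Longrightarrow> x i \<in> span B" "general_position x N d"
  shows "\<not> (\<exists>u\<in>span B. u \<noteq> 0 \<and> polar x I N u)"
proof
  assume "\<exists>u\<in>span B. u \<noteq> 0 \<and> polar x I N u"
  then obtain u where u: "u \<in> span B" "u \<noteq> 0" "polar x I N u" by auto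
  obtain j where j: "j \<in> I" using assms by auto
  have "u = 0"
    using general_position_normal_zero[OF assms(8,5,6,7,2,1,4) u(1) j] polar_eq[OF u(3) _ j assms(2)] by auto
  then show False using u by simp
qed

text \<open>
  Otherwise the cone contains \<open>x j - x i\<close> with \<open>i \<in> N - I\<close> and \<open>j \<in> I\<close>; affine independence determines
  its weights, and the weight of \<open>i\<close> is negative.
\<close>

lemma polar_nontrivial_of_simplex:
  fixes x :: "'i \<Rightarrow> 'a::real_inner"
  assumes "finite N" "I \<subset> N" "I \<noteq> {}" "\<And>i. i \<in> N \<Longrightarrow> x i \<in> span B" "affine_indep x N"
  shows "\<exists>u\<in>span B. u \<noteq> 0 \<and> polar x I N u"
proof (rule ccontr)
  assume nt: "\<not> ?thesis"
  obtain i j where ij: "i \<in> N" "i \<notin> I" "j \<in> I" using assms by auto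
  have "x j - x i \<in> span B" using ij assms by (auto intro!: span_diff)
  then have "x j - x i \<in> icone x I N"
    using polar_trivial_imp_mem[OF assms(1) _ assms(4) _ nt] assms(2) by auto
  then obtain l where l: "l \<in> coef I N" "x j - x i = (\<Sum>k\<in>N. l k *\<^sub>R x k)" by (auto simp: icone_def)
  let ?m = "\<lambda>k. l k - ((if k = j then 1 else 0) - (if k = i then 1 else 0))"
  have "j \<in> N" using ij assms by auto
  then have "(\<Sum>k\<in>N. ?m k *\<^sub>R x k) = 0"
    using ij assms(1) l(2)[symmetric]
    by (simp add: scaleR_left_diff_distrib sum_subtractf if_distrib[of "\<lambda>c. c *\<^sub>R _"] cong: if_cong)
  moreover have "?m \<in> coef N N"
    using l(1) ij \<open>j \<in> N\<close> assms(1) by (auto simp: coef_def sum_subtractf)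
  ultimately have "?m i = 0" by (intro aindD[OF assms(5), of ?m])
  then have "l i = - 1" using ij by (auto split: if_splits)
  moreover have "l i \<ge> 0" using l(1) ij unfolding coef_def by blast
  ultimately show False by simp
qed

section \<open>Index sets of faces\<close>

text \<open>
  \<open>J\<close> is the index set of a face of \<open>convex hull (x ` N)\<close>: some linear functional \<open>u \<in> V\<close> is maximal over the
  points exactly on \<open>J\<close>.
\<close>

definition face_index :: "'a::real_inner set \<Rightarrow> ('i \<Rightarrow> 'a) \<Rightarrow> 'i set \<Rightarrow> 'i set \<Rightarrow> bool" where
  "face_index V x N J \<longleftrightarrow> J \<subseteq> N \<and> (\<exists>u\<in>V. (\<forall>i\<in>J. \<forall>j\<in>J. u \<bullet> (x i - x j) = 0) \<and> (\<forall>i\<in>N - J. \<forall>j\<in>J. u \<bullet> (x i - x j) < 0))"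

text \<open>
  A face of a face is a face: add a large multiple of the functional for \<open>K\<close> to that for \<open>I\<close>.
\<close>

lemma face_index_trans:
  assumes "subspace V" "face_index V x N K" "face_index V x K I" "finite N" "I \<noteq> {}"
  shows "face_index V x N I"
proof -
  obtain u where u: "u \<in> V" "\<And>i j. i \<in> K \<Longrightarrow> j \<in> K \<Longrightarrow> u \<bullet> (x i - x j) = 0"
    "\<And>i j. i \<in> N - K \<Longrightarrow> j \<in> K \<Longrightarrow> u \<bullet> (x i - x j) < 0" and KN: "K \<subseteq> N"
    using assms(2) unfolding face_index_def by blast
  obtain v where v: "v \<in> V" "\<And>i j. i \<in> I \<Longrightarrow> j \<in> I \<Longrightarrow> v \<bullet> (x i - x j) = 0"
    "\<And>i j. i \<in> K - I \<Longrightarrow> j \<in> I \<Longrightarrow> v \<bullet> (x i - x j) < 0" and IK: "I \<subseteq> K"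
    using assms(3) unfolding face_index_def by blast
  \<comment> \<open>Large enough for \<open>M *\<^sub>R u\<close> to dominate \<open>v\<close> on all pairs outside of \<open>K\<close>.\<close>
  define M where "M = (\<Sum>(i,j)\<in>(N - K) \<times> I. \<bar>v \<bullet> (x i - x j)\<bar> / \<bar>u \<bullet> (x i - x j)\<bar>) + 1"
  have fin: "finite ((N - K) \<times> I)" using assms(4) IK KN by (meson finite_Diff finite_SigmaI finite_subset)
  define w where "w = M *\<^sub>R u + v"
  have neg: "w \<bullet> (x i - x j) < 0" if ij: "i \<in> N - K" "j \<in> I" for i j
  proof -
    have un: "u \<bullet> (x i - x j) < 0" using u(3) ij IK by auto
    have "\<bar>v \<bullet> (x i - x j)\<bar> / \<bar>u \<bullet> (x i - x j)\<bar> \<le> M - 1"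
    proof -
      have "(\<lambda>(i,j). \<bar>v \<bullet> (x i - x j)\<bar> / \<bar>u \<bullet> (x i - x j)\<bar>) (i,j) \<le> M - 1"
        unfolding M_def add_diff_cancel_right' using ij fin by (intro member_le_sum) auto
      then show ?thesis by simp
    qed
    then have "\<bar>v \<bullet> (x i - x j)\<bar> / \<bar>u \<bullet> (x i - x j)\<bar> < M" by simp
    then have "\<bar>v \<bullet> (x i - x j)\<bar> < M * \<bar>u \<bullet> (x i - x j)\<bar>"
      using un by (subst (asm) pos_divide_less_eq) auto
    then have "v \<bullet> (x i - x j) < - (M * (u \<bullet> (x i - x j)))"
      unfolding abs_of_neg[OF un] using abs_ge_self[of "v \<bullet> (x i - x j)"] by linarith
    then show ?thesis by (simp only: w_def inner_add_left inner_scaleR_left)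
  qed
  have "w \<in> V" using assms(1) u v by (simp add: w_def subspace_add subspace_scale)
  moreover have "w \<bullet> (x i - x j) = 0" if "i \<in> I" "j \<in> I" for i j
    using that u v IK by (simp add: w_def inner_add_left subset_iff)
  moreover have "w \<bullet> (x i - x j) < 0" if ij: "i \<in> N - I" "j \<in> I" for i j
  proof (cases "i \<in> K")
    case True
    then have "u \<bullet> (x i - x j) = 0" using u(2) ij IK by auto
    then show ?thesis using v(3) True ij by (simp add: w_def inner_add_left)
  qed (use neg ij in auto)
  ultimately have "\<exists>u\<in>V. (\<forall>i\<in>I. \<forall>j\<in>I. u \<bullet> (x i - x j) = 0) \<and> (\<forall>i\<in>N - I. \<forall>j\<in>I. u \<bullet> (x i - x j) < 0)"
    by (intro bexI[of _ w]) blast+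
  then show ?thesis using IK KN unfolding face_index_def by blast
qed

text \<open>
  For \<open>i \<in> K - I\<close>, a functional \<open>v i\<close> that is constant on the facet opposite to \<open>x i\<close> and smaller at
  \<open>x i\<close> is the residual of \<open>x i\<close> on that facet. The sum of these is maximal exactly on \<open>I\<close>.
\<close>

lemma face_index_simplex:
  fixes x :: "'i \<Rightarrow> 'a::real_inner"
  assumes "subspace V" "finite K" "affine_indep x K" "I \<subseteq> K" "I \<noteq> {}" "\<And>i. i \<in> K \<Longrightarrow> x i \<in> V"
  shows "face_index V x K I"
proof -
  obtain j where j: "j \<in> I" using assms by auto
  \<comment> \<open>The functional that is constant on the facet opposite to \<open>x i\<close> and smaller at \<open>x i\<close>.\<close>
  have ex: "\<exists>v\<in>V. (\<forall>a\<in>K - {i}. \<forall>b\<in>K - {i}. v \<bullet> (x a - x b) = 0) \<and> (\<forall>b\<in>K - {i}. v \<bullet> (x i - x b) < 0)" if i: "i \<in> K - I" for i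
  proof -
    obtain p where p: "p \<in> icone x (K - {i}) (K - {i})" "polar x (K - {i}) (K - {i}) (x i - x j - p)" "(x i - x j - p) \<bullet> p = 0"
      using moreau_icone[of "K - {i}" "K - {i}" x "x i - x j"] assms(2) by auto
    let ?v = "x i - x j - p"
    have pV: "p \<in> V" using p(1) icone_subset_subspace[OF assms(1), of "K - {i}" x] assms(6) by auto
    have vne: "?v \<noteq> 0"
    proof
      assume "?v = 0"
      then obtain l where l: "l \<in> coef (K - {i}) (K - {i})" "x i - x j = (\<Sum>k\<in>K - {i}. l k *\<^sub>R x k)"
        using p(1) by (auto simp: icone_def)
      let ?m = "\<lambda>k. l k - ((if k = i then 1 else 0) - (if k = j then 1 else 0))"
      have sl: "(\<Sum>k\<in>K. l k *\<^sub>R x k) = (\<Sum>k\<in>K - {i}. l k *\<^sub>R x k)" "sum l K = sum l (K - {i})"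
      proof -
        have l0: "\<forall>k\<in>K - (K - {i}). l k = 0" using l(1) by (auto simp: coef_def)
        show "(\<Sum>k\<in>K. l k *\<^sub>R x k) = (\<Sum>k\<in>K - {i}. l k *\<^sub>R x k)"
          by (rule sum.mono_neutral_right) (use assms(2) l0 in auto)
        show "sum l K = sum l (K - {i})"
          by (rule sum.mono_neutral_right) (use assms(2) l0 in auto)
      qed
      have "(\<Sum>k\<in>K. ?m k *\<^sub>R x k) = 0"
        using i j assms l(2)[symmetric] sl
        by (auto simp add: scaleR_left_diff_distrib sum_subtractf if_distrib[of "\<lambda>c. c *\<^sub>R _"] cong: if_cong)
      moreover have "?m \<in> coef K K"
        using l(1) i j assms sl by (auto simp: coef_def sum_subtractf)
      ultimately have "?m i = 0" by (intro aindD[OF assms(3), of ?m])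
      moreover have "l i = 0" using l(1) by (auto simp: coef_def)
      ultimately show False using i j by (auto split: if_splits)
    qed
    have orth: "?v \<bullet> (x a - x b) = 0" if "a \<in> K - {i}" "b \<in> K - {i}" for a b
      using polar_eq[OF p(2) that] by simp
    have "?v \<bullet> (x i - x j) = ?v \<bullet> ?v" using p(3) by (simp add: inner_diff_right)
    then have "?v \<bullet> (x i - x j) > 0" using vne by simp
    then have pos: "?v \<bullet> (x i - x b) > 0" if "b \<in> K - {i}" for b
    proof -
      have "j \<in> K - {i}" using i j assms(4) by auto
      from orth[OF this that] show ?thesis
        using \<open>?v \<bullet> (x i - x j) > 0\<close> by (simp only: inner_diff_right)
    qed
    show ?thesis
    proof (intro bexI[of _ "- ?v"] conjI ballI)
      fix a b assume "a \<in> K - {i}" "b \<in> K - {i}"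
      then show "- ?v \<bullet> (x a - x b) = 0" using orth by (simp only: inner_minus_left)
    next
      fix b assume "b \<in> K - {i}"
      then show "- ?v \<bullet> (x i - x b) < 0" using pos by (simp only: inner_minus_left neg_less_0_iff_less)
    next
      have "x i - x j - p \<in> V" using assms(1,4,6) pV i j by (intro subspace_diff) auto
      then show "- ?v \<in> V" using subspace_neg[OF assms(1)] by blast
    qed
  qed
  then obtain v where v: "\<And>i. i \<in> K - I \<Longrightarrow> v i \<in> V"
    "\<And>i a b. i \<in> K - I \<Longrightarrow> a \<in> K - {i} \<Longrightarrow> b \<in> K - {i} \<Longrightarrow> v i \<bullet> (x a - x b) = 0"
    "\<And>i b. i \<in> K - I \<Longrightarrow> b \<in> K - {i} \<Longrightarrow> v i \<bullet> (x i - x b) < 0" by metis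
  define u where "u = (\<Sum>i\<in>K - I. v i)"
  have "u \<in> V" unfolding u_def using assms(1) v(1) by (intro subspace_sum) auto
  moreover have "u \<bullet> (x a - x b) = 0" if "a \<in> I" "b \<in> I" for a b
    unfolding u_def inner_sum_left
  proof (intro sum.neutral ballI)
    fix i assume "i \<in> K - I"
    then show "v i \<bullet> (x a - x b) = 0" by (rule v(2)) (use that assms(4) \<open>i \<in> K - I\<close> in blast)+
  qed
  moreover have "u \<bullet> (x a - x b) < 0" if "a \<in> K - I" "b \<in> I" for a b
  proof -
    have "u \<bullet> (x a - x b) = v a \<bullet> (x a - x b) + (\<Sum>i\<in>K - I - {a}. v i \<bullet> (x a - x b))"
      unfolding u_def inner_sum_left using that assms by (subst sum.remove[of _ a]) auto
    also have "(\<Sum>i\<in>K - I - {a}. v i \<bullet> (x a - x b)) = 0"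
    proof (intro sum.neutral ballI)
      fix i assume "i \<in> K - I - {a}"
      then show "v i \<bullet> (x a - x b) = 0" by (intro v(2)) (use that assms(4) in blast)+
    qed
    finally have "u \<bullet> (x a - x b) = v a \<bullet> (x a - x b)" by simp
    moreover have "v a \<bullet> (x a - x b) < 0" by (rule v(3)) (use that assms(4) in blast)+
    ultimately show ?thesis by simp
  qed
  ultimately have "\<exists>u\<in>V. (\<forall>i\<in>I. \<forall>j\<in>I. u \<bullet> (x i - x j) = 0) \<and> (\<forall>i\<in>K - I. \<forall>j\<in>I. u \<bullet> (x i - x j) < 0)"
    by (intro bexI[of _ u]) blast+
  then show ?thesis using assms(4) unfolding face_index_def by blast
qed

lemma face_index_card_le:
  fixes x :: "'i \<Rightarrow> 'a::real_inner"
  assumes "face_index (span B) x N J" "J \<noteq> N" "J \<noteq> {}" "finite N" "orthonormal B" "card B = d" "general_position x N d"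
    "\<And>i. i \<in> N \<Longrightarrow> x i \<in> span B"
  shows "card J \<le> d"
proof (rule ccontr)
  assume "\<not> card J \<le> d"
  obtain u where u: "u \<in> span B" "\<And>i j. i \<in> J \<Longrightarrow> j \<in> J \<Longrightarrow> u \<bullet> (x i - x j) = 0"
    "\<And>i j. i \<in> N - J \<Longrightarrow> j \<in> J \<Longrightarrow> u \<bullet> (x i - x j) < 0" and KN: "J \<subseteq> N"
    using assms(1) unfolding face_index_def by blast
  obtain j where j: "j \<in> J" using assms by auto
  have "u = 0"
    using general_position_normal_zero[OF assms(7,5,6,8) KN assms(4) _ u(1) j] u(2) j \<open>\<not> card J \<le> d\<close> by auto
  moreover obtain i where "i \<in> N - J" using KN assms(2) by auto
  ultimately show False using u(3) j by force
qed

text \<open>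
  In general position, the points with \<open>u \<bullet> x i\<close> maximal are affinely independent if \<open>u \<noteq> 0\<close>, so
  they form a simplex face, of which \<open>I\<close> indexes a face.
\<close>

lemma face_index_iff_polar_nontrivial:
  fixes x :: "'i \<Rightarrow> 'a::real_inner"
  assumes "finite N" "I \<subset> N" "I \<noteq> {}" "orthonormal B" "card B = d" "general_position x N d" "\<And>i. i \<in> N \<Longrightarrow> x i \<in> span B"
  shows "face_index (span B) x N I \<longleftrightarrow> (\<exists>u\<in>span B. u \<noteq> 0 \<and> polar x I N u)"
proof
  assume "face_index (span B) x N I"
  then obtain u where u: "u \<in> span B" "\<And>i j. i \<in> I \<Longrightarrow> j \<in> I \<Longrightarrow> u \<bullet> (x i - x j) = 0"
    "\<And>i j. i \<in> N - I \<Longrightarrow> j \<in> I \<Longrightarrow> u \<bullet> (x i - x j) < 0"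
    unfolding face_index_def by blast
  obtain i j where ij: "i \<in> N - I" "j \<in> I" using assms by auto
  have "u \<noteq> 0" using u(3)[OF ij] by auto
  moreover have "polar x I N u"
    unfolding polar_def using u(2,3) by (metis DiffI eq_iff less_imp_le)
  ultimately show "\<exists>u\<in>span B. u \<noteq> 0 \<and> polar x I N u" using u(1) by auto
next
  assume "\<exists>u\<in>span B. u \<noteq> 0 \<and> polar x I N u"
  then obtain u where u: "u \<in> span B" "u \<noteq> 0" "polar x I N u" by auto
  obtain j where j: "j \<in> I" using assms by auto
  let ?K = "{i\<in>N. u \<bullet> (x i - x j) = 0}"
  have IN: "I \<subseteq> N" using assms by auto
  have IK: "I \<subseteq> ?K" using polar_eq[OF u(3) _ j IN] IN by auto
  have cK: "card ?K \<le> d"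
  proof (rule ccontr)
    assume "\<not> card ?K \<le> d"
    then have cK: "card ?K \<ge> d + 1" by simp
    have KN: "?K \<subseteq> N" by blast
    have "u = 0"
      by (rule general_position_normal_zero[OF assms(6,4,5,7) KN assms(1) cK u(1)]) (use IK j in blast)+
    then show False using u by simp
  qed
  have ai: "affine_indep x ?K" using assms(6) cK unfolding general_position_def by simp
  have "face_index (span B) x N ?K"
    unfolding face_index_def
  proof (intro conjI bexI[OF _ u(1)] ballI)
    fix a b assume "a \<in> ?K" "b \<in> ?K"
    then have "u \<bullet> (x a - x j) = 0" "u \<bullet> (x b - x j) = 0" by blast+
    then show "u \<bullet> (x a - x b) = 0" by (simp add: inner_diff_right)
  next
    fix a b assume ab: "a \<in> N - ?K" "b \<in> ?K"
    have "u \<bullet> (x a - x j) \<le> 0" using u(3) ab j by (auto simp: polar_def)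
    moreover have "u \<bullet> (x a - x j) \<noteq> 0" "u \<bullet> (x b - x j) = 0" using ab by blast+
    ultimately show "u \<bullet> (x a - x b) < 0" by (simp add: inner_diff_right)
  qed auto
  moreover have "face_index (span B) x ?K I"
    using assms ai IK by (intro face_index_simplex) auto
  ultimately show "face_index (span B) x N I"
    using assms by (intro face_index_trans[of "span B" x N ?K I]) auto
qed

section \<open>Measurability by projection of closed sets\<close>

text \<open>
  Projection along a compact factor is closed, by the tube lemma.
\<close>

lemma closed_projection_compact:
  assumes "compact K" "closed A"
  shows "closed {x. \<exists>y\<in>K. (x, y) \<in> A}"
proof -
  have "open (- {x. \<exists>y\<in>K. (x, y) \<in> A})"
  proof (subst open_subopen, intro ballI)
    fix x assume "x \<in> - {x. \<exists>y\<in>K. (x, y) \<in> A}"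
    then have "{x} \<times> K \<subseteq> - A" by auto
    from Elementary_Topology.tube_lemma[OF assms(1) _ this] assms(2) obtain X where
      "x \<in> X" "open X" "X \<times> K \<subseteq> - A" by auto
    then show "\<exists>T. open T \<and> x \<in> T \<and> T \<subseteq> - {x. \<exists>y\<in>K. (x, y) \<in> A}" by (intro exI[of _ X]) auto
  qed
  then show ?thesis by (simp add: closed_def)
qed

lemma compact_fun_box:
  "compact {c :: 'k \<Rightarrow> real. (\<forall>k\<in>S. \<bar>c k\<bar> \<le> R) \<and> (\<forall>k. k \<notin> S \<longrightarrow> c k = 0)}"
proof -
  have "compactin (product_topology (\<lambda>_. euclidean) UNIV) (PiE UNIV (\<lambda>k::'k. if k \<in> S then {- R..R} else {0::real}))"
    by (subst compactin_PiE) auto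
  moreover have "PiE UNIV (\<lambda>k::'k. if k \<in> S then {- R..R} else {0::real})
     = {c. (\<forall>k\<in>S. \<bar>c k\<bar> \<le> R) \<and> (\<forall>k. k \<notin> S \<longrightarrow> c k = 0)}"
    by (auto simp: PiE_def Pi_def abs_le_iff minus_le_iff split: if_splits)
  ultimately show ?thesis by (simp add: euclidean_product_topology)
qed

text \<open>
  Existential conditions on finitely many real parameters define an \<open>F_\<sigma>\<close> set: the parameters range over a
  countable union of compact boxes. The measurability of all events below rests on this.
\<close>

lemma borel_Ex_finite_support:
  fixes A :: "('x::topological_space \<times> ('k \<Rightarrow> real)) set"
  assumes "finite S" "closed A" "\<And>x c k. (x, c) \<in> A \<Longrightarrow> k \<notin> S \<Longrightarrow> c k = 0"
  shows "{x. \<exists>c. (x, c) \<in> A} \<in> sets borel"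
proof -
  define Q where "Q = (\<lambda>R. {c :: 'k \<Rightarrow> real. (\<forall>k\<in>S. \<bar>c k\<bar> \<le> R) \<and> (\<forall>k. k \<notin> S \<longrightarrow> c k = 0)})"
  have "{x. \<exists>c. (x, c) \<in> A} = (\<Union>n::nat. {x. \<exists>c\<in>Q (real n). (x, c) \<in> A})"
  proof safe
    fix x c assume xc: "(x, c) \<in> A"
    obtain n :: nat where n: "(\<Sum>k\<in>S. \<bar>c k\<bar>) \<le> real n" using real_arch_simple by blast
    have "\<bar>c k\<bar> \<le> real n" if "k \<in> S" for k
      using member_le_sum[of k S "\<lambda>k. \<bar>c k\<bar>"] that assms(1) n by auto
    then have "c \<in> Q (real n)" using assms(3)[OF xc] by (auto simp: Q_def)
    then show "x \<in> (\<Union>n::nat. {x. \<exists>c\<in>Q (real n). (x, c) \<in> A})" using xc by auto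
  qed auto
  also have "\<dots> \<in> sets borel"
  proof -
    have "{x. \<exists>c\<in>Q (real n). (x, c) \<in> A} \<in> sets borel" for n
      unfolding Q_def by (intro borel_closed closed_projection_compact compact_fun_box assms(2))
    then show ?thesis by blast
  qed
  finally show ?thesis .
qed

lemma closed_Collect_Ball:
  assumes "\<And>i. i \<in> N \<Longrightarrow> closed {x. P x i}"
  shows "closed {x. \<forall>i\<in>N. P x i}"
proof -
  have "{x. \<forall>i\<in>N. P x i} = (\<Inter>i\<in>N. {x. P x i})" by auto
  then show ?thesis using assms by auto
qed

lemma norm_lookup_le: "norm (Poly_Mapping.lookup p i) \<le> norm (p :: 'i \<Rightarrow>\<^sub>0 'a::real_inner)"
proof -
  have "Poly_Mapping.lookup p i \<bullet> Poly_Mapping.lookup p i \<le> p \<bullet> p"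
  proof (cases "i \<in> Poly_Mapping.keys p")
    case True
    then show ?thesis unfolding inner_poly_mapping_def
      by (intro member_le_sum[of i _ "\<lambda>i. Poly_Mapping.lookup p i \<bullet> Poly_Mapping.lookup p i"]) auto
  qed (auto simp: in_keys_iff)
  then show ?thesis by (simp add: norm_eq_sqrt_inner)
qed

lemma bounded_linear_lookup: "bounded_linear (\<lambda>p :: 'i \<Rightarrow>\<^sub>0 'a::real_inner. Poly_Mapping.lookup p i)"
  by (rule bounded_linear_intro[where K=1]) (auto simp: lookup_add norm_lookup_le)

lemmas continuous_on_lookup [continuous_intros] = bounded_linear.continuous_on[OF bounded_linear_lookup]

lemma measurable_lookup [measurable]:
  "(\<lambda>p :: 'i::countable \<Rightarrow>\<^sub>0 'a::{real_inner,second_countable_topology}. Poly_Mapping.lookup p i) \<in> borel_measurable borel"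
  by (intro borel_measurable_continuous_onI continuous_intros)

lemmas continuous_on_coord [continuous_intros] = continuous_on_product_then_coordinatewise

abbreviation "lk \<equiv> Poly_Mapping.lookup"

lemmas closed_events = closed_Collect_conj closed_Collect_Ball closed_Collect_le closed_Collect_eq continuous_intros

lemma borel_mem_icone:
  fixes J :: "nat set"
  assumes "finite J"
  shows "{p :: (nat \<Rightarrow>\<^sub>0 'a::{real_inner,second_countable_topology}) \<times> 'a. snd p \<in> icone (lk (fst p)) I J} \<in> sets borel"
proof -
  define A where "A = {q :: ((nat \<Rightarrow>\<^sub>0 'a) \<times> 'a) \<times> (nat \<Rightarrow> real). (\<forall>i\<in>-J. snd q i = 0) \<and> sum (snd q) J = 0 \<and>
     (\<forall>i\<in>J-I. 0 \<le> snd q i) \<and> snd (fst q) = (\<Sum>i\<in>J. snd q i *\<^sub>R lk (fst (fst q)) i)}"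
  have "closed A" unfolding A_def by (intro closed_events)
  then have "{x. \<exists>c. (x, c) \<in> A} \<in> sets borel"
    using assms by (intro borel_Ex_finite_support[of J]) (auto simp: A_def)
  also have "{x. \<exists>c. (x, c) \<in> A} = {p. snd p \<in> icone (lk (fst p)) I J}"
    by (auto simp: A_def icone_def coef_def)
  finally show ?thesis .
qed

lemma borel_kkt:
  fixes J :: "nat set"
  assumes "finite J"
  shows "{p :: (nat \<Rightarrow>\<^sub>0 'a::{real_inner,second_countable_topology}) \<times> 'a. kkt (lk (fst p)) I J N (snd p)} \<in> sets borel"
proof -
  define A where "A = {q :: ((nat \<Rightarrow>\<^sub>0 'a) \<times> 'a) \<times> (nat \<Rightarrow> real). (\<forall>i\<in>-J. snd q i = 0) \<and> sum (snd q) J = 0 \<and>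
     (\<forall>i\<in>J-I. 0 \<le> snd q i) \<and> (\<forall>i\<in>N. \<forall>j\<in>J. (snd (fst q) - (\<Sum>i\<in>J. snd q i *\<^sub>R lk (fst (fst q)) i)) \<bullet>
       (lk (fst (fst q)) i - lk (fst (fst q)) j) \<le> 0)}"
  have "closed A" unfolding A_def by (intro closed_events)
  then have "{x. \<exists>c. (x, c) \<in> A} \<in> sets borel"
    using assms by (intro borel_Ex_finite_support[of J]) (auto simp: A_def)
  also have "{x. \<exists>c. (x, c) \<in> A} = {p. kkt (lk (fst p)) I J N (snd p)}" (is "_ = ?R")
  proof (intro set_eqI iffI)
    fix x assume "x \<in> {x. \<exists>c. (x, c) \<in> A}"
    then obtain c where "(x, c) \<in> A" by auto
    then show "x \<in> ?R"
      unfolding A_def kkt_def polar_def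
      by (auto intro!: bexI[of _ "\<Sum>i\<in>J. c i *\<^sub>R lk (fst x) i"] iconeI[of c] simp: coef_def)
  next
    fix x assume "x \<in> ?R"
    then obtain c where "c \<in> coef I J" "polar (lk (fst x)) J N (snd x - (\<Sum>i\<in>J. c i *\<^sub>R lk (fst x) i))"
      by (auto simp: kkt_def icone_def)
    then have "(x, c) \<in> A" by (auto simp: A_def coef_def polar_def)
    then show "x \<in> {x. \<exists>c. (x, c) \<in> A}" by auto
  qed
  finally show ?thesis .
qed

lemma borel_polar_nontrivial:
  fixes N :: "nat set" and B :: "'a::{real_inner,second_countable_topology} set"
  assumes "finite B"
  shows "{G :: nat \<Rightarrow>\<^sub>0 'a. \<exists>u\<in>span B. u \<noteq> 0 \<and> polar (lk G) I N u} \<in> sets borel"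
proof -
  \<comment> \<open>After normalisation, \<open>u \<noteq> 0\<close> becomes a closed condition.\<close>
  define A where "A = {q :: (nat \<Rightarrow>\<^sub>0 'a) \<times> ('a \<Rightarrow> real). (\<forall>b\<in>-B. snd q b = 0) \<and> 1 \<le> norm (\<Sum>b\<in>B. snd q b *\<^sub>R b) \<and>
     (\<forall>i\<in>N. \<forall>j\<in>I. (\<Sum>b\<in>B. snd q b *\<^sub>R b) \<bullet> (lk (fst q) i - lk (fst q) j) \<le> 0)}"
  have "closed A" unfolding A_def by (intro closed_events)
  then have "{x. \<exists>c. (x, c) \<in> A} \<in> sets borel"
    using assms by (intro borel_Ex_finite_support[of B]) (auto simp: A_def)
  also have "{x. \<exists>c. (x, c) \<in> A} = {G. \<exists>u\<in>span B. u \<noteq> 0 \<and> polar (lk G) I N u}" (is "_ = ?R")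
  proof (intro set_eqI iffI)
    fix x assume "x \<in> {x. \<exists>c. (x, c) \<in> A}"
    then obtain c where "(x, c) \<in> A" by auto
    then show "x \<in> ?R"
      unfolding A_def polar_def using assms
      by (auto intro!: bexI[of _ "\<Sum>b\<in>B. c b *\<^sub>R b"] span_sum_scaleR)
  next
    fix x assume "x \<in> ?R"
    then obtain u where u: "u \<in> span B" "u \<noteq> 0" "polar (lk x) I N u" by auto
    then have "sgn u \<in> span B" by (simp add: sgn_div_norm span_scale)
    then obtain c where c: "sgn u = (\<Sum>b\<in>B. c b *\<^sub>R b)" using assms by (auto simp: span_finite)
    define c' where "c' b = (if b \<in> B then c b else 0)" for b
    have s: "(\<Sum>b\<in>B. c' b *\<^sub>R b) = sgn u" unfolding c by (intro sum.cong) (auto simp: c'_def)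
    have "sgn u \<bullet> (lk x i - lk x j) \<le> 0" if "i \<in> N" "j \<in> I" for i j
    proof -
      have "sgn u \<bullet> (lk x i - lk x j) = inverse (norm u) * (u \<bullet> (lk x i - lk x j))"
        by (simp only: sgn_div_norm inner_scaleR_left)
      then show ?thesis using u that by (simp only: polar_def) (simp add: mult_nonneg_nonpos)
    qed
    then have "(x, c') \<in> A" unfolding A_def using u by (simp add: s norm_sgn) (simp add: c'_def)
    then show "x \<in> {x. \<exists>c. (x, c) \<in> A}" by auto
  qed
  finally show ?thesis .
qed

lemma borel_face_index:
  fixes N :: "nat set"
  assumes "finite N"
  shows "{G :: nat \<Rightarrow>\<^sub>0 'a::euclidean_space. face_index UNIV (lk G) N J} \<in> sets borel"
proof (cases "J \<subseteq> N")
  case True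
  \<comment> \<open>After scaling the functional, the strict inequalities become bounds by \<open>-1\<close>, which are closed.\<close>
  define A where "A = {q :: (nat \<Rightarrow>\<^sub>0 'a) \<times> ('a \<Rightarrow> real). (\<forall>b\<in>-Basis. snd q b = 0) \<and>
     (\<forall>i\<in>J. \<forall>j\<in>J. (\<Sum>b\<in>Basis. snd q b *\<^sub>R b) \<bullet> (lk (fst q) i - lk (fst q) j) = 0) \<and>
     (\<forall>i\<in>N - J. \<forall>j\<in>J. (\<Sum>b\<in>Basis. snd q b *\<^sub>R b) \<bullet> (lk (fst q) i - lk (fst q) j) \<le> - 1)}"
  have "closed A" unfolding A_def by (intro closed_events)
  then have "{x. \<exists>c. (x, c) \<in> A} \<in> sets borel"
    by (intro borel_Ex_finite_support[of Basis]) (auto simp: A_def)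
  also have "{x. \<exists>c. (x, c) \<in> A} = {G. face_index UNIV (lk G) N J}" (is "_ = ?R")
  proof (intro set_eqI iffI)
    fix x assume "x \<in> {x. \<exists>c. (x, c) \<in> A}"
    then obtain c where c: "(x, c) \<in> A" by auto
    let ?u = "\<Sum>b\<in>Basis. c b *\<^sub>R b"
    have "\<forall>i\<in>J. \<forall>j\<in>J. ?u \<bullet> (lk x i - lk x j) = 0" using c unfolding A_def by simp
    moreover have "\<forall>i\<in>N - J. \<forall>j\<in>J. ?u \<bullet> (lk x i - lk x j) < 0"
      using c unfolding A_def by (force simp del: inner_simps)
    ultimately show "x \<in> ?R" using True unfolding face_index_def by blast
  next
    fix x assume "x \<in> ?R"
    then obtain u where u: "\<And>i j. i \<in> J \<Longrightarrow> j \<in> J \<Longrightarrow> u \<bullet> (lk x i - lk x j) = 0"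
      "\<And>i j. i \<in> N - J \<Longrightarrow> j \<in> J \<Longrightarrow> u \<bullet> (lk x i - lk x j) < 0" unfolding face_index_def by blast
    define M where "M = (\<Sum>(i,j)\<in>(N - J) \<times> J. 1 / \<bar>u \<bullet> (lk x i - lk x j)\<bar>)"
    have fin: "finite ((N - J) \<times> J)" using assms True by (meson finite_Diff finite_SigmaI finite_subset)
    have neg: "(M *\<^sub>R u) \<bullet> (lk x i - lk x j) \<le> - 1" if ij: "i \<in> N - J" "j \<in> J" for i j
    proof -
      have un: "u \<bullet> (lk x i - lk x j) < 0" using u(2) ij by auto
      have "(\<lambda>(i,j). 1 / \<bar>u \<bullet> (lk x i - lk x j)\<bar>) (i,j) \<le> M"
        unfolding M_def using ij fin by (intro member_le_sum) auto
      then have "1 / \<bar>u \<bullet> (lk x i - lk x j)\<bar> \<le> M" by simp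
      then have "1 \<le> M * \<bar>u \<bullet> (lk x i - lk x j)\<bar>" using un by (subst (asm) pos_divide_le_eq) auto
      then show ?thesis unfolding abs_of_neg[OF un] inner_scaleR_left by linarith
    qed
    define c where "c b = (if b \<in> Basis then (M *\<^sub>R u) \<bullet> b else 0)" for b
    have s: "(\<Sum>b\<in>Basis. c b *\<^sub>R b) = M *\<^sub>R u"
    proof -
      have "(\<Sum>b\<in>Basis. c b *\<^sub>R b) = (\<Sum>b\<in>Basis. ((M *\<^sub>R u) \<bullet> b) *\<^sub>R b)" by (intro sum.cong) (auto simp: c_def)
      then show ?thesis by (simp only: euclidean_representation)
    qed
    have "(x, c) \<in> A"
      unfolding A_def mem_Collect_eq fst_conv snd_conv s
    proof (intro conjI ballI)
      fix i j assume "i \<in> J" "j \<in> J"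
      then show "(M *\<^sub>R u) \<bullet> (lk x i - lk x j) = 0" using u(1) by (simp only: inner_scaleR_left mult_zero_right)
    next
      fix i j assume "i \<in> N - J" "j \<in> J"
      then show "(M *\<^sub>R u) \<bullet> (lk x i - lk x j) \<le> - 1" by (rule neg)
    qed (simp add: c_def)
    then show "x \<in> {x. \<exists>c. (x, c) \<in> A}" by auto
  qed
  finally show ?thesis .
qed (auto simp: face_index_def)

text \<open>
  Dependence is witnessed by weights bounded away from \<open>0\<close>.
\<close>

lemma borel_affine_indep:
  fixes K :: "nat set"
  assumes "finite K"
  shows "{G :: nat \<Rightarrow>\<^sub>0 'a::{real_inner,second_countable_topology}. affine_indep (lk G) K} \<in> sets borel"
proof -
  define A where "A = {q :: (nat \<Rightarrow>\<^sub>0 'a) \<times> (nat \<Rightarrow> real). (\<forall>i\<in>-K. snd q i = 0) \<and> sum (snd q) K = 0 \<and>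
     (\<Sum>i\<in>K. snd q i *\<^sub>R lk (fst q) i) = 0 \<and> 1 \<le> (\<Sum>i\<in>K. \<bar>snd q i\<bar>)}"
  have "closed A" unfolding A_def by (intro closed_events)
  then have "{x. \<exists>c. (x, c) \<in> A} \<in> sets borel"
    using assms by (intro borel_Ex_finite_support[of K]) (auto simp: A_def)
  also have "{x. \<exists>c. (x, c) \<in> A} = {G. \<not> affine_indep (lk G) K}" (is "_ = ?R")
  proof (intro set_eqI iffI)
    fix x assume "x \<in> {x. \<exists>c. (x, c) \<in> A}"
    then obtain c where c: "(x, c) \<in> A" by auto
    have "\<not> (\<forall>i. c i = 0)"
    proof
      assume "\<forall>i. c i = 0"
      then have "(\<Sum>i\<in>K. \<bar>c i\<bar>) = 0" by simp
      then show False using c by (auto simp: A_def)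
    qed
    then show "x \<in> ?R" using c unfolding affine_indep_def A_def coef_def by auto
  next
    fix x assume "x \<in> ?R"
    then obtain l i where l: "l \<in> coef K K" "(\<Sum>i\<in>K. l i *\<^sub>R lk x i) = 0" "l i \<noteq> 0"
      unfolding affine_indep_def by auto
    define s where "s = (\<Sum>i\<in>K. \<bar>l i\<bar>)"
    have "i \<in> K" using l by (auto simp: coef_def)
    then have "s > 0" unfolding s_def using l assms by (intro sum_pos2[of K i]) auto
    have 1: "(\<Sum>i\<in>K. (l i / s) *\<^sub>R lk x i) = 0"
    proof -
      have "(\<Sum>i\<in>K. (l i / s) *\<^sub>R lk x i) = (1 / s) *\<^sub>R (\<Sum>i\<in>K. l i *\<^sub>R lk x i)"
        by (simp add: scaleR_sum_right)
      then show ?thesis using l by simp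
    qed
    have 2: "(\<Sum>i\<in>K. \<bar>l i / s\<bar>) = 1"
      using \<open>s > 0\<close> by (simp add: s_def[symmetric] sum_divide_distrib[symmetric])
    have "(x, \<lambda>i. l i / s) \<in> A"
      unfolding A_def using l(1) 1 2 by (auto simp: coef_def sum_divide_distrib[symmetric])
    then show "x \<in> {x. \<exists>c. (x, c) \<in> A}" by auto
  qed
  finally have "- {G :: nat \<Rightarrow>\<^sub>0 'a. \<not> affine_indep (lk G) K} \<in> sets borel" by (rule sets.compl_sets[where M=borel, unfolded space_borel, folded Compl_eq_Diff_UNIV])
  then show ?thesis by (simp add: Collect_neg_eq[symmetric])
qed

section \<open>Gaussian matrices\<close>

text \<open>
  A point configuration in \<open>'a\<close> is an element of the tensor product of the finitely supported
  sequences and \<open>'a\<close>; this is the elementary tensor of \<open>h\<close> and \<open>b\<close>, with \<open>i\<close>-th point \<open>lk h i *\<^sub>R b\<close>.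
\<close>

definition tens :: "(nat \<Rightarrow>\<^sub>0 real) \<Rightarrow> 'a::real_inner \<Rightarrow> (nat \<Rightarrow>\<^sub>0 'a)" where
  "tens h b = (\<Sum>i\<in>Poly_Mapping.keys h. Poly_Mapping.single i (lk h i *\<^sub>R b))"

definition tensors :: "(nat \<Rightarrow>\<^sub>0 real) set \<Rightarrow> 'a::real_inner set \<Rightarrow> (nat \<Rightarrow>\<^sub>0 'a) set" where
  "tensors H B = (\<lambda>(h, b). tens h b) ` (H \<times> B)"

definition unitv :: "nat set \<Rightarrow> (nat \<Rightarrow>\<^sub>0 real) set" where
  "unitv N = (\<lambda>i. Poly_Mapping.single i 1) ` N"

lemma lookup_tens [simp]: "lk (tens h b) i = lk h i *\<^sub>R b"
  unfolding tens_def lookup_sum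
  by (cases "i \<in> Poly_Mapping.keys h") (auto simp: lookup_single when_def in_keys_iff)

lemma inner_lookup_superset:
  fixes p q :: "'i \<Rightarrow>\<^sub>0 'a::real_inner"
  assumes "finite A" "Poly_Mapping.keys p \<subseteq> A"
  shows "p \<bullet> q = (\<Sum>k\<in>A. lk p k \<bullet> lk q k)"
  using assms by (intro inner_poly_mapping_superset) auto

lemma inner_tens: "tens h b \<bullet> tens h' b' = (h \<bullet> h') * (b \<bullet> b')"
proof -
  let ?A = "Poly_Mapping.keys h"
  have k: "Poly_Mapping.keys (tens h b) \<subseteq> ?A" by (auto simp: in_keys_iff)
  have "tens h b \<bullet> tens h' b' = (\<Sum>k\<in>?A. lk (tens h b) k \<bullet> lk (tens h' b') k)"
    by (rule inner_lookup_superset[OF _ k]) simp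
  also have "\<dots> = (\<Sum>k\<in>?A. (lk h k \<bullet> lk h' k) * (b \<bullet> b'))" by (intro sum.cong) auto
  also have "\<dots> = (h \<bullet> h') * (b \<bullet> b')"
    by (subst inner_lookup_superset[of ?A h h']) (auto simp: sum_distrib_right)
  finally show ?thesis .
qed

lemma tens_add_left: "tens (h + h') b = tens h b + tens h' b"
  and tens_scale_left: "tens (t *\<^sub>R h) b = t *\<^sub>R tens h b"
  and tens_add_right: "tens h (b + b') = tens h b + tens h b'"
  and tens_scale_right: "tens h (t *\<^sub>R b) = t *\<^sub>R tens h b"
  and tens_zero_left [simp]: "tens 0 b = 0" and tens_zero_right [simp]: "tens h 0 = 0"
  by (auto intro!: poly_mapping_eqI simp: lookup_add scaleR_left_distrib scaleR_right_distrib)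

lemma orthonormal_unitv: "finite N \<Longrightarrow> orthonormal (unitv N)"
proof -
  have "Poly_Mapping.single i (1::real) \<bullet> Poly_Mapping.single j 1 = (if i = j then 1 else 0)" for i j :: nat
    by (subst inner_lookup_superset[of "{i}"]) (auto simp: lookup_single when_def)
  moreover have "Poly_Mapping.single i (1::real) = Poly_Mapping.single j 1 \<longleftrightarrow> i = j" for i j :: nat
    by (metis lookup_single_eq lookup_single_not_eq zero_neq_one)
  ultimately show "finite N \<Longrightarrow> orthonormal (unitv N)"
    unfolding orthonormal_def unitv_def by auto
qed

lemma span_unitv:
  assumes "finite N"
  shows "span (unitv N) = {v. Poly_Mapping.keys v \<subseteq> N}"
proof (rule subset_antisym)
  have "subspace {v :: nat \<Rightarrow>\<^sub>0 real. Poly_Mapping.keys v \<subseteq> N}"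
    by (rule subspaceI) (auto simp: in_keys_iff lookup_add subset_iff, metis add_0)
  then show "span (unitv N) \<subseteq> {v. Poly_Mapping.keys v \<subseteq> N}"
    by (rule span_minimal[rotated]) (auto simp: unitv_def)
  show "{v. Poly_Mapping.keys v \<subseteq> N} \<subseteq> span (unitv N)"
  proof clarify
    fix v :: "nat \<Rightarrow>\<^sub>0 real" assume v: "Poly_Mapping.keys v \<subseteq> N"
    have "v = (\<Sum>i\<in>N. lk v i *\<^sub>R Poly_Mapping.single i 1)"
    proof -
      have "Poly_Mapping.single i (lk v i) = lk v i *\<^sub>R Poly_Mapping.single i 1" for i
        by (rule poly_mapping_eqI) (simp add: lookup_single when_def)
      then show ?thesis using poly_mapping_sum_single[OF assms v] by simp
    qed
    also have "\<dots> \<in> span (unitv N)"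
      by (auto simp: unitv_def intro!: span_sum span_scale intro: span_base)
    finally show "v \<in> span (unitv N)" .
  qed
qed

lemma card_unitv: "card (unitv N) = card N"
  unfolding unitv_def by (intro card_image inj_onI) (metis lookup_single_eq lookup_single_not_eq zero_neq_one)

lemma orthonormal_tensors:
  assumes "orthonormal H" "orthonormal B"
  shows "orthonormal (tensors H B)" and "inj_on (\<lambda>(h, b). tens h b) (H \<times> B)"
proof -
  have e: "tens h b \<bullet> tens h' b' = (if h = h' \<and> b = b' then 1 else 0)"
    if "h \<in> H" "h' \<in> H" "b \<in> B" "b' \<in> B" for h h' b b'
    using that assms by (simp add: inner_tens orthonormal_inner)
  show inj: "inj_on (\<lambda>(h, b). tens h b) (H \<times> B)"
  proof (rule inj_onI, clarify)
    fix h b h' b' assume a: "h \<in> H" "b \<in> B" "h' \<in> H" "b' \<in> B" "tens h b = tens h' b'"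
    have "tens h b \<bullet> tens h' b' = 1" using e[of h h b b] a by simp
    then show "h = h' \<and> b = b'" using e[of h h' b b'] a by (simp split: if_splits)
  qed
  show "orthonormal (tensors H B)"
    unfolding orthonormal_def
  proof (intro conjI ballI)
    show "finite (tensors H B)" using assms by (auto simp: tensors_def orthonormal_finite)
    fix p q assume "p \<in> tensors H B" "q \<in> tensors H B"
    then obtain h b h' b' where pq: "p = tens h b" "h \<in> H" "b \<in> B" "q = tens h' b'" "h' \<in> H" "b' \<in> B"
      by (auto simp: tensors_def)
    have "p = q \<longleftrightarrow> h = h' \<and> b = b'" using inj pq by (auto simp: inj_on_def)
    then show "p \<bullet> q = (if p = q then 1 else 0)" using e pq by simp
  qed
qed

lemma tens_in_span:
  assumes "h \<in> span H" "b \<in> span B"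
  shows "tens h b \<in> span (tensors H B)"
  using assms(1)
proof (induction rule: span_induct)
  case base
  show ?case
    by (rule subspaceI) (auto simp: tens_add_left tens_scale_left intro: span_zero span_add span_scale)
next
  case (step h)
  from assms(2) show ?case
  proof (induction rule: span_induct)
    case base
    show ?case
      by (rule subspaceI) (auto simp: tens_add_right tens_scale_right intro: span_zero span_add span_scale)
  next
    case (step b)
    then show ?case using \<open>h \<in> H\<close> by (auto simp: tensors_def intro!: span_base)
  qed
qed

lemma span_tensors_cong:
  assumes "span H = span H'" "span B = span B'"
  shows "span (tensors H B) = span (tensors H' B')"
proof -
  have "tensors H B \<subseteq> span (tensors H' B')" if "span H = span H'" "span B = span B'" for H B H' and B' :: "'a set"
  proof -
    have "h \<in> span H'" "b \<in> span B'" if "h \<in> H" "b \<in> B" for h b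
      using that \<open>span H = span H'\<close> \<open>span B = span B'\<close> span_base by blast+
    then have "tens h b \<in> span (tensors H' B')" if "h \<in> H" "b \<in> B" for h b
      using that by (intro tens_in_span) blast+
    then show ?thesis unfolding tensors_def[of H B] by auto
  qed
  from this[OF assms] this[OF assms(1)[symmetric] assms(2)[symmetric]] show ?thesis
    by (metis span_minimal subspace_span subset_antisym)
qed

lemma tensors_Un: "tensors (H \<union> H') B = tensors H B \<union> tensors H' B" "tensors H (B \<union> B') = tensors H B \<union> tensors H B'"
  by (auto simp: tensors_def)

lemma tensors_disjoint:
  assumes "orthonormal (H \<union> H')" "orthonormal (B \<union> B')" "H \<inter> H' = {} \<or> B \<inter> B' = {}"
  shows "tensors H B \<inter> tensors H' B' = {}"
proof -
  have "inj_on (\<lambda>(h, b). tens h b) ((H \<union> H') \<times> (B \<union> B'))" using assms by (intro orthonormal_tensors)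
  then show ?thesis
    unfolding tensors_def using assms(3) by (auto simp: inj_on_def) blast+
qed

text \<open>
  The law of independent standard Gaussian points in \<open>span B\<close>, indexed by \<open>N\<close>. It is a Gaussian measure on
  the tensor product, so that it may be written in any pair of orthonormal bases of the factors.
\<close>

abbreviation gauss_points :: "nat set \<Rightarrow> 'a::{real_inner,second_countable_topology} set \<Rightarrow> (nat \<Rightarrow>\<^sub>0 'a) measure" where
  "gauss_points N B \<equiv> gauss (tensors (unitv N) B)"

lemma gauss_points_cong:
  assumes "finite N" "orthonormal H" "span H = span (unitv N)" "orthonormal B" "orthonormal B'" "span B = span B'"
  shows "gauss_points N B = gauss (tensors H B')"
  using assms by (intro gauss_cong_span orthonormal_tensors orthonormal_unitv span_tensors_cong) auto

lemma span_tensors_lookup: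
  assumes "G \<in> span (tensors H B)"
  shows "lk G i \<in> span B"
  using assms
proof (induction rule: span_induct)
  case base
  show ?case by (rule subspaceI) (auto simp: lookup_add intro: span_zero span_add span_scale)
next
  case (step G)
  then show ?case by (auto simp: tensors_def intro!: span_scale intro: span_base)
qed

lemma span_tensors_functional:
  fixes G :: "nat \<Rightarrow>\<^sub>0 'a::real_inner"
  assumes "G \<in> span (tensors H B)" "\<And>h. h \<in> H \<Longrightarrow> (\<Sum>i\<in>S. c i * lk h i) = 0"
  shows "(\<Sum>i\<in>S. c i *\<^sub>R lk G i) = 0"
  using assms(1)
proof (induction rule: span_induct)
  case base
  show ?case
  proof (rule subspaceI)
    fix p q :: "nat \<Rightarrow>\<^sub>0 'a" assume "p \<in> Collect (\<lambda>G. (\<Sum>i\<in>S. c i *\<^sub>R lk G i) = 0)" "q \<in> Collect (\<lambda>G. (\<Sum>i\<in>S. c i *\<^sub>R lk G i) = 0)"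
    then show "p + q \<in> Collect (\<lambda>G. (\<Sum>i\<in>S. c i *\<^sub>R lk G i) = 0)"
      by (simp add: lookup_add scaleR_right_distrib sum.distrib)
  next
    fix t and p :: "nat \<Rightarrow>\<^sub>0 'a" assume "p \<in> Collect (\<lambda>G. (\<Sum>i\<in>S. c i *\<^sub>R lk G i) = 0)"
    moreover have "(\<Sum>i\<in>S. c i *\<^sub>R lk (t *\<^sub>R p) i) = t *\<^sub>R (\<Sum>i\<in>S. c i *\<^sub>R lk p i)"
      by (simp add: scaleR_sum_right mult.commute)
    ultimately show "t *\<^sub>R p \<in> Collect (\<lambda>G. (\<Sum>i\<in>S. c i *\<^sub>R lk G i) = 0)" by simp
  qed simp
next
  case (step G)
  then obtain h b where "G = tens h b" "h \<in> H" by (auto simp: tensors_def)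
  then show ?case using assms(2)[of h] by (simp add: scaleR_sum_left[symmetric])
qed

lemma span_tensors_lookup_eq_0:
  assumes "G \<in> span (tensors H B)" "\<And>h. h \<in> H \<Longrightarrow> lk h i = 0"
  shows "lk G i = 0"
  using span_tensors_functional[OF assms(1), where S="{i}" and c="\<lambda>_. 1"] assms(2) by simp

lemma AE_gauss_points_span:
  assumes "finite N" "orthonormal B"
  shows "AE G in gauss_points N B. (\<forall>i. lk G i \<in> span B) \<and> (\<forall>i. i \<notin> N \<longrightarrow> lk G i = 0)"
  using AE_gauss_span[OF orthonormal_tensors(1)[OF orthonormal_unitv[OF assms(1)] assms(2)]]
proof eventually_elim
  case (elim G)
  then show ?case
    by (auto intro: span_tensors_lookup span_tensors_lookup_eq_0 simp: unitv_def lookup_single when_def)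
qed

lemma affine_indep_insert:
  fixes x :: "'i \<Rightarrow> 'a::real_vector"
  assumes "affine_indep x K" "finite K" "i \<notin> K" "j \<in> K" "x i - x j \<notin> icone x K K"
  shows "affine_indep x (insert i K)"
  unfolding affine_indep_def
proof (intro ballI impI allI)
  fix l k assume l: "l \<in> coef (insert i K) (insert i K)" "(\<Sum>i\<in>insert i K. l i *\<^sub>R x i) = 0"
  have s: "l i + sum l K = 0" "l i *\<^sub>R x i + (\<Sum>i\<in>K. l i *\<^sub>R x i) = 0"
    using l assms by (auto simp: coef_def)
  have sup: "l k = 0" if "k \<notin> insert i K" for k using l(1) that by (auto simp: coef_def)
  have "l i = 0"
  proof (rule ccontr)
    assume li: "l i \<noteq> 0"
    define m where "m k = (if k \<in> K then (if k = j then - 1 else 0) - l k / l i else 0)" for k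
    have sumK: "(\<Sum>k\<in>K. m k *\<^sub>R f k) = - f j - (1 / l i) *\<^sub>R (\<Sum>k\<in>K. l k *\<^sub>R f k)" for f :: "'i \<Rightarrow> 'b::real_vector"
    proof -
      have "(\<Sum>k\<in>K. m k *\<^sub>R f k) = (\<Sum>k\<in>K. (if k = j then - f j else 0) - (1 / l i) *\<^sub>R (l k *\<^sub>R f k))"
        by (intro sum.cong) (auto simp: m_def scaleR_left_diff_distrib)
      also have "\<dots> = - f j - (1 / l i) *\<^sub>R (\<Sum>k\<in>K. l k *\<^sub>R f k)"
        using assms by (simp add: sum_subtractf scaleR_sum_right)
      finally show ?thesis .
    qed
    have "sum m K = 0"
    proof -
      have "sum m K = - 1 - (1 / l i) * sum l K" using sumK[of "\<lambda>_. 1::real"] by simp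
      also have "sum l K = - l i" using s by simp
      finally show ?thesis using li by simp
    qed
    moreover have "(\<Sum>k\<in>K. m k *\<^sub>R x k) = x i - x j"
    proof -
      have "(\<Sum>i\<in>K. l i *\<^sub>R x i) = - (l i *\<^sub>R x i)" using s(2) by (simp add: eq_neg_iff_add_eq_0 add.commute)
      then show ?thesis using li by (simp add: sumK)
    qed
    ultimately have "x i - x j \<in> icone x K K"
      by (intro iconeI[of m]) (auto simp: coef_def m_def)
    then show False using assms by simp
  qed
  moreover have "l k = 0" if "k \<notin> K" for k using that sup \<open>l i = 0\<close> by (cases "k = i") auto
  ultimately have "l \<in> coef K K" "(\<Sum>i\<in>K. l i *\<^sub>R x i) = 0" using s by (auto simp: coef_def)
  from aindD[OF assms(1) this] show "l k = 0" .
qed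

lemma affine_indep_insert_notin:
  fixes x :: "'i \<Rightarrow> 'a::real_vector"
  assumes "affine_indep x (insert i K)" "finite K" "i \<notin> K" "j \<in> K"
  shows "x i - x j \<notin> icone x K K"
proof
  assume "x i - x j \<in> icone x K K"
  then obtain l where l: "l \<in> coef K K" "x i - x j = (\<Sum>k\<in>K. l k *\<^sub>R x k)" by (auto simp: icone_def)
  define m where "m k = (if k = i then 1 else 0) - (if k = j then 1 else 0) - l k" for k
  have mi: "m i = 1" using l assms by (auto simp: m_def coef_def)
  have mK: "(\<Sum>k\<in>K. m k *\<^sub>R f k) = - f j - (\<Sum>k\<in>K. l k *\<^sub>R f k)" for f :: "'i \<Rightarrow> 'b::real_vector"
  proof -
    have "(\<Sum>k\<in>K. m k *\<^sub>R f k) = (\<Sum>k\<in>K. (if k = j then - f j else 0) - l k *\<^sub>R f k)"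
      using assms by (intro sum.cong) (auto simp: m_def scaleR_left_diff_distrib)
    then show ?thesis using assms by (simp add: sum_subtractf)
  qed
  have "sum m K = - 1" using mK[of "\<lambda>_. 1::real"] l by (simp add: coef_def)
  then have "m \<in> coef (insert i K) (insert i K)"
    using assms mi l by (auto simp: coef_def m_def)
  moreover have "(\<Sum>k\<in>insert i K. m k *\<^sub>R x k) = 0"
    using assms mi mK[of x] l(2)[symmetric] by simp
  ultimately have "m i = 0" by (rule aindD[OF assms(1)])
  then show False using mi by simp
qed

lemma icone_cong: "(\<And>i. i \<in> J \<Longrightarrow> x i = y i) \<Longrightarrow> icone x I J = icone y I J"
  unfolding icone_def by (metis (no_types, lifting) sum.cong)

lemma affine_indep_single: "affine_indep x {i}"
  unfolding affine_indep_def coef_def by auto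

text \<open>
  Add one point at a time: given at most \<open>card B\<close> points, the next one avoids a hyperplane that contains
  them.
\<close>

lemma AE_gauss_points_affine_indep:
  fixes B :: "'a::{real_inner,second_countable_topology} set"
  assumes "finite N" "orthonormal B" "K \<subseteq> N" "card K \<le> card B + 1"
  shows "AE G in gauss_points N B. affine_indep (lk G) K"
proof -
  have "finite K" using assms finite_subset by blast
  then show ?thesis using assms(3,4)
  proof (induction K)
    case empty
    then show ?case by (auto simp: affine_indep_def coef_def)
  next
    case (insert i K)
    show ?case
    proof (cases "K = {}")
      case True
      then show ?thesis by (simp add: affine_indep_single)
    next
      case False
      then obtain j where j: "j \<in> K" by auto
      have iN: "i \<in> N" "K \<subseteq> N - {i}" using insert by auto
      have IH: "AE G in gauss_points N B. affine_indep (lk G) K" using insert by auto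
      let ?A = "tensors (unitv (N - {i})) B" and ?C = "tensors (unitv {i}) B"
      have uN: "unitv N = unitv (N - {i}) \<union> unitv {i}" using iN by (auto simp: unitv_def)
      have dj: "unitv (N - {i}) \<inter> unitv {i} = {}"
        unfolding unitv_def by (auto) (metis lookup_single_eq lookup_single_not_eq zero_neq_one)
      have "orthonormal (unitv (N - {i}) \<union> unitv {i})" using orthonormal_unitv[OF assms(1)] uN by simp
      then have "?A \<inter> ?C = {}" using assms(2) dj by (intro tensors_disjoint) auto
      then have on: "orthonormal ?A" "orthonormal ?C" "?A \<inter> ?C = {}"
        using assms by (auto intro!: orthonormal_tensors orthonormal_unitv)
      have "AE G in gauss (?A \<union> ?C). lk G i - lk G j \<notin> icone (lk G) K K"
      proof (rule AE_gauss_Un)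
        show "Measurable.pred borel (\<lambda>G::nat \<Rightarrow>\<^sub>0 'a. lk G i - lk G j \<notin> icone (lk G) K K)"
        proof -
          have "(\<lambda>G::nat \<Rightarrow>\<^sub>0 'a. (G, lk G i - lk G j)) \<in> measurable borel borel"
            unfolding borel_prod[symmetric] by measurable
          from measurable_sets[OF this borel_mem_icone[OF insert.hyps(1), of K]]
          have "{G::nat \<Rightarrow>\<^sub>0 'a. lk G i - lk G j \<in> icone (lk G) K K} \<in> sets borel"
            by (simp add: vimage_def)
          then show ?thesis unfolding pred_def by (auto simp: Collect_neg_eq)
        qed
        show "AE G1 in gauss ?A. AE G2 in gauss ?C. lk (G1 + G2) i - lk (G1 + G2) j \<notin> icone (lk (G1 + G2)) K K"
          using AE_gauss_span[OF on(1)]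
        proof eventually_elim
          case (elim G1)
          have fK: "finite K" by fact
          have "card K \<le> card B" using insert by simp
          \<comment> \<open>A hyperplane through the previous points; the new point avoids it.\<close>
          then obtain v where v: "v \<in> span B" "v \<noteq> 0" "\<And>a b. a \<in> K \<Longrightarrow> b \<in> K \<Longrightarrow> v \<bullet> (lk G1 a - lk G1 b) = 0"
            using exists_normal_to_lin[OF assms(2) fK False, of "lk G1"] span_tensors_lookup[OF elim] by metis
          let ?t = "tens (Poly_Mapping.single i 1) v"
          have "?t \<in> span ?C" using v by (intro tens_in_span) (auto simp: unitv_def span_base)
          moreover have "?t \<noteq> 0"
          proof
            assume "?t = 0"
            then have "lk ?t i = 0" by simp
            then show False using v by simp
          qed
          ultimately have "AE G2 in gauss ?C. G2 \<bullet> ?t \<noteq> v \<bullet> lk G1 j"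
            using on by (intro AE_gauss_hyperplane) auto
          with AE_gauss_span[OF on(2)] show ?case
          proof eventually_elim
            case (elim G2)
            have g1: "lk G1 i = 0"
              using \<open>G1 \<in> span ?A\<close> by (rule span_tensors_lookup_eq_0) (auto simp: unitv_def lookup_single when_def split: if_splits)
            have g2: "lk G2 k = 0" if "k \<noteq> i" for k
              using elim(1) by (rule span_tensors_lookup_eq_0) (use that in \<open>auto simp: unitv_def lookup_single when_def\<close>)
            have ic: "icone (lk (G1 + G2)) K K = icone (lk G1) K K"
            proof (intro icone_cong)
              fix a assume "a \<in> K"
              then have "a \<noteq> i" using insert.hyps by auto
              then show "lk (G1 + G2) a = lk G1 a" using g2 by (simp add: lookup_add)
            qed
            have "?t \<bullet> G2 = (\<Sum>k\<in>{i}. lk ?t k \<bullet> lk G2 k)"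
            proof (rule inner_lookup_superset)
              show "Poly_Mapping.keys ?t \<subseteq> {i}"
              proof
                fix k assume "k \<in> Poly_Mapping.keys ?t"
                then have "lk ?t k \<noteq> 0" by (simp add: in_keys_iff)
                then show "k \<in> {i}" by (cases "k = i") (auto simp: lookup_single)
              qed
            qed simp
            then have t: "G2 \<bullet> ?t = v \<bullet> lk G2 i" by (simp add: inner_commute)
            have "j \<noteq> i" using j insert.hyps(2) by metis
            then have "v \<bullet> (lk (G1 + G2) i - lk (G1 + G2) j) = v \<bullet> lk G2 i - v \<bullet> lk G1 j"
              using g1 g2 by (simp add: lookup_add inner_diff_right)
            then have "v \<bullet> (lk (G1 + G2) i - lk (G1 + G2) j) \<noteq> 0"
              using elim(2) unfolding t by simp
            moreover have "v \<bullet> (lk (G1 + G2) i - lk (G1 + G2) j) = 0"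
              if "lk (G1 + G2) i - lk (G1 + G2) j \<in> icone (lk G1) K K"
              by (rule lin_orthogonal[OF _ that]) (rule v(3))
            ultimately show ?case unfolding ic by argo
          qed
        qed
      qed (rule orthonormal_finite[OF on(1)] orthonormal_finite[OF on(2)] on(3))+
      then have "AE G in gauss_points N B. lk G i - lk G j \<notin> icone (lk G) K K"
        unfolding uN tensors_Un(1) .
      with IH show ?thesis
      proof eventually_elim
        case (elim G)
        then show ?case by (intro affine_indep_insert[OF _ insert.hyps(1,2) j])
      qed
    qed
  qed
qed

lemma AE_gauss_points_general_position:
  fixes B :: "'a::{real_inner,second_countable_topology} set"
  assumes "finite N" "orthonormal B"
  shows "AE G in gauss_points N B. general_position (lk G) N (card B)"
proof -
  have "AE G in gauss_points N B. \<forall>K\<in>{K. K \<subseteq> N \<and> card K \<le> card B + 1}. affine_indep (lk G) K"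
    using assms by (intro AE_finite_allI AE_gauss_points_affine_indep) auto
  then show ?thesis by eventually_elim (auto simp: general_position_def)
qed

text \<open>
  Each condition requires the inner product of \<open>z\<close> with some fixed nonzero vector not to vanish: with a normal
  of \<open>icone x J J\<close>, or with the residual of \<open>x i - x j\<close> on this space.
\<close>

lemma AE_generic_point:
  fixes B :: "'a::{real_inner,second_countable_topology} set" and x :: "nat \<Rightarrow> 'a"
  assumes "finite N" "orthonormal B" "general_position x N (card B)" "\<And>i. i \<in> N \<Longrightarrow> x i \<in> span B"
  shows "AE z in gauss B. generic_point x N (card B) z"
proof -
  have "AE z in gauss B. z \<notin> icone x J J \<and>
     (\<forall>p\<in>icone x J J. (\<forall>i\<in>J. \<forall>j\<in>J. (z - p) \<bullet> (x i - x j) = 0) \<longrightarrow> (\<forall>i\<in>N - J. \<forall>j\<in>J. (z - p) \<bullet> (x i - x j) \<noteq> 0))"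
    if J: "J \<subseteq> N" "J \<noteq> {}" "card J \<le> card B" for J
  proof -
    have fJ: "finite J" using J assms finite_subset by blast
    have xJ: "x i \<in> span B" if "i \<in> J" for i using that J assms by auto
    have lB: "icone x J J \<subseteq> span B" using xJ by (intro icone_subset_subspace) auto
    obtain v where v: "v \<in> span B" "v \<noteq> 0" "\<And>i j. i \<in> J \<Longrightarrow> j \<in> J \<Longrightarrow> v \<bullet> (x i - x j) = 0"
      using exists_normal_to_lin[OF assms(2) fJ J(2,3), of x] xJ by metis
    have 1: "AE z in gauss B. z \<bullet> v \<noteq> 0" using assms v by (intro AE_gauss_hyperplane)
    have "AE z in gauss B. \<forall>p\<in>icone x J J. (\<forall>i\<in>J. \<forall>j\<in>J. (z - p) \<bullet> (x i - x j) = 0) \<longrightarrow> (z - p) \<bullet> (x i - x j) \<noteq> 0"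
      if ij: "i \<in> N - J" "j \<in> J" for i j
    proof -
      have "insert i J \<subseteq> N" "card (insert i J) \<le> card B + 1" using ij J fJ by auto
      then have "affine_indep x (insert i J)" using assms(3) unfolding general_position_def by blast
      then have y: "x i - x j \<notin> icone x J J" using fJ ij by (intro affine_indep_insert_notin) auto
      obtain p0 where p0: "p0 \<in> icone x J J" "polar x J J (x i - x j - p0)"
        using moreau_icone[OF fJ subset_refl] by metis
      define w where "w = x i - x j - p0"
      have w: "w \<in> span B" "w \<noteq> 0"
        using y p0 lB ij J assms(4) xJ by (auto simp: w_def intro!: span_diff)
      have wl: "w \<bullet> p = 0" if "p \<in> icone x J J" for p
        by (rule lin_orthogonal[OF _ that]) (use polar_eq[OF p0(2)] in \<open>auto simp: w_def\<close>)
      have "AE z in gauss B. z \<bullet> w \<noteq> 0" using assms w by (intro AE_gauss_hyperplane)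
      then show ?thesis
      proof eventually_elim
        case (elim z)
        show ?case
        proof (intro ballI impI)
          fix p assume p: "p \<in> icone x J J" "\<forall>i\<in>J. \<forall>j\<in>J. (z - p) \<bullet> (x i - x j) = 0"
          have "(z - p) \<bullet> p0 = 0" by (rule lin_orthogonal[OF _ p0(1)]) (use p in blast)
          then have "(z - p) \<bullet> (x i - x j) = (z - p) \<bullet> w" by (simp add: w_def inner_diff_right)
          also have "\<dots> = z \<bullet> w" using wl[OF p(1)] by (simp add: inner_diff_left inner_commute[of p])
          finally show "(z - p) \<bullet> (x i - x j) \<noteq> 0" using elim by simp
        qed
      qed
    qed
    then have "AE z in gauss B. \<forall>(i,j)\<in>(N - J) \<times> J. \<forall>p\<in>icone x J J. (\<forall>i\<in>J. \<forall>j\<in>J. (z - p) \<bullet> (x i - x j) = 0) \<longrightarrow> (z - p) \<bullet> (x i - x j) \<noteq> 0"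
      using assms(1) fJ by (intro AE_finite_allI) auto
    with 1 show ?thesis
    proof eventually_elim
      case (elim z)
      have "z \<notin> icone x J J" using elim(1) lin_orthogonal[of J v x z] v(3) by (auto simp: inner_commute)
      then show ?case using elim(2) by blast
    qed
  qed
  then have "AE z in gauss B. \<forall>J\<in>{J. J \<subseteq> N \<and> J \<noteq> {} \<and> card J \<le> card B}. z \<notin> icone x J J \<and>
     (\<forall>p\<in>icone x J J. (\<forall>i\<in>J. \<forall>j\<in>J. (z - p) \<bullet> (x i - x j) = 0) \<longrightarrow> (\<forall>i\<in>N - J. \<forall>j\<in>J. (z - p) \<bullet> (x i - x j) \<noteq> 0))"
    using assms(1) by (intro AE_finite_allI) auto
  then show ?thesis by eventually_elim (auto simp: generic_point_def)
qed

lemma polar_cong: "J \<subseteq> N \<Longrightarrow> (\<And>i. i \<in> N \<Longrightarrow> x i = y i) \<Longrightarrow> polar x J N w = polar y J N w"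
  unfolding polar_def by (intro ball_cong refl) (simp add: subset_iff)

lemma kkt_cong: "J \<subseteq> N \<Longrightarrow> (\<And>i. i \<in> N \<Longrightarrow> x i = y i) \<Longrightarrow> kkt x I J N z = kkt y I J N z"
proof -
  assume a: "J \<subseteq> N" "\<And>i. i \<in> N \<Longrightarrow> x i = y i"
  have "icone x I J = icone y I J" using a by (intro icone_cong) auto
  then show ?thesis unfolding kkt_def by (simp only: polar_cong[OF a])
qed

lemma lookup_of_points: "finite N \<Longrightarrow> i \<in> N \<Longrightarrow> lk (\<Sum>i\<in>N. Poly_Mapping.single i (x i)) i = x i"
  by (simp add: lookup_sum lookup_single when_def)

lemma borel_icone:
  fixes x :: "nat \<Rightarrow> 'a::{real_inner,second_countable_topology}"
  assumes "finite J"
  shows "icone x I J \<in> sets borel"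
proof -
  let ?G = "\<Sum>i\<in>J. Poly_Mapping.single i (x i)"
  have "{p :: (nat \<Rightarrow>\<^sub>0 'a) \<times> 'a. snd p \<in> icone (lk (fst p)) I J} \<in> sets (borel \<Otimes>\<^sub>M borel)"
    unfolding borel_prod by (rule borel_mem_icone[OF assms])
  from sets_Pair1[OF this, of ?G] have "icone (lk ?G) I J \<in> sets borel" by (simp add: vimage_def)
  moreover have "icone (lk ?G) I J = icone x I J"
    using assms by (intro icone_cong) (simp add: lookup_of_points)
  ultimately show ?thesis by simp
qed

lemma borel_kkt_slice:
  fixes x :: "nat \<Rightarrow> 'a::{real_inner,second_countable_topology}"
  assumes "finite N" "J \<subseteq> N"
  shows "{z. kkt x I J N z} \<in> sets borel"
proof -
  let ?G = "\<Sum>i\<in>N. Poly_Mapping.single i (x i)"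
  have "{p :: (nat \<Rightarrow>\<^sub>0 'a) \<times> 'a. kkt (lk (fst p)) I J N (snd p)} \<in> sets (borel \<Otimes>\<^sub>M borel)"
    unfolding borel_prod by (rule borel_kkt[OF finite_subset[OF assms(2,1)]])
  from sets_Pair1[OF this, of ?G] have "{z. kkt (lk ?G) I J N z} \<in> sets borel" by (simp add: vimage_def)
  moreover have "kkt (lk ?G) I J N z = kkt x I J N z" for z
    using assms by (intro kkt_cong) (simp_all add: lookup_of_points)
  ultimately show ?thesis by simp
qed

lemma borel_polar_cone:
  fixes B :: "'a::{real_inner,second_countable_topology} set"
  assumes "orthonormal B"
  shows "{w \<in> span B. polar x J N w} \<in> sets borel"
proof -
  have "closed {w :: 'a. \<forall>i\<in>N. \<forall>j\<in>J. w \<bullet> (x i - x j) \<le> 0}" by (intro closed_events)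
  then have "span B \<inter> {w. polar x J N w} \<in> sets borel"
    unfolding polar_def using assms by (intro sets.Int sets_span borel_closed)
  then show ?thesis by (simp add: Int_def)
qed

lemma scone_polar_cone: "scone {w \<in> span B. polar x J N w}"
  unfolding scone_def polar_def
  by (auto simp: span_zero span_scale mult_nonneg_nonpos inner_scaleR_left simp del: inner_diff_right)

text \<open>
  The functional that exposes the face \<open>J\<close> is in the relative interior of the normal cone: every \<open>v \<in> V\<close>
  is a difference of elements of the cone after adding a large multiple of it.
\<close>

lemma span_polar_cone:
  assumes N: "finite N" and f: "face_index (span B) x N J" "J \<noteq> {}"
    and ch: "\<And>v. v \<in> span B \<Longrightarrow> (\<forall>i\<in>J. \<forall>j\<in>J. v \<bullet> (x i - x j) = 0) \<longleftrightarrow> v \<in> V" and V: "subspace V" "V \<subseteq> span B"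
  shows "span {w \<in> span B. polar x J N w} = V"
proof (rule subset_antisym)
  have JN: "J \<subseteq> N" using f by (simp add: face_index_def)
  have "{w \<in> span B. polar x J N w} \<subseteq> V"
    using polar_eq[of x J N] JN ch by blast
  then show "span {w \<in> span B. polar x J N w} \<subseteq> V" using V by (simp add: span_minimal)
  obtain u where u: "u \<in> span B" "\<And>i j. i \<in> J \<Longrightarrow> j \<in> J \<Longrightarrow> u \<bullet> (x i - x j) = 0"
    "\<And>i j. i \<in> N - J \<Longrightarrow> j \<in> J \<Longrightarrow> u \<bullet> (x i - x j) < 0" using f(1) unfolding face_index_def by blast
  have up: "u \<in> {w \<in> span B. polar x J N w}"
    unfolding polar_def using u by (smt (verit) Diff_iff mem_Collect_eq)
  show "V \<subseteq> span {w \<in> span B. polar x J N w}"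
  proof
    fix v assume v: "v \<in> V"
    then have vB: "v \<in> span B" using V by auto
    have v0: "v \<bullet> (x i - x j) = 0" if "i \<in> J" "j \<in> J" for i j using ch[OF vB] v that by blast
    define M where "M = (\<Sum>(i,j)\<in>(N - J) \<times> J. \<bar>v \<bullet> (x i - x j)\<bar> / \<bar>u \<bullet> (x i - x j)\<bar>)"
    have fin: "finite ((N - J) \<times> J)" using N JN by (meson finite_Diff finite_SigmaI finite_subset)
    have neg: "(v + M *\<^sub>R u) \<bullet> (x i - x j) \<le> 0" if ij: "i \<in> N" "j \<in> J" for i j
    proof (cases "i \<in> J")
      case True
      then show ?thesis using v0 u(2) ij by (simp only: inner_add_left inner_scaleR_left mult_zero_right)
    next
      case False
      then have un: "u \<bullet> (x i - x j) < 0" using u(3) ij by auto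
      have "(\<lambda>(i,j). \<bar>v \<bullet> (x i - x j)\<bar> / \<bar>u \<bullet> (x i - x j)\<bar>) (i,j) \<le> M"
        unfolding M_def using ij False fin by (intro member_le_sum) auto
      then have "\<bar>v \<bullet> (x i - x j)\<bar> / \<bar>u \<bullet> (x i - x j)\<bar> \<le> M" by simp
      then have "\<bar>v \<bullet> (x i - x j)\<bar> \<le> M * \<bar>u \<bullet> (x i - x j)\<bar>"
        using un by (subst (asm) pos_divide_le_eq) auto
      then show ?thesis
        unfolding abs_of_neg[OF un] inner_add_left inner_scaleR_left using abs_ge_self[of "v \<bullet> (x i - x j)"] by linarith
    qed
    have "v + M *\<^sub>R u \<in> {w \<in> span B. polar x J N w}"
      using neg vB u(1) unfolding polar_def by (auto intro!: span_add span_scale simp del: inner_simps)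
    then have "v + M *\<^sub>R u \<in> span {w \<in> span B. polar x J N w}" "M *\<^sub>R u \<in> span {w \<in> span B. polar x J N w}"
      using up by (auto intro: span_base span_scale)
    from span_diff[OF this] show "v \<in> span {w \<in> span B. polar x J N w}" by simp
  qed
qed

text \<open>
  The face \<open>icone x I J\<close> and its normal cone span orthogonal complements, so the components of the Gaussian
  vector in them are independent; the projection lies in the face exactly if one component is in the
  face and the other in the normal cone.
\<close>

theorem measure_kkt_split:
  fixes B :: "'a::{real_inner,second_countable_topology} set" and x :: "nat \<Rightarrow> 'a"
  assumes N: "finite N" and B: "orthonormal B" and xB: "\<And>i. i \<in> N \<Longrightarrow> x i \<in> span B"
    and I: "I \<noteq> {}" "I \<subseteq> J" and f: "face_index (span B) x N J"
  shows "measure (gauss B) {z. kkt x I J N z} = solid_angle (icone x I J) * solid_angle {w \<in> span B. polar x J N w}"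
proof -
  have JN: "J \<subseteq> N" using f by (simp add: face_index_def)
  have fJ: "finite J" using JN N finite_subset by blast
  obtain j0 where j0: "j0 \<in> I" using I by auto
  let ?A = "(\<lambda>i. x i - x j0) ` J"
  have spA: "span ?A = icone x J J"
  proof -
    have "?A = insert 0 ((\<lambda>i. x i - x j0) ` (J - {j0}))" using j0 I by auto
    then show ?thesis using lin_eq_span[OF fJ, of j0 x] j0 I by (auto simp: span_insert_0)
  qed
  have "?A \<subseteq> span B" using xB JN j0 I by (auto intro!: span_diff)
  then obtain B1 B2 where BB: "orthonormal (B1 \<union> B2)" "B1 \<inter> B2 = {}" "span B1 = span ?A"
    "span (B1 \<union> B2) = span B" "\<And>v. v \<in> span B \<Longrightarrow> (\<forall>a\<in>?A. v \<bullet> a = 0) \<longleftrightarrow> v \<in> span B2"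
    using orthonormal_complement[OF B, of ?A] fJ by blast
  have o12: "orthonormal B1" "orthonormal B2" using BB(1) by (auto intro: orthonormal_subset)
  have B2B: "span B2 \<subseteq> span B" "span B1 \<subseteq> span B" using BB(4) span_mono[of B2 "B1 \<union> B2"] span_mono[of B1 "B1 \<union> B2"] by auto
  have ch: "(\<forall>i\<in>J. \<forall>j\<in>J. v \<bullet> (x i - x j) = 0) \<longleftrightarrow> v \<in> span B2" if "v \<in> span B" for v
  proof -
    have "(\<forall>i\<in>J. \<forall>j\<in>J. v \<bullet> (x i - x j) = 0) \<longleftrightarrow> (\<forall>a\<in>?A. v \<bullet> a = 0)"
      using j0 I by (auto simp: inner_diff_right)
    then show ?thesis using BB(5)[OF that] by simp
  qed
  let ?N = "{w \<in> span B. polar x J N w}"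
  have spN: "span ?N = span B2"
    using N f I j0 by (intro span_polar_cone ch) (use B2B in auto)
  have icl: "icone x I J \<subseteq> icone x J J" using I by (intro icone_mono_left)
  have "emeasure (gauss (B1 \<union> B2)) {z. kkt x I J N z} = emeasure (gauss B1) (icone x I J) * emeasure (gauss B2) ?N"
  proof (rule emeasure_gauss_orthogonal_event[OF o12 BB(2)])
    fix a b assume a: "a \<in> span B1" and b: "b \<in> span B2"
    have al: "a \<in> icone x J J" using a BB(3) spA by simp
    have bB: "b \<in> span B" using b B2B by auto
    have b0: "b \<bullet> (x i - x j) = 0" if "i \<in> J" "j \<in> J" for i j using ch[OF bB] b that by blast
    show "a + b \<in> {z. kkt x I J N z} \<longleftrightarrow> a \<in> icone x I J \<and> b \<in> ?N"
    proof
      assume "a + b \<in> {z. kkt x I J N z}"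
      then obtain p where p: "p \<in> icone x I J" "polar x J N (a + b - p)" by (auto simp: kkt_def)
      have "a - p \<in> icone x J J" using al p icl by (intro subspace_diff[OF subspace_lin]) auto
      then have "(a + b - p) \<bullet> (a - p) = 0" "b \<bullet> (a - p) = 0"
        using lin_orthogonal[of J "a + b - p" x "a - p"] lin_orthogonal[of J b x "a - p"] polar_eq[OF p(2) _ _ JN] b0 by blast+
      then have "(a - p) \<bullet> (a - p) = 0" by (simp add: inner_diff_left inner_add_left)
      then have "p = a" by simp
      then show "a \<in> icone x I J \<and> b \<in> ?N" using p bB by auto
    next
      assume "a \<in> icone x I J \<and> b \<in> ?N"
      then show "a + b \<in> {z. kkt x I J N z}" by (auto simp: kkt_def intro!: bexI[of _ a])
    qed
  qed (use N JN fJ B in \<open>auto intro: borel_kkt_slice borel_icone borel_polar_cone\<close>)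
  moreover have "gauss (B1 \<union> B2) = gauss B" using BB B by (intro gauss_cong_span) auto
  moreover have "solid_angle (icone x I J) = measure (gauss B1) (icone x I J)"
    using fJ j0 I BB(3) spA by (intro solid_angle_gauss o12 scone_icone borel_icone) (auto simp: span_icone)
  moreover have "solid_angle ?N = measure (gauss B2) ?N"
    using spN B by (intro solid_angle_gauss o12 scone_polar_cone borel_polar_cone) auto
  ultimately show ?thesis
    by (simp add: measure_def enn2real_mult)
qed

section \<open>The cones of the regular simplex\<close>

abbreviation ev :: "nat \<Rightarrow> (nat \<Rightarrow>\<^sub>0 real)" where "ev i \<equiv> Poly_Mapping.single i 1"

text \<open>
  The tangent cone of the regular simplex with vertex set \<open>J\<close> at its face \<open>I\<close>; \<open>ncone J N\<close> is the
  normal cone of the simplex with vertex set \<open>N\<close> at \<open>J\<close>, taken within \<open>\<real>\<^sup>N\<close>, so that it contains the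
  line spanned by the all-ones vector.
\<close>

definition tcone :: "nat set \<Rightarrow> nat set \<Rightarrow> (nat \<Rightarrow>\<^sub>0 real) set" where
  "tcone I J = icone ev I J"

definition ncone :: "nat set \<Rightarrow> nat set \<Rightarrow> (nat \<Rightarrow>\<^sub>0 real) set" where
  "ncone J N = {w \<in> span (unitv N). polar ev J N w}"

definition tangent_angle :: "nat set \<Rightarrow> nat set \<Rightarrow> real" where "tangent_angle I J = solid_angle (tcone I J)"
definition normal_angle :: "nat set \<Rightarrow> nat set \<Rightarrow> real" where "normal_angle J N = solid_angle (ncone J N)"

lemma inner_ev: "w \<bullet> ev i = lk w i"
proof -
  have "ev i \<bullet> w = (\<Sum>k\<in>{i}. lk (ev i) k \<bullet> lk w k)" by (rule inner_lookup_superset) auto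
  then show ?thesis by (simp add: inner_commute)
qed

lemma mem_ncone:
  assumes "finite N"
  shows "w \<in> ncone J N \<longleftrightarrow> Poly_Mapping.keys w \<subseteq> N \<and> (\<forall>i\<in>N. \<forall>j\<in>J. lk w i \<le> lk w j)"
  using assms by (auto simp: ncone_def span_unitv polar_def inner_diff_right inner_ev)

lemma ev_in_span: "i \<in> N \<Longrightarrow> ev i \<in> span (unitv N)"
  by (auto simp: unitv_def intro: span_base)

lemma sum_ev_lookup: "finite J \<Longrightarrow> lk (\<Sum>i\<in>J. l i *\<^sub>R ev i) k = (if k \<in> J then l k else 0)"
proof -
  assume "finite J"
  have "lk (\<Sum>i\<in>J. l i *\<^sub>R ev i) k = (\<Sum>i\<in>J. if i = k then l i else 0)"
    unfolding lookup_sum by (intro sum.cong) (auto simp: lookup_single when_def)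
  then show ?thesis using \<open>finite J\<close> by simp
qed

lemma mem_tcone:
  assumes "finite J"
  shows "v \<in> tcone I J \<longleftrightarrow> Poly_Mapping.keys v \<subseteq> J \<and> sum (lk v) J = 0 \<and> (\<forall>i\<in>J - I. lk v i \<ge> 0)"
proof
  assume "v \<in> tcone I J"
  then obtain l where l: "l \<in> coef I J" "v = (\<Sum>i\<in>J. l i *\<^sub>R ev i)" by (auto simp: tcone_def icone_def)
  have lk: "lk v k = l k" for k using l assms by (auto simp: sum_ev_lookup coef_def)
  show "Poly_Mapping.keys v \<subseteq> J \<and> sum (lk v) J = 0 \<and> (\<forall>i\<in>J - I. lk v i \<ge> 0)"
    using l(1) by (auto simp: coef_def in_keys_iff lk)
next
  assume v: "Poly_Mapping.keys v \<subseteq> J \<and> sum (lk v) J = 0 \<and> (\<forall>i\<in>J - I. lk v i \<ge> 0)"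
  then have "lk v \<in> coef I J" by (auto simp: coef_def in_keys_iff)
  moreover have "v = (\<Sum>i\<in>J. lk v i *\<^sub>R ev i)"
    using v assms by (intro poly_mapping_eqI) (auto simp: sum_ev_lookup in_keys_iff)
  ultimately show "v \<in> tcone I J" unfolding tcone_def by (rule iconeI)
qed

lemma affine_indep_ev: "finite K \<Longrightarrow> affine_indep ev K"
  unfolding affine_indep_def
proof (intro ballI impI allI)
  fix l i assume "finite K" "l \<in> coef K K" "(\<Sum>i\<in>K. l i *\<^sub>R ev i) = 0"
  then have "lk (\<Sum>i\<in>K. l i *\<^sub>R ev i) i = 0" by simp
  then show "l i = 0" using \<open>finite K\<close> \<open>l \<in> coef K K\<close> by (auto simp: sum_ev_lookup coef_def split: if_splits)
qed

lemma sum_measure_eq_integral_card: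
  assumes "prob_space M" "finite S" "\<And>J. J \<in> S \<Longrightarrow> A J \<in> sets M"
  shows "(\<Sum>J\<in>S. emeasure M (A J)) = (\<integral>\<^sup>+z. of_nat (card {J\<in>S. z \<in> A J}) \<partial>M)"
proof -
  have "(\<Sum>J\<in>S. emeasure M (A J)) = (\<Sum>J\<in>S. \<integral>\<^sup>+z. indicator (A J) z \<partial>M)" using assms by simp
  also have "\<dots> = (\<integral>\<^sup>+z. (\<Sum>J\<in>S. indicator (A J) z) \<partial>M)"
    using assms by (intro nn_integral_sum[symmetric]) auto
  also have "\<dots> = (\<integral>\<^sup>+z. of_nat (card {J\<in>S. z \<in> A J}) \<partial>M)"
  proof (intro nn_integral_cong)
    fix z
    have "(\<Sum>J\<in>S. indicator (A J) z :: ennreal) = (\<Sum>J\<in>{J\<in>S. z \<in> A J}. 1)"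
      using assms(2) by (intro sum.mono_neutral_cong_right) (auto simp: indicator_def)
    then show "(\<Sum>J\<in>S. indicator (A J) z :: ennreal) = of_nat (card {J\<in>S. z \<in> A J})" by simp
  qed
  finally show ?thesis .
qed

text \<open>
  Integrates \<open>card_kkt\<close>.
\<close>

lemma sum_emeasure_kkt:
  fixes B :: "'a::{real_inner,second_countable_topology} set" and x :: "nat \<Rightarrow> 'a"
  assumes N: "finite N" "I \<subseteq> N" "I \<noteq> {}" and B: "orthonormal B"
    and xB: "\<And>i. i \<in> N \<Longrightarrow> x i \<in> span B" and gp: "general_position x N (card B)"
  shows "(\<Sum>J | I \<subseteq> J \<and> J \<subseteq> N \<and> card J \<le> card B. emeasure (gauss B) {z. kkt x I J N z}) = emeasure (gauss B) (- icone x I N)"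
proof -
  let ?S = "{J. I \<subseteq> J \<and> J \<subseteq> N \<and> card J \<le> card B}"
  have fS: "finite ?S" using N(1) by (rule_tac finite_subset[of _ "Pow N"]) auto
  have "(\<Sum>J\<in>?S. emeasure (gauss B) {z. kkt x I J N z}) = (\<integral>\<^sup>+z. of_nat (card {J\<in>?S. z \<in> {z. kkt x I J N z}}) \<partial>gauss B)"
    using N by (intro sum_measure_eq_integral_card prob_space_gauss fS) (auto intro!: borel_kkt_slice)
  also have "\<dots> = (\<integral>\<^sup>+z. indicator (- icone x I N) z \<partial>gauss B)"
  proof (rule nn_integral_cong_AE)
    show "AE z in gauss B. of_nat (card {J\<in>?S. z \<in> {z. kkt x I J N z}}) = (indicator (- icone x I N) z :: ennreal)"
    proof -
      have "AE z in gauss B. generic_point x N (card B) z" by (rule AE_generic_point[OF N(1) B gp xB])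
      with AE_gauss_span[OF B] show ?thesis
    proof eventually_elim
      case (elim z)
      have "{J\<in>?S. z \<in> {z. kkt x I J N z}} = {J. I \<subseteq> J \<and> J \<subseteq> N \<and> card J \<le> card B \<and> kkt x I J N z}" by auto
      then show ?case
        using card_kkt[OF N B refl _ elim(1) gp elim(2)] xB by (simp add: indicator_def)
    qed
    qed
  qed
  also have "\<dots> = emeasure (gauss B) (- icone x I N)"
    using borel_icone[OF N(1), of x I] by (subst nn_integral_indicator) (auto simp: Compl_eq_Diff_UNIV)
  finally show ?thesis .
qed

text \<open>
  The cone is contained in a hyperplane.
\<close>

lemma AE_notin_icone_small:
  fixes B :: "'a::{real_inner,second_countable_topology} set" and x :: "nat \<Rightarrow> 'a"
  assumes N: "finite N" "I \<subseteq> N" "I \<noteq> {}" "card N \<le> card B" and B: "orthonormal B"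
    and xB: "\<And>i. i \<in> N \<Longrightarrow> x i \<in> span B"
  shows "AE z in gauss B. z \<notin> icone x N N"
proof -
  have "N \<noteq> {}" using N by auto
  then obtain v where v: "v \<in> span B" "v \<noteq> 0" "\<And>i j. i \<in> N \<Longrightarrow> j \<in> N \<Longrightarrow> v \<bullet> (x i - x j) = 0"
    using exists_normal_to_lin[OF B N(1) _ N(4), of x] xB by metis
  have "AE z in gauss B. z \<bullet> v \<noteq> 0" using B v by (intro AE_gauss_hyperplane)
  then show ?thesis
  proof eventually_elim
    case (elim z)
    then show ?case using lin_orthogonal[of N v x z] v(3) by (auto simp: inner_commute)
  qed
qed

lemma sum_emeasure_kkt_small:
  fixes B :: "'a::{real_inner,second_countable_topology} set" and x :: "nat \<Rightarrow> 'a"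
  assumes N: "finite N" "I \<subseteq> N" "I \<noteq> {}" "card N \<le> card B" and B: "orthonormal B"
    and xB: "\<And>i. i \<in> N \<Longrightarrow> x i \<in> span B" and gp: "general_position x N (card B)"
  shows "(\<Sum>J | I \<subseteq> J \<and> J \<subseteq> N. emeasure (gauss B) {z. kkt x I J N z}) = 1"
proof -
  have "{J. I \<subseteq> J \<and> J \<subseteq> N} = {J. I \<subseteq> J \<and> J \<subseteq> N \<and> card J \<le> card B}"
    using N card_mono[OF N(1)] order_trans by blast
  moreover have "emeasure (gauss B) (- icone x I N) = 1"
  proof -
    have "AE z in gauss B. z \<notin> icone x N N" by (rule AE_notin_icone_small[OF N B xB])
    then have "AE z in gauss B. z \<in> - icone x I N"
    proof eventually_elim
      case (elim z)
      then show ?case using icone_mono_left[OF N(2), of x N] by blast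
    qed
    then show ?thesis using borel_icone[OF N(1), of x I] by (intro gauss.emeasure_eq_1_AE) (auto simp: Compl_eq_Diff_UNIV)
  qed
  ultimately show ?thesis using sum_emeasure_kkt[OF N(1-3) B _ gp] xB by simp
qed

text \<open>
  A Gaussian point in \<open>\<real>\<^sup>N\<close> projects into exactly one face of the tangent cone; the simplex has few
  enough points for \<open>card_kkt\<close> to count all \<open>J\<close>, as its cones do not have full dimension.
\<close>

theorem sum_angles_simplex:
  assumes N: "finite N" "I \<subseteq> N" "I \<noteq> {}"
  shows "(\<Sum>J | I \<subseteq> J \<and> J \<subseteq> N. tangent_angle I J * normal_angle J N) = 1"
proof -
  have B: "orthonormal (unitv N)" "card (unitv N) = card N" using N by (auto simp: orthonormal_unitv card_unitv)
  have gp: "general_position ev N (card (unitv N))" unfolding general_position_def using affine_indep_ev N(1) finite_subset by blast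
  have "(\<Sum>J | I \<subseteq> J \<and> J \<subseteq> N. emeasure (gauss (unitv N)) {z. kkt ev I J N z}) = 1"
    using N B gp by (intro sum_emeasure_kkt_small) (auto intro: ev_in_span)
  moreover have "emeasure (gauss (unitv N)) {z. kkt ev I J N z} = ennreal (tangent_angle I J * normal_angle J N)" if "I \<subseteq> J" "J \<subseteq> N" for J
  proof -
    have "face_index (span (unitv N)) ev N J"
      using N that by (intro face_index_simplex) (auto intro: affine_indep_ev ev_in_span)
    then have "measure (gauss (unitv N)) {z. kkt ev I J N z} = tangent_angle I J * normal_angle J N"
      unfolding tangent_angle_def normal_angle_def tcone_def ncone_def using N B that
      by (intro measure_kkt_split) (auto intro: ev_in_span)
    then show ?thesis by (simp add: gauss.emeasure_eq_measure)
  qed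
  ultimately have "(\<Sum>J | I \<subseteq> J \<and> J \<subseteq> N. ennreal (tangent_angle I J * normal_angle J N)) = 1" by simp
  moreover have "0 \<le> tangent_angle I J * normal_angle J N" for J by (simp add: tangent_angle_def normal_angle_def solid_angle_def)
  ultimately show ?thesis by (simp add: sum_ennreal) 
qed

lemma solid_angle_nonneg [simp]: "0 \<le> solid_angle C" by (simp add: solid_angle_def)

text \<open>
  The normal cone of a simplex at itself is a subspace.
\<close>

lemma normal_angle_self:
  assumes "finite J"
  shows "normal_angle J J = 1"
proof -
  have eq: "ncone J J = {w. Poly_Mapping.keys w \<subseteq> J} \<inter> {w. \<forall>i\<in>J. \<forall>j\<in>J. lk w i = lk w j}"
  proof (intro set_eqI)
    fix w :: "nat \<Rightarrow>\<^sub>0 real"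
    have "(\<forall>i\<in>J. \<forall>j\<in>J. lk w i \<le> lk w j) \<longleftrightarrow> (\<forall>i\<in>J. \<forall>j\<in>J. lk w i = lk w j)"
      by (rule iffI) (meson order_antisym, metis order_refl)
    then show "w \<in> ncone J J \<longleftrightarrow> w \<in> {w. Poly_Mapping.keys w \<subseteq> J} \<inter> {w. \<forall>i\<in>J. \<forall>j\<in>J. lk w i = lk w j}"
      by (simp only: mem_ncone[OF assms] Int_iff mem_Collect_eq)
  qed
  have "subspace {w :: nat \<Rightarrow>\<^sub>0 real. Poly_Mapping.keys w \<subseteq> J}"
    unfolding span_unitv[OF assms, symmetric] by (rule subspace_span)
  moreover have "subspace {w :: nat \<Rightarrow>\<^sub>0 real. \<forall>i\<in>J. \<forall>j\<in>J. lk w i = lk w j}"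
  proof (rule subspaceI)
    fix v w :: "nat \<Rightarrow>\<^sub>0 real" assume "v \<in> {w. \<forall>i\<in>J. \<forall>j\<in>J. lk w i = lk w j}" "w \<in> {w. \<forall>i\<in>J. \<forall>j\<in>J. lk w i = lk w j}"
    then have "\<And>i j. i \<in> J \<Longrightarrow> j \<in> J \<Longrightarrow> lk v i = lk v j" "\<And>i j. i \<in> J \<Longrightarrow> j \<in> J \<Longrightarrow> lk w i = lk w j" by blast+
    then show "v + w \<in> {w. \<forall>i\<in>J. \<forall>j\<in>J. lk w i = lk w j}"
      unfolding mem_Collect_eq lookup_add by metis
  next
    fix t and v :: "nat \<Rightarrow>\<^sub>0 real" assume "v \<in> {w. \<forall>i\<in>J. \<forall>j\<in>J. lk w i = lk w j}"
    then have "\<And>i j. i \<in> J \<Longrightarrow> j \<in> J \<Longrightarrow> lk v i = lk v j" by blast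
    then show "t *\<^sub>R v \<in> {w. \<forall>i\<in>J. \<forall>j\<in>J. lk w i = lk w j}"
      unfolding mem_Collect_eq lookup_scaleR by metis
  qed simp
  ultimately have "subspace (ncone J J)" unfolding eq by (rule subspace_inter)
  then show ?thesis by (simp add: normal_angle_def solid_angle_def)
qed

section \<open>Factorization of the projection probability\<close>

text \<open>
  The vector of the inner products of \<open>u\<close> with the points.
\<close>

definition dotm :: "'a::real_inner \<Rightarrow> (nat \<Rightarrow>\<^sub>0 'a) \<Rightarrow> (nat \<Rightarrow>\<^sub>0 real)" where
  "dotm u G = (\<Sum>i\<in>Poly_Mapping.keys G. Poly_Mapping.single i (u \<bullet> lk G i))"

lemma lookup_dotm [simp]: "lk (dotm u G) i = u \<bullet> lk G i"
  unfolding dotm_def lookup_sum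
  by (cases "i \<in> Poly_Mapping.keys G") (auto simp: lookup_single when_def in_keys_iff)

lemma bounded_linear_dotm: "bounded_linear (dotm u)"
proof (rule bounded_linear_intro[where K="norm u"])
  fix G
  have k: "Poly_Mapping.keys (dotm u G) \<subseteq> Poly_Mapping.keys G" by (auto simp: in_keys_iff)
  have "(norm (dotm u G))\<^sup>2 = (\<Sum>i\<in>Poly_Mapping.keys G. (u \<bullet> lk G i)\<^sup>2)"
    unfolding power2_norm_eq_inner by (subst inner_lookup_superset[OF _ k]) (auto simp: power2_eq_square)
  also have "\<dots> \<le> (\<Sum>i\<in>Poly_Mapping.keys G. (norm u)\<^sup>2 * (norm (lk G i))\<^sup>2)"
    by (intro sum_mono) (metis Cauchy_Schwarz_ineq power2_norm_eq_inner)
  also have "\<dots> = (norm u)\<^sup>2 * (norm G)\<^sup>2"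
    unfolding power2_norm_eq_inner[of G] by (subst inner_lookup_superset[of "Poly_Mapping.keys G"]) (auto simp: power2_norm_eq_inner sum_distrib_left)
  also have "\<dots> = (norm G * norm u)\<^sup>2" by (simp add: power_mult_distrib mult.commute)
  finally show "norm (dotm u G) \<le> norm G * norm u" by (rule power2_le_imp_le) simp
qed (auto intro!: poly_mapping_eqI simp: lookup_add inner_add_right)

lemma dotm_tens: "dotm u (tens h b) = (u \<bullet> b) *\<^sub>R h"
  by (rule poly_mapping_eqI) (simp add: mult.commute)

text \<open>
  In an orthonormal basis that contains \<open>u\<close>, all other components are killed.
\<close>

lemma gauss_dotm:
  fixes B :: "'a::{real_inner,second_countable_topology} set"
  assumes H: "orthonormal H" and B: "orthonormal B" and u: "u \<in> span B" "norm u = 1"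
  shows "distr (gauss (tensors H B)) borel (dotm u) = gauss H"
proof -
  obtain C where C: "orthonormal C" "u \<in> C" "span C = span B" using gauss_exchange[OF B u] by blast
  have C': "C = {u} \<union> (C - {u})" using C by auto
  have g: "gauss (tensors H B) = gauss (tensors H {u} \<union> tensors H (C - {u}))"
    unfolding tensors_Un(2)[symmetric] C'[symmetric]
    using H B C by (intro gauss_cong_span orthonormal_tensors span_tensors_cong) auto
  have ou: "orthonormal {u}" using u by (auto simp: orthonormal_def norm_eq_1)
  have oC: "orthonormal (C - {u})" using C(1) by (rule orthonormal_subset) auto
  have u1: "u \<bullet> u = 1" using u by (simp add: norm_eq_1)
  have im: "dotm u ` tensors H {u} = H"
    by (force simp: tensors_def dotm_tens u1 image_iff)
  have "distr (gauss (tensors H {u} \<union> tensors H (C - {u}))) borel (dotm u) = gauss (dotm u ` tensors H {u})"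
  proof (rule gauss_kernel)
    show "finite (tensors H {u})" "finite (tensors H (C - {u}))"
      using H ou oC orthonormal_tensors orthonormal_finite by blast+
    show "tensors H {u} \<inter> tensors H (C - {u}) = {}"
      using H C C' by (intro tensors_disjoint) auto
    show "inj_on (dotm u) (tensors H {u})" by (auto simp: inj_on_def tensors_def dotm_tens u1)
    show "linear (dotm u)" using bounded_linear_dotm bounded_linear.linear by blast
    show "dotm u \<in> borel_measurable borel"
      using bounded_linear.continuous_on[OF bounded_linear_dotm[of u] continuous_on_id]
      by (intro borel_measurable_continuous_onI) simp
    show "dotm u b = 0" if bm: "b \<in> tensors H (C - {u})" for b
    proof -
      obtain h c where hc: "b = tens h c" "c \<in> C" "c \<noteq> u" using bm by (auto simp: tensors_def)
      then have "u \<bullet> c = 0" using orthonormal_inner[OF C(1,2) hc(2)] by auto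
      then show ?thesis by (simp add: hc(1) dotm_tens)
    qed
  qed
  then show ?thesis using g im by simp
qed

lemma lin_diff_eq:
  assumes "\<And>i j. i \<in> J \<Longrightarrow> j \<in> J \<Longrightarrow> x i - x j = y i - y j"
  shows "icone x I J = icone y I J"
proof (cases "J = {}")
  case False
  then obtain j where j: "j \<in> J" by auto
  have "(\<Sum>i\<in>J. l i *\<^sub>R x i) = (\<Sum>i\<in>J. l i *\<^sub>R y i)" if "l \<in> coef I J" for l
  proof -
    have "(\<Sum>i\<in>J. l i *\<^sub>R x i) = (\<Sum>i\<in>J. l i *\<^sub>R (x i - x j))"
      using that by (intro coef_sum_shift) (simp add: coef_def)
    also have "\<dots> = (\<Sum>i\<in>J. l i *\<^sub>R (y i - y j))" using assms j by (intro sum.cong) auto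
    also have "\<dots> = (\<Sum>i\<in>J. l i *\<^sub>R y i)"
      using that by (intro coef_sum_shift[symmetric]) (simp add: coef_def)
    finally show ?thesis .
  qed
  then show ?thesis unfolding icone_def by auto
qed (simp add: icone_def)

text \<open>
  All vectors in the normal cone \<open>ncone J N\<close> are constant on \<open>J\<close>.
\<close>

lemma section_constant:
  fixes G1 :: "nat \<Rightarrow>\<^sub>0 'a::real_inner"
  assumes "finite N" "J \<subseteq> N" "span H1 = span (ncone J N)" "G1 \<in> span (tensors H1 B)" "i \<in> J" "j \<in> J"
  shows "lk G1 i = lk G1 j"
proof -
  have hconst: "lk h i = lk h j" if "h \<in> H1" "i \<in> J" "j \<in> J" for h i j
  proof -
    have "h \<in> span (ncone J N)" using that assms(3) span_base by blast
    then show ?thesis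
    proof (induction rule: span_induct)
      case base
      show ?case by (rule subspaceI) (auto simp: lookup_add)
    next
      case (step w)
      then show ?case using that assms(2) by (auto simp: mem_ncone[OF assms(1)] intro!: antisym)
    qed
  qed
  show ?thesis
  proof (cases "i = j")
    case False
    have "(\<Sum>k\<in>{i,j}. (if k = i then 1 else - 1) *\<^sub>R lk G1 k) = 0"
      using assms(4)
    proof (rule span_tensors_functional)
      fix h assume "h \<in> H1"
      then have "lk h i = lk h j" using hconst assms(5,6) by blast
      then show "(\<Sum>k\<in>{i,j}. (if k = i then 1 else - 1) * lk h k) = 0" using False by simp
    qed
    then show ?thesis using False by simp
  qed simp
qed

lemma kkt_diff_cong:
  assumes "\<And>i j. i \<in> J \<Longrightarrow> j \<in> J \<Longrightarrow> x i - x j = y i - y j"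
  shows "kkt x I J J z = kkt y I J J z"
proof -
  have "icone x I J = icone y I J" by (rule lin_diff_eq[OF assms])
  moreover have "polar x J J w = polar y J J w" for w
    unfolding polar_def by (intro ball_cong refl) (simp only: assms)
  ultimately show ?thesis unfolding kkt_def by simp
qed

text \<open>
  The configuration is \<open>G2 + G1\<close>, with \<open>G1\<close> in the part spanned by the normal cone of the simplex at \<open>J\<close>
  and \<open>G2\<close> in the complement. As the points of \<open>G1\<close> with index in \<open>J\<close> coincide, the cone \<open>icone x I J\<close> and the residual \<open>w\<close> of the
  projection of \<open>z\<close> depend only on \<open>G2\<close>. Moreover \<open>w\<close> is orthogonal to all points of \<open>G2\<close>, so the remaining
  condition on \<open>w\<close> concerns the inner products with \<open>G1\<close>, which form a standard Gaussian vector.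
\<close>

lemma measure_section_kkt:
  fixes B :: "'a::{real_inner,second_countable_topology} set"
  assumes N: "finite N" and J: "I \<subseteq> J" "J \<subseteq> N" "I \<noteq> {}" and B: "orthonormal B"
    and H: "orthonormal H1" "span H1 = span (ncone J N)"
      "\<And>h. h \<in> H2 \<Longrightarrow> \<forall>a\<in>ncone J N. h \<bullet> a = 0"
    and G2: "G2 \<in> span (tensors H2 B)" and z: "z \<in> span B" "z \<notin> icone (lk G2) J J"
  shows "emeasure (gauss (tensors H1 B)) {G1. kkt (lk (G2 + G1)) I J N z}
       = ennreal (normal_angle J N) * indicator {z. kkt (lk G2) I J J z} z"
proof -
  have fJ: "finite J" using J N finite_subset by blast
  obtain j0 where j0: "j0 \<in> I" using J by auto
  let ?y = "lk G2"
  have yB: "?y i \<in> span B" for i using G2 by (rule span_tensors_lookup)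
  \<comment> \<open>The vectors \<open>- ev i\<close> with \<open>i \<in> N - J\<close> and the all-ones vector on \<open>J\<close> are in the normal cone, so the points of \<open>G2\<close> vanish outside of \<open>J\<close> and have barycenter \<open>0\<close>.\<close>
  have hz: "lk h i = 0" if h: "h \<in> H2" and i: "i \<in> N - J" for h i
  proof -
    have "- ev i \<in> ncone J N" using i J by (auto simp: mem_ncone[OF N] lookup_single when_def in_keys_iff)
    then have "h \<bullet> (- ev i) = 0" using H(3)[OF h] by blast
    then show ?thesis by (simp add: inner_ev)
  qed
  have hs: "sum (lk h) J = 0" if h: "h \<in> H2" for h
  proof -
    have l: "lk (\<Sum>i\<in>J. ev i) k = (if k \<in> J then 1 else 0)" for k
      using sum_ev_lookup[OF fJ, of "\<lambda>_. 1" k] by simp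
    then have "(\<Sum>i\<in>J. ev i) \<in> ncone J N" using J by (auto simp: mem_ncone[OF N] in_keys_iff l split: if_splits)
    then have "h \<bullet> (\<Sum>i\<in>J. ev i) = 0" using H(3)[OF h] by blast
    then show ?thesis by (simp add: inner_sum_right inner_ev)
  qed
  have y0: "?y i = 0" if "i \<in> N - J" for i
    using G2 by (rule span_tensors_lookup_eq_0) (use hz that in auto)
  have ys: "(\<Sum>i\<in>J. ?y i) = 0"
    using span_tensors_functional[OF G2, where S=J and c="\<lambda>_. 1"] hs by simp
  have yl: "?y j \<in> icone ?y J J" if j: "j \<in> J" for j
  proof -
    let ?l = "\<lambda>k. if k \<in> J then (if k = j then 1 else 0) - 1 / real (card J) else 0"
    have cJ: "card J > 0" using j fJ by (auto simp: card_gt_0_iff)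
    have "sum ?l J = (\<Sum>k\<in>J. (if k = j then 1 else 0) - 1 / real (card J))" by (intro sum.cong) auto
    also have "\<dots> = 0" using j fJ cJ by (auto simp: sum_subtractf)
    finally have "?l \<in> coef J J" by (auto simp: coef_def)
    moreover have "?y j = (\<Sum>k\<in>J. ?l k *\<^sub>R ?y k)"
    proof -
      have "(\<Sum>k\<in>J. ?l k *\<^sub>R ?y k) = (\<Sum>k\<in>J. (if k = j then ?y j else 0) - (1 / real (card J)) *\<^sub>R ?y k)"
        by (intro sum.cong) (auto simp: scaleR_left_diff_distrib)
      also have "\<dots> = ?y j - (1 / real (card J)) *\<^sub>R (\<Sum>k\<in>J. ?y k)"
        using j fJ by (simp add: sum_subtractf scaleR_sum_right)
      finally show ?thesis using ys by simp
    qed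
    ultimately show ?thesis by (rule iconeI)
  qed
  have diff: "lk G1 i - lk G1 j = 0" if "G1 \<in> span (tensors H1 B)" "i \<in> J" "j \<in> J" for G1 i j
    using section_constant[OF N J(2) H(2) that] by simp
  have restr: "kkt ?y I J J z" if G1: "G1 \<in> span (tensors H1 B)" and k: "kkt (lk (G2 + G1)) I J N z" for G1
  proof -
    have d: "lk (G2 + G1) i - lk (G2 + G1) j = ?y i - ?y j" if "i \<in> J" "j \<in> J" for i j
      using diff[OF G1 that] by (simp add: lookup_add algebra_simps)
    obtain p where p: "p \<in> icone (lk (G2 + G1)) I J" "polar (lk (G2 + G1)) J N (z - p)" using k by (auto simp: kkt_def)
    have "icone (lk (G2 + G1)) I J = icone ?y I J" by (rule lin_diff_eq[OF d])
    then have "p \<in> icone ?y I J" using p(1) by simp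
    moreover have "polar ?y J J (z - p)"
      unfolding polar_def
    proof (intro ballI)
      fix i j assume ij: "i \<in> J" "j \<in> J"
      then have "(z - p) \<bullet> (lk (G2 + G1) i - lk (G2 + G1) j) \<le> 0"
        using p(2) J unfolding polar_def by blast
      then show "(z - p) \<bullet> (?y i - ?y j) \<le> 0" by (simp only: d[OF ij])
    qed
    ultimately show ?thesis by (auto simp: kkt_def)
  qed
  have on: "orthonormal (tensors H1 B)" using H B by (intro orthonormal_tensors)
  have meas: "{G1. kkt (lk (G2 + G1)) I J N z} \<in> sets borel"
  proof -
    have "(\<lambda>G1. (G2 + G1, z)) \<in> measurable borel borel" unfolding borel_prod[symmetric] by measurable
    from measurable_sets[OF this borel_kkt[OF fJ, of I N]] show ?thesis by (simp add: vimage_def)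
  qed
  show ?thesis
  proof (cases "kkt ?y I J J z")
    case False
    have "emeasure (gauss (tensors H1 B)) {G1. kkt (lk (G2 + G1)) I J N z} = emeasure (gauss (tensors H1 B)) {}"
    proof (rule emeasure_eq_AE)
      show "AE G1 in gauss (tensors H1 B). (G1 \<in> {G1. kkt (lk (G2 + G1)) I J N z}) = (G1 \<in> {})"
        using AE_gauss_span[OF on]
      proof eventually_elim
        case (elim G1)
        then show ?case using restr[OF elim] False by blast
      qed
    qed (use meas in simp_all)
    then show ?thesis using False by simp
  next
    case True
    then obtain p where p: "p \<in> icone ?y I J" "polar ?y J J (z - p)" by (auto simp: kkt_def)
    define w where "w = z - p"
    have pl: "p \<in> icone ?y J J" using p(1) icone_mono_left[OF J(1)] by blast
    have wl: "w \<bullet> q = 0" if "q \<in> icone ?y J J" for q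
      unfolding w_def by (rule lin_orthogonal[OF _ that]) (rule polar_eq[OF p(2) _ _ subset_refl])
    have "icone ?y J J \<subseteq> span B" using yB by (intro icone_subset_subspace) auto
    then have w: "w \<in> span B" "w \<noteq> 0" using pl z by (auto simp: w_def intro: span_diff)
    define u where "u = sgn w"
    have u: "u \<in> span B" "norm u = 1" using w by (auto simp: u_def sgn_div_norm span_scale)
    \<comment> \<open>As the barycenter of \<open>G2\<close> is \<open>0\<close>, its points lie in \<open>icone ?y J J\<close>, to which \<open>w\<close> is orthogonal.\<close>
    have wy: "w \<bullet> ?y i = 0" if "i \<in> N" for i
      using y0[of i] wl[OF yl, of i] that by (cases "i \<in> J") auto
    have iff: "kkt (lk (G2 + G1)) I J N z \<longleftrightarrow> dotm u G1 \<in> ncone J N"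
      if G1: "G1 \<in> span (tensors H1 B)" for G1
    proof -
      have d: "lk (G2 + G1) i - lk (G2 + G1) j = ?y i - ?y j" if "i \<in> J" "j \<in> J" for i j
        using diff[OF G1 that] by (simp add: lookup_add algebra_simps)
      have ic: "icone (lk (G2 + G1)) I J = icone ?y I J" by (rule lin_diff_eq[OF d])
      have "kkt (lk (G2 + G1)) I J N z \<longleftrightarrow> polar (lk (G2 + G1)) J N w"
      proof
        assume "kkt (lk (G2 + G1)) I J N z"
        then obtain q where q: "q \<in> icone ?y I J" "polar (lk (G2 + G1)) J N (z - q)" by (auto simp: kkt_def ic)
        have ql: "q \<in> icone ?y J J" using q(1) icone_mono_left[OF J(1)] by blast
        have qd: "(z - q) \<bullet> (?y i - ?y j) = 0" if "i \<in> J" "j \<in> J" for i j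
          using polar_eq[OF q(2) that J(2)] unfolding d[OF that] .
        have zq: "(z - q) \<bullet> r = 0" if "r \<in> icone ?y J J" for r
          by (rule lin_orthogonal[OF _ that]) (rule qd)
        have "p - q \<in> icone ?y J J" using pl ql by (rule subspace_diff[OF subspace_lin])
        then have "(z - q) \<bullet> (p - q) = 0" "w \<bullet> (p - q) = 0" using zq wl by auto
        then have "(p - q) \<bullet> (p - q) = 0" by (simp add: w_def inner_diff_left)
        then show "polar (lk (G2 + G1)) J N w" using q(2) by (simp add: w_def)
      next
        assume "polar (lk (G2 + G1)) J N w"
        then show "kkt (lk (G2 + G1)) I J N z" using p(1) by (auto simp: kkt_def ic w_def)
      qed
      also have "\<dots> \<longleftrightarrow> (\<forall>i\<in>N. \<forall>j\<in>J. w \<bullet> lk G1 i \<le> w \<bullet> lk G1 j)"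
        unfolding polar_def
      proof (intro ball_cong refl)
        fix i j assume "i \<in> N" "j \<in> J"
        then have "w \<bullet> ?y i = 0" "w \<bullet> ?y j = 0" using wy J(2) by blast+
        then show "w \<bullet> (lk (G2 + G1) i - lk (G2 + G1) j) \<le> 0 \<longleftrightarrow> w \<bullet> lk G1 i \<le> w \<bullet> lk G1 j"
          by (simp add: lookup_add inner_diff_right inner_add_right)
      qed
      also have "\<dots> \<longleftrightarrow> (\<forall>i\<in>N. \<forall>j\<in>J. lk (dotm u G1) i \<le> lk (dotm u G1) j)"
        using w by (simp add: u_def sgn_div_norm)
      also have "\<dots> \<longleftrightarrow> dotm u G1 \<in> ncone J N"
      proof -
        have h0: "lk h i = 0" if "h \<in> H1" "i \<notin> N" for h i
        proof -
          have "ncone J N \<subseteq> span (unitv N)" by (auto simp: ncone_def)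
          then have "span (ncone J N) \<subseteq> span (unitv N)" by (simp add: span_minimal)
          then have "h \<in> span (unitv N)" using that H(2) span_base by blast
          then show ?thesis using that by (auto simp: span_unitv[OF N] in_keys_iff)
        qed
        have "lk G1 i = 0" if "i \<notin> N" for i
          using G1 by (rule span_tensors_lookup_eq_0) (use h0 that in auto)
        then have "Poly_Mapping.keys (dotm u G1) \<subseteq> N" by (auto simp: in_keys_iff) (metis inner_zero_right)
        then show ?thesis by (simp add: mem_ncone[OF N])
      qed
      finally show ?thesis .
    qed
    have nb: "ncone J N \<in> sets borel" unfolding ncone_def using N by (intro borel_polar_cone orthonormal_unitv)
    have dm: "dotm u \<in> borel_measurable borel"
      using bounded_linear.continuous_on[OF bounded_linear_dotm[of u] continuous_on_id]
      by (intro borel_measurable_continuous_onI) simp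
    have "emeasure (gauss (tensors H1 B)) {G1. kkt (lk (G2 + G1)) I J N z} = emeasure (gauss (tensors H1 B)) (dotm u -` ncone J N)"
    proof (rule emeasure_eq_AE)
      show "AE G1 in gauss (tensors H1 B). (G1 \<in> {G1. kkt (lk (G2 + G1)) I J N z}) = (G1 \<in> dotm u -` ncone J N)"
        using AE_gauss_span[OF on]
      proof eventually_elim
        case (elim G1)
        then show ?case using iff[OF elim] by blast
      qed
    qed (use meas measurable_sets[OF dm nb] in simp_all)
    also have "\<dots> = emeasure (distr (gauss (tensors H1 B)) borel (dotm u)) (ncone J N)"
      using dm nb by (subst emeasure_distr) (auto cong: measurable_cong_sets)
    also have "\<dots> = emeasure (gauss H1) (ncone J N)" using gauss_dotm[OF H(1) B u] by simp
    also have "\<dots> = ennreal (normal_angle J N)"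
    proof -
      have "scone (ncone J N)" unfolding ncone_def by (rule scone_polar_cone)
      then show ?thesis unfolding normal_angle_def using solid_angle_gauss[OF H(1) _ _ nb] H(2) by (simp add: gauss.emeasure_eq_measure)
    qed
    finally show ?thesis using True by simp
  qed
qed

section \<open>Projection probabilities of Gaussian cones\<close>

definition kkt_prob :: "nat set \<Rightarrow> 'a::{real_inner,second_countable_topology} set \<Rightarrow> nat set \<Rightarrow> nat set \<Rightarrow> nat set \<Rightarrow> ennreal" where
  "kkt_prob N B I J J' = (\<integral>\<^sup>+G. emeasure (gauss B) {z. kkt (lk G) I J J' z} \<partial>gauss_points N B)"

lemma pair_kkt_sets:
  fixes J :: "nat set"
  assumes "finite J"
  shows "{p. kkt (lk (fst p)) I J J' (snd p)} \<in> sets (borel \<Otimes>\<^sub>M (borel :: 'a::{real_inner,second_countable_topology} measure))"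
  unfolding borel_prod by (rule borel_kkt[OF assms])

lemma measurable_emeasure_section:
  fixes B :: "'a::{real_inner,second_countable_topology} set" and M :: "'b::second_countable_topology measure"
  assumes "{p. P (fst p) (snd p)} \<in> sets (borel \<Otimes>\<^sub>M borel)"
  shows "(\<lambda>G. emeasure (gauss B) {z. P G z}) \<in> borel_measurable borel"
proof -
  have "{p. P (fst p) (snd p)} \<in> sets (borel \<Otimes>\<^sub>M gauss B)"
    using assms by (simp cong: sets_pair_measure_cong)
  from gauss.measurable_emeasure_Pair[OF this]
  show ?thesis by (simp add: vimage_def)
qed

lemma measurable_kkt_section:
  fixes J :: "nat set" and B :: "'a::{real_inner,second_countable_topology} set"
  assumes "finite J" "sets M = sets borel"
  shows "(\<lambda>G. emeasure (gauss B) {z. kkt (lk G) I J J' z}) \<in> borel_measurable M"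
  using measurable_emeasure_section[OF pair_kkt_sets[OF assms(1), of I J'], of B] assms(2)
  by (simp cong: measurable_cong_sets)

lemma nn_integral_gauss_Un:
  fixes A B :: "'a::{real_inner,second_countable_topology} set"
  assumes "finite A" "finite B" "A \<inter> B = {}" and [measurable]: "f \<in> borel_measurable borel"
  shows "(\<integral>\<^sup>+x. f x \<partial>gauss (A \<union> B)) = (\<integral>\<^sup>+x. \<integral>\<^sup>+y. f (x + y) \<partial>gauss B \<partial>gauss A)"
  using assms by (simp add: gauss_Un nn_integral_sum_law gauss.sigma_finite_measure_axioms)

lemma swap_sections:
  fixes A :: "'a::{real_inner,second_countable_topology} set" and B :: "'b::{real_inner,second_countable_topology} set"
  assumes P: "{p. P (fst p) (snd p)} \<in> sets (borel \<Otimes>\<^sub>M borel)"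
  shows "(\<integral>\<^sup>+x. emeasure (gauss B) {y. P x y} \<partial>gauss A) = (\<integral>\<^sup>+y. emeasure (gauss A) {x. P x y} \<partial>gauss B)"
proof -
  interpret Q: pair_sigma_finite "gauss A" "gauss B" ..
  have X: "{p. P (fst p) (snd p)} \<in> sets (gauss A \<Otimes>\<^sub>M gauss B)"
    using P by (simp cong: sets_pair_measure_cong)
  have "(\<integral>\<^sup>+x. emeasure (gauss B) {y. P x y} \<partial>gauss A) = emeasure (gauss A \<Otimes>\<^sub>M gauss B) {p. P (fst p) (snd p)}"
    using X by (subst gauss.emeasure_pair_measure_alt) (simp_all add: vimage_def)
  also have "\<dots> = (\<integral>\<^sup>+y. emeasure (gauss A) {x. P x y} \<partial>gauss B)"
    using X by (subst Q.emeasure_pair_measure_alt2) (simp_all add: vimage_def)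
  finally show ?thesis .
qed

text \<open>
  Fubini for the decomposition in \<open>measure_section_kkt\<close>.
\<close>

theorem kkt_prob_factor:
  fixes B :: "'a::{real_inner,second_countable_topology} set"
  assumes N: "finite N" and J: "I \<subseteq> J" "J \<subseteq> J'" "J' \<subseteq> N" "I \<noteq> {}" and B: "orthonormal B" and cJ: "card J \<le> card B"
  shows "kkt_prob N B I J J' = ennreal (normal_angle J J') * kkt_prob N B I J J"
proof -
  have fJ': "finite J'" by (rule finite_subset[OF J(3) N])
  have fJ: "finite J" by (rule finite_subset[OF J(2) fJ'])
  have uN: "orthonormal (unitv N)" using N by (rule orthonormal_unitv)
  have nc: "ncone J J' \<subseteq> span (unitv N)"
  proof
    fix w assume "w \<in> ncone J J'"
    then have "Poly_Mapping.keys w \<subseteq> N" using J(3) by (simp only: mem_ncone[OF fJ']) (meson subset_trans)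
    then show "w \<in> span (unitv N)" by (simp add: span_unitv[OF N])
  qed
  have nc': "ncone J J' \<subseteq> span (unitv J')" by (auto simp: ncone_def)
  have spn: "\<exists>S. finite S \<and> S \<subseteq> ncone J J' \<and> span S = span (ncone J J')"
  proof -
    obtain S where S: "S \<subseteq> ncone J J'" "independent S" "ncone J J' \<subseteq> span S"
      by (rule maximal_independent_subset)
    have "finite (unitv J')" using fJ' by (simp add: unitv_def)
    moreover have "S \<subseteq> span (unitv J')" using S(1) nc' by (rule subset_trans)
    ultimately have "finite S" using independent_span_bound[of "unitv J'" S] S(2) by simp
    moreover have "span S = span (ncone J J')"
      by (rule subset_antisym) (simp_all add: S(1,3) span_mono span_minimal)
    ultimately show ?thesis using S(1) by auto
  qed
  then obtain S where S: "finite S" "S \<subseteq> ncone J J'" "span S = span (ncone J J')" by blast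
  obtain H1 H2 where H: "orthonormal (H1 \<union> H2)" "H1 \<inter> H2 = {}" "span H1 = span S"
    "span (H1 \<union> H2) = span (unitv N)" "\<And>v. v \<in> span (unitv N) \<Longrightarrow> (\<forall>a\<in>S. v \<bullet> a = 0) \<longleftrightarrow> v \<in> span H2"
    using orthonormal_complement[OF uN S(1) subset_trans[OF S(2) nc]] by blast
  have oH: "orthonormal H1" "orthonormal H2" using H(1) by (auto intro: orthonormal_subset)
  have H2p: "h \<bullet> a = 0" if h: "h \<in> span H2" and a: "a \<in> span (ncone J J')" for h a
  proof -
    have "h \<in> span (unitv N)" using h H(4) span_mono[of H2 "H1 \<union> H2"] by auto
    then have "\<forall>a\<in>S. h \<bullet> a = 0" using H(5) h by blast
    then have "orthogonal h a" using a unfolding S(3)[symmetric]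
      by (intro orthogonal_to_span[of a S]) (auto simp: orthogonal_def)
    then show ?thesis by (simp add: orthogonal_def)
  qed
  let ?T1 = "tensors H1 B" and ?T2 = "tensors H2 B"
  have oT: "orthonormal ?T1" "orthonormal ?T2" using oH B by (auto intro: orthonormal_tensors)
  have dT: "?T2 \<inter> ?T1 = {}" using H B by (intro tensors_disjoint) (auto simp: Un_commute)
  have g: "gauss_points N B = gauss (?T2 \<union> ?T1)"
  proof -
    have "gauss_points N B = gauss (tensors (H1 \<union> H2) B)" using N H B by (intro gauss_points_cong) auto
    then show ?thesis by (simp add: tensors_Un Un_commute)
  qed
  have split: "kkt_prob N B I J K = (\<integral>\<^sup>+G2. \<integral>\<^sup>+z. emeasure (gauss ?T1) {G1. kkt (lk (G2 + G1)) I J K z} \<partial>gauss B \<partial>gauss ?T2)" for K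
  proof -
    have "kkt_prob N B I J K = (\<integral>\<^sup>+G2. \<integral>\<^sup>+G1. emeasure (gauss B) {z. kkt (lk (G2 + G1)) I J K z} \<partial>gauss ?T1 \<partial>gauss ?T2)"
      unfolding kkt_prob_def g using oT dT
      by (subst nn_integral_gauss_Un) (auto simp: orthonormal_finite intro!: measurable_kkt_section fJ)
    also have "\<dots> = (\<integral>\<^sup>+G2. \<integral>\<^sup>+z. emeasure (gauss ?T1) {G1. kkt (lk (G2 + G1)) I J K z} \<partial>gauss B \<partial>gauss ?T2)"
    proof (intro nn_integral_cong swap_sections)
      fix G2 :: "nat \<Rightarrow>\<^sub>0 'a"
      have "(\<lambda>p. (G2 + fst p, snd p)) \<in> measurable (borel \<Otimes>\<^sub>M borel) (borel \<Otimes>\<^sub>M (borel :: 'a measure))" by measurable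
      from measurable_sets[OF this pair_kkt_sets[OF fJ, of I K]]
      show "{p. kkt (lk (G2 + fst p)) I J K (snd p)} \<in> sets (borel \<Otimes>\<^sub>M (borel :: 'a measure))"
        by (simp add: vimage_def space_pair_measure)
    qed
    finally show ?thesis .
  qed
  have "kkt_prob N B I J J' = (\<integral>\<^sup>+G2. \<integral>\<^sup>+z. ennreal (normal_angle J J') * indicator {z. kkt (lk G2) I J J z} z \<partial>gauss B \<partial>gauss ?T2)"
    unfolding split
  proof (rule nn_integral_cong_AE)
    show "AE G2 in gauss ?T2. (\<integral>\<^sup>+z. emeasure (gauss ?T1) {G1. kkt (lk (G2 + G1)) I J J' z} \<partial>gauss B)
      = (\<integral>\<^sup>+z. ennreal (normal_angle J J') * indicator {z. kkt (lk G2) I J J z} z \<partial>gauss B)"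
      using AE_gauss_span[OF oT(2)]
    proof eventually_elim
      case (elim G2)
      have lB: "lk G2 i \<in> span B" for i using elim by (rule span_tensors_lookup)
      have aez: "AE z in gauss B. z \<notin> icone (lk G2) J J"
        using lB cJ J fJ B by (intro AE_notin_icone_small[of J I]) auto
      have h2: "\<forall>a\<in>ncone J J'. h \<bullet> a = 0" if "h \<in> H2" for h
        using that H2p by (auto intro: span_base)
      show ?case
      proof (rule nn_integral_cong_AE)
        show "AE z in gauss B. emeasure (gauss ?T1) {G1. kkt (lk (G2 + G1)) I J J' z}
            = ennreal (normal_angle J J') * indicator {z. kkt (lk G2) I J J z} z"
          using aez AE_gauss_span[OF B]
        proof eventually_elim
          case (elim z)
          show ?case
            by (rule measure_section_kkt[OF fJ' J(1,2,4) B oH(1) _ h2 \<open>G2 \<in> span ?T2\<close> elim(2,1)]) (simp_all add: H(3) S(3))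
        qed
      qed
    qed
  qed
  also have "\<dots> = (\<integral>\<^sup>+G2. ennreal (normal_angle J J') * emeasure (gauss B) {z. kkt (lk G2) I J J z} \<partial>gauss ?T2)"
    using fJ by (intro nn_integral_cong nn_integral_cmult_indicator) (auto intro!: borel_kkt_slice)
  also have "\<dots> = ennreal (normal_angle J J') * (\<integral>\<^sup>+G2. emeasure (gauss B) {z. kkt (lk G2) I J J z} \<partial>gauss ?T2)"
    using fJ by (intro nn_integral_cmult) (auto intro!: measurable_kkt_section)
  also have "(\<integral>\<^sup>+G2. emeasure (gauss B) {z. kkt (lk G2) I J J z} \<partial>gauss ?T2) = kkt_prob N B I J J"
  proof -
    have "kkt_prob N B I J J = (\<integral>\<^sup>+G2. \<integral>\<^sup>+G1. emeasure (gauss B) {z. kkt (lk (G2 + G1)) I J J z} \<partial>gauss ?T1 \<partial>gauss ?T2)"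
      unfolding kkt_prob_def g using oT dT
      by (subst nn_integral_gauss_Un) (auto simp: orthonormal_finite intro!: measurable_kkt_section fJ)
    also have "\<dots> = (\<integral>\<^sup>+G2. \<integral>\<^sup>+G1. emeasure (gauss B) {z. kkt (lk G2) I J J z} \<partial>gauss ?T1 \<partial>gauss ?T2)"
    proof (rule nn_integral_cong, rule nn_integral_cong_AE)
      fix G2
      show "AE G1 in gauss ?T1. emeasure (gauss B) {z. kkt (lk (G2 + G1)) I J J z} = emeasure (gauss B) {z. kkt (lk G2) I J J z}"
        using AE_gauss_span[OF oT(1)]
      proof eventually_elim
        case (elim G1)
        have "kkt (lk (G2 + G1)) I J J z = kkt (lk G2) I J J z" for z
        proof (rule kkt_diff_cong)
          fix i j assume ij: "i \<in> J" "j \<in> J"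
          have "lk G1 i = lk G1 j"
            by (rule section_constant[OF fJ' J(2) _ elim ij]) (simp add: H(3) S(3))
          then show "lk (G2 + G1) i - lk (G2 + G1) j = lk G2 i - lk G2 j" by (simp add: lookup_add)
        qed
        then show ?case by simp
      qed
    qed
    also have "\<dots> = (\<integral>\<^sup>+G2. emeasure (gauss B) {z. kkt (lk G2) I J J z} \<partial>gauss ?T2)"
      using gauss.emeasure_space_1[of ?T1] by simp
    finally show ?thesis ..
  qed
  finally show ?thesis .
qed

text \<open>
  Both \<open>kkt_prob N B I K K\<close> and \<open>tangent_angle I K\<close> satisfy
  \<open>\<Sum>K. _ * normal_angle K J = 1\<close>, with \<open>K\<close> ranging over the sets between \<open>I\<close> and \<open>J\<close>, and
  \<open>normal_angle J J = 1\<close>. So the terms with \<open>K = J\<close> agree by induction.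
\<close>

theorem kkt_prob_self:
  fixes B :: "'a::{real_inner,second_countable_topology} set"
  assumes N: "finite N" and I: "I \<noteq> {}" and B: "orthonormal B"
  shows "I \<subseteq> J \<Longrightarrow> J \<subseteq> N \<Longrightarrow> card J \<le> card B \<Longrightarrow> kkt_prob N B I J J = ennreal (tangent_angle I J)"
proof (induction "card J" arbitrary: J rule: less_induct)
  case less
  have fJ: "finite J" using less.prems N finite_subset by blast
  let ?S = "{K. I \<subseteq> K \<and> K \<subseteq> J}"
  have fS: "finite ?S" using fJ by (rule_tac finite_subset[of _ "Pow J"]) auto
  have JS: "J \<in> ?S" using less.prems by auto
  have cK: "card K \<le> card B" "finite K" if "K \<in> ?S" for K
    using that card_mono[OF fJ, of K] less.prems(3) fJ finite_subset by auto
  have 1: "(\<Sum>K\<in>?S. kkt_prob N B I K J) = 1"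
  proof -
    have "(\<Sum>K\<in>?S. kkt_prob N B I K J) = (\<integral>\<^sup>+G. (\<Sum>K\<in>?S. emeasure (gauss B) {z. kkt (lk G) I K J z}) \<partial>gauss_points N B)"
      unfolding kkt_prob_def using cK
      by (intro nn_integral_sum[symmetric]) (auto intro!: measurable_kkt_section)
    also have "\<dots> = (\<integral>\<^sup>+G. 1 \<partial>gauss_points N B)"
    proof (rule nn_integral_cong_AE)
      show "AE G in gauss_points N B. (\<Sum>K\<in>?S. emeasure (gauss B) {z. kkt (lk G) I K J z}) = 1"
        using AE_gauss_points_general_position[OF N B] AE_gauss_points_span[OF N B]
      proof eventually_elim
        case (elim G)
        have gJ: "general_position (lk G) J (card B)" using elim(1) less.prems(2) unfolding general_position_def by blast
        show ?case
          by (rule sum_emeasure_kkt_small[OF fJ less.prems(1) I less.prems(3) B _ gJ]) (use elim(2) in blast)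
      qed
    qed
    finally show ?thesis using gauss.emeasure_space_1[of "tensors (unitv N) B"] by simp
  qed
  have fac: "kkt_prob N B I K J = ennreal (normal_angle K J) * kkt_prob N B I K K" if "K \<in> ?S" for K
    using that cK[OF that] less.prems N I B by (intro kkt_prob_factor) auto
  have na0: "0 \<le> normal_angle K J" "0 \<le> tangent_angle I K" for K by (simp_all add: normal_angle_def tangent_angle_def)
  have IH: "kkt_prob N B I K J = ennreal (tangent_angle I K * normal_angle K J)" if "K \<in> ?S - {J}" for K
  proof -
    have "card K < card J" using that fJ by (intro psubset_card_mono) auto
    then have "kkt_prob N B I K K = ennreal (tangent_angle I K)"
      using that less.prems cK[of K] by (intro less.hyps) auto
    then show ?thesis using fac[of K] that na0 by (simp add: ennreal_mult mult.commute)
  qed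
  have naJ: "normal_angle J J = 1" using fJ by (rule normal_angle_self)
  have "ennreal (\<Sum>K\<in>?S. tangent_angle I K * normal_angle K J) = 1"
    using sum_angles_simplex[OF fJ less.prems(1) I] by simp
  moreover have "ennreal (\<Sum>K\<in>?S. tangent_angle I K * normal_angle K J) = (\<Sum>K\<in>?S. ennreal (tangent_angle I K * normal_angle K J))"
    using na0 by (intro sum_ennreal[symmetric]) auto
  ultimately have 2: "ennreal (tangent_angle I J) + (\<Sum>K\<in>?S - {J}. ennreal (tangent_angle I K * normal_angle K J)) = 1"
    using sum.remove[OF fS JS, of "\<lambda>K. ennreal (tangent_angle I K * normal_angle K J)"] naJ by simp
  have "kkt_prob N B I J J + (\<Sum>K\<in>?S - {J}. ennreal (tangent_angle I K * normal_angle K J)) = 1"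
    using 1 sum.remove[OF fS JS, of "\<lambda>K. kkt_prob N B I K J"] IH by simp
  with 2 have "kkt_prob N B I J J + (\<Sum>K\<in>?S - {J}. ennreal (tangent_angle I K * normal_angle K J)) = ennreal (tangent_angle I J) + (\<Sum>K\<in>?S - {J}. ennreal (tangent_angle I K * normal_angle K J))"
    by simp
  moreover have "(\<Sum>K\<in>?S - {J}. ennreal (tangent_angle I K * normal_angle K J)) \<noteq> \<top>"
    using na0 by (subst sum_ennreal) auto
  ultimately show ?case by (simp add: add.commute[of _ "sum _ _"] ennreal_add_left_cancel)
qed

corollary kkt_prob_eq:
  fixes B :: "'a::{real_inner,second_countable_topology} set"
  assumes "finite N" "I \<noteq> {}" "orthonormal B" "I \<subseteq> J" "J \<subseteq> N" "card J \<le> card B"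
  shows "kkt_prob N B I J N = ennreal (tangent_angle I J * normal_angle J N)"
proof -
  have "kkt_prob N B I J N = ennreal (normal_angle J N) * kkt_prob N B I J J"
    using assms by (intro kkt_prob_factor) auto
  also have "kkt_prob N B I J J = ennreal (tangent_angle I J)" using assms by (intro kkt_prob_self) auto
  finally show ?thesis by (simp add: ennreal_mult[symmetric] normal_angle_def tangent_angle_def mult.commute)
qed

section \<open>Points in a random cone\<close>

text \<open>
  The \<open>k\<close>-th conic intrinsic volume of the tangent cone at the face \<open>I\<close> of the regular simplex with vertex
  set \<open>N\<close>.
\<close>

definition simplex_vol :: "nat set \<Rightarrow> nat set \<Rightarrow> nat \<Rightarrow> real" where
  "simplex_vol I N k = (\<Sum>J | I \<subseteq> J \<and> J \<subseteq> N \<and> card J = k + 1. tangent_angle I J * normal_angle J N)"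

text \<open>
  The probability that the random cone \<open>icone x I N\<close> in dimension \<open>d\<close> contains an independent Gaussian
  point, by \<open>emeasure_mem_icone\<close>.
\<close>

definition hit_prob :: "nat set \<Rightarrow> nat set \<Rightarrow> nat \<Rightarrow> real" where
  "hit_prob I N d = 1 - (\<Sum>k<d. simplex_vol I N k)"

lemma sum_simplex_vol:
  assumes "finite N" "I \<noteq> {}"
  shows "(\<Sum>J | I \<subseteq> J \<and> J \<subseteq> N \<and> card J \<le> d. tangent_angle I J * normal_angle J N) = (\<Sum>k<d. simplex_vol I N k)"
proof -
  have "(\<Sum>k<d. simplex_vol I N k) = (\<Sum>J\<in>(\<Union>k\<in>{..<d}. {J. I \<subseteq> J \<and> J \<subseteq> N \<and> card J = k + 1}). tangent_angle I J * normal_angle J N)"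
    unfolding simplex_vol_def
    by (rule sum.UNION_disjoint[symmetric]) (use assms in \<open>auto intro!: finite_subset[of _ "Pow N"]\<close>)
  also have "(\<Union>k\<in>{..<d}. {J. I \<subseteq> J \<and> J \<subseteq> N \<and> card J = k + 1}) = {J. I \<subseteq> J \<and> J \<subseteq> N \<and> card J \<le> d}"
  proof (intro set_eqI iffI)
    fix J assume J: "J \<in> {J. I \<subseteq> J \<and> J \<subseteq> N \<and> card J \<le> d}"
    then have "card J > 0" using assms finite_subset by (metis (mono_tags, lifting) card_gt_0_iff mem_Collect_eq subset_empty)
    then have "card J - 1 < d" "card J = (card J - 1) + 1" using J by auto
    then show "J \<in> (\<Union>k\<in>{..<d}. {J. I \<subseteq> J \<and> J \<subseteq> N \<and> card J = k + 1})" using J by blast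
  qed auto
  finally show ?thesis ..
qed

lemma hit_prob_small: "finite N \<Longrightarrow> d < card I \<Longrightarrow> hit_prob I N d = 1"
proof -
  assume a: "finite N" "d < card I"
  have "{J. I \<subseteq> J \<and> J \<subseteq> N \<and> card J = k + 1} = {}" if "k < d" for k
  proof -
    have False if J: "I \<subseteq> J" "J \<subseteq> N" "card J = k + 1" for J
      using card_mono[OF finite_subset[OF J(2) a(1)] J(1)] J(3) a(2) \<open>k < d\<close> by simp
    then show ?thesis by blast
  qed
  then have "simplex_vol I N k = 0" if "k < d" for k unfolding simplex_vol_def using that by (metis (no_types, lifting) sum.empty)
  then show ?thesis unfolding hit_prob_def by simp
qed

lemma hit_prob_nonneg:
  assumes N: "finite N" "I \<subseteq> N" "I \<noteq> {}"
  shows "0 \<le> hit_prob I N d"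
proof -
  have "(\<Sum>J | I \<subseteq> J \<and> J \<subseteq> N \<and> card J \<le> d. tangent_angle I J * normal_angle J N) \<le> (\<Sum>J | I \<subseteq> J \<and> J \<subseteq> N. tangent_angle I J * normal_angle J N)"
    using N by (intro sum_mono2) (auto simp: tangent_angle_def normal_angle_def)
  then show ?thesis using sum_simplex_vol[OF N(1,3), of d] sum_angles_simplex[OF N] by (simp add: hit_prob_def)
qed

text \<open>
  A point outside of the cone projects into exactly one face \<open>icone x I J\<close> with \<open>card J \<le> card B\<close>.
\<close>

lemma emeasure_mem_icone:
  fixes B :: "'a::{real_inner,second_countable_topology} set"
  assumes N: "finite N" and I: "I \<noteq> {}" "I \<subseteq> N" and B: "orthonormal B"
  shows "(\<integral>\<^sup>+G. emeasure (gauss B) {z. z \<in> icone (lk G) I N} \<partial>gauss_points N B) = ennreal (hit_prob I N (card B))"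
proof -
  let ?U = "\<integral>\<^sup>+G. emeasure (gauss B) {z. z \<in> icone (lk G) I N} \<partial>gauss_points N B"
  let ?S = "{J. I \<subseteq> J \<and> J \<subseteq> N \<and> card J \<le> card B}"
  have fS: "finite ?S" using N by (rule_tac finite_subset[of _ "Pow N"]) auto
  have sI: "{p. snd p \<in> icone (lk (fst p)) I N} \<in> sets (borel \<Otimes>\<^sub>M (borel :: 'a measure))"
    unfolding borel_prod by (rule borel_mem_icone[OF N])
  have mK: "(\<lambda>G. emeasure (gauss B) {z. kkt (lk G) I J N z}) \<in> borel_measurable (gauss_points N B)" if "J \<in> ?S" for J
    using that N finite_subset by (auto intro!: measurable_kkt_section)
  have "?U + (\<Sum>J\<in>?S. kkt_prob N B I J N)
     = (\<integral>\<^sup>+G. emeasure (gauss B) {z. z \<in> icone (lk G) I N} + (\<Sum>J\<in>?S. emeasure (gauss B) {z. kkt (lk G) I J N z}) \<partial>gauss_points N B)"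
  proof -
    have "(\<lambda>G. emeasure (gauss B) {z. z \<in> icone (lk G) I N}) \<in> borel_measurable (gauss_points N B)"
      using measurable_emeasure_section[OF sI, of B] by (simp cong: measurable_cong_sets)
    moreover have "(\<Sum>J\<in>?S. kkt_prob N B I J N) = (\<integral>\<^sup>+G. (\<Sum>J\<in>?S. emeasure (gauss B) {z. kkt (lk G) I J N z}) \<partial>gauss_points N B)"
      unfolding kkt_prob_def by (rule nn_integral_sum[symmetric]) (rule mK)
    moreover have "(\<lambda>G. \<Sum>J\<in>?S. emeasure (gauss B) {z. kkt (lk G) I J N z}) \<in> borel_measurable (gauss_points N B)"
      by (rule borel_measurable_sum) (rule mK)
    ultimately show ?thesis by (simp only: nn_integral_add)
  qed
  also have "\<dots> = (\<integral>\<^sup>+G. 1 \<partial>gauss_points N B)"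
  proof (rule nn_integral_cong_AE, rule AE_mp[OF AE_gauss_points_general_position[OF N B]], rule AE_mp[OF AE_gauss_points_span[OF N B]], intro AE_I2 impI)
    fix G :: "nat \<Rightarrow>\<^sub>0 'a"
    assume elim: "(\<forall>i. lk G i \<in> span B) \<and> (\<forall>i. i \<notin> N \<longrightarrow> lk G i = 0)" "general_position (lk G) N (card B)"
    have "(\<Sum>J\<in>?S. emeasure (gauss B) {z. kkt (lk G) I J N z}) = emeasure (gauss B) (- icone (lk G) I N)"
      by (rule sum_emeasure_kkt[OF N I(2,1) B _ elim(2)]) (use elim(1) in blast)
    moreover have "emeasure (gauss B) {z. z \<in> icone (lk G) I N} + emeasure (gauss B) (- icone (lk G) I N) = emeasure (gauss B) UNIV"
      using borel_icone[OF N, of "lk G" I] by (subst plus_emeasure) (auto simp: Compl_eq_Diff_UNIV)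
    ultimately show "emeasure (gauss B) {z. z \<in> icone (lk G) I N} + (\<Sum>J\<in>?S. emeasure (gauss B) {z. kkt (lk G) I J N z}) = 1"
      using gauss.emeasure_space_1[of B] by simp
  qed
  also have "\<dots> = 1" using gauss.emeasure_space_1[of "tensors (unitv N) B"] by simp
  finally have 1: "?U + (\<Sum>J\<in>?S. kkt_prob N B I J N) = 1" .
  have 2: "(\<Sum>J\<in>?S. kkt_prob N B I J N) = ennreal (\<Sum>k<card B. simplex_vol I N k)"
  proof -
    have "(\<Sum>J\<in>?S. kkt_prob N B I J N) = (\<Sum>J\<in>?S. ennreal (tangent_angle I J * normal_angle J N))"
      using N I B by (intro sum.cong kkt_prob_eq) auto
    also have "\<dots> = ennreal (\<Sum>J\<in>?S. tangent_angle I J * normal_angle J N)"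
      by (rule sum_ennreal) (simp add: tangent_angle_def normal_angle_def)
    finally show ?thesis using sum_simplex_vol[OF N I(1)] by simp
  qed
  have v0: "0 \<le> (\<Sum>k<card B. simplex_vol I N k)"
    unfolding simplex_vol_def by (intro sum_nonneg mult_nonneg_nonneg) (auto simp: tangent_angle_def normal_angle_def)
  obtain r where r: "?U = ennreal r" "r \<ge> 0"
    using 1 by (cases ?U) auto
  then have "ennreal (r + (\<Sum>k<card B. simplex_vol I N k)) = ennreal 1" using 1 2 v0 by (simp add: ennreal_plus)
  then have "r + (\<Sum>k<card B. simplex_vol I N k) = 1" using r v0 by (subst (asm) ennreal_inj) auto
  then show ?thesis using r by (simp add: hit_prob_def)
qed

text \<open>
  The tangent cone at \<open>I\<close> is not the whole space \<open>span B\<close>, expressed by the polar cone. Points outside of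
  \<open>span B\<close> are thereby projected to it first.
\<close>

section \<open>Proper tangent cones and the Gauss-Bonnet relation\<close>

definition proper_tangent :: "'a::real_inner set \<Rightarrow> nat set \<Rightarrow> nat set \<Rightarrow> (nat \<Rightarrow>\<^sub>0 'a) \<Rightarrow> bool" where
  "proper_tangent B I N G \<longleftrightarrow> (\<exists>u\<in>span B. u \<noteq> 0 \<and> polar (lk G) I N u)"

lemma borel_proper_tangent:
  fixes B :: "'a::{real_inner,second_countable_topology} set"
  shows "finite B \<Longrightarrow> {G. proper_tangent B I N G} \<in> sets borel"
  unfolding proper_tangent_def by (rule borel_polar_nontrivial)

definition proper_prob :: "nat set \<Rightarrow> nat set \<Rightarrow> 'a::{real_inner,second_countable_topology} set \<Rightarrow> real" where
  "proper_prob I N B = measure (gauss_points N B) {G. proper_tangent B I N G}"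

text \<open>
  The projection of Gaussian points to a hyperplane consists of Gaussian points in the hyperplane.
\<close>

lemma emeasure_proper_tangent_projection:
  fixes B :: "'a::{real_inner,second_countable_topology} set"
  assumes N: "finite N" "I \<subseteq> N" and B: "orthonormal B" and C: "orthonormal C" "e \<in> C" "span C = span B"
  shows "emeasure (gauss_points N B) {G. proper_tangent (C - {e}) I N G} = ennreal (proper_prob I N (C - {e}))"
proof -
  let ?A = "tensors (unitv N) (C - {e})" and ?D = "tensors (unitv N) {e}"
  have uN: "orthonormal (unitv N)" using N by (simp add: orthonormal_unitv)
  have oe: "orthonormal {e}" "orthonormal (C - {e})" using C by (auto intro: orthonormal_subset)
  have CC: "C = (C - {e}) \<union> {e}" using C by auto
  have g: "gauss_points N B = gauss (?A \<union> ?D)"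
  proof -
    have "gauss_points N B = gauss (tensors (unitv N) C)" using N B C uN by (intro gauss_points_cong) auto
    then show ?thesis using CC tensors_Un(2)[of "unitv N" "C - {e}" "{e}"] by simp
  qed
  have dj: "?A \<inter> ?D = {}" using uN C CC by (intro tensors_disjoint) auto
  have m: "{G. proper_tangent (C - {e}) I N G} \<in> sets borel" using oe by (intro borel_proper_tangent orthonormal_finite)
  have "emeasure (gauss (?A \<union> ?D)) {G. proper_tangent (C - {e}) I N G} = emeasure (gauss ?A) {G. proper_tangent (C - {e}) I N G} * emeasure (gauss ?D) UNIV"
  proof (rule emeasure_gauss_orthogonal_event)
    fix G1 G2 assume G2: "G2 \<in> span ?D"
    have "u \<bullet> lk G2 i = 0" if "u \<in> span (C - {e})" for u i
    proof -
      have "lk G2 i \<in> span {e}" using G2 by (rule span_tensors_lookup)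
      moreover have "u \<bullet> e = 0" using that orthonormal_span_remove[OF C(1,2)] by auto
      ultimately show ?thesis by (auto simp: span_singleton)
    qed
    then have "polar (lk (G1 + G2)) I N u = polar (lk G1) I N u" if "u \<in> span (C - {e})" for u
      unfolding polar_def using that by (simp add: lookup_add inner_diff_right inner_add_right)
    then show "G1 + G2 \<in> {G. proper_tangent (C - {e}) I N G} \<longleftrightarrow> G1 \<in> {G. proper_tangent (C - {e}) I N G} \<and> G2 \<in> UNIV"
      unfolding proper_tangent_def by auto
  qed (use m dj uN oe in \<open>simp_all add: orthonormal_tensors\<close>)
  then show ?thesis
    using gauss.emeasure_space_1[of ?D] unfolding g proper_prob_def by (simp add: gauss.emeasure_eq_measure)
qed

text \<open>
  Integrates \<open>projection_dichotomy\<close>. The left-hand side arises from \<open>z\<close> and \<open>-z\<close>, which have the same law; on the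
  right-hand side are the probabilities that the projected cone and the cone are full.
\<close>

lemma proper_prob_step:
  fixes B :: "'a::{real_inner,second_countable_topology} set"
  assumes N: "finite N" "I \<subseteq> N" "I \<noteq> {}" and B: "orthonormal B" "card B = d" and d: "card I \<le> d" "d + 1 \<le> card N"
    and IH: "\<And>C :: 'a set. orthonormal C \<Longrightarrow> card C = d - 1 \<Longrightarrow> proper_prob I N C = r"
  shows "2 * hit_prob I N d = (1 - r) + (1 - proper_prob I N B)"
proof -
  have d1: "d \<ge> 1" using d N finite_subset[OF N(2,1)] by (metis Suc_leI card_gt_0_iff One_nat_def le_trans)
  have fB: "finite B" using B by (simp add: orthonormal_finite)
  have sI: "{p. snd p \<in> icone (lk (fst p)) K J} \<in> sets (borel \<Otimes>\<^sub>M (borel :: 'a measure))" if "finite J" for J :: "nat set" and K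
    unfolding borel_prod by (rule borel_mem_icone[OF that])
  have sI': "{p. - snd p \<in> icone (lk (fst p)) I N} \<in> sets (borel \<Otimes>\<^sub>M (borel :: 'a measure))"
  proof -
    have "(\<lambda>p. (fst p, - snd p)) \<in> measurable (borel \<Otimes>\<^sub>M borel) (borel \<Otimes>\<^sub>M (borel :: 'a measure))" by measurable
    from measurable_sets[OF this sI[OF N(1), of I]] show ?thesis by (simp add: vimage_def space_pair_measure)
  qed
  let ?M = "gauss_points N B"
  interpret Q: pair_sigma_finite ?M "gauss B" ..
  have sec: "{G. z \<in> icone (lk G) K J} \<in> sets borel" if "finite J" for z :: 'a and J K :: "nat set"
    using sets_Pair2[OF sI[OF that, of K], of z] by (simp add: vimage_def)
  \<comment> \<open>The spaces \<open>icone x J J\<close> are proper, so almost no \<open>z\<close> lies in one of them; Fubini then allows to fix \<open>z\<close> first.\<close>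
  have ae1: "AE G in ?M. AE z in gauss B. \<forall>J\<in>{J. J \<subseteq> N \<and> J \<noteq> {} \<and> card J \<le> d}. z \<notin> icone (lk G) J J"
    using AE_gauss_points_span[OF N(1) B(1)]
  proof eventually_elim
    case (elim G)
    show ?case
    proof (intro AE_finite_allI)
      fix J assume J: "J \<in> {J. J \<subseteq> N \<and> J \<noteq> {} \<and> card J \<le> d}"
      then have "finite J" using N(1) finite_subset by auto
      then show "AE z in gauss B. z \<notin> icone (lk G) J J"
        using J elim B by (intro AE_notin_icone_small[of J J]) auto
    qed (use N in auto)
  qed
  have ae2: "AE z in gauss B. AE G in ?M. \<forall>J\<in>{J. J \<subseteq> N \<and> J \<noteq> {} \<and> card J \<le> d}. z \<notin> icone (lk G) J J"
  proof -
    have "{p \<in> space (?M \<Otimes>\<^sub>M gauss B). \<forall>J\<in>{J. J \<subseteq> N \<and> J \<noteq> {} \<and> card J \<le> d}. snd p \<notin> icone (lk (fst p)) J J}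
       = (\<Inter>J\<in>{J. J \<subseteq> N \<and> J \<noteq> {} \<and> card J \<le> d}. space (borel \<Otimes>\<^sub>M borel) - {p. snd p \<in> icone (lk (fst p)) J J}) \<inter> space (borel \<Otimes>\<^sub>M borel)"
      by (auto simp: space_pair_measure)
    also have "\<dots> \<in> sets (borel \<Otimes>\<^sub>M borel)"
    proof (cases "{J. J \<subseteq> N \<and> J \<noteq> {} \<and> card J \<le> d} = {}")
      case False
      then show ?thesis
        using N(1) finite_subset[OF _ N(1)]
        by (intro sets.Int sets.finite_INT sets.Diff sets.top sI) auto
    next
      case True
      show ?thesis unfolding True by simp
    qed
    also have "sets (borel \<Otimes>\<^sub>M borel) = sets (?M \<Otimes>\<^sub>M gauss B)" by (simp cong: sets_pair_measure_cong)
    finally have "(AE G in ?M. AE z in gauss B. \<forall>J\<in>{J. J \<subseteq> N \<and> J \<noteq> {} \<and> card J \<le> d}. z \<notin> icone (lk G) J J)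
      \<longleftrightarrow> (AE z in gauss B. AE G in ?M. \<forall>J\<in>{J. J \<subseteq> N \<and> J \<noteq> {} \<and> card J \<le> d}. z \<notin> icone (lk G) J J)"
      by (rule Q.AE_commute)
    then show ?thesis using ae1 by blast
  qed
  have ae0: "AE z in gauss B. z \<noteq> 0"
  proof -
    obtain b where b: "b \<in> B" using B d1 by fastforce
    then have "b \<noteq> 0" using orthonormal_norm[OF B(1), of b] by auto
    then have "AE z in gauss B. z \<bullet> b \<noteq> 0"
      using B b by (intro AE_gauss_hyperplane) (auto intro: span_base)
    then show ?thesis by eventually_elim auto
  qed
  \<comment> \<open>For fixed \<open>z\<close>, the configuration is written in an orthonormal basis that contains the direction of \<open>z\<close>.\<close>
  have main: "emeasure ?M {G. z \<in> icone (lk G) I N} + emeasure ?M {G. - z \<in> icone (lk G) I N}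
      = ennreal ((1 - r) + (1 - proper_prob I N B))"
    if z: "z \<in> span B" "z \<noteq> 0" and generic_point: "AE G in ?M. \<forall>J\<in>{J. J \<subseteq> N \<and> J \<noteq> {} \<and> card J \<le> d}. z \<notin> icone (lk G) J J" for z
  proof -
    have sz: "sgn z \<in> span B" "norm (sgn z) = 1" using z by (auto simp: sgn_div_norm span_scale)
    obtain C where C: "orthonormal C" "sgn z \<in> C" "span C = span B" using gauss_exchange[OF B(1) sz] by blast
    let ?C = "C - {sgn z}"
    have fC: "finite C" using C by (simp add: orthonormal_finite)
    have cC: "card ?C = d - 1" using orthonormal_card_eq[OF C(1) B(1) C(3)] B C fC by simp
    have oC: "orthonormal ?C" using C(1) by (rule orthonormal_subset) auto
    have pC: "proper_prob I N ?C = r" using oC cC by (rule IH)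
    have spC: "u \<in> span ?C \<longleftrightarrow> u \<in> span B \<and> u \<bullet> z = 0" for u
      using orthonormal_span_remove[OF C(1,2)] C(3) z by (auto simp: sgn_div_norm)
    have mz: "{G. z \<in> icone (lk G) I N} \<in> sets ?M" "{G. - z \<in> icone (lk G) I N} \<in> sets ?M" using sec[OF N(1)] by auto
    have mt: "{G. proper_tangent ?C I N G} \<in> sets ?M" "{G. proper_tangent B I N G} \<in> sets ?M"
      using borel_proper_tangent[of ?C I N] borel_proper_tangent[OF fB, of I N] fC by auto
    have "emeasure ?M {G. z \<in> icone (lk G) I N} + emeasure ?M {G. - z \<in> icone (lk G) I N}
       = (\<integral>\<^sup>+G. indicator {G. z \<in> icone (lk G) I N} G + indicator {G. - z \<in> icone (lk G) I N} G \<partial>?M)"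
      using mz by (subst nn_integral_add) auto
    also have "\<dots> = (\<integral>\<^sup>+G. indicator (space ?M - {G. proper_tangent ?C I N G}) G + indicator (space ?M - {G. proper_tangent B I N G}) G \<partial>?M)"
    proof (rule nn_integral_cong_AE, rule AE_mp[OF generic_point], rule AE_mp[OF AE_gauss_points_general_position[OF N(1) B(1)]], rule AE_mp[OF AE_gauss_points_span[OF N(1) B(1)]], intro AE_I2 impI)
      fix G :: "nat \<Rightarrow>\<^sub>0 'a"
      assume G: "(\<forall>i. lk G i \<in> span B) \<and> (\<forall>i. i \<notin> N \<longrightarrow> lk G i = 0)" "general_position (lk G) N (card B)"
        "\<forall>J\<in>{J. J \<subseteq> N \<and> J \<noteq> {} \<and> card J \<le> d}. z \<notin> icone (lk G) J J"
      have "of_bool (z \<in> icone (lk G) I N) + of_bool (- z \<in> icone (lk G) I N)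
        = (of_bool (\<not> (\<exists>u\<in>span B. u \<noteq> 0 \<and> u \<bullet> z = 0 \<and> polar (lk G) I N u))
          + of_bool (\<not> (\<exists>u\<in>span B. u \<noteq> 0 \<and> polar (lk G) I N u)) :: ennreal)"
        using G(1,3) by (intro projection_dichotomy[OF N d(2) B _ z(1) G(2)[unfolded B(2)]]) auto
      moreover have "(\<exists>u\<in>span B. u \<noteq> 0 \<and> u \<bullet> z = 0 \<and> polar (lk G) I N u) \<longleftrightarrow> proper_tangent ?C I N G"
        unfolding proper_tangent_def using spC by blast
      ultimately show "indicator {G. z \<in> icone (lk G) I N} G + indicator {G. - z \<in> icone (lk G) I N} G
         = (indicator (space ?M - {G. proper_tangent ?C I N G}) G + indicator (space ?M - {G. proper_tangent B I N G}) G :: ennreal)"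
        unfolding proper_tangent_def by (simp add: indicator_def of_bool_def cong: if_cong)
    qed
    also have "\<dots> = emeasure ?M (space ?M - {G. proper_tangent ?C I N G}) + emeasure ?M (space ?M - {G. proper_tangent B I N G})"
      using mt by (subst nn_integral_add) auto
    also have "\<dots> = ennreal ((1 - r) + (1 - proper_prob I N B))"
    proof -
      have e: "measure ?M {G. proper_tangent ?C I N G} = r"
      proof -
        have "r \<ge> 0" unfolding pC[symmetric] proper_prob_def by simp
        then show ?thesis using emeasure_proper_tangent_projection[OF N(1,2) B(1) C] unfolding pC by (simp add: measure_def)
      qed
      have "emeasure ?M (space ?M - {G. proper_tangent ?C I N G}) = ennreal (1 - r)"
        using gauss.prob_compl[OF mt(1)] e by (simp only: gauss.emeasure_eq_measure)
      moreover have "emeasure ?M (space ?M - {G. proper_tangent B I N G}) = ennreal (1 - proper_prob I N B)"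
        using gauss.prob_compl[OF mt(2)] by (simp only: gauss.emeasure_eq_measure proper_prob_def)
      moreover have "1 - r \<ge> 0" "1 - proper_prob I N B \<ge> 0" using e gauss.prob_le_1 by (auto simp: proper_prob_def)
      ultimately show ?thesis by (simp only: ennreal_plus)
    qed
    finally show ?thesis .
  qed
  have r01: "0 \<le> (1 - r) + (1 - proper_prob I N B)"
  proof -
    obtain b where b: "b \<in> B" using B d1 by fastforce
    have "proper_prob I N (B - {b}) = r"
      using B b fB by (intro IH) (auto intro: orthonormal_subset)
    then have "r \<le> 1" "proper_prob I N B \<le> 1" using gauss.prob_le_1 by (auto simp: proper_prob_def)
    then show ?thesis by simp
  qed
  let ?f = "\<lambda>z. emeasure ?M {G. z \<in> icone (lk G) I N}"
  have mf: "?f \<in> borel_measurable borel" and mf': "(\<lambda>z. emeasure ?M {G. - z \<in> icone (lk G) I N}) \<in> borel_measurable borel"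
  proof -
    have A: "{p. snd p \<in> icone (lk (fst p)) I N} \<in> sets (borel :: ((nat \<Rightarrow>\<^sub>0 'a) \<times> 'a) measure)" using sI[OF N(1), of I] unfolding borel_prod .
    have "(\<lambda>p. (snd p, fst p)) \<in> measurable (borel :: ('a \<times> (nat \<Rightarrow>\<^sub>0 'a)) measure) borel"
      by (intro borel_measurable_Pair) (auto simp: borel_prod[symmetric])
    from measurable_sets_borel[OF this A]
    have "{p. fst p \<in> icone (lk (snd p)) I N} \<in> sets (borel :: ('a \<times> (nat \<Rightarrow>\<^sub>0 'a)) measure)"
      by (simp add: vimage_def)
    from measurable_emeasure_section[where P = "\<lambda>z G. z \<in> icone (lk G) I N", OF this[unfolded borel_prod[symmetric]]] show "?f \<in> borel_measurable borel" by simp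
    have "uminus \<in> measurable borel (borel :: 'a measure)" by measurable
    from measurable_compose[OF this \<open>?f \<in> borel_measurable borel\<close>]
    show "(\<lambda>z. emeasure ?M {G. - z \<in> icone (lk G) I N}) \<in> borel_measurable borel" by simp
  qed
  have U: "(\<integral>\<^sup>+z. ?f z \<partial>gauss B) = ennreal (hit_prob I N d)"
    using swap_sections[OF sI[OF N(1), of I], of "tensors (unitv N) B" B] emeasure_mem_icone[OF N(1,3,2) B(1)] B(2) by simp
  have U': "(\<integral>\<^sup>+z. ?f (- z) \<partial>gauss B) = ennreal (hit_prob I N d)"
  proof -
    have "(\<integral>\<^sup>+z. ?f z \<partial>gauss B) = (\<integral>\<^sup>+z. ?f z \<partial>distr (gauss B) borel uminus)" by (simp add: gauss_uminus[OF B(1)])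
    also have "\<dots> = (\<integral>\<^sup>+z. ?f (- z) \<partial>gauss B)" using mf by (subst nn_integral_distr) auto
    finally show ?thesis using U by simp
  qed
  have "ennreal (hit_prob I N d) + ennreal (hit_prob I N d) = (\<integral>\<^sup>+z. ?f z + ?f (- z) \<partial>gauss B)"
    using mf mf' U U' by (subst nn_integral_add) auto
  also have "\<dots> = (\<integral>\<^sup>+z. ennreal ((1 - r) + (1 - proper_prob I N B)) \<partial>gauss B)"
  proof (rule nn_integral_cong_AE, rule AE_mp[OF ae2], rule AE_mp[OF ae0], rule AE_mp[OF AE_gauss_span[OF B(1)]], intro AE_I2 impI)
    fix z :: 'a assume "z \<in> span B" "z \<noteq> 0" "AE G in ?M. \<forall>J\<in>{J. J \<subseteq> N \<and> J \<noteq> {} \<and> card J \<le> d}. z \<notin> icone (lk G) J J"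
    then show "?f z + ?f (- z) = ennreal ((1 - r) + (1 - proper_prob I N B))" by (rule main)
  qed
  also have "\<dots> = ennreal ((1 - r) + (1 - proper_prob I N B))" using gauss.emeasure_space_1[of B] by simp
  finally have fin: "ennreal (hit_prob I N d) + ennreal (hit_prob I N d) = ennreal ((1 - r) + (1 - proper_prob I N B))" .
  have u0: "0 \<le> hit_prob I N d" by (rule hit_prob_nonneg[OF N])
  have "ennreal (2 * hit_prob I N d) = ennreal ((1 - r) + (1 - proper_prob I N B))"
    using fin u0 by (simp add: ennreal_plus[symmetric] del: ennreal_plus)
  then show ?thesis using u0 r01 by (subst (asm) ennreal_inj) auto
qed

text \<open>
  The probability that the random cone in dimension \<open>d\<close> is proper and contains an independent Gaussian
  point, by \<open>emeasure_mem_proper_tangent\<close> for \<open>card I \<le> d + 1 \<le> card N\<close>.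
\<close>

definition alt_sum :: "nat set \<Rightarrow> nat set \<Rightarrow> nat \<Rightarrow> real" where
  "alt_sum I N d = (\<Sum>s<d. (- 1) ^ s * simplex_vol I N (d - 1 - s))"

lemma alt_sum_Suc: "alt_sum I N (Suc d) = simplex_vol I N d - alt_sum I N d"
proof -
  have "alt_sum I N (Suc d) = (- 1) ^ 0 * simplex_vol I N (Suc d - 1 - 0) + (\<Sum>s<d. (- 1) ^ Suc s * simplex_vol I N (Suc d - 1 - Suc s))"
    unfolding alt_sum_def by (rule sum.lessThan_Suc_shift)
  also have "(\<Sum>s<d. (- 1) ^ Suc s * simplex_vol I N (Suc d - 1 - Suc s)) = - alt_sum I N d"
    unfolding alt_sum_def sum_negf[symmetric] by (intro sum.cong) (auto simp: diff_commute)
  finally show ?thesis by simp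
qed

lemma simplex_vol_small:
  assumes "finite N" "k + 1 < card I"
  shows "simplex_vol I N k = 0"
proof -
  have "{J. I \<subseteq> J \<and> J \<subseteq> N \<and> card J = k + 1} = {}"
  proof -
    have False if J: "I \<subseteq> J" "J \<subseteq> N" "card J = k + 1" for J
      using card_mono[OF finite_subset[OF J(2) assms(1)] J(1)] J(3) assms(2) by simp
    then show ?thesis by blast
  qed
  then show ?thesis unfolding simplex_vol_def by (metis (no_types, lifting) sum.empty)
qed

lemma alt_sum_reverse: "alt_sum I N d = (- 1) ^ (d + 1) * (\<Sum>k<d. (- 1) ^ k * simplex_vol I N k)"
proof (induction d)
  case (Suc d)
  have "(- 1 :: real) ^ d * (- 1) ^ d = 1" by (simp add: power_mult_distrib[symmetric])
  then show ?case by (simp add: alt_sum_Suc Suc algebra_simps)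
qed (simp add: alt_sum_def)

text \<open>
  Solves the recursion of \<open>proper_prob_step\<close>. It starts at \<open>card I = d + 1\<close>, where the cone contains the whole
  space, all quantities \<open>simplex_vol I N k\<close> with \<open>k < d\<close> vanish, and \<open>proper_prob I N B = 0\<close>.
\<close>

theorem proper_prob_formula:
  fixes B :: "'a::{real_inner,second_countable_topology} set"
  assumes N: "finite N" "I \<subseteq> N" "I \<noteq> {}"
  shows "orthonormal B \<Longrightarrow> card B = d \<Longrightarrow> card I \<le> d + 1 \<Longrightarrow> d + 1 \<le> card N \<Longrightarrow> proper_prob I N B = alt_sum I N d + 1 - hit_prob I N d"
proof (induction d arbitrary: B)
  case 0
  then have "span B = {0}" by (simp add: orthonormal_finite)
  then have "proper_prob I N B = 0" by (simp add: proper_prob_def proper_tangent_def)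
  then show ?case by (simp add: alt_sum_def hit_prob_def)
next
  case (Suc d)
  show ?case
  proof (cases "card I \<le> Suc d")
    case True
    have "proper_prob I N C = alt_sum I N d + 1 - hit_prob I N d" if "orthonormal C" "card C = Suc d - 1" for C :: "'a set"
      using that True Suc.prems by (intro Suc.IH) auto
    from proper_prob_step[OF N Suc.prems(1,2) True Suc.prems(4) this]
    have "proper_prob I N B = 2 - 2 * hit_prob I N (Suc d) - (alt_sum I N d + 1 - hit_prob I N d)" by simp
    moreover have "hit_prob I N (Suc d) = hit_prob I N d - simplex_vol I N d" by (simp add: hit_prob_def)
    ultimately show ?thesis by (simp add: alt_sum_Suc)
  next
    case False
    then have cI: "card I = Suc d + 1" using Suc.prems by simp
    have "AE G in gauss_points N B. \<not> proper_tangent B I N G"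
      using AE_gauss_points_general_position[OF N(1) Suc.prems(1)] AE_gauss_points_span[OF N(1) Suc.prems(1)]
    proof eventually_elim
      case (elim G)
      have "general_position (lk G) N (Suc d)" using elim(1) Suc.prems(2) by simp
      then show ?case
        unfolding proper_tangent_def
        using polar_trivial_of_full[OF N, of "Suc d" B "lk G"] cI Suc.prems(1,2) elim(2) by simp
    qed
    then have "proper_prob I N B = 0"
      unfolding proper_prob_def using borel_proper_tangent[of B I N] Suc.prems(1)
      by (subst gauss.prob_eq_0) (auto simp: orthonormal_finite)
    moreover have "alt_sum I N (Suc d) = 0"
      unfolding alt_sum_def using simplex_vol_small[OF N(1)] cI by (intro sum.neutral) auto
    moreover have "hit_prob I N (Suc d) = 1" using hit_prob_small[OF N(1)] cI by simp
    ultimately show ?thesis by simp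
  qed
qed

text \<open>
  The alternating sum of the conic intrinsic volumes of a cone that is not a subspace vanishes. Here it
  follows from \<open>proper_prob_formula\<close> in dimension \<open>card N - 1\<close>, where the points are affinely independent
  and all tangent cones at proper faces are proper.
\<close>

theorem gauss_bonnet_simplex:
  assumes N: "finite N" "I \<subset> N" "I \<noteq> {}"
  shows "(\<Sum>k<card N. (- 1) ^ k * simplex_vol I N k) = 0"
proof -
  have fI: "finite I" using N finite_subset by blast
  have "card N > 0" using N by (metis card_gt_0_iff psubset_imp_subset subset_empty)
  then obtain m where m: "card N = Suc m" using gr0_implies_Suc by blast
  \<comment> \<open>\<open>unitv S\<close> serves as an orthonormal system of \<open>card N - 1\<close> vectors.\<close>
  obtain S where S: "S \<subseteq> N" "card S = m" using obtain_subset_with_card_n[of m N] m by auto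
  let ?B = "unitv S"
  have fS: "finite S" using S N finite_subset by blast
  have B: "orthonormal ?B" "card ?B = m" using S fS by (auto simp: orthonormal_unitv card_unitv)
  have cI: "card I \<le> m" using psubset_card_mono[OF N(1,2)] m by simp
  have "AE G in gauss_points N ?B. proper_tangent ?B I N G"
    using AE_gauss_points_general_position[OF N(1) B(1)] AE_gauss_points_span[OF N(1) B(1)]
  proof eventually_elim
    case (elim G)
    have "affine_indep (lk G) N" using elim(1) B(2) m by (simp add: general_position_def)
    then show ?case
      unfolding proper_tangent_def using elim(2) N by (intro polar_nontrivial_of_simplex) auto
  qed
  then have "proper_prob I N ?B = 1"
    unfolding proper_prob_def using borel_proper_tangent[of ?B I N] B(1)
    by (subst gauss.prob_eq_1) (auto simp: orthonormal_finite)
  then have "alt_sum I N m = hit_prob I N m"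
    using proper_prob_formula[of N I ?B m] N B cI m by auto
  also have "hit_prob I N m = simplex_vol I N m"
  proof -
    have "(\<Sum>k<Suc m. simplex_vol I N k) = 1"
    proof -
      have "{J. I \<subseteq> J \<and> J \<subseteq> N \<and> card J \<le> Suc m} = {J. I \<subseteq> J \<and> J \<subseteq> N}"
        using card_mono[OF N(1)] m by auto
      then show ?thesis using sum_simplex_vol[OF N(1,3), of "Suc m"] sum_angles_simplex[OF N(1) _ N(3)] N(2) by auto
    qed
    then show ?thesis by (simp add: hit_prob_def)
  qed
  finally have "alt_sum I N (Suc m) = 0" by (simp add: alt_sum_Suc)
  then show ?thesis unfolding m alt_sum_reverse by (simp del: sum.lessThan_Suc)
qed

text \<open>
  A cone that is not proper contains every point, so the probability is \<open>hit_prob\<close> minus the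
  probability of a full cone.
\<close>

theorem emeasure_mem_proper_tangent:
  fixes B :: "'a::{real_inner,second_countable_topology} set"
  assumes N: "finite N" "I \<subseteq> N" "I \<noteq> {}" and B: "orthonormal B" "card B = d" and d: "card I \<le> d + 1" "d + 1 \<le> card N"
  shows "(\<integral>\<^sup>+G. emeasure (gauss B) {z. z \<in> icone (lk G) I N} * indicator {G. proper_tangent B I N G} G \<partial>gauss_points N B) = ennreal (alt_sum I N d)"
    and "0 \<le> alt_sum I N d"
proof -
  let ?M = "gauss_points N B"
  let ?X = "{G. proper_tangent B I N G}"
  have mX: "?X \<in> sets ?M" using borel_proper_tangent[of B I N] B by (simp add: orthonormal_finite)
  have sI: "{p. snd p \<in> icone (lk (fst p)) I N} \<in> sets (borel \<Otimes>\<^sub>M (borel :: 'a measure))"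
    unfolding borel_prod by (rule borel_mem_icone[OF N(1)])
  have mf: "(\<lambda>G. emeasure (gauss B) {z. z \<in> icone (lk G) I N}) \<in> borel_measurable ?M"
    using measurable_emeasure_section[OF sI, of B] by (simp cong: measurable_cong_sets)
  have U: "(\<integral>\<^sup>+G. emeasure (gauss B) {z. z \<in> icone (lk G) I N} \<partial>?M) = ennreal (hit_prob I N d)"
    using emeasure_mem_icone[OF N(1,3,2) B(1)] B(2) by simp
  have "(\<integral>\<^sup>+G. emeasure (gauss B) {z. z \<in> icone (lk G) I N} \<partial>?M)
     = (\<integral>\<^sup>+G. emeasure (gauss B) {z. z \<in> icone (lk G) I N} * indicator ?X G + indicator (space ?M - ?X) G \<partial>?M)"
  proof (rule nn_integral_cong_AE, rule AE_mp[OF AE_gauss_points_span[OF N(1) B(1)]], intro AE_I2 impI)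
    fix G :: "nat \<Rightarrow>\<^sub>0 'a" assume G: "(\<forall>i. lk G i \<in> span B) \<and> (\<forall>i. i \<notin> N \<longrightarrow> lk G i = 0)"
    show "emeasure (gauss B) {z. z \<in> icone (lk G) I N}
      = emeasure (gauss B) {z. z \<in> icone (lk G) I N} * indicator ?X G + indicator (space ?M - ?X) G"
    proof (cases "proper_tangent B I N G")
      case False
      have "AE z in gauss B. z \<in> {z. z \<in> icone (lk G) I N}"
        using AE_gauss_span[OF B(1)]
      proof eventually_elim
        case (elim z)
        then show ?case
          using polar_trivial_imp_mem[OF N(1,2), of "lk G" B z] G False unfolding proper_tangent_def by auto
      qed
      then have "emeasure (gauss B) {z. z \<in> icone (lk G) I N} = 1"
        using borel_icone[OF N(1), of "lk G" I] by (intro gauss.emeasure_eq_1_AE) auto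
      then show ?thesis using False by simp
    qed simp
  qed
  also have "\<dots> = (\<integral>\<^sup>+G. emeasure (gauss B) {z. z \<in> icone (lk G) I N} * indicator ?X G \<partial>?M) + emeasure ?M (space ?M - ?X)"
    using mf mX by (subst nn_integral_add) auto
  also have "emeasure ?M (space ?M - ?X) = ennreal (1 - proper_prob I N B)"
    using gauss.prob_compl[OF mX] by (simp only: gauss.emeasure_eq_measure proper_prob_def)
  finally have e: "ennreal (hit_prob I N d) = (\<integral>\<^sup>+G. emeasure (gauss B) {z. z \<in> icone (lk G) I N} * indicator ?X G \<partial>?M) + ennreal (1 - proper_prob I N B)"
    using U by simp
  have p: "1 - proper_prob I N B \<ge> 0" using gauss.prob_le_1 by (simp add: proper_prob_def)
  let ?Y = "\<integral>\<^sup>+G. emeasure (gauss B) {z. z \<in> icone (lk G) I N} * indicator ?X G \<partial>?M"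
  obtain r where r: "?Y = ennreal r" "r \<ge> 0"
    using e by (cases ?Y) auto
  then have "ennreal (hit_prob I N d) = ennreal (r + (1 - proper_prob I N B))" using e p by (simp add: ennreal_plus)
  moreover have "hit_prob I N d \<ge> 0" by (rule hit_prob_nonneg[OF N])
  ultimately have "hit_prob I N d = r + (1 - proper_prob I N B)" using r p by (subst (asm) ennreal_inj) auto
  then have "r = alt_sum I N d" using proper_prob_formula[OF N B d] by simp
  then show "?Y = ennreal (alt_sum I N d)" "0 \<le> alt_sum I N d" using r by simp_all
qed

section \<open>Faces and tangent cones of polytopes\<close>

lemma convex_hull_image_finite:
  fixes x :: "'i \<Rightarrow> 'a::real_vector"
  assumes "finite N"
  shows "convex hull (x ` N) = {\<Sum>i\<in>N. m i *\<^sub>R x i | m. (\<forall>i\<in>N. 0 \<le> m i) \<and> sum m N = 1}"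
proof (rule subset_antisym)
  show "convex hull (x ` N) \<subseteq> {\<Sum>i\<in>N. m i *\<^sub>R x i | m. (\<forall>i\<in>N. 0 \<le> m i) \<and> sum m N = 1}"
  proof (rule hull_minimal)
    show "x ` N \<subseteq> {\<Sum>i\<in>N. m i *\<^sub>R x i | m. (\<forall>i\<in>N. 0 \<le> m i) \<and> sum m N = 1}"
    proof clarify
      fix i assume "i \<in> N"
      then show "\<exists>m. x i = (\<Sum>i\<in>N. m i *\<^sub>R x i) \<and> (\<forall>i\<in>N. 0 \<le> m i) \<and> sum m N = 1"
        using assms by (intro exI[of _ "\<lambda>k. if k = i then 1 else 0"]) (auto simp: if_distrib[of "\<lambda>c. c *\<^sub>R _"] cong: if_cong)
    qed
    show "convex {\<Sum>i\<in>N. m i *\<^sub>R x i | m. (\<forall>i\<in>N. 0 \<le> m i) \<and> sum m N = 1}"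
    proof (rule convexI)
      fix p q and u v :: real
      assume p: "p \<in> {\<Sum>i\<in>N. m i *\<^sub>R x i | m. (\<forall>i\<in>N. 0 \<le> m i) \<and> sum m N = 1}"
        and q: "q \<in> {\<Sum>i\<in>N. m i *\<^sub>R x i | m. (\<forall>i\<in>N. 0 \<le> m i) \<and> sum m N = 1}"
        and uv: "0 \<le> u" "0 \<le> v" "u + v = 1"
      then obtain a b where ab: "p = (\<Sum>i\<in>N. a i *\<^sub>R x i)" "\<forall>i\<in>N. 0 \<le> a i" "sum a N = 1"
        "q = (\<Sum>i\<in>N. b i *\<^sub>R x i)" "\<forall>i\<in>N. 0 \<le> b i" "sum b N = 1" by blast
      have "u *\<^sub>R p + v *\<^sub>R q = (\<Sum>i\<in>N. (u * a i + v * b i) *\<^sub>R x i)"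
        by (simp add: ab scaleR_sum_right scaleR_left_distrib sum.distrib)
      moreover have "sum (\<lambda>i. u * a i + v * b i) N = 1"
        using ab uv by (simp add: sum.distrib sum_distrib_left[symmetric])
      ultimately show "u *\<^sub>R p + v *\<^sub>R q \<in> {\<Sum>i\<in>N. m i *\<^sub>R x i | m. (\<forall>i\<in>N. 0 \<le> m i) \<and> sum m N = 1}"
        using ab uv by (auto intro!: exI[of _ "\<lambda>i. u * a i + v * b i"])
    qed
  qed
  show "{\<Sum>i\<in>N. m i *\<^sub>R x i | m. (\<forall>i\<in>N. 0 \<le> m i) \<and> sum m N = 1} \<subseteq> convex hull (x ` N)"
  proof clarify
    fix m :: "'i \<Rightarrow> real" assume "\<forall>i\<in>N. 0 \<le> m i" "sum m N = 1"
    then show "(\<Sum>i\<in>N. m i *\<^sub>R x i) \<in> convex hull (x ` N)"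
      using assms by (intro convex_sum) (auto intro: hull_inc)
  qed
qed

text \<open>
  The directions that lead from \<open>f\<close> into a convex set form a convex cone.
\<close>

lemma feasible_directions:
  fixes P :: "'a::real_vector set"
  assumes "convex P" "f \<in> P"
  defines "K \<equiv> {v. \<exists>\<epsilon>>0. f + \<epsilon> *\<^sub>R v \<in> P}"
  shows "0 \<in> K" "\<And>v w. v \<in> K \<Longrightarrow> w \<in> K \<Longrightarrow> v + w \<in> K" "\<And>t v. v \<in> K \<Longrightarrow> t \<ge> 0 \<Longrightarrow> t *\<^sub>R v \<in> K"
    "\<And>p. p \<in> P \<Longrightarrow> p - f \<in> K"
proof -
  show z: "0 \<in> K" using assms by (auto simp: K_def intro!: exI[of _ 1])
  show "p - f \<in> K" if "p \<in> P" for p using that by (auto simp: K_def intro!: exI[of _ 1])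
  show "v + w \<in> K" if vw: "v \<in> K" "w \<in> K" for v w
  proof -
    obtain a b where ab: "a > 0" "f + a *\<^sub>R v \<in> P" "b > 0" "f + b *\<^sub>R w \<in> P" using vw by (auto simp: K_def)
    define t s where "t = b / (a + b)" and "s = a / (a + b)"
    have ts: "t \<ge> 0" "s \<ge> 0" "t + s = 1"
      using ab by (simp_all add: t_def s_def add_divide_distrib[symmetric] add.commute)
    have "t *\<^sub>R (f + a *\<^sub>R v) + s *\<^sub>R (f + b *\<^sub>R w) \<in> P"
      using assms(1) ab ts by (intro convexD) auto
    moreover have "t *\<^sub>R (f + a *\<^sub>R v) + s *\<^sub>R (f + b *\<^sub>R w) = f + (a * b / (a + b)) *\<^sub>R (v + w)"
    proof -
      have "t *\<^sub>R (f + a *\<^sub>R v) + s *\<^sub>R (f + b *\<^sub>R w) = (t + s) *\<^sub>R f + ((t * a) *\<^sub>R v + (s * b) *\<^sub>R w)"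
        by (simp add: scaleR_right_distrib scaleR_left_distrib)
      moreover have "t * a = a * b / (a + b)" "s * b = a * b / (a + b)" by (auto simp: t_def s_def)
      ultimately show ?thesis using ts(3) by (simp only: scaleR_right_distrib scaleR_one)
    qed
    ultimately show ?thesis using ab by (auto simp: K_def intro!: exI[of _ "a * b / (a + b)"])
  qed
  show "t *\<^sub>R v \<in> K" if v: "v \<in> K" "t \<ge> 0" for t v
  proof (cases "t = 0")
    case False
    obtain a where a: "a > 0" "f + a *\<^sub>R v \<in> P" using v by (auto simp: K_def)
    have "f + (a / t) *\<^sub>R (t *\<^sub>R v) \<in> P" using a False by simp
    then show ?thesis using a v False by (auto simp: K_def intro!: exI[of _ "a / t"])
  qed (use z in simp)
qed

text \<open>
  A point \<open>f\<close> of the relative interior of the face is a strict convex combination of each vertex and another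
  point of the face, so the directions from \<open>f\<close> into the face include \<open>f - x j\<close>. The existence of such \<open>f\<close>
  is an assumption, since it is to be applied in a space that is not finite-dimensional.
\<close>

lemma tangent_cone_hull:
  fixes x :: "nat \<Rightarrow> 'a::real_normed_vector"
  assumes N: "finite N" "I \<subseteq> N" "I \<noteq> {}"
    and f: "f \<in> rel_interior (convex hull (x ` I))"
    and ext: "\<And>j. j \<in> I \<Longrightarrow> \<exists>e>1. (1 - e) *\<^sub>R x j + e *\<^sub>R f \<in> convex hull (x ` I)"
  shows "tangent_cone (convex hull (x ` I)) (convex hull (x ` N)) = icone x I N"
proof -
  let ?F = "convex hull (x ` I)" and ?P = "convex hull (x ` N)"
  have fI: "finite I" by (rule finite_subset[OF N(2,1)])
  have FP: "?F \<subseteq> ?P" using N by (intro hull_mono) auto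
  have ri: "rel_interior ?F \<subseteq> ?F" by (auto simp: rel_interior_def)
  have fF: "f \<in> ?F" using f ri by blast
  let ?K = "{v. \<exists>\<epsilon>>0. f + \<epsilon> *\<^sub>R v \<in> ?P}"
  have fP: "f \<in> ?P" using fF FP by blast
  note fd = feasible_directions[OF convex_convex_hull fP]
  have "icone x I N \<subseteq> ?K"
  proof -
    obtain j0 where j0: "j0 \<in> I" using N by auto
    show ?thesis
    proof (rule icone_least[OF j0 N(2)])
      fix i j assume ij: "i \<in> N" "j \<in> I"
      have "x i \<in> ?P" using ij by (intro hull_inc) auto
      then have 1: "x i - f \<in> ?K" by (rule fd(4))
      obtain e where e: "e > 1" "(1 - e) *\<^sub>R x j + e *\<^sub>R f \<in> ?F" using ext[OF ij(2)] by blast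
      have "(1 - e) *\<^sub>R x j + e *\<^sub>R f = f + (e - 1) *\<^sub>R (f - x j)" by (simp add: algebra_simps)
      then have "f + (e - 1) *\<^sub>R (f - x j) \<in> ?P" using e FP by auto
      then have 2: "f - x j \<in> ?K" using e by (auto intro!: exI[of _ "e - 1"])
      from fd(2)[OF 1 2] show "x i - x j \<in> ?K" by simp
    qed (use fd in auto)
  qed
  then have "icone x I N \<subseteq> tangent_cone ?F ?P" unfolding tangent_cone_def using f by blast
  moreover have "tangent_cone ?F ?P \<subseteq> icone x I N"
  proof
    fix v assume "v \<in> tangent_cone ?F ?P"
    then obtain g e where g: "g \<in> rel_interior ?F" "e > 0" "g + e *\<^sub>R v \<in> ?P" by (auto simp: tangent_cone_def)
    then have "g \<in> ?F" using ri by blast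
    then obtain a where a: "g = (\<Sum>i\<in>I. a i *\<^sub>R x i)" "sum a I = 1" unfolding convex_hull_image_finite[OF fI] by blast
    obtain b where b: "g + e *\<^sub>R v = (\<Sum>i\<in>N. b i *\<^sub>R x i)" "\<forall>i\<in>N. 0 \<le> b i" "sum b N = 1"
      using g(3) unfolding convex_hull_image_finite[OF N(1)] by blast
    define a' where "a' i = (if i \<in> I then a i else 0)" for i
    have a': "(\<Sum>i\<in>N. a' i *\<^sub>R x i) = g" "sum a' N = 1"
      unfolding a(1) a(2)[symmetric] using N by (auto intro!: sum.mono_neutral_cong_right simp: a'_def)
    let ?l = "\<lambda>i. if i \<in> N then (b i - a' i) / e else 0"
    have "sum ?l N = (\<Sum>i\<in>N. (b i - a' i) / e)" by (intro sum.cong) auto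
    also have "\<dots> = 0" using a' b by (simp add: sum_divide_distrib[symmetric] sum_subtractf)
    finally have "?l \<in> coef I N" using b g by (auto simp: coef_def a'_def)
    moreover have "v = (\<Sum>i\<in>N. ?l i *\<^sub>R x i)"
    proof -
      have "(\<Sum>i\<in>N. ?l i *\<^sub>R x i) = (\<Sum>i\<in>N. (1 / e) *\<^sub>R (b i *\<^sub>R x i - a' i *\<^sub>R x i))"
        by (intro sum.cong) (auto simp: scaleR_left_diff_distrib diff_divide_distrib scaleR_right_diff_distrib)
      also have "\<dots> = (1 / e) *\<^sub>R ((g + e *\<^sub>R v) - g)"
        by (simp only: scaleR_sum_right[symmetric] sum_subtractf a'(1) b(1))
      also have "\<dots> = v" using g by simp
      finally show ?thesis by simp
    qed
    ultimately show "v \<in> icone x I N" by (rule iconeI)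
  qed
  ultimately show ?thesis by blast
qed

lemma tangent_cone_polytope:
  fixes x :: "nat \<Rightarrow> 'a::euclidean_space"
  assumes N: "finite N" "I \<subseteq> N" "I \<noteq> {}"
  shows "tangent_cone (convex hull (x ` I)) (convex hull (x ` N)) = icone x I N"
proof -
  obtain f where f: "f \<in> rel_interior (convex hull (x ` I))"
    using rel_interior_eq_empty[OF convex_convex_hull[of "x ` I"]] N by auto
  show ?thesis
  proof (rule tangent_cone_hull[OF N f])
    fix j assume "j \<in> I"
    then have "x j \<in> convex hull (x ` I)" by (intro hull_inc) auto
    then show "\<exists>e>1. (1 - e) *\<^sub>R x j + e *\<^sub>R f \<in> convex hull (x ` I)"
      using bspec[OF convex_rel_interior_if2[OF convex_convex_hull f] hull_inc] by blast
  qed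
qed

lemma convex_icone: "convex (icone x I J)"
  by (rule convexI) (intro icone_add icone_scale; assumption)

text \<open>
  The tangent cone of a tangent cone is the tangent cone at the larger face.
\<close>

lemma tangent_cone_icone:
  fixes x :: "nat \<Rightarrow> 'a::euclidean_space"
  assumes N: "finite N" "I \<subseteq> J" "J \<subseteq> N" "I \<noteq> {}"
  shows "tangent_cone (icone x I J) (icone x I N) = icone x J N"
proof -
  let ?F = "icone x I J" and ?C = "icone x I N"
  have fJ: "finite J" by (rule finite_subset[OF N(3,1)])
  have FC: "?F \<subseteq> ?C" using N by (intro icone_mono)
  obtain f where f: "f \<in> rel_interior ?F"
    using rel_interior_eq_empty[OF convex_icone[of x I J]] icone_zero[of x I J] by blast
  have fF: "f \<in> ?F" using f rel_interior_subset by blast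
  have fC: "f \<in> ?C" using fF FC by blast
  obtain j0 where j0: "j0 \<in> I" using N by auto
  let ?K = "{v. \<exists>\<epsilon>>0. f + \<epsilon> *\<^sub>R v \<in> ?C}"
  note fd = feasible_directions[OF convex_icone fC]
  have "icone x J N \<subseteq> ?K"
  proof (rule icone_least[of j0 J])
    fix i j assume ij: "i \<in> N" "j \<in> J"
    have "x i - x j0 \<in> ?C" using N ij j0 by (intro icone_diff_mem) auto
    then have "f + (x i - x j0) \<in> ?C" by (intro icone_add fC)
    then have 1: "x i - x j0 \<in> ?K" by (auto intro!: exI[of _ 1])
    have "x j - x j0 \<in> ?F" using N ij j0 fJ by (intro icone_diff_mem) auto
    then have pF: "f + (x j - x j0) \<in> ?F" by (intro icone_add fF)
    then obtain e where e: "e > 1" "(1 - e) *\<^sub>R (f + (x j - x j0)) + e *\<^sub>R f \<in> ?F"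
      using bspec[OF convex_rel_interior_if2[OF convex_icone f] hull_inc] by blast
    have "(1 - e) *\<^sub>R (f + (x j - x j0)) + e *\<^sub>R f = f + (e - 1) *\<^sub>R (x j0 - x j)" by (simp add: algebra_simps)
    then have "f + (e - 1) *\<^sub>R (x j0 - x j) \<in> ?C" using e FC by auto
    then have 2: "x j0 - x j \<in> ?K" using e by (auto intro!: exI[of _ "e - 1"])
    from fd(2)[OF 1 2] show "x i - x j \<in> ?K" by simp
  qed (use fd N j0 in auto)
  then have "icone x J N \<subseteq> tangent_cone ?F ?C" unfolding tangent_cone_def using f by blast
  moreover have "tangent_cone ?F ?C \<subseteq> icone x J N"
  proof
    fix v assume "v \<in> tangent_cone ?F ?C"
    then obtain g e where g: "g \<in> rel_interior ?F" "e > 0" "g + e *\<^sub>R v \<in> ?C" by (auto simp: tangent_cone_def)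
    then have "g \<in> ?F" using rel_interior_subset by blast
    then have "g \<in> icone x J J" using icone_mono_left[OF N(2)] by blast
    then have "- g \<in> icone x J J" by (rule subspace_neg[OF subspace_lin])
    then have "- g \<in> icone x J N" using icone_mono[OF N(1,3)] by blast
    moreover have "g + e *\<^sub>R v \<in> icone x J N" using g(3) icone_mono_left[OF N(2)] by blast
    ultimately have "(g + e *\<^sub>R v) + - g \<in> icone x J N" using icone_add by blast
    then have "e *\<^sub>R v \<in> icone x J N" by simp
    from icone_scale[OF this, of "1 / e"] show "v \<in> icone x J N" using g(2) by simp
  qed
  ultimately show ?thesis by blast
qed

lemma normal_cone_icone:
  fixes x :: "nat \<Rightarrow> 'a::euclidean_space"
  assumes N: "finite N" "I \<subseteq> J" "J \<subseteq> N" "I \<noteq> {}"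
  shows "normal_cone UNIV (icone x I J) (icone x I N) = {w \<in> span Basis. polar x J N w}"
proof -
  have "J \<noteq> {}" using N by auto
  then have "(\<forall>u\<in>icone x J N. w \<bullet> u \<le> 0) \<longleftrightarrow> polar x J N w" for w
    using polar_inner_icone[of x J N w] N unfolding polar_def
    by (meson icone_diff_mem subset_iff)
  then show ?thesis unfolding normal_cone_def tangent_cone_icone[OF N] by (simp add: span_Basis)
qed

text \<open>
  The dimension of the affine hull of the points.
\<close>

definition hull_dim :: "('i \<Rightarrow> 'a::euclidean_space) \<Rightarrow> 'i set \<Rightarrow> nat" where
  "hull_dim x J = dim (icone x J J)"

lemma aff_dim_icone:
  fixes x :: "nat \<Rightarrow> 'a::euclidean_space"
  assumes "finite J" "I \<subseteq> J" "I \<noteq> {}"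
  shows "aff_dim (icone x I J) = int (hull_dim x J)"
proof -
  obtain j where "j \<in> I" using assms by auto
  have "0 \<in> affine hull (icone x I J)" by (rule hull_inc) simp
  then have "aff_dim (icone x I J) = int (dim (icone x I J))" by (rule aff_dim_zero)
  also have "dim (icone x I J) = dim (span (icone x I J))" by (rule dim_span[symmetric])
  also have "span (icone x I J) = icone x J J" using assms \<open>j \<in> I\<close> by (intro span_icone)
  finally show ?thesis by (simp add: hull_dim_def)
qed

lemma aff_dim_hull_hull_dim:
  fixes x :: "nat \<Rightarrow> 'a::euclidean_space"
  assumes "finite J" "J \<noteq> {}"
  shows "aff_dim (convex hull (x ` J)) = int (hull_dim x J)"
proof -
  obtain j where j: "j \<in> J" using assms by auto
  let ?A = "(\<lambda>i. x i - x j) ` J"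
  have "aff_dim (convex hull (x ` J)) = aff_dim ((\<lambda>y. - x j + y) ` (x ` J))"
    by (simp only: aff_dim_convex_hull aff_dim_translation_eq)
  also have "(\<lambda>y. - x j + y) ` (x ` J) = ?A" by (auto simp: image_image)
  also have "aff_dim ?A = int (dim ?A)"
    using j by (intro aff_dim_zero hull_inc) (auto simp: image_iff intro!: bexI[of _ j])
  also have "dim ?A = dim (span ?A)" by (rule dim_span[symmetric])
  also have "?A = insert 0 ((\<lambda>i. x i - x j) ` (J - {j}))" using j by auto
  also have "span \<dots> = icone x J J" using lin_eq_span[OF assms(1) j, of x] by (simp add: span_insert_0)
  finally show ?thesis by (simp add: hull_dim_def)
qed

lemma face_index_functional:
  fixes x :: "nat \<Rightarrow> 'a::euclidean_space"
  assumes "face_index UNIV x N I" "I \<noteq> {}"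
  obtains u c where "I \<subseteq> N" "\<And>i. i \<in> I \<Longrightarrow> u \<bullet> x i = c" "\<And>i. i \<in> N - I \<Longrightarrow> u \<bullet> x i < c"
proof -
  obtain u where u: "\<And>i j. i \<in> I \<Longrightarrow> j \<in> I \<Longrightarrow> u \<bullet> (x i - x j) = 0"
    "\<And>i j. i \<in> N - I \<Longrightarrow> j \<in> I \<Longrightarrow> u \<bullet> (x i - x j) < 0" "I \<subseteq> N"
    using assms(1) unfolding face_index_def by blast
  obtain j where j: "j \<in> I" using assms by auto
  show ?thesis
  proof (rule that[of u "u \<bullet> x j"])
    show "u \<bullet> x i = u \<bullet> x j" if "i \<in> I" for i using u(1)[OF that j] by (simp add: inner_diff_right)
    show "u \<bullet> x i < u \<bullet> x j" if "i \<in> N - I" for i using u(2)[OF that j] by (simp add: inner_diff_right)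
  qed fact
qed

text \<open>
  A convex combination attains the maximal value \<open>c\<close> only if all its weight is on \<open>I\<close>.
\<close>

lemma hull_supporting_face:
  fixes x :: "nat \<Rightarrow> 'a::euclidean_space"
  assumes N: "finite N" "I \<subseteq> N" and u: "\<And>i. i \<in> I \<Longrightarrow> u \<bullet> x i = c" "\<And>i. i \<in> N - I \<Longrightarrow> u \<bullet> x i < c"
  shows "convex hull (x ` I) = convex hull (x ` N) \<inter> {y. u \<bullet> y = c}" "convex hull (x ` N) \<subseteq> {y. u \<bullet> y \<le> c}"
proof -
  have fI: "finite I" by (rule finite_subset[OF N(2,1)])
  have val: "u \<bullet> (\<Sum>i\<in>N. m i *\<^sub>R x i) = c - (\<Sum>i\<in>N. m i * (c - u \<bullet> x i))" if "sum m N = 1" for m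
  proof -
    have "(\<Sum>i\<in>N. m i * (c - u \<bullet> x i)) = c * sum m N - (\<Sum>i\<in>N. m i * (u \<bullet> x i))"
      by (simp add: right_diff_distrib sum_subtractf sum_distrib_left mult.commute)
    then show ?thesis using that by (simp add: inner_sum_right)
  qed
  have nn: "0 \<le> c - u \<bullet> x i" if "i \<in> N" for i using u that by (cases "i \<in> I") (auto simp: less_imp_le)
  show "convex hull (x ` N) \<subseteq> {y. u \<bullet> y \<le> c}"
  proof
    fix y assume "y \<in> convex hull (x ` N)"
    then obtain m where m: "y = (\<Sum>i\<in>N. m i *\<^sub>R x i)" "\<forall>i\<in>N. 0 \<le> m i" "sum m N = 1"
      unfolding convex_hull_image_finite[OF N(1)] by blast
    have "0 \<le> (\<Sum>i\<in>N. m i * (c - u \<bullet> x i))" using m nn by (intro sum_nonneg) auto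
    then show "y \<in> {y. u \<bullet> y \<le> c}" using val[OF m(3)] m(1) by simp
  qed
  show "convex hull (x ` I) = convex hull (x ` N) \<inter> {y. u \<bullet> y = c}"
  proof (rule subset_antisym)
    have "convex hull (x ` I) \<subseteq> {y. u \<bullet> y = c}"
      using u by (intro hull_minimal convex_hyperplane) auto
    moreover have "convex hull (x ` I) \<subseteq> convex hull (x ` N)" using N by (intro hull_mono) auto
    ultimately show "convex hull (x ` I) \<subseteq> convex hull (x ` N) \<inter> {y. u \<bullet> y = c}" by blast
    show "convex hull (x ` N) \<inter> {y. u \<bullet> y = c} \<subseteq> convex hull (x ` I)"
    proof
      fix y assume y: "y \<in> convex hull (x ` N) \<inter> {y. u \<bullet> y = c}"
      then obtain m where m: "y = (\<Sum>i\<in>N. m i *\<^sub>R x i)" "\<forall>i\<in>N. 0 \<le> m i" "sum m N = 1"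
        unfolding convex_hull_image_finite[OF N(1)] by blast
      have "(\<Sum>i\<in>N. m i * (c - u \<bullet> x i)) = 0" using val[OF m(3)] m(1) y by simp
      then have "\<forall>i\<in>N. m i * (c - u \<bullet> x i) = 0"
        using m nn by (subst (asm) sum_nonneg_eq_0_iff) (auto simp: N)
      then have m0: "m i = 0" if "i \<in> N - I" for i using u(2)[OF that] that by fastforce
      have "(\<Sum>i\<in>N. m i *\<^sub>R x i) = (\<Sum>i\<in>I. m i *\<^sub>R x i)" "sum m N = sum m I"
        using N m0 by (auto intro!: sum.mono_neutral_right)
      then have "y = (\<Sum>i\<in>I. m i *\<^sub>R x i)" "sum m I = 1" using m by simp_all
      moreover have "\<forall>i\<in>I. 0 \<le> m i" using m(2) N(2) by auto
      ultimately show "y \<in> convex hull (x ` I)"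
        unfolding convex_hull_image_finite[OF fI] by blast
    qed
  qed
qed

text \<open>
  All faces of a polytope are exposed.
\<close>

lemma face_of_hull_iff:
  fixes x :: "nat \<Rightarrow> 'a::euclidean_space"
  assumes N: "finite N"
  shows "F face_of convex hull (x ` N) \<and> F \<noteq> {} \<longleftrightarrow> (\<exists>I. I \<noteq> {} \<and> face_index UNIV x N I \<and> F = convex hull (x ` I))"
proof
  assume F: "F face_of convex hull (x ` N) \<and> F \<noteq> {}"
  have "polyhedron (convex hull (x ` N))"
    using N by (intro polytope_imp_polyhedron) (auto simp: polytope_def)
  then have "F exposed_face_of convex hull (x ` N)" using F exposed_face_of_polyhedron by blast
  then obtain u c where u: "convex hull (x ` N) \<subseteq> {y. u \<bullet> y \<le> c}" "F = convex hull (x ` N) \<inter> {y. u \<bullet> y = c}"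
    unfolding exposed_face_of_def by blast
  let ?I = "{i\<in>N. u \<bullet> x i = c}"
  have le: "u \<bullet> x i \<le> c" if "i \<in> N" for i using u(1) that hull_inc[of "x i" "x ` N"] by auto
  have "F = convex hull (x ` ?I)"
    unfolding u(2) using le N by (intro hull_supporting_face(1)[symmetric]) (auto simp: less_le)
  moreover have "?I \<noteq> {}" using calculation F by auto
  moreover have "face_index UNIV x N ?I"
    unfolding face_index_def using le by (auto simp: inner_diff_right less_le intro!: exI[of _ u])
  ultimately show "\<exists>I. I \<noteq> {} \<and> face_index UNIV x N I \<and> F = convex hull (x ` I)" by (intro exI[of _ ?I] conjI)
next
  assume "\<exists>I. I \<noteq> {} \<and> face_index UNIV x N I \<and> F = convex hull (x ` I)"
  then obtain I where I: "I \<noteq> {}" "face_index UNIV x N I" "F = convex hull (x ` I)" by blast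
  obtain u c where u: "I \<subseteq> N" "\<And>i. i \<in> I \<Longrightarrow> u \<bullet> x i = c" "\<And>i. i \<in> N - I \<Longrightarrow> u \<bullet> x i < c"
    using face_index_functional[OF I(2,1)] by blast
  note h = hull_supporting_face[where x = x and u = u and c = c, OF N u(1)]
  have "convex hull (x ` I) = convex hull (x ` N) \<inter> {y. u \<bullet> y = c}" "convex hull (x ` N) \<subseteq> {y. u \<bullet> y \<le> c}"
    by (rule h; simp add: u)+
  then have "F face_of convex hull (x ` N)"
    unfolding I(3) by (simp only:) (intro face_of_Int_supporting_hyperplane_le convex_convex_hull, auto)
  then show "F face_of convex hull (x ` N) \<and> F \<noteq> {}" using I by simp
qed

text \<open>
  The index set is determined by the face, hence sums over faces become sums over index sets.
\<close>

lemma face_index_hull_inj: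
  fixes x :: "nat \<Rightarrow> 'a::euclidean_space"
  assumes N: "finite N" and I: "face_index UNIV x N I" "I \<noteq> {}"
  shows "I = {i\<in>N. x i \<in> convex hull (x ` I)}"
proof -
  obtain u c where u: "I \<subseteq> N" "\<And>i. i \<in> I \<Longrightarrow> u \<bullet> x i = c" "\<And>i. i \<in> N - I \<Longrightarrow> u \<bullet> x i < c"
    using face_index_functional[OF I] by blast
  have "x i \<in> convex hull (x ` I)" if "i \<in> I" for i using that by (intro hull_inc) auto
  moreover have "x i \<notin> convex hull (x ` I)" if "i \<in> N - I" for i
  proof
    assume "x i \<in> convex hull (x ` I)"
    then have "u \<bullet> x i = c" using hull_supporting_face(1)[of N I u x c] N u by blast
    then show False using u(3)[OF that] by simp
  qed
  ultimately show ?thesis using u(1) by blast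
qed

lemma polyhedron_icone:
  fixes x :: "nat \<Rightarrow> 'a::euclidean_space"
  assumes N: "finite N" "I \<subseteq> N" "I \<noteq> {}"
  shows "polyhedron (icone x I N)"
proof -
  let ?S = "(\<lambda>(i,j). x i - x j) ` (N \<times> I)"
  obtain j0 where j0: "j0 \<in> I" using N by auto
  have "icone x I N = convex_cone hull ?S"
  proof (rule subset_antisym)
    show "icone x I N \<subseteq> convex_cone hull ?S"
      by (rule icone_least[OF j0 N(2)])
         (auto intro: convex_cone_hull_contains_0 convex_cone_hull_add convex_cone_hull_mul hull_inc)
    have "convex_cone (icone x I N)"
      unfolding convex_cone_def conic_def using convex_icone icone_scale icone_zero by blast
    then show "convex_cone hull ?S \<subseteq> icone x I N"
      using N by (intro hull_minimal) (auto intro!: icone_diff_mem)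
  qed
  moreover have "finite ?S" using N finite_subset[OF N(2,1)] by simp
  ultimately show ?thesis by (simp add: polyhedron_convex_cone_hull)
qed

lemma icone_supporting_face:
  fixes x :: "nat \<Rightarrow> 'a::euclidean_space"
  assumes N: "finite N" "I \<subseteq> J" "I \<noteq> {}" "J \<subseteq> N"
    and u: "\<And>i j. i \<in> J \<Longrightarrow> j \<in> J \<Longrightarrow> u \<bullet> (x i - x j) = 0" "\<And>i j. i \<in> N - J \<Longrightarrow> j \<in> J \<Longrightarrow> u \<bullet> (x i - x j) < 0"
  shows "icone x I J = icone x I N \<inter> {y. u \<bullet> y = 0}" "icone x I N \<subseteq> {y. u \<bullet> y \<le> 0}"
proof -
  have IN: "I \<subseteq> N" using N by auto
  have pol: "polar x I N u"
    unfolding polar_def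
  proof (intro ballI)
    fix i j assume "i \<in> N" "j \<in> I"
    then show "u \<bullet> (x i - x j) \<le> 0" using u(1)[of i j] u(2)[of i j] N by (cases "i \<in> J") (auto simp: less_imp_le subset_iff)
  qed
  show "icone x I N \<subseteq> {y. u \<bullet> y \<le> 0}" using polar_inner_icone[OF pol IN N(3)] by auto
  have KJ: "{i\<in>N. \<forall>j\<in>I. u \<bullet> (x i - x j) = 0} = J"
  proof -
    obtain j where j: "j \<in> I" using N by auto
    have "i \<in> J" if "i \<in> N" "\<forall>j\<in>I. u \<bullet> (x i - x j) = 0" for i
      using u(2)[of i j] that j N by (cases "i \<in> J") auto
    then show ?thesis using u(1) N by blast
  qed
  show "icone x I J = icone x I N \<inter> {y. u \<bullet> y = 0}"
  proof (rule subset_antisym)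
    have "u \<bullet> p = 0" if "p \<in> icone x I J" for p
    proof (rule lin_orthogonal[of J])
      show "p \<in> icone x J J" using that icone_mono_left[OF N(2)] by blast
    qed (rule u(1))
    then show "icone x I J \<subseteq> icone x I N \<inter> {y. u \<bullet> y = 0}" using icone_mono[OF N(1,4)] by blast
    show "icone x I N \<inter> {y. u \<bullet> y = 0} \<subseteq> icone x I J"
    proof
      fix p assume "p \<in> icone x I N \<inter> {y. u \<bullet> y = 0}"
      then show "p \<in> icone x I J" using icone_face[OF pol IN N(3,1), of p] unfolding KJ by simp
    qed
  qed
qed

text \<open>
  A cone has the same faces as the polytope that it is tangent to, as far as they contain \<open>I\<close>.
\<close>

lemma face_of_icone_iff:
  fixes x :: "nat \<Rightarrow> 'a::euclidean_space"
  assumes N: "finite N" "I \<subseteq> N" "I \<noteq> {}"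
  shows "F face_of icone x I N \<and> F \<noteq> {} \<longleftrightarrow> (\<exists>J. I \<subseteq> J \<and> face_index UNIV x N J \<and> F = icone x I J)"
proof
  assume F: "F face_of icone x I N \<and> F \<noteq> {}"
  then have "F exposed_face_of icone x I N" using exposed_face_of_polyhedron[OF polyhedron_icone[OF N]] by blast
  then obtain u c where u: "icone x I N \<subseteq> {y. u \<bullet> y \<le> c}" "F = icone x I N \<inter> {y. u \<bullet> y = c}"
    unfolding exposed_face_of_def by blast
  have c0: "c = 0"
  proof -
    have "0 \<le> c" using u(1) icone_zero[of x I N] by (metis (mono_tags, lifting) inner_zero_right mem_Collect_eq subsetD)
    obtain y where y: "y \<in> icone x I N" "u \<bullet> y = c" using F u(2) by blast
    then have "2 *\<^sub>R y \<in> icone x I N" by (intro icone_scale) auto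
    then have "u \<bullet> (2 *\<^sub>R y) \<le> c" using u(1) by blast
    then show ?thesis using y \<open>0 \<le> c\<close> by simp
  qed
  have le: "u \<bullet> (x i - x j) \<le> 0" if "i \<in> N" "j \<in> I" for i j
    using u(1) icone_diff_mem[OF N(1), of i j I x] that N c0 by blast
  obtain j0 where j0: "j0 \<in> I" using N by auto
  let ?J = "{i\<in>N. u \<bullet> (x i - x j0) = 0}"
  have IJ: "I \<subseteq> ?J"
  proof
    fix i assume i: "i \<in> I"
    then have "u \<bullet> (x i - x j0) \<le> 0" "u \<bullet> (x j0 - x i) \<le> 0" using le j0 N by auto
    then show "i \<in> ?J" using i N by (auto simp: inner_diff_right)
  qed
  have e: "u \<bullet> (x i - x j) = 0" if "i \<in> ?J" "j \<in> ?J" for i j using that by (auto simp: inner_diff_right)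
  have l: "u \<bullet> (x i - x j) < 0" if "i \<in> N - ?J" "j \<in> ?J" for i j
  proof -
    have "u \<bullet> (x i - x j0) \<le> 0" "u \<bullet> (x i - x j0) \<noteq> 0" "u \<bullet> (x j - x j0) = 0" using that le j0 by auto
    then show ?thesis by (simp add: inner_diff_right)
  qed
  have JN: "?J \<subseteq> N" by auto
  have "F = icone x I ?J" using icone_supporting_face(1)[where x = x, OF N(1) IJ N(3) JN e l] u(2) c0 by simp
  moreover have "face_index UNIV x N ?J" unfolding face_index_def using e l JN by blast
  ultimately show "\<exists>J. I \<subseteq> J \<and> face_index UNIV x N J \<and> F = icone x I J" using IJ by blast
next
  assume "\<exists>J. I \<subseteq> J \<and> face_index UNIV x N J \<and> F = icone x I J"
  then obtain J where J: "I \<subseteq> J" "face_index UNIV x N J" "F = icone x I J" by blast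
  then obtain u where u: "\<And>i j. i \<in> J \<Longrightarrow> j \<in> J \<Longrightarrow> u \<bullet> (x i - x j) = 0"
    "\<And>i j. i \<in> N - J \<Longrightarrow> j \<in> J \<Longrightarrow> u \<bullet> (x i - x j) < 0" "J \<subseteq> N" unfolding face_index_def by blast
  have "icone x I J = icone x I N \<inter> {y. u \<bullet> y = 0}" "icone x I N \<subseteq> {y. u \<bullet> y \<le> 0}"
    by (rule icone_supporting_face[OF N(1) J(1) N(3) u(3)]; simp add: u)+
  then have "F face_of icone x I N"
    unfolding J(3) by (simp only:) (intro face_of_Int_supporting_hyperplane_le convex_icone, auto)
  then show "F face_of icone x I N \<and> F \<noteq> {}" using J icone_zero by blast
qed

lemma face_index_icone_inj:
  fixes x :: "nat \<Rightarrow> 'a::euclidean_space"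
  assumes N: "finite N" and J: "face_index UNIV x N J" "I \<subseteq> J" and j: "j \<in> I"
  shows "J = {i\<in>N. x i - x j \<in> icone x I J}"
proof -
  obtain u where u: "\<And>i j. i \<in> J \<Longrightarrow> j \<in> J \<Longrightarrow> u \<bullet> (x i - x j) = 0"
    "\<And>i j. i \<in> N - J \<Longrightarrow> j \<in> J \<Longrightarrow> u \<bullet> (x i - x j) < 0" "J \<subseteq> N" using J(1) unfolding face_index_def by blast
  have fJ: "finite J" by (rule finite_subset[OF u(3) N])
  have "x i - x j \<in> icone x I J" if "i \<in> J" for i using that fJ j J(2) by (intro icone_diff_mem) auto
  moreover have "x i - x j \<notin> icone x I J" if "i \<in> N - J" for i
  proof
    assume "x i - x j \<in> icone x I J"
    then have "u \<bullet> (x i - x j) = 0"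
      using icone_supporting_face(1)[where x = x, OF N(1) J(2) _ u(3,1,2)] j by blast
    moreover have "u \<bullet> (x i - x j) < 0" using u(2)[OF that] j J(2) by blast
    ultimately show False by simp
  qed
  ultimately show ?thesis using u(3) by blast
qed

lemma conic_intrinsic_volume_icone:
  fixes x :: "nat \<Rightarrow> 'a::euclidean_space"
  assumes N: "finite N" "I \<subseteq> N" "I \<noteq> {}"
  shows "conic_intrinsic_volume k (icone x I N)
    = (\<Sum>J | I \<subseteq> J \<and> face_index UNIV x N J \<and> hull_dim x J = k. measure (gauss Basis) {z. kkt x I J N z})"
proof -
  obtain j where j: "j \<in> I" using N by auto
  let ?S = "{J. I \<subseteq> J \<and> face_index UNIV x N J \<and> hull_dim x J = k}"
  have dimJ: "aff_dim (icone x I J) = int (hull_dim x J)" if "I \<subseteq> J" "J \<subseteq> N" for J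
    using that N finite_subset[OF that(2) N(1)] by (intro aff_dim_icone)
  have faces: "faces k (icone x I N) = icone x I ` ?S"
  proof (intro set_eqI iffI)
    fix F assume "F \<in> faces k (icone x I N)"
    then have F: "F face_of icone x I N" "aff_dim F = int k" by (auto simp: faces_def)
    then have "F \<noteq> {}" by auto
    then obtain J where J: "I \<subseteq> J" "face_index UNIV x N J" "F = icone x I J" using F(1) face_of_icone_iff[OF N] by blast
    then show "F \<in> icone x I ` ?S" using F(2) dimJ[of J] by (auto simp: face_index_def)
  next
    fix F assume "F \<in> icone x I ` ?S"
    then obtain J where J: "I \<subseteq> J" "face_index UNIV x N J" "F = icone x I J" "hull_dim x J = k" by blast
    then have "F face_of icone x I N" using face_of_icone_iff[OF N] by blast
    then show "F \<in> faces k (icone x I N)" using J dimJ[of J] by (auto simp: faces_def face_index_def)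
  qed
  have inj: "inj_on (icone x I) ?S"
  proof (rule inj_onI)
    fix J J' assume J: "J \<in> ?S" "J' \<in> ?S" and eq: "icone x I J = icone x I J'"
    have "J = {i\<in>N. x i - x j \<in> icone x I J}" using J by (intro face_index_icone_inj N j) auto
    moreover have "J' = {i\<in>N. x i - x j \<in> icone x I J'}" using J by (intro face_index_icone_inj N j) auto
    ultimately show "J = J'" using eq by simp
  qed
  have "conic_intrinsic_volume k (icone x I N)
    = (\<Sum>J\<in>?S. solid_angle (icone x I J) * solid_angle (normal_cone UNIV (icone x I J) (icone x I N)))"
    unfolding conic_intrinsic_volume_def faces by (simp add: sum.reindex[OF inj])
  also have "\<dots> = (\<Sum>J\<in>?S. measure (gauss Basis) {z. kkt x I J N z})"
  proof (intro sum.cong refl)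
    fix J assume J: "J \<in> ?S"
    then have JN: "J \<subseteq> N" by (auto simp: face_index_def)
    have "measure (gauss Basis) {z. kkt x I J N z} = solid_angle (icone x I J) * solid_angle {w \<in> span Basis. polar x J N w}"
      using N J by (intro measure_kkt_split orthonormal_Basis) (auto simp: span_Basis)
    then show "solid_angle (icone x I J) * solid_angle (normal_cone UNIV (icone x I J) (icone x I N)) = measure (gauss Basis) {z. kkt x I J N z}"
      using normal_cone_icone[OF N(1) _ JN N(3), of x] J by (simp add: span_Basis)
  qed
  finally show ?thesis .
qed

text \<open>
  The formula holds in all positions, and its right-hand side is visibly measurable in \<open>x\<close>: only
  finitely many index sets occur.
\<close>

theorem face_sum_polytope:
  fixes x :: "nat \<Rightarrow> 'a::euclidean_space"
  assumes N: "finite N"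
  shows "(\<Sum>F\<in>faces j (convex hull (x ` N)). conic_intrinsic_volume k (tangent_cone F (convex hull (x ` N))))
    = (\<Sum>I | I \<noteq> {} \<and> face_index UNIV x N I \<and> hull_dim x I = j.
        \<Sum>J | I \<subseteq> J \<and> face_index UNIV x N J \<and> hull_dim x J = k. measure (gauss Basis) {z. kkt x I J N z})"
proof -
  let ?P = "convex hull (x ` N)"
  let ?S = "{I. I \<noteq> {} \<and> face_index UNIV x N I \<and> hull_dim x I = j}"
  have sub: "I \<subseteq> N" "finite I" if "I \<in> ?S" for I using that N finite_subset by (auto simp: face_index_def)
  have faces: "faces j ?P = (\<lambda>I. convex hull (x ` I)) ` ?S"
  proof (intro set_eqI iffI)
    fix F assume "F \<in> faces j ?P"
    then have F: "F face_of ?P" "aff_dim F = int j" by (auto simp: faces_def)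
    then have "F \<noteq> {}" by auto
    then obtain I where I: "I \<noteq> {}" "face_index UNIV x N I" "F = convex hull (x ` I)" using F(1) face_of_hull_iff[OF N] by blast
    moreover have "finite I" using I(2) N finite_subset by (auto simp: face_index_def)
    ultimately show "F \<in> (\<lambda>I. convex hull (x ` I)) ` ?S" using F(2) aff_dim_hull_hull_dim[of I x] by auto
  next
    fix F assume "F \<in> (\<lambda>I. convex hull (x ` I)) ` ?S"
    then obtain I where I: "I \<in> ?S" "F = convex hull (x ` I)" by blast
    then have "F face_of ?P" using face_of_hull_iff[OF N] by blast
    then show "F \<in> faces j ?P" using I sub[OF I(1)] aff_dim_hull_hull_dim[of I x] by (auto simp: faces_def)
  qed
  have inj: "inj_on (\<lambda>I. convex hull (x ` I)) ?S"
  proof (rule inj_onI)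
    fix I I' assume I: "I \<in> ?S" "I' \<in> ?S" and eq: "convex hull (x ` I) = convex hull (x ` I')"
    have "I = {i\<in>N. x i \<in> convex hull (x ` I)}" using I by (intro face_index_hull_inj N) auto
    moreover have "I' = {i\<in>N. x i \<in> convex hull (x ` I')}" using I by (intro face_index_hull_inj N) auto
    ultimately show "I = I'" using eq by simp
  qed
  show ?thesis
    unfolding faces sum.reindex[OF inj] o_def
  proof (intro sum.cong refl)
    fix I assume I: "I \<in> ?S"
    then show "conic_intrinsic_volume k (tangent_cone (convex hull (x ` I)) ?P)
      = (\<Sum>J | I \<subseteq> J \<and> face_index UNIV x N J \<and> hull_dim x J = k. measure (gauss Basis) {z. kkt x I J N z})"
      using sub[OF I] tangent_cone_polytope[OF N, of I x] conic_intrinsic_volume_icone[OF N, of I k x] by simp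
  qed
qed

lemma affine_indep_of_independent:
  fixes x :: "'i \<Rightarrow> 'a::real_vector"
  assumes "finite K" "j \<in> K" "inj_on (\<lambda>i. x i - x j) (K - {j})" "independent ((\<lambda>i. x i - x j) ` (K - {j}))"
  shows "affine_indep x K"
  unfolding affine_indep_def
proof (intro ballI impI allI)
  fix l k assume l: "l \<in> coef K K" "(\<Sum>i\<in>K. l i *\<^sub>R x i) = 0"
  have "(\<Sum>i\<in>K. l i *\<^sub>R x i) = (\<Sum>i\<in>K. l i *\<^sub>R (x i - x j))"
    using l(1) by (simp add: coef_def scaleR_diff_right sum_subtractf scaleR_sum_left[symmetric])
  also have "\<dots> = (\<Sum>i\<in>K - {j}. l i *\<^sub>R (x i - x j))"
    using assms by (intro sum.mono_neutral_right) auto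
  finally have z: "(\<Sum>i\<in>K - {j}. l i *\<^sub>R (x i - x j)) = 0" using l(2) by simp
  have "l i = 0" if "i \<in> K - {j}" for i
  proof -
    let ?g = "inv_into (K - {j}) (\<lambda>i. x i - x j)"
    have "(\<Sum>v\<in>(\<lambda>i. x i - x j) ` (K - {j}). l (?g v) *\<^sub>R v) = (\<Sum>i\<in>K - {j}. l i *\<^sub>R (x i - x j))"
      unfolding sum.reindex[OF assms(3)] o_def by (intro sum.cong refl) (simp only: inv_into_f_f[OF assms(3)])
    then have s0: "(\<Sum>v\<in>(\<lambda>i. x i - x j) ` (K - {j}). l (?g v) *\<^sub>R v) = 0" using z by simp
    have "l (?g (x i - x j)) = 0"
      by (rule independentD[OF assms(4) _ subset_refl s0 imageI[OF that]]) (simp add: assms(1))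
    then show ?thesis by (simp only: inv_into_f_f[OF assms(3) that])
  qed
  then have "\<forall>i\<in>K - {j}. l i = 0" by blast
  moreover have "sum l K = l j + sum l (K - {j})" using assms by (simp add: sum.remove)
  moreover have "sum l K = 0" "k \<notin> K \<Longrightarrow> l k = 0" using l(1) by (auto simp: coef_def)
  ultimately show "l k = 0" by (cases "k \<in> K"; cases "k = j") auto
qed

text \<open>
  Turns the dimension into a finite combination of events of affine independence, for measurability.
\<close>

lemma hull_dim_ge_iff:
  fixes x :: "nat \<Rightarrow> 'a::euclidean_space"
  assumes J: "finite J" "J \<noteq> {}"
  shows "m \<le> hull_dim x J \<longleftrightarrow> (\<exists>K\<subseteq>J. card K = m + 1 \<and> affine_indep x K)"
proof
  assume m: "m \<le> hull_dim x J"
  obtain j where j: "j \<in> J" using J by auto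
  let ?A = "(\<lambda>i. x i - x j) ` (J - {j})"
  obtain S where S: "S \<subseteq> ?A" "independent S" "?A \<subseteq> span S" by (rule maximal_independent_subset)
  obtain L where L: "L \<subseteq> J - {j}" "inj_on (\<lambda>i. x i - x j) L" "S = (\<lambda>i. x i - x j) ` L"
    using S(1) subset_image_inj[of S "\<lambda>i. x i - x j" "J - {j}"] by blast
  have fL: "finite L" using finite_subset[OF L(1)] J by simp
  have "span S = span ?A" using S(1,3) by (simp add: span_mono span_minimal subset_antisym)
  then have "dim (icone x J J) = card S"
    using S(2) lin_eq_span[OF J(1) j, of x] by (metis dim_span_eq_card_independent)
  then have cL: "card L = hull_dim x J" using L by (simp add: hull_dim_def card_image)
  have jL: "j \<notin> L" using L by auto
  have IL: "insert j L - {j} = L" using jL by auto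
  have "affine_indep x (insert j L)"
    using fL L S(2) by (intro affine_indep_of_independent[of _ j]) (simp_all add: jL)
  note ai = this
  obtain L' where L': "L' \<subseteq> L" "card L' = m" using m cL obtain_subset_with_card_n by metis
  have "finite L'" by (rule finite_subset[OF L'(1) fL])
  moreover have "j \<notin> L'" using jL L'(1) by blast
  ultimately have "card (insert j L') = m + 1" using L'(2) by simp
  moreover have "insert j L' \<subseteq> J" using L(1) L'(1) j by blast
  moreover have "affine_indep x (insert j L')" using L'(1) fL by (intro affine_indep_subset[OF ai]) auto
  ultimately have "insert j L' \<subseteq> J \<and> card (insert j L') = m + 1 \<and> affine_indep x (insert j L')" by blast
  then show "\<exists>K\<subseteq>J. card K = m + 1 \<and> affine_indep x K" by blast
next
  assume "\<exists>K\<subseteq>J. card K = m + 1 \<and> affine_indep x K"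
  then obtain K where K: "K \<subseteq> J" "card K = m + 1" "affine_indep x K" by blast
  have fK: "finite K" by (rule finite_subset[OF K(1) J(1)])
  have "K \<noteq> {}" using K by auto
  then obtain j where j: "j \<in> K" by auto
  note ind = affine_indep_imp_independent[OF K(3) fK j]
  have "card ((\<lambda>i. x i - x j) ` (K - {j})) = m" using card_image[OF ind(1)] K j fK by simp
  moreover have "(\<lambda>i. x i - x j) ` (K - {j}) \<subseteq> icone x J J"
    using K j J by (auto intro!: icone_diff_mem)
  ultimately show "m \<le> hull_dim x J" unfolding hull_dim_def using independent_card_le_dim[OF _ ind(2)] by metis
qed

lemma hull_dim_affine_indep:
  fixes x :: "nat \<Rightarrow> 'a::euclidean_space"
  assumes "affine_indep x J" "finite J" "J \<noteq> {}"
  shows "hull_dim x J + 1 = card J"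
proof -
  have "card J - 1 \<le> hull_dim x J"
    using assms by (subst hull_dim_ge_iff) (auto intro!: exI[of _ J] simp: card_gt_0_iff Suc_leI)
  moreover have "\<not> card J \<le> hull_dim x J"
  proof
    assume "card J \<le> hull_dim x J"
    then obtain K where "K \<subseteq> J" "card K = card J + 1" using hull_dim_ge_iff[OF assms(2,3)] by blast
    then show False using card_mono[OF assms(2), of K] by simp
  qed
  moreover have "card J > 0" using assms by (simp add: card_gt_0_iff)
  ultimately show ?thesis by simp
qed

lemma borel_hull_dim:
  fixes J :: "nat set"
  assumes "finite J" "J \<noteq> {}"
  shows "{G :: nat \<Rightarrow>\<^sub>0 'a::euclidean_space. hull_dim (lk G) J = k} \<in> sets borel"
proof -
  have ge: "{G :: nat \<Rightarrow>\<^sub>0 'a. m \<le> hull_dim (lk G) J} \<in> sets borel" for m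
  proof -
    have "{G :: nat \<Rightarrow>\<^sub>0 'a. m \<le> hull_dim (lk G) J} = (\<Union>K\<in>{K. K \<subseteq> J \<and> card K = m + 1}. {G. affine_indep (lk G) K})"
      using hull_dim_ge_iff[OF assms] by blast
    also have "\<dots> \<in> sets borel"
      using assms(1) finite_subset[OF _ assms(1)] by (intro sets.finite_UN borel_affine_indep) auto
    finally show ?thesis .
  qed
  have "{G :: nat \<Rightarrow>\<^sub>0 'a. hull_dim (lk G) J = k} = {G. k \<le> hull_dim (lk G) J} - {G. Suc k \<le> hull_dim (lk G) J}" by auto
  then show ?thesis using ge by simp
qed

section \<open>The law of a random point configuration\<close>

lemma bounded_linear_single: "bounded_linear (Poly_Mapping.single i :: 'a::real_inner \<Rightarrow> 'i \<Rightarrow>\<^sub>0 'a)"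
proof (rule bounded_linear_intro[where K = 1])
  show "Poly_Mapping.single i (r *\<^sub>R v) = r *\<^sub>R Poly_Mapping.single i v" for r and v :: 'a
    by (rule poly_mapping_eqI) (simp add: lookup_single when_def)
qed (simp_all add: single_add)

lemma measurable_single [measurable]:
  "(Poly_Mapping.single i :: 'a::{real_inner,second_countable_topology} \<Rightarrow> nat \<Rightarrow>\<^sub>0 'a) \<in> borel_measurable borel"
  by (intro borel_measurable_continuous_onI linear_continuous_on bounded_linear_single)

lemma gauss_points_singleton:
  fixes B :: "'a::{real_inner,second_countable_topology} set"
  assumes "finite B"
  shows "gauss_points {i} B = distr (gauss B) borel (Poly_Mapping.single i)"
proof -
  have "tens (Poly_Mapping.single i 1) b = Poly_Mapping.single i b" for b :: 'a
    by (rule poly_mapping_eqI) (simp add: lookup_single when_def)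
  then have "tensors (unitv {i}) B = Poly_Mapping.single i ` B"
    by (auto simp: tensors_def unitv_def image_iff)
  moreover have "linear (Poly_Mapping.single i :: 'a \<Rightarrow> nat \<Rightarrow>\<^sub>0 'a)"
    using bounded_linear_single by (rule bounded_linear.linear)
  moreover have "inj_on (Poly_Mapping.single i :: 'a \<Rightarrow> nat \<Rightarrow>\<^sub>0 'a) B"
    by (rule inj_onI) (metis lookup_single_eq)
  ultimately show ?thesis using gauss_image[OF assms, of "Poly_Mapping.single i :: 'a \<Rightarrow> nat \<Rightarrow>\<^sub>0 'a"] by simp
qed

text \<open>
  Induction on \<open>N\<close>, adding one independent point to the configuration.
\<close>

lemma nn_integral_PiM_gauss:
  fixes B :: "'a::{real_inner,second_countable_topology} set"
  assumes B: "orthonormal B" and "finite N" and [measurable]: "f \<in> borel_measurable borel"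
  shows "(\<integral>\<^sup>+x. f (\<Sum>i\<in>N. Poly_Mapping.single i (x i)) \<partial>(\<Pi>\<^sub>M i\<in>N. gauss B)) = (\<integral>\<^sup>+G. f G \<partial>gauss_points N B)"
  using assms(2,3)
proof (induction N arbitrary: f)
  case empty
  show ?case by (simp add: PiM_empty nn_integral_count_space_finite tensors_def unitv_def gauss_empty nn_integral_return empty.prems)
next
  case (insert i N)
  note [measurable] = insert.prems
  interpret P: product_sigma_finite "\<lambda>_. gauss B" ..
  have fB: "finite B" using B by (rule orthonormal_finite)
  let ?s = "Poly_Mapping.single i :: 'a \<Rightarrow> nat \<Rightarrow>\<^sub>0 'a"
  have ins: "unitv (insert i N) = unitv N \<union> unitv {i}" by (auto simp: unitv_def)
  have dis: "tensors (unitv N) B \<inter> tensors (unitv {i}) B = {}"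
  proof (rule tensors_disjoint)
    show "orthonormal (unitv N \<union> unitv {i})" unfolding ins[symmetric] using insert by (intro orthonormal_unitv) simp
    have "Poly_Mapping.single i (1 :: real) \<noteq> Poly_Mapping.single j 1" if "j \<in> N" for j
      using insert.hyps(2) that by (metis lookup_single_eq lookup_single_not_eq zero_neq_one)
    then have "Poly_Mapping.single i (1 :: real) \<notin> (\<lambda>j. Poly_Mapping.single j 1) ` N" by blast
    then show "unitv N \<inter> unitv {i} = {} \<or> B \<inter> B = {}" unfolding unitv_def by simp
  qed (simp add: B)
  have "(\<integral>\<^sup>+x. f (\<Sum>k\<in>insert i N. Poly_Mapping.single k (x k)) \<partial>(\<Pi>\<^sub>M i\<in>insert i N. gauss B))
    = (\<integral>\<^sup>+x. \<integral>\<^sup>+y. f (\<Sum>k\<in>insert i N. Poly_Mapping.single k ((x(i := y)) k)) \<partial>gauss B \<partial>(\<Pi>\<^sub>M i\<in>N. gauss B))"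
    using insert.hyps by (intro P.product_nn_integral_insert) measurable
  also have "\<dots> = (\<integral>\<^sup>+x. (\<integral>\<^sup>+y. f ((\<Sum>k\<in>N. Poly_Mapping.single k (x k)) + ?s y) \<partial>gauss B) \<partial>(\<Pi>\<^sub>M i\<in>N. gauss B))"
  proof (intro nn_integral_cong)
    fix x :: "nat \<Rightarrow> 'a" and y :: 'a
    have "(\<Sum>k\<in>N. Poly_Mapping.single k ((x(i := y)) k)) = (\<Sum>k\<in>N. Poly_Mapping.single k (x k))"
      using insert.hyps(2) by (intro sum.cong) auto
    then have "(\<Sum>k\<in>insert i N. Poly_Mapping.single k ((x(i := y)) k)) = (\<Sum>k\<in>N. Poly_Mapping.single k (x k)) + ?s y"
      using insert.hyps by (simp add: add.commute)
    then show "f (\<Sum>k\<in>insert i N. Poly_Mapping.single k ((x(i := y)) k)) = f ((\<Sum>k\<in>N. Poly_Mapping.single k (x k)) + ?s y)"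
      by (rule arg_cong)
  qed
  also have "\<dots> = (\<integral>\<^sup>+G. (\<integral>\<^sup>+y. f (G + ?s y) \<partial>gauss B) \<partial>gauss_points N B)"
    by (rule insert.IH) measurable
  also have "\<dots> = (\<integral>\<^sup>+G. \<integral>\<^sup>+H. f (G + H) \<partial>gauss_points {i} B \<partial>gauss_points N B)"
    unfolding gauss_points_singleton[OF fB] by (intro nn_integral_cong nn_integral_distr[symmetric]) measurable
  also have "\<dots> = (\<integral>\<^sup>+G. f G \<partial>gauss_points (insert i N) B)"
    unfolding ins tensors_Un
    using insert.hyps(1) fB dis by (intro nn_integral_gauss_Un[symmetric]) (auto simp: tensors_def unitv_def)
  finally show ?case .
qed

lemma distr_standard_gaussian:
  fixes X :: "nat \<Rightarrow> 'w \<Rightarrow> 'a::euclidean_space"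
  assumes M: "prob_space M" and N: "finite N" "N \<noteq> {}"
    and ind: "prob_space.indep_vars M (\<lambda>_. borel) X N"
    and X: "\<And>i. i \<in> N \<Longrightarrow> standard_gaussian M (X i)"
  shows "(\<lambda>\<omega>. \<Sum>i\<in>N. Poly_Mapping.single i (X i \<omega>)) \<in> borel_measurable M"
    and "distr M borel (\<lambda>\<omega>. \<Sum>i\<in>N. Poly_Mapping.single i (X i \<omega>)) = gauss_points N (Basis :: 'a set)"
proof -
  interpret prob_space M by fact
  have rv: "X i \<in> borel_measurable M" if "i \<in> N" for i
    using X[OF that] by (simp add: standard_gaussian_def distributed_def)
  have law: "distr M borel (X i) = gauss Basis" if "i \<in> N" for i
  proof -
    have "distr M borel (X i) = distr M lborel (X i)" by (rule distr_cong) simp_all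
    also have "\<dots> = gauss Basis"
      using X[OF that] unfolding standard_gaussian_def distributed_def gauss_Basis_density by simp
    finally show ?thesis .
  qed
  show meas: "(\<lambda>\<omega>. \<Sum>i\<in>N. Poly_Mapping.single i (X i \<omega>)) \<in> borel_measurable M"
    using rv by (intro borel_measurable_sum measurable_compose[OF _ measurable_single]) auto
  have joint: "distr M (\<Pi>\<^sub>M i\<in>N. borel) (\<lambda>\<omega>. \<lambda>i\<in>N. X i \<omega>) = (\<Pi>\<^sub>M i\<in>N. gauss Basis)"
  proof -
    have "distr M (\<Pi>\<^sub>M i\<in>N. borel) (\<lambda>\<omega>. \<lambda>i\<in>N. X i \<omega>) = (\<Pi>\<^sub>M i\<in>N. distr M borel (X i))"
      using ind indep_vars_iff_distr_eq_PiM'[where I = N and M' = "\<lambda>_. borel" and X = X] N(2) rv by simp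
    also have "\<dots> = (\<Pi>\<^sub>M i\<in>N. gauss Basis)" by (intro PiM_cong refl law)
    finally show ?thesis .
  qed
  show "distr M borel (\<lambda>\<omega>. \<Sum>i\<in>N. Poly_Mapping.single i (X i \<omega>)) = gauss_points N (Basis :: 'a set)"
  proof (rule measure_eqI_nn_integral)
    fix f :: "(nat \<Rightarrow>\<^sub>0 'a) \<Rightarrow> ennreal" assume f: "f \<in> borel_measurable borel"
    note [measurable] = f
    have "(\<integral>\<^sup>+G. f G \<partial>distr M borel (\<lambda>\<omega>. \<Sum>i\<in>N. Poly_Mapping.single i (X i \<omega>)))
      = (\<integral>\<^sup>+\<omega>. f (\<Sum>i\<in>N. Poly_Mapping.single i (X i \<omega>)) \<partial>M)"
      by (intro nn_integral_distr meas) (simp add: f)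
    also have "\<dots> = (\<integral>\<^sup>+\<omega>. f (\<Sum>i\<in>N. Poly_Mapping.single i ((\<lambda>i\<in>N. X i \<omega>) i)) \<partial>M)"
      by (intro nn_integral_cong arg_cong[where f = f] sum.cong) auto
    also have "\<dots> = (\<integral>\<^sup>+x. f (\<Sum>i\<in>N. Poly_Mapping.single i (x i)) \<partial>distr M (\<Pi>\<^sub>M i\<in>N. borel) (\<lambda>\<omega>. \<lambda>i\<in>N. X i \<omega>))"
    proof (rule nn_integral_distr[symmetric])
      show "(\<lambda>\<omega>. \<lambda>i\<in>N. X i \<omega>) \<in> measurable M (\<Pi>\<^sub>M i\<in>N. borel)" using rv by (intro measurable_restrict)
      have "(\<lambda>x. f (\<Sum>i\<in>N. Poly_Mapping.single i (x i))) \<in> borel_measurable (\<Pi>\<^sub>M i\<in>N. borel)" by measurable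
      then show "(\<lambda>x. f (\<Sum>i\<in>N. Poly_Mapping.single i (x i))) \<in> borel_measurable (distr M (\<Pi>\<^sub>M i\<in>N. borel) (\<lambda>\<omega>. \<lambda>i\<in>N. X i \<omega>))"
        by (simp cong: measurable_cong_sets)
    qed
    also have "\<dots> = (\<integral>\<^sup>+G. f G \<partial>gauss_points N Basis)"
      unfolding joint by (rule nn_integral_PiM_gauss[OF orthonormal_Basis N(1) f])
    finally show "(\<integral>\<^sup>+G. f G \<partial>distr M borel (\<lambda>\<omega>. \<Sum>i\<in>N. Poly_Mapping.single i (X i \<omega>))) = (\<integral>\<^sup>+G. f G \<partial>gauss_points N Basis)" .
  qed simp_all
qed

section \<open>Expected face sums\<close>

definition face_sum :: "nat \<Rightarrow> nat \<Rightarrow> nat set \<Rightarrow> (nat \<Rightarrow> 'a::euclidean_space) \<Rightarrow> real" where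
  "face_sum j k N x = (\<Sum>F\<in>faces j (convex hull (x ` N)). conic_intrinsic_volume k (tangent_cone F (convex hull (x ` N))))"

text \<open>
  For \<open>I \<subseteq> J\<close> this describes a flag of two faces, of dimensions \<open>j\<close> and \<open>k\<close>.
\<close>

definition flag :: "nat \<Rightarrow> nat \<Rightarrow> nat set \<Rightarrow> nat set \<Rightarrow> nat set \<Rightarrow> (nat \<Rightarrow> 'a::euclidean_space) \<Rightarrow> bool" where
  "flag j k N I J x \<longleftrightarrow> face_index UNIV x N I \<and> hull_dim x I = j \<and> face_index UNIV x N J \<and> hull_dim x J = k"

lemma face_sum_eq:
  fixes x :: "nat \<Rightarrow> 'a::euclidean_space"
  assumes N: "finite N"
  shows "ennreal (face_sum j k N x) = (\<Sum>I | I \<subseteq> N \<and> I \<noteq> {}. \<Sum>J | I \<subseteq> J \<and> J \<subseteq> N.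
    emeasure (gauss Basis) {z. kkt x I J N z} * indicator {x. flag j k N I J x} x)"
proof -
  let ?m = "\<lambda>I J. measure (gauss Basis) {z. kkt x I J N z}"
  have "face_sum j k N x = (\<Sum>I | I \<noteq> {} \<and> face_index UNIV x N I \<and> hull_dim x I = j. \<Sum>J | I \<subseteq> J \<and> face_index UNIV x N J \<and> hull_dim x J = k. ?m I J)"
    unfolding face_sum_def by (rule face_sum_polytope[OF N])
  also have "\<dots> = (\<Sum>I | I \<noteq> {} \<and> face_index UNIV x N I \<and> hull_dim x I = j. \<Sum>J | I \<subseteq> J \<and> J \<subseteq> N. if flag j k N I J x then ?m I J else 0)"
    using N by (intro sum.cong refl sum.mono_neutral_cong_left) (auto simp: face_index_def flag_def)
  also have "\<dots> = (\<Sum>I | I \<subseteq> N \<and> I \<noteq> {}. \<Sum>J | I \<subseteq> J \<and> J \<subseteq> N. if flag j k N I J x then ?m I J else 0)"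
  proof (rule sum.mono_neutral_left)
    show "finite {I. I \<subseteq> N \<and> I \<noteq> {}}" using N by simp
    show "{I. I \<noteq> {} \<and> face_index UNIV x N I \<and> hull_dim x I = j} \<subseteq> {I. I \<subseteq> N \<and> I \<noteq> {}}" by (auto simp: face_index_def)
    show "\<forall>I\<in>{I. I \<subseteq> N \<and> I \<noteq> {}} - {I. I \<noteq> {} \<and> face_index UNIV x N I \<and> hull_dim x I = j}.
      (\<Sum>J | I \<subseteq> J \<and> J \<subseteq> N. if flag j k N I J x then ?m I J else 0) = 0"
      by (intro ballI sum.neutral) (auto simp: flag_def)
  qed
  finally have "ennreal (face_sum j k N x) = (\<Sum>I | I \<subseteq> N \<and> I \<noteq> {}. \<Sum>J | I \<subseteq> J \<and> J \<subseteq> N. ennreal (if flag j k N I J x then ?m I J else 0))"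
    by (simp add: sum_ennreal[symmetric] sum_nonneg del: sum_ennreal)
  also have "\<dots> = (\<Sum>I | I \<subseteq> N \<and> I \<noteq> {}. \<Sum>J | I \<subseteq> J \<and> J \<subseteq> N.
    emeasure (gauss Basis) {z. kkt x I J N z} * indicator {x. flag j k N I J x} x)"
    by (intro sum.cong refl) (simp add: gauss.emeasure_eq_measure)
  finally show ?thesis .
qed

lemma face_sum_nonneg: "finite N \<Longrightarrow> 0 \<le> face_sum j k N x"
  by (simp add: face_sum_def face_sum_polytope sum_nonneg)

lemma borel_flag:
  assumes N: "finite N" "I \<subseteq> J" "J \<subseteq> N" "I \<noteq> {}"
  shows "{G :: nat \<Rightarrow>\<^sub>0 'a::euclidean_space. flag j k N I J (lk G)} \<in> sets borel"
proof -
  have fJ: "finite J" by (rule finite_subset[OF N(3,1)])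
  have fI: "finite I" by (rule finite_subset[OF N(2) fJ])
  have "{G :: nat \<Rightarrow>\<^sub>0 'a. flag j k N I J (lk G)} = {G. face_index UNIV (lk G) N I} \<inter> {G. hull_dim (lk G) I = j}
    \<inter> {G. face_index UNIV (lk G) N J} \<inter> {G. hull_dim (lk G) J = k}" by (auto simp: flag_def)
  also have "\<dots> \<in> sets borel"
    using N(2,4) by (intro sets.Int borel_face_index[OF N(1)] borel_hull_dim fI fJ) auto
  finally show ?thesis .
qed

lemma measurable_face_sum_term:
  assumes N: "finite N" "I \<subseteq> J" "J \<subseteq> N" "I \<noteq> {}"
  shows "(\<lambda>G. emeasure (gauss (Basis :: 'a::euclidean_space set)) {z. kkt (lk G) I J N z} * indicator {G. flag j k N I J (lk G)} G) \<in> borel_measurable borel"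
  using measurable_kkt_section[OF finite_subset[OF N(3,1)], of borel "Basis :: 'a set" I N] borel_flag[OF N] by measurable

text \<open>
  All terms are nonnegative, so the integral may be computed in \<open>ennreal\<close>, term by term.
\<close>

lemma expectation_face_sum:
  fixes X :: "nat \<Rightarrow> 'w \<Rightarrow> 'a::euclidean_space"
  assumes M: "prob_space M" and N: "finite N" "N \<noteq> {}"
    and ind: "prob_space.indep_vars M (\<lambda>_. borel) X N"
    and X: "\<And>i. i \<in> N \<Longrightarrow> standard_gaussian M (X i)"
  shows "(\<integral>\<omega>. face_sum j k N (\<lambda>i. X i \<omega>) \<partial>M)
    = enn2real (\<Sum>I | I \<subseteq> N \<and> I \<noteq> {}. \<Sum>J | I \<subseteq> J \<and> J \<subseteq> N. \<integral>\<^sup>+G. emeasure (gauss (Basis :: 'a set)) {z. kkt (lk G) I J N z} * indicator {G. flag j k N I J (lk G)} G \<partial>gauss_points N Basis)"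
proof -
  let ?X = "\<lambda>\<omega>. \<Sum>i\<in>N. Poly_Mapping.single i (X i \<omega>)"
  let ?t = "\<lambda>I J G. emeasure (gauss (Basis :: 'a set)) {z. kkt (lk G) I J N z} * indicator {G. flag j k N I J (lk G)} G"
  let ?F = "\<lambda>G. \<Sum>I | I \<subseteq> N \<and> I \<noteq> {}. \<Sum>J | I \<subseteq> J \<and> J \<subseteq> N. ?t I J G"
  have mt: "?t I J \<in> borel_measurable borel" if "I \<subseteq> J" "J \<subseteq> N" "I \<noteq> {}" for I J
    using that by (intro measurable_face_sum_term N(1))
  have mF: "?F \<in> borel_measurable borel"
    using mt by (intro borel_measurable_sum) auto
  have eF: "ennreal (face_sum j k N (lk G)) = ?F G" for G :: "nat \<Rightarrow>\<^sub>0 'a"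
    by (simp add: face_sum_eq[OF N(1)] indicator_def)
  have fe: "face_sum j k N (lk G) = enn2real (?F G)" for G :: "nat \<Rightarrow>\<^sub>0 'a"
    unfolding eF[symmetric] by (simp add: face_sum_nonneg[OF N(1)])
  have mf: "(\<lambda>G :: nat \<Rightarrow>\<^sub>0 'a. face_sum j k N (lk G)) \<in> borel_measurable borel"
    unfolding fe using mF by measurable
  have same: "face_sum j k N (\<lambda>i. X i \<omega>) = face_sum j k N (lk (?X \<omega>))" for \<omega>
  proof -
    have "lk (?X \<omega>) ` N = (\<lambda>i. X i \<omega>) ` N" using lookup_of_points[OF N(1)] by (intro image_cong) auto
    then show ?thesis by (simp add: face_sum_def)
  qed
  note law = distr_standard_gaussian[OF M N ind X]
  have "(\<integral>\<omega>. face_sum j k N (\<lambda>i. X i \<omega>) \<partial>M) = (\<integral>G. face_sum j k N (lk G) \<partial>distr M borel ?X)"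
    unfolding same using law(1) mf by (rule integral_distr[symmetric])
  also have "\<dots> = (\<integral>G. face_sum j k N (lk G) \<partial>gauss_points N (Basis :: 'a set))" by (simp only: law(2))
  also have "\<dots> = enn2real (\<integral>\<^sup>+G. ennreal (face_sum j k N (lk G)) \<partial>gauss_points N (Basis :: 'a set))"
    using mf face_sum_nonneg[OF N(1)] by (intro integral_eq_nn_integral) (auto cong: measurable_cong_sets)
  also have "(\<integral>\<^sup>+G. ennreal (face_sum j k N (lk G)) \<partial>gauss_points N (Basis :: 'a set)) = (\<integral>\<^sup>+G. ?F G \<partial>gauss_points N Basis)"
    unfolding eF ..
  also have "\<dots> = (\<Sum>I | I \<subseteq> N \<and> I \<noteq> {}. \<integral>\<^sup>+G. (\<Sum>J | I \<subseteq> J \<and> J \<subseteq> N. ?t I J G) \<partial>gauss_points N Basis)"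
    using mt by (intro nn_integral_sum) (auto intro!: borel_measurable_sum cong: measurable_cong_sets)
  also have "\<dots> = (\<Sum>I | I \<subseteq> N \<and> I \<noteq> {}. \<Sum>J | I \<subseteq> J \<and> J \<subseteq> N. \<integral>\<^sup>+G. ?t I J G \<partial>gauss_points N Basis)"
    using mt by (intro sum.cong refl nn_integral_sum) (auto cong: measurable_cong_sets)
  finally show ?thesis .
qed

text \<open>
  The residual of the projection is a functional that exposes \<open>J\<close>.
\<close>

lemma kkt_generic_point_imp_face_index:
  fixes x :: "nat \<Rightarrow> 'a::real_inner"
  assumes "kkt x I J N z" "I \<subseteq> J" "J \<subseteq> N" "J \<noteq> {}" "card J \<le> d" "generic_point x N d z"
  shows "face_index UNIV x N J"
proof -
  obtain p where p: "p \<in> icone x I J" "polar x J N (z - p)" using assms(1) unfolding kkt_def by blast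
  have pJ: "p \<in> icone x J J" using p(1) icone_mono_left[OF assms(2)] by blast
  have e: "(z - p) \<bullet> (x i - x j) = 0" if "i \<in> J" "j \<in> J" for i j
    by (rule polar_eq[OF p(2) that assms(3)])
  have n: "(z - p) \<bullet> (x i - x j) \<noteq> 0" if "i \<in> N - J" "j \<in> J" for i j
    using assms(6) pJ e that assms(3-5) unfolding generic_point_def by blast
  have "(z - p) \<bullet> (x i - x j) < 0" if "i \<in> N - J" "j \<in> J" for i j
    using n[OF that] p(2) that unfolding polar_def by (auto simp: less_le)
  then show ?thesis unfolding face_index_def using e assms(3) by blast
qed

context
  fixes x :: "nat \<Rightarrow> 'a::euclidean_space" and N :: "nat set"
  assumes N: "finite N" "DIM('a) + 1 \<le> card N" and gp: "general_position x N DIM('a)"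
begin

lemma generic_hull_dim_full: "hull_dim x N = DIM('a)"
proof -
  obtain K where K: "K \<subseteq> N" "card K = DIM('a) + 1" using obtain_subset_with_card_n[OF N(2)] by metis
  then have "affine_indep x K" using gp by (simp add: general_position_def)
  then have "DIM('a) \<le> hull_dim x N" using K N by (subst hull_dim_ge_iff) auto
  moreover have "hull_dim x N \<le> DIM('a)" by (simp add: hull_dim_def dim_subset_UNIV)
  ultimately show ?thesis by simp
qed

lemma generic_face:
  assumes "J \<subseteq> N" "J \<noteq> {}" "card J \<le> DIM('a)"
  shows "affine_indep x J" "hull_dim x J + 1 = card J"
proof -
  show "affine_indep x J" using gp assms by (simp add: general_position_def)
  then show "hull_dim x J + 1 = card J" using assms finite_subset[OF assms(1) N(1)] by (intro hull_dim_affine_indep)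
qed

lemma generic_proper_face:
  assumes "face_index UNIV x N J" "J \<noteq> N" "J \<noteq> {}"
  shows "card J \<le> DIM('a)"
  using assms N gp by (intro face_index_card_le[of Basis x N J]) (auto simp: orthonormal_Basis span_Basis)

text \<open>
  In general position a proper face of the polytope is a simplex, so dimensions are given by
  cardinalities, and all subsets of \<open>J\<close> index faces. If \<open>J\<close> does not index a face, then almost no \<open>z\<close>
  projects to it.
\<close>

lemma generic_flag_proper:
  assumes I: "I \<noteq> {}" "I \<subseteq> J" "J \<subseteq> N" and k: "k < DIM('a)"
  shows "emeasure (gauss (Basis :: 'a set)) {z. kkt x I J N z} * indicator {x. flag j k N I J x} x
    = (if card I = j + 1 \<and> card J = k + 1 then emeasure (gauss Basis) {z. kkt x I J N z} else 0)"
proof -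
  have fJ: "finite J" by (rule finite_subset[OF I(3) N(1)])
  have J: "J \<noteq> {}" using I by auto
  have flag: "flag j k N I J x \<longleftrightarrow> card I = j + 1 \<and> card J = k + 1 \<and> face_index UNIV x N J"
  proof
    assume "flag j k N I J x"
    then have f: "hull_dim x I = j" "face_index UNIV x N J" "hull_dim x J = k" by (auto simp: flag_def)
    have "J \<noteq> N" using generic_hull_dim_full f(3) k by auto
    then have cJ: "card J \<le> DIM('a)" using generic_proper_face f(2) J by blast
    have "card I \<le> DIM('a)" using card_mono[OF fJ I(2)] cJ by simp
    then show "card I = j + 1 \<and> card J = k + 1 \<and> face_index UNIV x N J"
      using generic_face(2)[of I] generic_face(2)[OF I(3) J cJ] f I by auto
  next
    assume c: "card I = j + 1 \<and> card J = k + 1 \<and> face_index UNIV x N J"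
    have cJ: "card J \<le> DIM('a)" using c k by simp
    have cI: "card I \<le> DIM('a)" using card_mono[OF fJ I(2)] cJ by simp
    have "face_index UNIV x J I" using generic_face(1)[OF I(3) J cJ] I fJ by (intro face_index_simplex) auto
    then have "face_index UNIV x N I" using c I N by (intro face_index_trans[of UNIV x N J I]) auto
    then show "flag j k N I J x"
      using c generic_face(2)[OF _ I(1) cI] generic_face(2)[OF I(3) J cJ] I by (auto simp: flag_def)
  qed
  have zero: "emeasure (gauss (Basis :: 'a set)) {z. kkt x I J N z} = 0" if c: "card J = k + 1" "\<not> face_index UNIV x N J"
  proof -
    have "AE z in gauss (Basis :: 'a set). generic_point x N DIM('a) z"
      using AE_generic_point[OF N(1) orthonormal_Basis, of x] gp by (simp add: span_Basis)
    then have "AE z in gauss (Basis :: 'a set). z \<notin> {z. kkt x I J N z}"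
    proof eventually_elim
      case (elim z)
      then show ?case using kkt_generic_point_imp_face_index[of x I J N z "DIM('a)"] I J c k by auto
    qed
    then show ?thesis
      using borel_kkt_slice[OF N(1) I(3), of x I] by (subst AE_iff_measurable[symmetric, of _ _ "\<lambda>z. \<not> kkt x I J N z"]) auto
  qed
  show ?thesis
  proof (cases "face_index UNIV x N J")
    case True
    then show ?thesis by (simp add: flag)
  next
    case False
    show ?thesis
    proof (cases "card J = k + 1")
      case True
      then show ?thesis using zero[OF True False] by simp
    qed (simp add: flag)
  qed
qed

lemma kkt_full_iff:
  assumes "I \<noteq> {}" "I \<subseteq> N"
  shows "kkt x I N N z \<longleftrightarrow> z \<in> icone x I N"
proof
  assume "z \<in> icone x I N"
  then show "kkt x I N N z" unfolding kkt_def by (intro bexI[of _ z]) (simp_all add: polar_def)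
next
  assume "kkt x I N N z"
  then obtain p where p: "p \<in> icone x I N" "polar x N N (z - p)" unfolding kkt_def by blast
  obtain j where j: "j \<in> N" using assms by auto
  have "z - p = 0"
    using gp polar_eq[OF p(2) _ j subset_refl] N j
    by (intro general_position_normal_zero[where x = x and N = N and K = N and B = Basis and d = "DIM('a)" and j = j])
       (auto simp: orthonormal_Basis span_Basis)
  then show "z \<in> icone x I N" using p(1) by simp
qed

text \<open>
  Only the polytope itself has dimension \<open>d\<close>. A point is its own projection to the cone, and \<open>I\<close> indexes
  a face exactly if its tangent cone is proper.
\<close>

lemma generic_flag_full:
  assumes I: "I \<noteq> {}" "I \<subseteq> J" "J \<subseteq> N" and j: "j < DIM('a)"
  shows "emeasure (gauss (Basis :: 'a set)) {z. kkt x I J N z} * indicator {x. flag j DIM('a) N I J x} x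
    = (if J = N \<and> card I = j + 1
       then emeasure (gauss Basis) {z. z \<in> icone x I N} * of_bool (\<exists>u\<in>span (Basis :: 'a set). u \<noteq> 0 \<and> polar x I N u) else 0)"
proof (cases "J = N")
  case False
  have "\<not> flag j DIM('a) N I J x"
  proof
    assume "flag j DIM('a) N I J x"
    then have f: "face_index UNIV x N J" "hull_dim x J = DIM('a)" by (auto simp: flag_def)
    have J: "J \<noteq> {}" using I by auto
    show False using generic_face(2)[OF I(3) J generic_proper_face[OF f(1) False J]] generic_proper_face[OF f(1) False J] f(2) by simp
  qed
  then show ?thesis using False by simp
next
  case True
  have IN: "I \<subseteq> N" using I by auto
  let ?nt = "\<exists>u\<in>span (Basis :: 'a set). u \<noteq> 0 \<and> polar x I N u"
  have iff: "face_index UNIV x N I \<longleftrightarrow> ?nt" if "I \<noteq> N"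
    using face_index_iff_polar_nontrivial[OF N(1) _ I(1) orthonormal_Basis refl gp] that IN by (auto simp: span_Basis)
  have fN: "face_index UNIV x N N" unfolding face_index_def by (auto intro!: exI[of _ 0])
  have "flag j DIM('a) N I N x \<longleftrightarrow> card I = j + 1 \<and> ?nt"
  proof
    assume "flag j DIM('a) N I N x"
    then have f: "face_index UNIV x N I" "hull_dim x I = j" by (auto simp: flag_def)
    then have ne: "I \<noteq> N" using generic_hull_dim_full j by auto
    show "card I = j + 1 \<and> ?nt"
      using generic_face(2)[OF IN I(1) generic_proper_face[OF f(1) ne I(1)]] f iff[OF ne] by simp
  next
    assume c: "card I = j + 1 \<and> ?nt"
    then have "I \<noteq> N" using N(2) j by auto
    then show "flag j DIM('a) N I N x"
      using c iff generic_face(2)[OF IN I(1)] j fN generic_hull_dim_full by (auto simp: flag_def)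
  qed
  then show ?thesis using kkt_full_iff[OF I(1) IN] True by auto
qed

end

section \<open>Symmetry of the angles of the simplex\<close>

text \<open>
  The linear isometry from \<open>\<real>\<^sup>J\<close> to \<open>\<real>\<^bsup>p ` J\<^esup>\<close> that permutes the coordinates. Coordinates outside of \<open>J\<close>
  are dropped, which makes the map continuous on the whole space.
\<close>

definition relabel :: "(nat \<Rightarrow> nat) \<Rightarrow> nat set \<Rightarrow> (nat \<Rightarrow>\<^sub>0 real) \<Rightarrow> (nat \<Rightarrow>\<^sub>0 real)" where
  "relabel p J v = (\<Sum>i\<in>J. lk v i *\<^sub>R ev (p i))"

context
  fixes p :: "nat \<Rightarrow> nat" and J :: "nat set"
  assumes J: "finite J" "inj_on p J"
begin

lemma lookup_relabel: "i \<in> J \<Longrightarrow> lk (relabel p J v) (p i) = lk v i"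
proof -
  assume i: "i \<in> J"
  have "lk (relabel p J v) (p i) = (\<Sum>k\<in>J. if k = i then lk v k else 0)"
    unfolding relabel_def lookup_sum using i J(2) by (intro sum.cong refl) (auto simp: lookup_single when_def inj_on_def)
  also have "\<dots> = lk v i" using J(1) i by simp
  finally show ?thesis .
qed

lemma keys_relabel: "Poly_Mapping.keys (relabel p J v) \<subseteq> p ` J"
proof
  fix k assume "k \<in> Poly_Mapping.keys (relabel p J v)"
  then have "(\<Sum>i\<in>J. lk v i * lk (ev (p i)) k) \<noteq> 0"
    by (simp add: relabel_def lookup_sum in_keys_iff)
  then obtain i where "i \<in> J" "lk (ev (p i)) k \<noteq> 0" by (metis (no_types, lifting) mult_eq_0_iff sum.neutral)
  then show "k \<in> p ` J" by (auto simp: lookup_single when_def split: if_splits)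
qed

lemma relabel_surj:
  assumes "Poly_Mapping.keys w \<subseteq> p ` J"
  obtains v where "Poly_Mapping.keys v \<subseteq> J" "relabel p J v = w"
proof
  let ?v = "\<Sum>i\<in>J. lk w (p i) *\<^sub>R ev i"
  have lv: "lk ?v k = (if k \<in> J then lk w (p k) else 0)" for k by (rule sum_ev_lookup[OF J(1)])
  show "Poly_Mapping.keys ?v \<subseteq> J" by (auto simp: in_keys_iff lv simp del: sum_ev_lookup split: if_splits)
  show "relabel p J ?v = w"
  proof (rule poly_mapping_eqI)
    fix k show "lk (relabel p J ?v) k = lk w k"
    proof (cases "k \<in> p ` J")
      case True
      then obtain i where i: "i \<in> J" "k = p i" by blast
      show ?thesis unfolding i(2) lookup_relabel[OF i(1)] lv using i by simp
    next
      case False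
      then have "k \<notin> Poly_Mapping.keys (relabel p J ?v)" "k \<notin> Poly_Mapping.keys w" using keys_relabel assms by blast+
      then show ?thesis by (simp add: in_keys_iff)
    qed
  qed
qed

lemma linear_relabel: "linear (relabel p J)"
  by (rule linearI) (simp_all add: relabel_def lookup_add scaleR_left_distrib sum.distrib scaleR_sum_right)

lemma measurable_relabel: "relabel p J \<in> borel_measurable borel"
  unfolding relabel_def by measurable

lemma inner_relabel:
  assumes "Poly_Mapping.keys v \<subseteq> J" "Poly_Mapping.keys w \<subseteq> J"
  shows "relabel p J v \<bullet> relabel p J w = v \<bullet> w"
proof -
  have "relabel p J v \<bullet> relabel p J w = (\<Sum>k\<in>p ` J. lk (relabel p J v) k \<bullet> lk (relabel p J w) k)"
    using J(1) keys_relabel by (intro inner_lookup_superset) auto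
  also have "\<dots> = (\<Sum>i\<in>J. lk v i \<bullet> lk w i)"
    unfolding sum.reindex[OF J(2)] o_def by (intro sum.cong refl) (simp only: lookup_relabel)
  also have "\<dots> = v \<bullet> w" using J(1) assms(1) by (intro inner_lookup_superset[symmetric]) auto
  finally show ?thesis .
qed

lemma solid_angle_relabel:
  assumes C: "C \<subseteq> {v. Poly_Mapping.keys v \<subseteq> J}" "scone C" "C \<in> sets borel" "relabel p J ` C \<in> sets borel"
  shows "solid_angle (relabel p J ` C) = solid_angle C"
proof -
  have CJ: "C \<subseteq> span (unitv J)" using C(1) by (simp add: span_unitv J(1))
  obtain S where S: "S \<subseteq> C" "independent S" "C \<subseteq> span S" by (rule maximal_independent_subset)
  have "finite S"
  proof -
    have "S \<subseteq> span (unitv J)" using S(1) CJ by blast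
    moreover have "finite (unitv J)" using J(1) by (simp add: unitv_def)
    ultimately show ?thesis using independent_span_bound S(2) by blast
  qed
  then obtain B where B: "orthonormal B" "span B = span S" using orthonormal_extend_span by blast
  have sp: "span C = span B"
    unfolding B(2) using S(1,3) by (intro subset_antisym span_mono span_minimal) auto
  have "span B \<subseteq> span (unitv J)" unfolding sp[symmetric] using CJ by (intro span_minimal) auto
  then have BJ: "Poly_Mapping.keys v \<subseteq> J" if "v \<in> span B" for v using that by (auto simp: span_unitv J(1))
  show ?thesis
    by (rule solid_angle_isometry[OF B(1) sp C(2-4) linear_relabel measurable_relabel]) (intro inner_relabel BJ)
qed

lemma tangent_angle_relabel:
  assumes I: "I \<subseteq> J"
  shows "tangent_angle (p ` I) (p ` J) = tangent_angle I J"
proof -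
  have im: "relabel p J ` tcone I J = tcone (p ` I) (p ` J)"
  proof -
    have s: "sum (lk (relabel p J v)) (p ` J) = sum (lk v) J" for v
      unfolding sum.reindex[OF J(2)] o_def by (intro sum.cong refl) (simp only: lookup_relabel)
    have d: "p ` J - p ` I = p ` (J - I)" using J(2) I by (simp add: inj_on_image_set_diff[OF J(2)])
    have m: "relabel p J v \<in> tcone (p ` I) (p ` J) \<longleftrightarrow> v \<in> tcone I J" if "Poly_Mapping.keys v \<subseteq> J" for v
      unfolding mem_tcone[OF J(1)] mem_tcone[OF finite_imageI[OF J(1)]] s d
      using that keys_relabel[of v] by (auto simp: lookup_relabel)
    show ?thesis
    proof (rule subset_antisym)
      show "relabel p J ` tcone I J \<subseteq> tcone (p ` I) (p ` J)" using m mem_tcone[OF J(1)] by blast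
      show "tcone (p ` I) (p ` J) \<subseteq> relabel p J ` tcone I J"
      proof
        fix w assume w: "w \<in> tcone (p ` I) (p ` J)"
        then have "Poly_Mapping.keys w \<subseteq> p ` J" using mem_tcone[OF finite_imageI[OF J(1)]] by blast
        then obtain v where "Poly_Mapping.keys v \<subseteq> J" "relabel p J v = w" by (rule relabel_surj)
        then show "w \<in> relabel p J ` tcone I J" using m[of v] w by blast
      qed
    qed
  qed
  have bor: "tcone A K \<in> sets borel" if "finite K" for A K unfolding tcone_def by (rule borel_icone[OF that])
  show ?thesis unfolding tangent_angle_def im[symmetric]
  proof (rule solid_angle_relabel)
    show "tcone I J \<subseteq> {v. Poly_Mapping.keys v \<subseteq> J}" using mem_tcone[OF J(1)] by blast
    show "scone (tcone I J)" unfolding tcone_def by (rule scone_icone)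
  qed (simp_all add: im bor J(1))
qed

lemma normal_angle_relabel:
  assumes I: "I \<subseteq> J"
  shows "normal_angle (p ` I) (p ` J) = normal_angle I J"
proof -
  have im: "relabel p J ` ncone I J = ncone (p ` I) (p ` J)"
  proof -
    have m: "relabel p J v \<in> ncone (p ` I) (p ` J) \<longleftrightarrow> v \<in> ncone I J" if "Poly_Mapping.keys v \<subseteq> J" for v
      unfolding mem_ncone[OF J(1)] mem_ncone[OF finite_imageI[OF J(1)]]
      using that keys_relabel[of v] I by (auto simp: lookup_relabel subset_iff)
    show ?thesis
    proof (rule subset_antisym)
      show "relabel p J ` ncone I J \<subseteq> ncone (p ` I) (p ` J)" using m mem_ncone[OF J(1)] by blast
      show "ncone (p ` I) (p ` J) \<subseteq> relabel p J ` ncone I J"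
      proof
        fix w assume w: "w \<in> ncone (p ` I) (p ` J)"
        then have "Poly_Mapping.keys w \<subseteq> p ` J" using mem_ncone[OF finite_imageI[OF J(1)]] by blast
        then obtain v where "Poly_Mapping.keys v \<subseteq> J" "relabel p J v = w" by (rule relabel_surj)
        then show "w \<in> relabel p J ` ncone I J" using m[of v] w by blast
      qed
    qed
  qed
  have bor: "ncone A K \<in> sets borel" if "finite K" for A K
    unfolding ncone_def by (rule borel_polar_cone[OF orthonormal_unitv[OF that]])
  show ?thesis unfolding normal_angle_def im[symmetric]
  proof (rule solid_angle_relabel)
    show "ncone I J \<subseteq> {v. Poly_Mapping.keys v \<subseteq> J}" using mem_ncone[OF J(1)] by blast
    show "scone (ncone I J)" unfolding ncone_def by (rule scone_polar_cone)
  qed (simp_all add: im bor J(1))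
qed

end

lemma obtain_relabelling:
  fixes I J :: "nat set"
  assumes "finite J" "I \<subseteq> J"
  obtains p where "inj_on p J" "p ` I = {1..card I}" "p ` J = {1..card J}"
proof -
  have fI: "finite I" by (rule finite_subset[OF assms(2,1)])
  have le: "card I \<le> card J" by (rule card_mono[OF assms])
  obtain f where f: "bij_betw f I {1..card I}" using finite_same_card_bij[OF fI, of "{1..card I}"] by auto
  have "card (J - I) = card {card I + 1..card J}" using assms fI by (simp add: card_Diff_subset)
  then obtain g where g: "bij_betw g (J - I) {card I + 1..card J}"
    using finite_same_card_bij[of "J - I" "{card I + 1..card J}"] assms by auto
  let ?p = "\<lambda>i. if i \<in> I then f i else g i"
  have pI: "bij_betw ?p I {1..card I}" using f by (subst bij_betw_cong[of I ?p f]) auto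
  have pd: "bij_betw ?p (J - I) {card I + 1..card J}" using g by (subst bij_betw_cong[of "J - I" ?p g]) auto
  have "bij_betw ?p (I \<union> (J - I)) ({1..card I} \<union> {card I + 1..card J})"
    by (rule bij_betw_combine[OF pI pd]) auto
  moreover have "I \<union> (J - I) = J" using assms by auto
  moreover have "{1..card I} \<union> {card I + 1..card J} = {1..card J}" using le by auto
  ultimately have pJ: "bij_betw ?p J {1..card J}" by simp
  show ?thesis using that[of ?p] pI pJ by (simp add: bij_betw_def)
qed

lemma tangent_angle_card: "finite J \<Longrightarrow> I \<subseteq> J \<Longrightarrow> tangent_angle I J = tangent_angle {1..card I} {1..card J}"
  by (metis obtain_relabelling tangent_angle_relabel)

lemma normal_angle_card: "finite J \<Longrightarrow> I \<subseteq> J \<Longrightarrow> normal_angle I J = normal_angle {1..card I} {1..card J}"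
  by (metis obtain_relabelling normal_angle_relabel)

text \<open>
  Verified by hand, as the ambient space is not finite-dimensional: a neighbourhood of the barycenter in
  the affine hull is given by positivity of the coordinates.
\<close>

lemma barycenter_rel_interior:
  assumes k: "k \<ge> 1"
  defines "f \<equiv> \<Sum>i\<in>{1..k}. (1 / real k) *\<^sub>R ev i"
  shows "f \<in> rel_interior (convex hull (ev ` {1..k}))"
    and "\<And>j. j \<in> {1..k} \<Longrightarrow> \<exists>e>1. (1 - e) *\<^sub>R ev j + e *\<^sub>R f \<in> convex hull (ev ` {1..k})"
proof -
  let ?K = "{1..k}"
  let ?S = "convex hull (ev ` ?K)"
  let ?A = "{v :: nat \<Rightarrow>\<^sub>0 real. Poly_Mapping.keys v \<subseteq> ?K \<and> sum (lk v) ?K = 1}"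
  have lf: "lk f i = (if i \<in> ?K then 1 / real k else 0)" for i
    unfolding f_def by (rule sum_ev_lookup) simp
  have hull: "v \<in> ?S" if v: "v \<in> ?A" "\<And>i. i \<in> ?K \<Longrightarrow> lk v i \<ge> 0" for v
  proof -
    have "v = (\<Sum>i\<in>?K. lk v i *\<^sub>R ev i)"
    proof (rule poly_mapping_eqI)
      fix i show "lk v i = lk (\<Sum>i\<in>?K. lk v i *\<^sub>R ev i) i"
        unfolding sum_ev_lookup[OF finite_atLeastAtMost] using v(1) by (auto simp: in_keys_iff)
    qed
    moreover have "(\<Sum>i\<in>?K. lk v i *\<^sub>R ev i) \<in> ?S"
      using v by (intro convex_sum) (auto intro: hull_inc)
    ultimately show ?thesis by simp
  qed
  have affA: "affine hull ?S \<subseteq> ?A"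
  proof -
    have "affine ?A"
      unfolding affine_def
    proof (intro ballI allI impI)
      fix v w :: "nat \<Rightarrow>\<^sub>0 real" and a b :: real assume vw: "v \<in> ?A" "w \<in> ?A" "a + b = 1"
      have "Poly_Mapping.keys (a *\<^sub>R v + b *\<^sub>R w) \<subseteq> ?K"
        using vw by (auto simp: in_keys_iff lookup_add subset_iff) (metis add_0 mult_zero_right)+
      moreover have "sum (lk (a *\<^sub>R v + b *\<^sub>R w)) ?K = a * sum (lk v) ?K + b * sum (lk w) ?K"
        by (simp add: lookup_add sum.distrib sum_distrib_left)
      ultimately show "a *\<^sub>R v + b *\<^sub>R w \<in> ?A" using vw by simp
    qed
    moreover have "ev ` ?K \<subseteq> ?A" by (auto simp: lookup_single when_def)
    ultimately have "affine hull (ev ` ?K) \<subseteq> ?A" by (intro hull_minimal)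
    then show ?thesis by simp
  qed
  have fA: "f \<in> ?A" using k by (auto simp: in_keys_iff lf split: if_splits)
  have fS: "f \<in> ?S" using fA k by (intro hull) (auto simp: lf)
  show "f \<in> rel_interior ?S"
  proof -
    let ?U = "{v :: nat \<Rightarrow>\<^sub>0 real. \<forall>i\<in>?K. 0 < lk v i}"
    have "open ?U"
    proof -
      have "open {v :: nat \<Rightarrow>\<^sub>0 real. 0 < lk v i}" for i by (intro open_Collect_less continuous_intros)
      then have "open (\<Inter>i\<in>?K. {v :: nat \<Rightarrow>\<^sub>0 real. 0 < lk v i})" by (intro open_INT) auto
      moreover have "(\<Inter>i\<in>?K. {v :: nat \<Rightarrow>\<^sub>0 real. 0 < lk v i}) = ?U" by auto
      ultimately show ?thesis by simp
    qed
    then have "openin (top_of_set (affine hull ?S)) (affine hull ?S \<inter> ?U)" by (rule openin_open_Int)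
    moreover have "f \<in> affine hull ?S \<inter> ?U" using subsetD[OF convex_hull_subset_affine_hull fS] k by (simp add: lf)
    moreover have "affine hull ?S \<inter> ?U \<subseteq> ?S"
    proof
      fix v assume v: "v \<in> affine hull ?S \<inter> ?U"
      show "v \<in> ?S"
      proof (rule hull)
        show "v \<in> ?A" using v affA by blast
        show "0 \<le> lk v i" if "i \<in> ?K" for i using v that by (auto intro: less_imp_le)
      qed
    qed
    ultimately show ?thesis unfolding rel_interior_def by blast
  qed
  fix j assume j: "j \<in> ?K"
  let ?e = "1 + 1 / real k"
  define w where "w = (1 - ?e) *\<^sub>R ev j + ?e *\<^sub>R f"
  \<comment> \<open>The factor \<open>1 + 1 / k\<close> is small enough for the weight of \<open>j\<close> to remain nonnegative.\<close>
  have lw: "lk w i = (if i \<in> ?K then ?e / real k - (if i = j then 1 / real k else 0) else 0)" for i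
    using j by (auto simp: w_def lookup_add lookup_minus lf lookup_single when_def)
  have "w \<in> ?S"
  proof (rule hull)
    have "sum (lk w) ?K = (\<Sum>i\<in>?K. ?e / real k) - (\<Sum>i\<in>?K. if i = j then 1 / real k else 0)"
      unfolding lw by (simp add: sum_subtractf)
    also have "\<dots> = 1" using j k by (simp add: field_simps)
    finally show "w \<in> ?A" by (auto simp: in_keys_iff lw split: if_splits)
    show "0 \<le> lk w i" if "i \<in> ?K" for i unfolding lw using that k by (auto simp: field_simps)
  qed
  then show "\<exists>e>1. (1 - e) *\<^sub>R ev j + e *\<^sub>R f \<in> ?S" using k unfolding w_def by (intro exI[of _ ?e]) auto
qed

lemma tangent_cone_simplex:
  assumes "1 \<le> k" "k \<le> n"
  shows "tangent_cone (std_simplex k) (std_simplex n) = tcone {1..k} {1..n}"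
  unfolding std_simplex_def tcone_def
  using assms barycenter_rel_interior[OF assms(1)] by (intro tangent_cone_hull) auto

lemma normal_cone_simplex:
  assumes "1 \<le> k" "k \<le> n"
  shows "normal_cone (coord_space n) (std_simplex k) (std_simplex n) = ncone {1..k} {1..n}"
proof -
  have "(\<forall>u\<in>icone ev {1..k} {1..n}. w \<bullet> u \<le> 0) \<longleftrightarrow> polar ev {1..k} {1..n} w" for w
  proof
    assume "\<forall>u\<in>icone ev {1..k} {1..n}. w \<bullet> u \<le> 0"
    then show "polar ev {1..k} {1..n} w" unfolding polar_def using assms by (auto intro!: icone_diff_mem)
  next
    assume "polar ev {1..k} {1..n} w"
    then show "\<forall>u\<in>icone ev {1..k} {1..n}. w \<bullet> u \<le> 0" using assms by (intro ballI polar_inner_icone) auto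
  qed
  moreover have "coord_space n = span (unitv {1..n})" by (simp add: coord_space_def span_unitv)
  ultimately show ?thesis
    unfolding normal_cone_def tangent_cone_simplex[OF assms] ncone_def tcone_def by simp
qed

lemma internal_angle_sum_eq: "1 \<le> k \<Longrightarrow> k \<le> n \<Longrightarrow> internal_angle_sum n k = real (n choose k) * tangent_angle {1..k} {1..n}"
  by (simp add: internal_angle_sum_def tangent_angle_def tangent_cone_simplex)

lemma external_angle_sum_eq: "1 \<le> k \<Longrightarrow> k \<le> n \<Longrightarrow> external_angle_sum n k = real (n choose k) * normal_angle {1..k} {1..n}"
  by (simp add: external_angle_sum_def normal_angle_def normal_cone_simplex)

text \<open>
  By symmetry each pair \<open>I \<subseteq> J\<close> contributes the same product of angles. The sum is taken over \<open>J\<close> first, so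
  that the two binomial coefficients of the angle sums count the sets \<open>J\<close> and the sets \<open>I \<subseteq> J\<close>.
\<close>

lemma sum_simplex_vol_faces:
  "(\<Sum>I | I \<subseteq> {1..n} \<and> card I = j + 1. simplex_vol I {1..n} k) = external_angle_sum n (k + 1) * internal_angle_sum (k + 1) (j + 1)"
proof -
  let ?N = "{1..n}"
  let ?Js = "{J. J \<subseteq> ?N \<and> card J = k + 1}"
  have fin: "finite J" if "J \<subseteq> ?N" for J using that finite_subset by blast
  have "(\<Sum>I | I \<subseteq> ?N \<and> card I = j + 1. simplex_vol I ?N k) = (\<Sum>I | I \<subseteq> ?N \<and> card I = j + 1. \<Sum>J | J \<in> ?Js \<and> I \<subseteq> J. tangent_angle I J * normal_angle J ?N)"
    unfolding simplex_vol_def by (intro sum.cong refl) auto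
  also have "\<dots> = (\<Sum>J\<in>?Js. \<Sum>I | I \<in> {I. I \<subseteq> ?N \<and> card I = j + 1} \<and> I \<subseteq> J. tangent_angle I J * normal_angle J ?N)"
    by (rule sum.swap_restrict) simp_all
  also have "\<dots> = (\<Sum>J\<in>?Js. real (k + 1 choose (j + 1)) * tangent_angle {1..j+1} {1..k+1} * normal_angle {1..k+1} {1..n})"
  proof (intro sum.cong refl)
    fix J assume J: "J \<in> ?Js"
    then have fJ: "finite J" using fin by blast
    have "(\<Sum>I | I \<in> {I. I \<subseteq> ?N \<and> card I = j + 1} \<and> I \<subseteq> J. tangent_angle I J * normal_angle J ?N)
      = (\<Sum>I | I \<subseteq> J \<and> card I = j + 1. tangent_angle {1..j+1} {1..k+1} * normal_angle {1..k+1} {1..n})"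
    proof (intro sum.cong)
      show "{I. I \<in> {I. I \<subseteq> ?N \<and> card I = j + 1} \<and> I \<subseteq> J} = {I. I \<subseteq> J \<and> card I = j + 1}" using J by auto
      fix I assume "I \<in> {I. I \<subseteq> J \<and> card I = j + 1}"
      then show "tangent_angle I J * normal_angle J ?N = tangent_angle {1..j+1} {1..k+1} * normal_angle {1..k+1} {1..n}"
        using tangent_angle_card[OF fJ, of I] normal_angle_card[of ?N J] J by simp
    qed
    then show "(\<Sum>I | I \<in> {I. I \<subseteq> ?N \<and> card I = j + 1} \<and> I \<subseteq> J. tangent_angle I J * normal_angle J ?N)
      = real (k + 1 choose (j + 1)) * tangent_angle {1..j+1} {1..k+1} * normal_angle {1..k+1} {1..n}"
      using n_subsets[OF fJ, of "j + 1"] J by simp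
  qed
  also have "\<dots> = real (n choose (k + 1)) * (real (k + 1 choose (j + 1)) * tangent_angle {1..j+1} {1..k+1} * normal_angle {1..k+1} {1..n})"
    using n_subsets[of ?N "k + 1"] by simp
  also have "\<dots> = external_angle_sum n (k + 1) * internal_angle_sum (k + 1) (j + 1)"
  proof (cases "k + 1 \<le> n \<and> j \<le> k")
    case True
    then show ?thesis using internal_angle_sum_eq[of "j + 1" "k + 1"] external_angle_sum_eq[of "k + 1" n] by simp
  next
    case False
    then show ?thesis by (auto simp: external_angle_sum_def internal_angle_sum_def binomial_eq_0 not_le)
  qed
  finally show ?thesis .
qed

section \<open>The expected face sums of a Gaussian polytope\<close>

context
  fixes N :: "nat set"
  assumes N: "finite N" "DIM('a::euclidean_space) + 1 \<le> card N"
begin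

lemma nn_integral_flag_proper:
  assumes I: "I \<noteq> {}" "I \<subseteq> J" "J \<subseteq> N" and k: "k < DIM('a)"
  shows "(\<integral>\<^sup>+G. emeasure (gauss (Basis :: 'a set)) {z. kkt (lk G) I J N z} * indicator {G. flag j k N I J (lk G)} G \<partial>gauss_points N Basis)
    = ennreal (if card I = j + 1 \<and> card J = k + 1 then tangent_angle I J * normal_angle J N else 0)"
proof -
  let ?c = "card I = j + 1 \<and> card J = k + 1"
  have "(\<integral>\<^sup>+G. emeasure (gauss (Basis :: 'a set)) {z. kkt (lk G) I J N z} * indicator {G. flag j k N I J (lk G)} G \<partial>gauss_points N Basis)
    = (\<integral>\<^sup>+G. (if ?c then emeasure (gauss (Basis :: 'a set)) {z. kkt (lk G) I J N z} else 0) \<partial>gauss_points N Basis)"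
  proof (rule nn_integral_cong_AE, rule AE_mp[OF AE_gauss_points_general_position[OF N(1) orthonormal_Basis]], intro AE_I2 impI)
    fix G :: "nat \<Rightarrow>\<^sub>0 'a" assume "general_position (lk G) N DIM('a)"
    from generic_flag_proper[OF N this I k, of j]
    show "emeasure (gauss (Basis :: 'a set)) {z. kkt (lk G) I J N z} * indicator {G. flag j k N I J (lk G)} G
      = (if ?c then emeasure (gauss (Basis :: 'a set)) {z. kkt (lk G) I J N z} else 0)" by (simp add: indicator_def)
  qed
  also have "\<dots> = (if ?c then kkt_prob N (Basis :: 'a set) I J N else 0)"
  proof (cases ?c)
    case True
    then show ?thesis by (simp add: kkt_prob_def)
  next
    case False
    show ?thesis unfolding if_not_P[OF False] by simp
  qed
  also have "\<dots> = ennreal (if ?c then tangent_angle I J * normal_angle J N else 0)"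
    using kkt_prob_eq[OF N(1) I(1) orthonormal_Basis[where 'a = 'a] I(2,3)] k by auto
  finally show ?thesis .
qed

lemma nn_integral_flag_full:
  assumes I: "I \<noteq> {}" "I \<subseteq> J" "J \<subseteq> N" and j: "j < DIM('a)"
  shows "(\<integral>\<^sup>+G. emeasure (gauss (Basis :: 'a set)) {z. kkt (lk G) I J N z} * indicator {G. flag j DIM('a) N I J (lk G)} G \<partial>gauss_points N Basis)
    = ennreal (if J = N \<and> card I = j + 1 then alt_sum I N DIM('a) else 0)"
proof -
  let ?c = "J = N \<and> card I = j + 1"
  let ?g = "\<lambda>G. emeasure (gauss (Basis :: 'a set)) {z. z \<in> icone (lk G) I N} * indicator {G. proper_tangent Basis I N G} G"
  have "(\<integral>\<^sup>+G. emeasure (gauss (Basis :: 'a set)) {z. kkt (lk G) I J N z} * indicator {G. flag j DIM('a) N I J (lk G)} G \<partial>gauss_points N Basis)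
    = (\<integral>\<^sup>+G. (if ?c then ?g G else 0) \<partial>gauss_points N Basis)"
  proof (rule nn_integral_cong_AE, rule AE_mp[OF AE_gauss_points_general_position[OF N(1) orthonormal_Basis]], intro AE_I2 impI)
    fix G :: "nat \<Rightarrow>\<^sub>0 'a" assume "general_position (lk G) N DIM('a)"
    from generic_flag_full[OF N this I j]
    show "emeasure (gauss (Basis :: 'a set)) {z. kkt (lk G) I J N z} * indicator {G. flag j DIM('a) N I J (lk G)} G
      = (if ?c then ?g G else 0)" by (simp add: indicator_def proper_tangent_def of_bool_def)
  qed
  also have "\<dots> = (if ?c then (\<integral>\<^sup>+G. ?g G \<partial>gauss_points N Basis) else 0)"
  proof (cases ?c)
    case False
    show ?thesis unfolding if_not_P[OF False] by simp
  qed simp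
  also have "\<dots> = ennreal (if ?c then alt_sum I N DIM('a) else 0)"
    using emeasure_mem_proper_tangent(1)[OF N(1) _ I(1) orthonormal_Basis[where 'a = 'a] refl _ N(2)] I j by auto
  finally show ?thesis .
qed

end

context
  fixes M :: "'w measure" and X :: "nat \<Rightarrow> 'w \<Rightarrow> 'a::euclidean_space" and N :: "nat set"
  assumes M: "prob_space M" and N: "finite N" "DIM('a) + 1 \<le> card N"
    and ind: "prob_space.indep_vars M (\<lambda>_. borel) X N"
    and X: "\<And>i. i \<in> N \<Longrightarrow> standard_gaussian M (X i)"
begin

lemma expectation_face_sum_proper:
  assumes k: "k < DIM('a)"
  shows "(\<integral>\<omega>. face_sum j k N (\<lambda>i. X i \<omega>) \<partial>M) = (\<Sum>I | I \<subseteq> N \<and> card I = j + 1. simplex_vol I N k)"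
proof -
  have N0: "N \<noteq> {}" using N by auto
  let ?v = "\<lambda>I J. if card I = j + 1 \<and> card J = k + 1 then tangent_angle I J * normal_angle J N else 0"
  have nn: "0 \<le> ?v I J" for I J by (simp add: tangent_angle_def normal_angle_def)
  have "(\<integral>\<omega>. face_sum j k N (\<lambda>i. X i \<omega>) \<partial>M)
    = enn2real (\<Sum>I | I \<subseteq> N \<and> I \<noteq> {}. \<Sum>J | I \<subseteq> J \<and> J \<subseteq> N. ennreal (?v I J))"
    by (subst expectation_face_sum[OF M N(1) N0 ind X], assumption)
       (intro arg_cong[where f = enn2real] sum.cong refl nn_integral_flag_proper N k; simp)
  also have "\<dots> = (\<Sum>I | I \<subseteq> N \<and> I \<noteq> {}. \<Sum>J | I \<subseteq> J \<and> J \<subseteq> N. ?v I J)"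
    using nn by (simp add: sum_nonneg)
  also have "\<dots> = (\<Sum>I | I \<subseteq> N \<and> card I = j + 1. \<Sum>J | I \<subseteq> J \<and> J \<subseteq> N. ?v I J)"
    using N(1) by (intro sum.mono_neutral_right) auto
  also have "\<dots> = (\<Sum>I | I \<subseteq> N \<and> card I = j + 1. simplex_vol I N k)"
    unfolding simplex_vol_def using N(1) by (intro sum.cong refl sum.mono_neutral_cong_right) auto
  finally show ?thesis .
qed

lemma expectation_face_sum_full:
  assumes j: "j < DIM('a)"
  shows "(\<integral>\<omega>. face_sum j DIM('a) N (\<lambda>i. X i \<omega>) \<partial>M) = (\<Sum>I | I \<subseteq> N \<and> card I = j + 1. alt_sum I N DIM('a))"
proof -
  have N0: "N \<noteq> {}" using N by auto
  let ?v = "\<lambda>I J. if J = N \<and> card I = j + 1 then alt_sum I N DIM('a) else 0"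
  have nn: "0 \<le> ?v I J" if "I \<noteq> {}" "I \<subseteq> N" for I J
    using emeasure_mem_proper_tangent(2)[OF N(1) that(2,1) orthonormal_Basis[where 'a = 'a] refl _ N(2)] j by auto
  have "(\<integral>\<omega>. face_sum j DIM('a) N (\<lambda>i. X i \<omega>) \<partial>M)
    = enn2real (\<Sum>I | I \<subseteq> N \<and> I \<noteq> {}. \<Sum>J | I \<subseteq> J \<and> J \<subseteq> N. ennreal (?v I J))"
    by (subst expectation_face_sum[OF M N(1) N0 ind X], assumption)
       (intro arg_cong[where f = enn2real] sum.cong refl nn_integral_flag_full N j; simp)
  also have "\<dots> = enn2real (ennreal (\<Sum>I | I \<subseteq> N \<and> I \<noteq> {}. \<Sum>J | I \<subseteq> J \<and> J \<subseteq> N. ?v I J))"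
  proof (rule arg_cong[where f = enn2real])
    have "(\<Sum>I | I \<subseteq> N \<and> I \<noteq> {}. \<Sum>J | I \<subseteq> J \<and> J \<subseteq> N. ennreal (?v I J))
      = (\<Sum>I | I \<subseteq> N \<and> I \<noteq> {}. ennreal (\<Sum>J | I \<subseteq> J \<and> J \<subseteq> N. ?v I J))"
      using nn by (intro sum.cong refl sum_ennreal) auto
    also have "\<dots> = ennreal (\<Sum>I | I \<subseteq> N \<and> I \<noteq> {}. \<Sum>J | I \<subseteq> J \<and> J \<subseteq> N. ?v I J)"
      using nn by (intro sum_ennreal sum_nonneg) auto
    finally show "(\<Sum>I | I \<subseteq> N \<and> I \<noteq> {}. \<Sum>J | I \<subseteq> J \<and> J \<subseteq> N. ennreal (?v I J))
      = ennreal (\<Sum>I | I \<subseteq> N \<and> I \<noteq> {}. \<Sum>J | I \<subseteq> J \<and> J \<subseteq> N. ?v I J)" .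
  qed
  also have "\<dots> = (\<Sum>I | I \<subseteq> N \<and> I \<noteq> {}. \<Sum>J | I \<subseteq> J \<and> J \<subseteq> N. ?v I J)"
    using nn by (intro enn2real_ennreal sum_nonneg) auto
  also have "\<dots> = (\<Sum>I | I \<subseteq> N \<and> card I = j + 1. \<Sum>J | I \<subseteq> J \<and> J \<subseteq> N. ?v I J)"
    using N(1) by (intro sum.mono_neutral_right) auto
  also have "\<dots> = (\<Sum>I | I \<subseteq> N \<and> card I = j + 1. alt_sum I N DIM('a))"
  proof (intro sum.cong refl)
    fix I assume I: "I \<in> {I. I \<subseteq> N \<and> card I = j + 1}"
    have "(\<Sum>J | I \<subseteq> J \<and> J \<subseteq> N. ?v I J) = (\<Sum>J\<in>{N}. alt_sum I N DIM('a))"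
      using I N(1) by (intro sum.mono_neutral_cong_right) auto
    then show "(\<Sum>J | I \<subseteq> J \<and> J \<subseteq> N. ?v I J) = alt_sum I N DIM('a)" by simp
  qed
  finally show ?thesis .
qed

end

text \<open>
  The Gauss-Bonnet relation exchanges the summands below \<open>d\<close> with those from \<open>d\<close> on.
\<close>

lemma alt_sum_tail:
  assumes N: "finite N" "I \<subset> N" "I \<noteq> {}" and d: "d \<le> card N"
  shows "alt_sum I N d = (\<Sum>s\<in>{1..card N - d}. (- 1) ^ (s + 1) * simplex_vol I N (d + s - 1))"
proof -
  have "(\<Sum>k<card N. (- 1) ^ k * simplex_vol I N k) = (\<Sum>k<d. (- 1) ^ k * simplex_vol I N k) + (\<Sum>k\<in>{d..<card N}. (- 1) ^ k * simplex_vol I N k)"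
    using d by (simp add: lessThan_atLeast0 sum.atLeastLessThan_concat)
  then have "(\<Sum>k<d. (- 1) ^ k * simplex_vol I N k) = - (\<Sum>k\<in>{d..<card N}. (- 1) ^ k * simplex_vol I N k)"
    using gauss_bonnet_simplex[OF N] by simp
  then have "alt_sum I N d = (- 1) ^ d * (\<Sum>k\<in>{d..<card N}. (- 1) ^ k * simplex_vol I N k)"
    by (simp add: alt_sum_reverse)
  also have "\<dots> = (\<Sum>k\<in>{d..<card N}. (- 1) ^ (d + k) * simplex_vol I N k)"
    by (simp add: sum_distrib_left power_add mult.assoc)
  also have "\<dots> = (\<Sum>s\<in>{1..card N - d}. (- 1) ^ (s + 1) * simplex_vol I N (d + s - 1))"
  proof (rule sum.reindex_bij_witness[where i = "\<lambda>s. d + s - 1" and j = "\<lambda>k. k + 1 - d"])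
    fix k assume k: "k \<in> {d..<card N}"
    then have "(- 1 :: real) ^ (k + 1 - d + 1) = (- 1) ^ (d + k)"
      by (subst minus_one_power_iff, subst minus_one_power_iff) auto
    then show "(- 1) ^ (k + 1 - d + 1) * simplex_vol I N (d + (k + 1 - d) - 1) = (- 1) ^ (d + k) * simplex_vol I N k" using k by simp
  qed auto
  finally show ?thesis .
qed

lemma infsum_finite_support:
  fixes f :: "nat \<Rightarrow> real"
  assumes "finite F" "F \<subseteq> A" "\<And>s. s \<in> A - F \<Longrightarrow> f s = 0"
  shows "(\<Sum>\<^sub>\<infinity>s\<in>A. f s) = (\<Sum>s\<in>F. f s)"
proof -
  have "(\<Sum>\<^sub>\<infinity>s\<in>A. f s) = (\<Sum>\<^sub>\<infinity>s\<in>F. f s)" using assms by (intro infsum_cong_neutral) auto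
  then show ?thesis using assms(1) by simp
qed

theorem theorem4p11:
  fixes M :: "'w measure" and X :: "nat \<Rightarrow> 'w \<Rightarrow> real ^ 'd" and d n :: nat
  assumes "d = CARD('d)" and "n \<ge> d + 1"
    and "prob_space M"
    and "prob_space.indep_vars M (\<lambda>_. borel) X {1..n}"
    and "\<And>i. i \<in> {1..n} \<Longrightarrow> standard_gaussian M (X i)"
  shows "(\<forall>j\<in>{0..d-1}. \<forall>k\<in>{j..d-1}.
            (\<integral>\<omega>. (\<Sum>F\<in>faces j (random_polytope X n \<omega>).
                conic_intrinsic_volume k (tangent_cone F (random_polytope X n \<omega>))) \<partial>M)
            = external_angle_sum n (k + 1) * internal_angle_sum (k + 1) (j + 1))
       \<and> (\<forall>j\<in>{0..d-1}.
            (\<integral>\<omega>. (\<Sum>F\<in>faces j (random_polytope X n \<omega>).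
                conic_intrinsic_volume d (tangent_cone F (random_polytope X n \<omega>))) \<partial>M)
            = (\<Sum>\<^sub>\<infinity>s\<in>{0..}. (-1) ^ s * external_angle_sum n (d - s) * internal_angle_sum (d - s) (j + 1))
          \<and> (\<integral>\<omega>. (\<Sum>F\<in>faces j (random_polytope X n \<omega>).
                conic_intrinsic_volume d (tangent_cone F (random_polytope X n \<omega>))) \<partial>M)
            = (\<Sum>\<^sub>\<infinity>s\<in>{1..}. (-1) ^ (s + 1) * external_angle_sum n (d + s) * internal_angle_sum (d + s) (j + 1)))"
proof -
  let ?N = "{1..n}"
  have dim: "DIM(real ^ 'd) = d" using assms(1) by simp
  have N: "finite ?N" "DIM(real ^ 'd) + 1 \<le> card ?N" using dim assms(2) by simp_all
  have d1: "1 \<le> d" unfolding assms(1) by (simp add: Suc_leI)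
  have fs: "(\<Sum>F\<in>faces j (random_polytope X n \<omega>). conic_intrinsic_volume k (tangent_cone F (random_polytope X n \<omega>)))
    = face_sum j k ?N (\<lambda>i. X i \<omega>)" for j k \<omega>
    by (simp add: face_sum_def random_polytope_def)
  note E = expectation_face_sum_proper[OF assms(3) N assms(4,5)] expectation_face_sum_full[OF assms(3) N assms(4,5)]
  show ?thesis
    unfolding fs
  proof (intro conjI ballI)
    fix j k assume "j \<in> {0..d-1}" "k \<in> {j..d-1}"
    then have "k < d" using d1 by auto
    then have "k < DIM(real ^ 'd)" by (simp only: dim)
    then show "(\<integral>\<omega>. face_sum j k ?N (\<lambda>i. X i \<omega>) \<partial>M) = external_angle_sum n (k + 1) * internal_angle_sum (k + 1) (j + 1)"
      using E(1)[of k j] sum_simplex_vol_faces[where n = n and j = j and k = k] by simp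
  next
    fix j assume "j \<in> {0..d-1}"
    then have j: "j < d" using d1 by simp
    let ?Is = "{I. I \<subseteq> ?N \<and> card I = j + 1}"
    have e: "(\<integral>\<omega>. face_sum j d ?N (\<lambda>i. X i \<omega>) \<partial>M) = (\<Sum>I\<in>?Is. alt_sum I ?N d)"
      using E(2)[of j] j unfolding dim by simp
    have "(\<Sum>I\<in>?Is. alt_sum I ?N d) = (\<Sum>s<d. (- 1) ^ s * (\<Sum>I\<in>?Is. simplex_vol I ?N (d - 1 - s)))"
      unfolding alt_sum_def sum_distrib_left by (rule sum.swap)
    also have "\<dots> = (\<Sum>s<d. (- 1) ^ s * external_angle_sum n (d - s) * internal_angle_sum (d - s) (j + 1))"
    proof (intro sum.cong refl)
      fix s assume "s \<in> {..<d}"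
      then have "d - 1 - s + 1 = d - s" by auto
      then show "(- 1) ^ s * (\<Sum>I\<in>?Is. simplex_vol I ?N (d - 1 - s)) = (- 1) ^ s * external_angle_sum n (d - s) * internal_angle_sum (d - s) (j + 1)"
        unfolding sum_simplex_vol_faces by (simp add: mult.assoc)
    qed
    also have "\<dots> = (\<Sum>\<^sub>\<infinity>s\<in>{0..}. (-1) ^ s * external_angle_sum n (d - s) * internal_angle_sum (d - s) (j + 1))"
      by (rule infsum_finite_support[symmetric]) (auto simp: external_angle_sum_def)
    finally show "(\<integral>\<omega>. face_sum j d ?N (\<lambda>i. X i \<omega>) \<partial>M)
      = (\<Sum>\<^sub>\<infinity>s\<in>{0..}. (-1) ^ s * external_angle_sum n (d - s) * internal_angle_sum (d - s) (j + 1))" unfolding e .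
    have "(\<Sum>I\<in>?Is. alt_sum I ?N d) = (\<Sum>I\<in>?Is. \<Sum>s\<in>{1..n - d}. (- 1) ^ (s + 1) * simplex_vol I ?N (d + s - 1))"
    proof (intro sum.cong refl)
      fix I assume I: "I \<in> ?Is"
      then have "I \<noteq> {}" "I \<noteq> ?N" using j assms(2) by auto
      then show "alt_sum I ?N d = (\<Sum>s\<in>{1..n - d}. (- 1) ^ (s + 1) * simplex_vol I ?N (d + s - 1))"
        using alt_sum_tail[of ?N I d] I assms(2) by auto
    qed
    also have "\<dots> = (\<Sum>s\<in>{1..n - d}. (- 1) ^ (s + 1) * (\<Sum>I\<in>?Is. simplex_vol I ?N (d + s - 1)))"
      unfolding sum_distrib_left by (rule sum.swap)
    also have "\<dots> = (\<Sum>s\<in>{1..n - d}. (- 1) ^ (s + 1) * external_angle_sum n (d + s) * internal_angle_sum (d + s) (j + 1))"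
    proof (intro sum.cong refl)
      fix s assume "s \<in> {1..n - d}"
      then have "d + s - 1 + 1 = d + s" by auto
      then show "(- 1) ^ (s + 1) * (\<Sum>I\<in>?Is. simplex_vol I ?N (d + s - 1)) = (- 1) ^ (s + 1) * external_angle_sum n (d + s) * internal_angle_sum (d + s) (j + 1)"
        unfolding sum_simplex_vol_faces by (simp add: mult.assoc)
    qed
    also have "\<dots> = (\<Sum>\<^sub>\<infinity>s\<in>{1..}. (-1) ^ (s + 1) * external_angle_sum n (d + s) * internal_angle_sum (d + s) (j + 1))"
      by (rule infsum_finite_support[symmetric]) (auto simp: external_angle_sum_def)
    finally show "(\<integral>\<omega>. face_sum j d ?N (\<lambda>i. X i \<omega>) \<partial>M)
      = (\<Sum>\<^sub>\<infinity>s\<in>{1..}. (-1) ^ (s + 1) * external_angle_sum n (d + s) * internal_angle_sum (d + s) (j + 1))" unfolding e .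
  qed
qed

end
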